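(* Let $g$ satisfy (KPP$_g$) and $f$ satisfy (KPP$_f$). Then for every $i\in\{1,\ldots,N-1\}$ and every non-negative, continuous, bounded, compactly supported initial datum $(u_0,v_0)\not\equiv(0,0)$, the solution $(u,v)$ of (H) satisfies: (i) for all $c>c^*_\infty$, $\lim_{t\to\infty}\sup_{|x_i|\geq ct}(u,v)=(0,0)$, uniformly in $x_j$ for all $j\neq i$; (ii) for all $0<c<c^*_\infty$, $\lim_{t\to\infty}\sup_{|x_i|\leq ct}|(u,v)-(U,V)|=0$, locally uniformly in $x_j$ for all $j\neq i$, where $(U,V)$ is the unique positive bounded steady state of (H) depending only on $x_N$.
   Context: Problem (H) ($N\geq2$, $D,d,\mu,\nu>0$): $u_t-D\Delta u=g(u)$ in $\{x_N<0\}\times(0,\infty)$, $v_t-d\Delta v=f(v)$ in $\{x_N>0\}\times(0,\infty)$, $D\partial_{x_N}u=\nu v-\mu u$, $-d\partial_{x_N}v=\mu u-\nu v$ on $\{x_N=0\}\times(0,\infty)$. (KPP$_g$): $g$ locally Lipschitz, differentiable at $0$, $g(0)=g(1)=0$, $0<g(s)\leq g'(0)s$ on $(0,1)$, $g(s)<0$ for $s>1$. (KPP$_f$): for some $S>0$, $f$ locally Lipschitz, differentiable at $0$, $f(0)=f(S)=0$, $0<f(s)\leq f'(0)s$ on $(0,S)$, $f(s)<0$ for $s>S$. $c_f:=2\sqrt{df'(0)}$, $c_g:=2\sqrt{Dg'(0)}$, and $c^*_\infty:=c_f$ if $\frac{D}{d}\leq2-\frac{g'(0)}{f'(0)}$;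 $c^*_\infty:=c_g$ if $\frac{d}{D}\leq 2-\frac{f'(0)}{g'(0)}$; $c^*_\infty:=c_a:=\frac{|Df'(0)-dg'(0)|}{\sqrt{(D-d)(f'(0)-g'(0))}}$ otherwise. *)

theory Defs
  imports "HOL-Analysis.Analysis"
begin

text \<open>Points of R^N are written as pairs (y, z) with y in R^(N-1) (type real^'m, any finite
'm, so N-1 >= 1) and z = x_N in R.  Functions of space-time are w y z t.\<close>

definition loc_lipschitz :: "(real \<Rightarrow> real) \<Rightarrow> bool" where
  "loc_lipschitz h \<longleftrightarrow> (\<forall>R. \<exists>L. \<forall>x y. \<bar>x\<bar> \<le> R \<longrightarrow> \<bar>y\<bar> \<le> R \<longrightarrow> \<bar>h x - h y\<bar> \<le> L * \<bar>x - y\<bar>)"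

definition KPP_g :: "(real \<Rightarrow> real) \<Rightarrow> real \<Rightarrow> bool" where
  "KPP_g g gp \<longleftrightarrow> loc_lipschitz g \<and> (g has_real_derivative gp) (at 0) \<and> g 0 = 0 \<and> g 1 = 0
     \<and> (\<forall>s. 0 < s \<and> s < 1 \<longrightarrow> 0 < g s \<and> g s \<le> gp * s) \<and> (\<forall>s. s > 1 \<longrightarrow> g s < 0)"

definition KPP_f :: "(real \<Rightarrow> real) \<Rightarrow> real \<Rightarrow> real \<Rightarrow> bool" where
  "KPP_f f fp S \<longleftrightarrow> S > 0 \<and> loc_lipschitz f \<and> (f has_real_derivative fp) (at 0) \<and> f 0 = 0 \<and> f S = 0
     \<and> (\<forall>s. 0 < s \<and> s < S \<longrightarrow> 0 < f s \<and> f s \<le> fp * s) \<and> (\<forall>s. s > S \<longrightarrow> f s < 0)"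

definition cstar_inf :: "real \<Rightarrow> real \<Rightarrow> real \<Rightarrow> real \<Rightarrow> real" where
  "cstar_inf D d fp gp =
     (if D / d \<le> 2 - gp / fp then 2 * sqrt (d * fp)
      else if d / D \<le> 2 - fp / gp then 2 * sqrt (D * gp)
      else \<bar>D * fp - d * gp\<bar> / sqrt ((D - d) * (fp - gp)))"

definition dyi :: "'m::finite \<Rightarrow> (real^'m \<Rightarrow> real \<Rightarrow> real \<Rightarrow> real) \<Rightarrow> real^'m \<Rightarrow> real \<Rightarrow> real \<Rightarrow> real" where
  "dyi i w = (\<lambda>y z t. deriv (\<lambda>s. w (y + s *\<^sub>R axis i 1) z t) 0)"

definition dz :: "(real^'m \<Rightarrow> real \<Rightarrow> real \<Rightarrow> real) \<Rightarrow> real^'m \<Rightarrow> real \<Rightarrow> real \<Rightarrow> real" where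
  "dz w = (\<lambda>y z t. deriv (\<lambda>s. w y s t) z)"

definition dt :: "(real^'m \<Rightarrow> real \<Rightarrow> real \<Rightarrow> real) \<Rightarrow> real^'m \<Rightarrow> real \<Rightarrow> real \<Rightarrow> real" where
  "dt w = (\<lambda>y z t. deriv (\<lambda>s. w y z s) t)"

definition lap :: "(real^'m::finite \<Rightarrow> real \<Rightarrow> real \<Rightarrow> real) \<Rightarrow> real^'m \<Rightarrow> real \<Rightarrow> real \<Rightarrow> real" where
  "lap w = (\<lambda>y z t. (\<Sum>i\<in>UNIV. dyi i (dyi i w) y z t) + dz (dz w) y z t)"

definition reg21 :: "(real^'m::finite \<Rightarrow> real \<Rightarrow> real \<Rightarrow> real) \<Rightarrow> real set \<Rightarrow> bool" where
  "reg21 w Z \<longleftrightarrow>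
    (\<forall>y z t. z \<in> Z \<longrightarrow> t > 0 \<longrightarrow>
       (\<lambda>s. w y z s) differentiable (at t)
     \<and> (\<lambda>s. w y s t) differentiable (at z)
     \<and> (\<lambda>s. dz w y s t) differentiable (at z)
     \<and> (\<forall>i. (\<lambda>s. w (y + s *\<^sub>R axis i 1) z t) differentiable (at 0)
          \<and> (\<lambda>s. dyi i w (y + s *\<^sub>R axis i 1) z t) differentiable (at 0)))
   \<and> continuous_on {p. fst (snd p) \<in> Z \<and> snd (snd p) > 0} (\<lambda>(y, z, t). dt w y z t)
   \<and> continuous_on {p. fst (snd p) \<in> Z \<and> snd (snd p) > 0} (\<lambda>(y, z, t). dz w y z t)
   \<and> continuous_on {p. fst (snd p) \<in> Z \<and> snd (snd p) > 0} (\<lambda>(y, z, t). dz (dz w) y z t)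
   \<and> (\<forall>i. continuous_on {p. fst (snd p) \<in> Z \<and> snd (snd p) > 0} (\<lambda>(y, z, t). dyi i w y z t)
        \<and> continuous_on {p. fst (snd p) \<in> Z \<and> snd (snd p) > 0} (\<lambda>(y, z, t). dyi i (dyi i w) y z t))"

definition is_solution_H ::
  "real \<Rightarrow> real \<Rightarrow> real \<Rightarrow> real \<Rightarrow> (real \<Rightarrow> real) \<Rightarrow> (real \<Rightarrow> real) \<Rightarrow>
   (real^'m::finite \<Rightarrow> real \<Rightarrow> real) \<Rightarrow> (real^'m \<Rightarrow> real \<Rightarrow> real) \<Rightarrow>
   (real^'m \<Rightarrow> real \<Rightarrow> real \<Rightarrow> real) \<Rightarrow> (real^'m \<Rightarrow> real \<Rightarrow> real \<Rightarrow> real) \<Rightarrow> bool" where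
  "is_solution_H D d \<mu> \<nu> g f u0 v0 u v \<longleftrightarrow>
     continuous_on {p. fst (snd p) \<le> 0 \<and> snd (snd p) \<ge> 0} (\<lambda>(y, z, t). u y z t)
   \<and> continuous_on {p. fst (snd p) \<ge> 0 \<and> snd (snd p) \<ge> 0} (\<lambda>(y, z, t). v y z t)
   \<and> reg21 u {..<0} \<and> reg21 v {0<..}
   \<and> (\<forall>y z t. z < 0 \<longrightarrow> t > 0 \<longrightarrow> dt u y z t - D * lap u y z t = g (u y z t))
   \<and> (\<forall>y z t. z > 0 \<longrightarrow> t > 0 \<longrightarrow> dt v y z t - d * lap v y z t = f (v y z t))
   \<and> (\<forall>y t. t > 0 \<longrightarrow> (\<exists>a b.
         ((\<lambda>s. u y s t) has_real_derivative a) (at 0 within {..0})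
       \<and> ((\<lambda>s. v y s t) has_real_derivative b) (at 0 within {0..})
       \<and> D * a = \<nu> * v y 0 t - \<mu> * u y 0 t
       \<and> - d * b = \<mu> * u y 0 t - \<nu> * v y 0 t))
   \<and> (\<forall>y z. z \<le> 0 \<longrightarrow> u y z 0 = u0 y z)
   \<and> (\<forall>y z. z \<ge> 0 \<longrightarrow> v y z 0 = v0 y z)
   \<and> (\<forall>T. \<exists>M. \<forall>y z t. 0 \<le> t \<longrightarrow> t \<le> T \<longrightarrow>
         (z \<le> 0 \<longrightarrow> \<bar>u y z t\<bar> \<le> M) \<and> (z \<ge> 0 \<longrightarrow> \<bar>v y z t\<bar> \<le> M))"

definition steady_H ::
  "real \<Rightarrow> real \<Rightarrow> real \<Rightarrow> real \<Rightarrow> (real \<Rightarrow> real) \<Rightarrow> (real \<Rightarrow> real) \<Rightarrow>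
   (real \<Rightarrow> real) \<Rightarrow> (real \<Rightarrow> real) \<Rightarrow> bool" where
  "steady_H D d \<mu> \<nu> g f U V \<longleftrightarrow>
     continuous_on {..0} U \<and> continuous_on {0..} V
   \<and> (\<forall>z < 0. U differentiable (at z) \<and> deriv U differentiable (at z)
        \<and> D * deriv (deriv U) z + g (U z) = 0)
   \<and> (\<forall>z > 0. V differentiable (at z) \<and> deriv V differentiable (at z)
        \<and> d * deriv (deriv V) z + f (V z) = 0)
   \<and> (\<exists>a b. (U has_real_derivative a) (at 0 within {..0})
        \<and> (V has_real_derivative b) (at 0 within {0..})
        \<and> D * a = \<nu> * V 0 - \<mu> * U 0 \<and> - d * b = \<mu> * U 0 - \<nu> * V 0)
   \<and> (\<forall>z \<le> 0. U z > 0) \<and> (\<forall>z \<ge> 0. V z > 0)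
   \<and> (\<exists>M. (\<forall>z \<le> 0. U z \<le> M) \<and> (\<forall>z \<ge> 0. V z \<le> M))"

end

theory Submission
  imports Defs
begin

text \<open>Only comparison arguments are used.  With \<open>\<alpha>\<close> minimising the larger of \<open>D\<alpha> + g'(0)/\<alpha>\<close> and
  \<open>d\<alpha> + f'(0)/\<alpha>\<close>, whose minimum is \<open>c\<^sup>*\<^sub>\<infinity>\<close>, the pair \<open>\<nu>X, \<mu>X\<close> with
  \<open>X = K exp(- \<alpha>(\<plusminus>x\<^sub>i - c t))\<close>, \<open>c = c\<^sup>*\<^sub>\<infinity>\<close>, does not depend on \<open>x\<^sub>N\<close>, so it carries no
  flux through the interface and is a supersolution; this gives (i).

  For (ii), exponentially tilted bumps with compact support are subsolutions moving through one medium,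
  and a Hopf-type barrier carries mass across the interface.  Spending suitable fractions of the time in
  the two media, the bumps reach every speed below \<open>c\<^sup>*\<^sub>\<infinity>\<close>, and the solution stays above a
  positive constant behind the front.  There it is squeezed: the solutions of the stationary
  equation that converge to \<open>S\<close> at infinity form a one-parameter family, and sliding a slightly
  lowered member from below shows that asymptotic lower and upper bounds of \<open>u\<close> and \<open>v\<close> at the
  interface satisfy the flux balance of the steady state as inequalities.  Since the flux is monotone
  in the interface value, both bounds equal the interface values of the steady state.\<close>

section \<open>Comparison principle\<close>

text \<open>The usual route to convergence, compactness of time translates and a Liouville theorem,
  needs parabolic estimates up to the interface. Here filters on pairs (y, t) replace it: what holds
  eventually along a filter that is stable under bounded shifts plays the role of a property of all
  limit solutions, and the best eventual lower bound at the interface is a number to which a further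
  comparison applies. The anomalous speed is hard to reach because every crossing of the interface
  and every restart of a bump multiplies the amplitude by a small constant. These constants do not
  depend on the length of the runs in between, so long runs with positive mean growth rate outweigh
  them, and the time spent on crossings costs arbitrarily little speed. Nothing is known beforehand
  about the limits of a steady state far from the interface. A steady state is therefore treated as
  one more solution of the evolution problem and squeezed by the same estimates as
  \<open>(u, v)\<close>; convergence to it and its uniqueness come out together.\<close>

definition has_d2 :: "(real \<Rightarrow> real) \<Rightarrow> real \<Rightarrow> real \<Rightarrow> bool" where
  "has_d2 c x k \<longleftrightarrow> (\<exists>c'. (\<forall>\<^sub>F s in nhds x. (c has_real_derivative c' s) (at s))
     \<and> (c' has_real_derivative k) (at x))"

lemma has_d2I:
  assumes "\<And>s. (c has_real_derivative c' s) (at s)" "(c' has_real_derivative k) (at x)"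
  shows "has_d2 c x k"
  unfolding has_d2_def using assms by (intro exI[of _ c'] conjI always_eventually allI)

lemma has_d2_diff:
  assumes "has_d2 c x k" "has_d2 p x l"
  shows "has_d2 (\<lambda>s. c s - p s) x (k - l)"
proof -
  obtain c' p' where c: "\<forall>\<^sub>F s in nhds x. (c has_real_derivative c' s) (at s)" "(c' has_real_derivative k) (at x)"
    and p: "\<forall>\<^sub>F s in nhds x. (p has_real_derivative p' s) (at s)" "(p' has_real_derivative l) (at x)"
    using assms unfolding has_d2_def by blast
  show ?thesis unfolding has_d2_def
  proof (intro exI conjI)
    show "\<forall>\<^sub>F s in nhds x. ((\<lambda>s. c s - p s) has_real_derivative c' s - p' s) (at s)"
      using c(1) p(1) by eventually_elim (auto intro!: derivative_intros)
    show "((\<lambda>s. c' s - p' s) has_real_derivative k - l) (at x)"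
      using c(2) p(2) by (auto intro!: derivative_intros)
  qed
qed

lemma has_d2_minus: "has_d2 c x k \<Longrightarrow> has_d2 (\<lambda>s. - c s) x (- k)"
  unfolding has_d2_def
proof (elim exE conjE)
  fix c' assume c: "\<forall>\<^sub>F s in nhds x. (c has_real_derivative c' s) (at s)" "(c' has_real_derivative k) (at x)"
  show "\<exists>c'. (\<forall>\<^sub>F s in nhds x. ((\<lambda>s. - c s) has_real_derivative c' s) (at s)) \<and> (c' has_real_derivative - k) (at x)"
    apply (rule exI[of _ "\<lambda>s. - c' s"])
    using c by (auto elim!: eventually_mono intro!: derivative_intros)
qed

text \<open>The first derivative vanishes at the minimum. Were \<open>k\<close> negative, it would
  be negative just to the right, and the mean value theorem would produce a smaller value
  there.\<close>

lemma has_d2_local_min_nonneg: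
  assumes "has_d2 c x k" and min: "\<forall>\<^sub>F s in nhds x. c x \<le> c s"
  shows "0 \<le> k"
proof (rule ccontr)
  assume "\<not> 0 \<le> k"
  then have k: "k < 0" by simp
  obtain c' where c: "\<forall>\<^sub>F s in nhds x. (c has_real_derivative c' s) (at s)" "(c' has_real_derivative k) (at x)"
    using assms unfolding has_d2_def by blast
  obtain e where e: "e > 0" "\<And>s. dist s x < e \<Longrightarrow> (c has_real_derivative c' s) (at s) \<and> c x \<le> c s"
    using eventually_conj[OF c(1) min] unfolding eventually_nhds_metric by auto
  have "c' x = 0"
    by (rule DERIV_local_min[of c _ x e]) (use e in \<open>auto simp: dist_real_def\<close>)
  then obtain r where r: "r > 0" "\<And>h. 0 < h \<Longrightarrow> h < r \<Longrightarrow> c' (x + h) < 0"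
    using DERIV_neg_dec_right[OF c(2) k] by auto
  define h where "h = min e r / 2"
  have h: "0 < h" "h < e" "h < r" using e r by (auto simp: h_def)
  obtain w where w: "x < w" "w < x + h" "c (x + h) - c x = (x + h - x) * c' w"
    using MVT2[of x "x + h" c c'] h e by (auto simp: dist_real_def)
  have "c' w < 0" using r(2)[of "w - x"] w h by auto
  then have "h * c' w < 0" using h by (simp add: mult_pos_neg)
  then have "c (x + h) < c x" using w by simp
  moreover have "c x \<le> c (x + h)" using e(2)[of "x + h"] h by (auto simp: dist_real_def)
  ultimately show False by simp
qed

text \<open>A relation rather than a function: existence of the derivatives and the value of the
  operator are asserted together, at one point. Test functions then need to be differentiated only
  where they touch the solution.\<close>

definition heat_op :: "real \<Rightarrow> (real^'m::finite \<Rightarrow> real \<Rightarrow> real \<Rightarrow> real) \<Rightarrow> real^'m \<Rightarrow> real \<Rightarrow> real \<Rightarrow> real \<Rightarrow> bool" where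
  "heat_op D u y z t r \<longleftrightarrow> (\<exists>ut uy uz. ((\<lambda>s. u y z s) has_real_derivative ut) (at t)
     \<and> (\<forall>i. has_d2 (\<lambda>s. u (y + s *\<^sub>R axis i 1) z t) 0 (uy i)) \<and> has_d2 (\<lambda>s. u y s t) z uz
     \<and> ut - D * ((\<Sum>i\<in>UNIV. uy i) + uz) = r)"

lemma heat_opI:
  assumes "((\<lambda>s. u y z s) has_real_derivative ut) (at t)"
    and "\<And>i. has_d2 (\<lambda>s. u (y + s *\<^sub>R axis i 1) z t) 0 (uy i)" "has_d2 (\<lambda>s. u y s t) z uz"
    and "ut - D * ((\<Sum>i\<in>UNIV. uy i) + uz) = r"
  shows "heat_op D u y z t r"
  unfolding heat_op_def using assms by blast

lemma heat_op_diff: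
  assumes "heat_op D u y z t r" "heat_op D w y z t r'"
  shows "heat_op D (\<lambda>y z t. u y z t - w y z t) y z t (r - r')"
proof -
  obtain ut uy uz where u: "((\<lambda>s. u y z s) has_real_derivative ut) (at t)"
    "\<And>i. has_d2 (\<lambda>s. u (y + s *\<^sub>R axis i 1) z t) 0 (uy i)" "has_d2 (\<lambda>s. u y s t) z uz"
    "ut - D * ((\<Sum>i\<in>UNIV. uy i) + uz) = r" using assms(1) unfolding heat_op_def by blast
  obtain wt wy wz where w: "((\<lambda>s. w y z s) has_real_derivative wt) (at t)"
    "\<And>i. has_d2 (\<lambda>s. w (y + s *\<^sub>R axis i 1) z t) 0 (wy i)" "has_d2 (\<lambda>s. w y s t) z wz"
    "wt - D * ((\<Sum>i\<in>UNIV. wy i) + wz) = r'" using assms(2) unfolding heat_op_def by blast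
  show ?thesis
  proof (rule heat_opI)
    show "((\<lambda>s. u y z s - w y z s) has_real_derivative ut - wt) (at t)"
      using u w by (auto intro!: derivative_intros)
    show "has_d2 (\<lambda>s. u (y + s *\<^sub>R axis i 1) z t - w (y + s *\<^sub>R axis i 1) z t) 0 (uy i - wy i)" for i
      using u w by (intro has_d2_diff)
    show "has_d2 (\<lambda>s. u y s t - w y s t) z (uz - wz)"
      using u w by (intro has_d2_diff)
    show "ut - wt - D * ((\<Sum>i\<in>UNIV. uy i - wy i) + (uz - wz)) = r - r'"
      using u(4) w(4) by (simp add: sum_subtractf algebra_simps)
  qed
qed

lemma heat_op_minus:
  assumes "heat_op D u y z t r"
  shows "heat_op D (\<lambda>y z t. - u y z t) y z t (- r)"
proof -
  obtain ut uy uz where u: "((\<lambda>s. u y z s) has_real_derivative ut) (at t)"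
    "\<And>i. has_d2 (\<lambda>s. u (y + s *\<^sub>R axis i 1) z t) 0 (uy i)" "has_d2 (\<lambda>s. u y s t) z uz"
    "ut - D * ((\<Sum>i\<in>UNIV. uy i) + uz) = r" using assms(1) unfolding heat_op_def by blast
  show ?thesis
  proof (rule heat_opI)
    show "((\<lambda>s. - u y z s) has_real_derivative - ut) (at t)"
      using u by (auto intro!: derivative_intros)
    show "has_d2 (\<lambda>s. - u (y + s *\<^sub>R axis i 1) z t) 0 (- uy i)" for i
      using u by (intro has_d2_minus)
    show "has_d2 (\<lambda>s. - u y s t) z (- uz)"
      using u by (intro has_d2_minus)
    show "- ut - D * ((\<Sum>i\<in>UNIV. - uy i) + (- uz)) = - r"
      using u(4) by (simp add: sum_negf algebra_simps)
  qed
qed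

text \<open>Test functions are only compared with the solution in the past of the touching point, which
  is why the derivative in time contributes an inequality.\<close>

lemma heat_op_past_min_nonneg:
  fixes h :: "real^'m::finite \<Rightarrow> real \<Rightarrow> real \<Rightarrow> real"
  assumes op: "heat_op D h y z t r" and "D \<ge> 0" and N: "open N" "(y, z, t) \<in> N"
    and min: "\<And>y' z' t'. (y', z', t') \<in> N \<Longrightarrow> t' \<le> t \<Longrightarrow> h y z t \<le> h y' z' t'"
  shows "r \<le> 0"
proof -
  obtain ht hy hz where d: "((\<lambda>s. h y z s) has_real_derivative ht) (at t)"
    "\<And>i. has_d2 (\<lambda>s. h (y + s *\<^sub>R axis i 1) z t) 0 (hy i)" "has_d2 (\<lambda>s. h y s t) z hz"
    "ht - D * ((\<Sum>i\<in>UNIV. hy i) + hz) = r" using op unfolding heat_op_def by blast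
  have ev: "\<forall>\<^sub>F s in nhds s0. c s \<in> N" if "isCont c s0" "c s0 = (y, z, t)" for c :: "real \<Rightarrow> _" and s0
  proof -
    have "filterlim c (nhds (y, z, t)) (nhds s0)"
      using that tendsto_at_iff_tendsto_nhds[of c s0] by (simp add: isCont_def)
    then show ?thesis by (rule topological_tendstoD) (use N in auto)
  qed
  have "0 \<le> hy i" for i
  proof (rule has_d2_local_min_nonneg[OF d(2)])
    show "\<forall>\<^sub>F s in nhds 0. h (y + 0 *\<^sub>R axis i 1) z t \<le> h (y + s *\<^sub>R axis i 1) z t"
      using ev[where c = "\<lambda>s. (y + s *\<^sub>R axis i 1, z, t)" and ?s0.0 = 0]
      by (auto elim!: eventually_mono simp: min intro!: continuous_intros)
  qed
  moreover have "0 \<le> hz"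
  proof (rule has_d2_local_min_nonneg[OF d(3)])
    show "\<forall>\<^sub>F s in nhds z. h y z t \<le> h y s t"
      using ev[where c = "\<lambda>s. (y, s, t)" and ?s0.0 = z]
      by (auto elim!: eventually_mono simp: min intro!: continuous_intros)
  qed
  moreover have "ht \<le> 0"
  proof (rule ccontr)
    assume "\<not> ht \<le> 0"
    then obtain e where e: "e > 0" "\<And>k. 0 < k \<Longrightarrow> k < e \<Longrightarrow> h y z (t - k) < h y z t"
      using DERIV_pos_inc_left[OF d(1)] by auto
    obtain e' where e': "e' > 0" "\<And>s. dist s t < e' \<Longrightarrow> (y, z, s) \<in> N"
      using ev[where c = "\<lambda>s. (y, z, s)" and ?s0.0 = t] unfolding eventually_nhds_metric by (auto intro!: continuous_intros)
    define k where "k = min e e' / 2"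
    have k: "k > 0" "k < e" "k < e'" using e e' by (auto simp: k_def)
    have "h y z t \<le> h y z (t - k)" using k e'(2)[of "t - k"] by (intro min) (auto simp: dist_real_def)
    with e(2)[of k] k show False by simp
  qed
  ultimately show ?thesis using d(4) \<open>D \<ge> 0\<close>
    by (smt (verit) mult_nonneg_nonneg sum_nonneg)
qed

lemma left_derivative_min_nonpos:
  fixes h :: "real \<Rightarrow> real"
  assumes "(h has_real_derivative a) (at 0 within {..0})" and "e > 0"
    and "\<And>s. - e < s \<Longrightarrow> s \<le> 0 \<Longrightarrow> h 0 \<le> h s"
  shows "a \<le> 0"
proof (rule ccontr)
  assume "\<not> a \<le> 0"
  then obtain e' where e': "e' > 0" "\<And>k. 0 < k \<Longrightarrow> 0 - k \<in> {..0} \<Longrightarrow> k < e' \<Longrightarrow> h (0 - k) < h 0"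
    using has_real_derivative_pos_inc_left[OF assms(1)] by auto
  define k where "k = min e e' / 2"
  have k: "k > 0" "k < e" "k < e'" using e' assms by (auto simp: k_def)
  show False using e'(2)[of k] assms(3)[of "-k"] k by auto
qed

text \<open>Both halves of (H) are treated as a problem on \<open>z \<le> 0\<close> with prescribed flux \<open>q\<close> at \<open>z = 0\<close>;
  the upper half is reflected.\<close>

definition half :: "real \<Rightarrow> (real \<Rightarrow> real) \<Rightarrow> (real^'m::finite \<Rightarrow> real \<Rightarrow> real \<Rightarrow> real) \<Rightarrow> (real^'m \<Rightarrow> real \<Rightarrow> real) \<Rightarrow> bool" where
  "half D g u q \<longleftrightarrow>
     continuous_on {p. fst (snd p) \<le> 0 \<and> snd (snd p) \<ge> 0} (\<lambda>(y, z, t). u y z t)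
   \<and> (\<forall>y z t. z < 0 \<longrightarrow> t > 0 \<longrightarrow> heat_op D u y z t (g (u y z t)))
   \<and> (\<forall>y t. t > 0 \<longrightarrow> (\<exists>a. ((\<lambda>s. u y s t) has_real_derivative a) (at 0 within {..0}) \<and> D * a = q y t))"

text \<open>Turns upper bounds into lower bounds; all comparison arguments are stated for test
  functions below the solution.\<close>

lemma half_uminus:
  assumes "half D g u q"
  shows "half D (\<lambda>s. - g (- s)) (\<lambda>y z t. - u y z t) (\<lambda>y t. - q y t)"
  unfolding half_def
proof (intro conjI allI impI)
  show "continuous_on {p. fst (snd p) \<le> 0 \<and> snd (snd p) \<ge> 0} (\<lambda>(y, z, t). - u y z t)"
    using assms continuous_on_minus unfolding half_def by (fastforce simp: split_beta)
  show "heat_op D (\<lambda>y z t. - u y z t) y z t (- g (- (- u y z t)))" if "z < 0" "t > 0" for y z t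
    using assms heat_op_minus that unfolding half_def by fastforce
  fix y and t :: real assume "t > 0"
  then obtain a where "((\<lambda>s. u y s t) has_real_derivative a) (at 0 within {..0})" "D * a = q y t"
    using assms unfolding half_def by blast
  then show "\<exists>a. ((\<lambda>s. - u y s t) has_real_derivative a) (at 0 within {..0}) \<and> D * a = - q y t"
    by (intro exI[of _ "-a"]) (auto intro!: derivative_intros)
qed

text \<open>First-contact principle.  The two functions interact only through the flux at \<open>z = 0\<close>, where
  at the first contact time the other component is still above its test function.\<close>

lemma first_contact_one:
  fixes u \<phi> :: "real^'m::finite \<Rightarrow> real \<Rightarrow> real \<Rightarrow> real"
  assumes "half D g u q" "D > 0"
    and K: "K \<subseteq> {p. fst (snd p) \<le> 0 \<and> snd (snd p) \<ge> 0}"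
    and cont: "continuous_on K (\<lambda>(y, z, t). \<phi> y z t)"
    and nb: "\<And>y z t. (y, z, t) \<in> K \<Longrightarrow> u y z t \<le> \<phi> y z t \<Longrightarrow> t > 0 \<and>
         (\<exists>N. open N \<and> (y, z, t) \<in> N \<and> (\<forall>y' z' t'. (y', z', t') \<in> N \<longrightarrow> z' \<le> 0 \<longrightarrow> t' \<le> t \<longrightarrow> (y', z', t') \<in> K))"
    and before: "\<And>y z t. (y, z, t) \<in> K \<Longrightarrow> t < T \<Longrightarrow> \<phi> y z t < u y z t"
    and P: "(y, z, T) \<in> K"
  shows "\<phi> y z T \<le> u y z T"
    and "u y z T = \<phi> y z T \<Longrightarrow> z < 0 \<Longrightarrow> heat_op D \<phi> y z T r \<Longrightarrow> g (\<phi> y z T) \<le> r"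
    and "u y z T = \<phi> y z T \<Longrightarrow> z = 0 \<Longrightarrow> ((\<lambda>s. \<phi> y s T) has_real_derivative b) (at 0 within {..0})
          \<Longrightarrow> q y T \<le> D * b"
proof -
  have uc: "continuous_on K (\<lambda>(y, z, t). u y z t)"
    using assms(1) K unfolding half_def by (meson continuous_on_subset)
  \<comment> \<open>At the time \<open>T\<close> itself the weak inequality is a limit of strict
    ones: if it failed, \<open>nb\<close> would keep the points \<open>(y, z, T - 1 / Suc k)\<close>
    in \<open>K\<close> for large \<open>k\<close>, where \<open>before\<close> applies.\<close>
  have le: "\<phi> y z T \<le> u y z T" if P: "(y, z, T) \<in> K" for y z
  proof (rule ccontr)
    assume n: "\<not> \<phi> y z T \<le> u y z T"
    then obtain N where N: "open N" "(y, z, T) \<in> N" "\<And>y' z' t'. (y', z', t') \<in> N \<Longrightarrow> z' \<le> 0 \<Longrightarrow> t' \<le> T \<Longrightarrow> (y', z', t') \<in> K"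
      using nb[OF P] by auto
    have z: "z \<le> 0" using P K by auto
    define x where "x k = T - 1 / Suc k" for k :: nat
    have xT: "x \<longlonglongrightarrow> T" unfolding x_def
      using tendsto_diff[OF tendsto_const LIMSEQ_inverse_real_of_nat, of T] by (simp add: inverse_eq_divide)
    have lim: "(\<lambda>n. (y, z, x n)) \<longlonglongrightarrow> (y, z, T)" by (intro tendsto_intros xT)
    then have "\<forall>\<^sub>F n in sequentially. (y, z, x n) \<in> N" by (rule topological_tendstoD) (use N in auto)
    then have ev: "\<forall>\<^sub>F n in sequentially. (y, z, x n) \<in> K \<and> x n < T"
      by eventually_elim (use N z in \<open>auto simp: x_def\<close>)
    have c1: "(\<lambda>n. u y z (x n)) \<longlonglongrightarrow> u y z T"
      using continuous_on_tendsto_compose[OF uc lim P eventually_mono[OF ev]] by simp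
    have c2: "(\<lambda>n. \<phi> y z (x n)) \<longlonglongrightarrow> \<phi> y z T"
      using continuous_on_tendsto_compose[OF cont lim P eventually_mono[OF ev]] by simp
    have "\<phi> y z T \<le> u y z T"
      by (rule tendsto_le[OF _ c1 c2]) (use ev before in \<open>auto elim!: eventually_mono intro: less_imp_le\<close>)
    with n show False by simp
  qed
  then show "\<phi> y z T \<le> u y z T" using P by auto
  have all: "\<phi> y' z' t' \<le> u y' z' t'" if "(y', z', t') \<in> K" "t' \<le> T" for y' z' t'
    using that before[of y' z' t'] le by (cases "t' = T") force+
  { assume eq: "u y z T = \<phi> y z T" and z: "z < 0" and op: "heat_op D \<phi> y z T r"
    obtain N where N: "T > 0" "open N" "(y, z, T) \<in> N" "\<And>y' z' t'. (y', z', t') \<in> N \<Longrightarrow> z' \<le> 0 \<Longrightarrow> t' \<le> T \<Longrightarrow> (y', z', t') \<in> K"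
      using nb[OF P] eq by auto
    have op2: "heat_op D u y z T (g (u y z T))" using assms(1) z N unfolding half_def by auto
    have o: "open (N \<inter> (UNIV \<times> {..<0} \<times> UNIV))" using N by (intro open_Int open_Times) auto
    have "g (u y z T) - r \<le> 0"
      by (rule heat_op_past_min_nonneg[OF heat_op_diff[OF op2 op] _ o]) (use N z all eq assms(2) in \<open>force+\<close>)
    then show "g (\<phi> y z T) \<le> r" using eq by simp }
  { assume eq: "u y z T = \<phi> y z T" and z: "z = 0" and b: "((\<lambda>s. \<phi> y s T) has_real_derivative b) (at 0 within {..0})"
    obtain N where N: "T > 0" "open N" "(y, z, T) \<in> N" "\<And>y' z' t'. (y', z', t') \<in> N \<Longrightarrow> z' \<le> 0 \<Longrightarrow> t' \<le> T \<Longrightarrow> (y', z', t') \<in> K"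
      using nb[OF P] eq by auto
    obtain a where a: "((\<lambda>s. u y s T) has_real_derivative a) (at 0 within {..0})" "D * a = q y T"
      using assms(1) N unfolding half_def by blast
    have "((\<lambda>s. (y, s, T)) \<longlongrightarrow> (y, 0, T)) (nhds 0)" by (intro tendsto_intros) (simp add: filterlim_ident)
    then have "\<forall>\<^sub>F s in nhds 0. (y, s, T) \<in> N" by (rule topological_tendstoD) (use N z in auto)
    then obtain e where e: "e > 0" "\<And>s. dist s 0 < e \<Longrightarrow> (y, s, T) \<in> N"
      unfolding eventually_nhds_metric by auto
    have "a - b \<le> 0"
    proof (rule left_derivative_min_nonpos[of "\<lambda>s. u y s T - \<phi> y s T"])
      show "((\<lambda>s. u y s T - \<phi> y s T) has_real_derivative a - b) (at 0 within {..0})"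
        using a b by (auto intro!: derivative_intros)
      show "u y 0 T - \<phi> y 0 T \<le> u y s T - \<phi> y s T" if "- e < s" "s \<le> 0" for s
        using all[of y s T] N e(2)[of s] that eq z by (auto simp: dist_real_def)
    qed (fact e)
    then have "D * a \<le> D * b" using \<open>D > 0\<close> by simp
    then show "q y T \<le> D * b" using a by simp }
qed

text \<open>The points where one of the two inequalities fails form a compact set, so there is an
  earliest one. By \<open>nbu\<close> and \<open>nbv\<close> it lies off the initial slice and off
  the lateral boundary of its domain, and there the strict inequalities \<open>su\<close>,
  \<open>sv\<close>, \<open>bu\<close>, \<open>bv\<close> contradict
  \<open>first_contact_one\<close>. In \<open>bu\<close> and \<open>bv\<close> the other component
  may be assumed to be still above its test function; that is how the coupling is used.\<close>

lemma first_contact: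
  fixes u \<phi> v \<psi> :: "real^'m::finite \<Rightarrow> real \<Rightarrow> real \<Rightarrow> real"
  assumes hu: "half D g u q" "D > 0" and hv: "half d f v r" "d > 0"
    and K: "compact K" "K \<subseteq> {p. fst (snd p) \<le> 0 \<and> snd (snd p) \<ge> 0}"
    and J: "compact J" "J \<subseteq> {p. fst (snd p) \<le> 0 \<and> snd (snd p) \<ge> 0}"
    and c\<phi>: "continuous_on K (\<lambda>(y, z, t). \<phi> y z t)" and c\<psi>: "continuous_on J (\<lambda>(y, z, t). \<psi> y z t)"
    and nbu: "\<And>y z t. (y, z, t) \<in> K \<Longrightarrow> u y z t \<le> \<phi> y z t \<Longrightarrow> t > 0 \<and>
         (\<exists>N. open N \<and> (y, z, t) \<in> N \<and> (\<forall>y' z' t'. (y', z', t') \<in> N \<longrightarrow> z' \<le> 0 \<longrightarrow> t' \<le> t \<longrightarrow> (y', z', t') \<in> K))"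
    and nbv: "\<And>y z t. (y, z, t) \<in> J \<Longrightarrow> v y z t \<le> \<psi> y z t \<Longrightarrow> t > 0 \<and>
         (\<exists>N. open N \<and> (y, z, t) \<in> N \<and> (\<forall>y' z' t'. (y', z', t') \<in> N \<longrightarrow> z' \<le> 0 \<longrightarrow> t' \<le> t \<longrightarrow> (y', z', t') \<in> J))"
    and su: "\<And>y z t. (y, z, t) \<in> K \<Longrightarrow> u y z t = \<phi> y z t \<Longrightarrow> t > 0 \<Longrightarrow> z < 0 \<Longrightarrow> \<exists>a. heat_op D \<phi> y z t a \<and> a < g (\<phi> y z t)"
    and sv: "\<And>y z t. (y, z, t) \<in> J \<Longrightarrow> v y z t = \<psi> y z t \<Longrightarrow> t > 0 \<Longrightarrow> z < 0 \<Longrightarrow> \<exists>a. heat_op d \<psi> y z t a \<and> a < f (\<psi> y z t)"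
    and bu: "\<And>y t. (y, 0, t) \<in> K \<Longrightarrow> u y 0 t = \<phi> y 0 t \<Longrightarrow> t > 0 \<Longrightarrow> ((y, 0, t) \<in> J \<Longrightarrow> \<psi> y 0 t \<le> v y 0 t) \<Longrightarrow>
         \<exists>b. ((\<lambda>s. \<phi> y s t) has_real_derivative b) (at 0 within {..0}) \<and> D * b < q y t"
    and bv: "\<And>y t. (y, 0, t) \<in> J \<Longrightarrow> v y 0 t = \<psi> y 0 t \<Longrightarrow> t > 0 \<Longrightarrow> ((y, 0, t) \<in> K \<Longrightarrow> \<phi> y 0 t \<le> u y 0 t) \<Longrightarrow>
         \<exists>b. ((\<lambda>s. \<psi> y s t) has_real_derivative b) (at 0 within {..0}) \<and> d * b < r y t"
  shows "(\<forall>y z t. (y, z, t) \<in> K \<longrightarrow> \<phi> y z t < u y z t) \<and> (\<forall>y z t. (y, z, t) \<in> J \<longrightarrow> \<psi> y z t < v y z t)"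
proof -
  define A where "A = {p \<in> K. (\<lambda>(y, z, t). u y z t - \<phi> y z t) p \<le> 0}"
  define B where "B = {p \<in> J. (\<lambda>(y, z, t). v y z t - \<psi> y z t) p \<le> 0}"
  have cu: "continuous_on K (\<lambda>(y, z, t). u y z t - \<phi> y z t)"
    using continuous_on_diff[OF continuous_on_subset[OF _ K(2)] c\<phi>] hu unfolding half_def by (force simp: split_beta)
  have cv: "continuous_on J (\<lambda>(y, z, t). v y z t - \<psi> y z t)"
    using continuous_on_diff[OF continuous_on_subset[OF _ J(2)] c\<psi>] hv unfolding half_def by (force simp: split_beta)
  have comp: "compact {p \<in> S. h p \<le> 0}" if "compact S" "continuous_on S h" for S :: "((real^'m) \<times> real \<times> real) set" and h :: "(real^'m) \<times> real \<times> real \<Rightarrow> real"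
  proof -
    have "closedin (top_of_set S) (S \<inter> h -` {..0})"
      using that by (intro continuous_closedin_preimage) auto
    then have "closed (S \<inter> h -` {..0})"
      using that(1) by (meson closedin_closed_trans compact_imp_closed)
    moreover have "{p \<in> S. h p \<le> 0} = S \<inter> (S \<inter> h -` {..0})" by auto
    ultimately show ?thesis using compact_Int_closed[OF that(1)] by metis
  qed
  have cAB: "compact (A \<union> B)"
    unfolding A_def B_def by (intro compact_Un comp K J cu cv)
  have "A \<union> B = {}"
  proof (rule ccontr)
    assume "A \<union> B \<noteq> {}"
    \<comment> \<open>Minimising the time over the union of both contact sets guarantees that before
      \<open>T\<close> neither component has touched its test function.\<close>
    then have "\<exists>p\<in>A \<union> B. \<forall>p'\<in>A \<union> B. snd (snd p) \<le> snd (snd p')"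
      by (intro continuous_attains_inf[OF cAB] continuous_intros)
    then obtain p where p: "p \<in> A \<union> B" "\<And>p'. p' \<in> A \<union> B \<Longrightarrow> snd (snd p) \<le> snd (snd p')"
      by blast
    obtain y z T where pe: "p = (y, z, T)" by (cases p) auto
    have bK: "\<phi> y z t < u y z t" if "(y, z, t) \<in> K" "t < T" for y z t
      using p(2)[of "(y, z, t)"] that pe by (force simp: A_def)
    have bJ: "\<psi> y z t < v y z t" if "(y, z, t) \<in> J" "t < T" for y z t
      using p(2)[of "(y, z, t)"] that pe by (force simp: B_def)
    note fK = first_contact_one[OF hu K(2) c\<phi> nbu bK]
    note fJ = first_contact_one[OF hv J(2) c\<psi> nbv bJ]
    have leK: "\<phi> y z T \<le> u y z T" if "(y, z, T) \<in> K" for y z using fK(1)[OF _ _ _ _ that] by blast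
    have leJ: "\<psi> y z T \<le> v y z T" if "(y, z, T) \<in> J" for y z using fJ(1)[OF _ _ _ _ that] by blast
    from p(1) show False
    proof
      assume a: "p \<in> A"
      then have pK: "(y, z, T) \<in> K" and "u y z T \<le> \<phi> y z T" using pe by (auto simp: A_def)
      then have eq: "u y z T = \<phi> y z T" using leK[OF pK] by auto
      have T: "T > 0" using nbu[OF pK] eq by auto
      have z: "z \<le> 0" using pK K by auto
      show False
      proof (cases "z < 0")
        case True
        then show ?thesis using su[OF pK eq T] fK(2)[OF _ _ _ _ pK eq True] by fastforce
      next
        case False
        with z have z0: "z = 0" by simp
        obtain b where "((\<lambda>s. \<phi> y s T) has_real_derivative b) (at 0 within {..0})" "D * b < q y T"
          using bu[of y T] pK eq T z0 leJ by blast
        then show ?thesis using fK(3)[OF _ _ _ _ pK eq z0] by fastforce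
      qed
    next
      assume a: "p \<in> B"
      then have pK: "(y, z, T) \<in> J" and "v y z T \<le> \<psi> y z T" using pe by (auto simp: B_def)
      then have eq: "v y z T = \<psi> y z T" using leJ[OF pK] by auto
      have T: "T > 0" using nbv[OF pK] eq by auto
      have z: "z \<le> 0" using pK J by auto
      show False
      proof (cases "z < 0")
        case True
        then show ?thesis using sv[OF pK eq T] fJ(2)[OF _ _ _ _ pK eq True] by fastforce
      next
        case False
        with z have z0: "z = 0" by simp
        obtain b where "((\<lambda>s. \<psi> y s T) has_real_derivative b) (at 0 within {..0})" "d * b < r y T"
          using bv[of y T] pK eq T z0 leK by blast
        then show ?thesis using fJ(3)[OF _ _ _ _ pK eq z0] by fastforce
      qed
    qed
  qed
  then show ?thesis unfolding A_def B_def by force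
qed

lemma first_contact_single:
  fixes u \<phi> :: "real^'m::finite \<Rightarrow> real \<Rightarrow> real \<Rightarrow> real"
  assumes hu: "half D g u q" "D > 0"
    and K: "compact K" "K \<subseteq> {p. fst (snd p) \<le> 0 \<and> snd (snd p) \<ge> 0}"
    and c\<phi>: "continuous_on K (\<lambda>(y, z, t). \<phi> y z t)"
    and nbu: "\<And>y z t. (y, z, t) \<in> K \<Longrightarrow> u y z t \<le> \<phi> y z t \<Longrightarrow> t > 0 \<and>
         (\<exists>N. open N \<and> (y, z, t) \<in> N \<and> (\<forall>y' z' t'. (y', z', t') \<in> N \<longrightarrow> z' \<le> 0 \<longrightarrow> t' \<le> t \<longrightarrow> (y', z', t') \<in> K))"
    and su: "\<And>y z t. (y, z, t) \<in> K \<Longrightarrow> u y z t = \<phi> y z t \<Longrightarrow> t > 0 \<Longrightarrow> z < 0 \<Longrightarrow> \<exists>a. heat_op D \<phi> y z t a \<and> a < g (\<phi> y z t)"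
    and bu: "\<And>y t. (y, 0, t) \<in> K \<Longrightarrow> u y 0 t = \<phi> y 0 t \<Longrightarrow> t > 0 \<Longrightarrow>
         \<exists>b. ((\<lambda>s. \<phi> y s t) has_real_derivative b) (at 0 within {..0}) \<and> D * b < q y t"
    and P: "(y, z, t) \<in> K"
  shows "\<phi> y z t < u y z t"
proof -
  have "(\<forall>y z t. (y, z, t) \<in> K \<longrightarrow> \<phi> y z t < u y z t) \<and> (\<forall>y z t. (y, z, t) \<in> {} \<longrightarrow> \<phi> y z t < u y z t)"
    \<comment> \<open>An empty domain for the second component makes all conditions on it vacuous,
      so \<open>hu\<close> itself can serve as the second problem.\<close>
    by (rule first_contact[OF hu hu K _ _ c\<phi>, of "{}"]) (simp_all add: nbu su bu)
  then show ?thesis using P by blast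
qed

section \<open>Test functions that are quadratic along coordinate lines\<close>

lemma norm_line_sq:
  fixes y :: "real^'m::finite"
  shows "(norm (y + s *\<^sub>R axis i 1))\<^sup>2 = (norm y)\<^sup>2 + 2 * s * (y $ i) + s\<^sup>2"
proof -
  have "axis i 1 \<bullet> (axis i 1 :: real^'m) = 1" by (simp add: inner_axis_axis)
  then show ?thesis
    unfolding power2_norm_eq_inner
    by (simp add: inner_add_left inner_add_right inner_axis inner_axis' power2_eq_square algebra_simps)
qed

lemma sum_sq_norm: "(\<Sum>i\<in>UNIV. (y $ i)\<^sup>2) = (norm (y::real^'m::finite))\<^sup>2"
  unfolding power2_norm_eq_inner by (simp add: inner_vec_def power2_eq_square)

lemma has_d2_quadratic: "has_d2 (\<lambda>s. a + b * s + c * s\<^sup>2) x (2 * c)"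
  by (rule has_d2I[where c' = "\<lambda>s. b + 2 * c * s"]) (auto intro!: derivative_eq_intros)

lemma has_d2_cmult: "has_d2 c x k \<Longrightarrow> has_d2 (\<lambda>s. a * c s) x (a * k)"
  unfolding has_d2_def
proof (elim exE conjE)
  fix c' assume c: "\<forall>\<^sub>F s in nhds x. (c has_real_derivative c' s) (at s)" "(c' has_real_derivative k) (at x)"
  show "\<exists>c'. (\<forall>\<^sub>F s in nhds x. ((\<lambda>s. a * c s) has_real_derivative c' s) (at s)) \<and> (c' has_real_derivative a * k) (at x)"
    apply (rule exI[of _ "\<lambda>s. a * c' s"])
    using c by (auto elim!: eventually_mono intro!: DERIV_cmult)
qed

lemma has_d2_const: "has_d2 (\<lambda>s. a) x 0"
  using has_d2_quadratic[of a 0 0 x] by simp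

text \<open>Comparison with test functions \<open>\<nu>X, \<mu>X\<close> that do not depend on \<open>z\<close> and therefore
  carry no flux; the penalty term \<open>\<delta> e\<^sup>\<kappa>\<^sup>t (1 + |y|\<^sup>2 + z\<^sup>2 + z)\<close> compactifies the problem and
  has a strictly favourable flux.\<close>

lemma pair_compare:
  fixes u v :: "real^'m::finite \<Rightarrow> real \<Rightarrow> real \<Rightarrow> real" and X :: "real^'m \<Rightarrow> real \<Rightarrow> real"
  assumes pos: "D > 0" "d > 0" "\<mu> > 0" "\<nu> > 0" "L \<ge> 0"
    and hu: "half D g u (\<lambda>y t. \<nu> * v y 0 t - \<mu> * u y 0 t)"
    and hv: "half d f v (\<lambda>y t. \<mu> * u y 0 t - \<nu> * v y 0 t)"
    and bd: "\<And>y z t. z \<le> 0 \<Longrightarrow> 0 \<le> t \<Longrightarrow> t \<le> T \<Longrightarrow> \<bar>u y z t\<bar> \<le> M \<and> \<bar>v y z t\<bar> \<le> M"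
    and Xc: "continuous_on UNIV (\<lambda>(y, t). X y t)" and XC: "\<And>y t. X y t \<le> C"
    and Xeq: "\<And>y t. 0 < t \<Longrightarrow> t \<le> T \<Longrightarrow> \<exists>pt py. ((\<lambda>t. X y t) has_real_derivative pt) (at t)
       \<and> (\<forall>i. has_d2 (\<lambda>s. X (y + s *\<^sub>R axis i 1) t) 0 (py i))
       \<and> (\<forall>s. \<bar>s\<bar> \<le> M \<longrightarrow> s \<le> \<nu> * X y t \<longrightarrow> \<nu> * (pt - D * (\<Sum>i\<in>UNIV. py i)) \<le> g s + L * (\<nu> * X y t - s))
       \<and> (\<forall>s. \<bar>s\<bar> \<le> M \<longrightarrow> s \<le> \<mu> * X y t \<longrightarrow> \<mu> * (pt - d * (\<Sum>i\<in>UNIV. py i)) \<le> f s + L * (\<mu> * X y t - s))"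
    and init: "\<And>y z. z \<le> 0 \<Longrightarrow> \<nu> * X y 0 \<le> u y z 0 \<and> \<mu> * X y 0 \<le> v y z 0"
    and t: "0 \<le> t1" "t1 \<le> T" and z1: "z1 \<le> 0"
  shows "\<nu> * X y1 t1 \<le> u y1 z1 t1 \<and> \<mu> * X y1 t1 \<le> v y1 z1 t1"
proof -
  \<comment> \<open>Completing the square gives \<open>B \<ge> 3/4\<close>. The factor 8/3 then
    makes \<open>(\<kappa> - L) * B\<close> exceed \<open>D\<close> and \<open>d\<close> times the
    Laplacian \<open>2 * CARD('m) + 2\<close> of \<open>B\<close>.\<close>
  define \<kappa> where "\<kappa> = L + 8 / 3 * (D + d) * (real CARD('m) + 1) + 1"
  define B where "B y z = 1 + (norm y)\<^sup>2 + z\<^sup>2 + z" for y :: "real^'m" and z :: real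
  have B34: "B y z \<ge> 3/4" for y z
  proof -
    have "B y z = (norm y)\<^sup>2 + (z + 1/2)\<^sup>2 + 3/4" by (simp add: B_def power2_eq_square algebra_simps)
    then show ?thesis by simp
  qed
  have \<kappa>B: "(\<kappa> - L) * B y z > D * (2 * real CARD('m) + 2)" "(\<kappa> - L) * B y z > d * (2 * real CARD('m) + 2)" for y z
  proof -
    have "(\<kappa> - L) * B y z \<ge> (\<kappa> - L) * (3/4)"
      using B34 pos by (intro mult_left_mono) (auto simp: \<kappa>_def intro!: add_nonneg_nonneg mult_nonneg_nonneg)
    moreover have "(\<kappa> - L) * (3/4) = 2 * (D + d) * (real CARD('m) + 1) + 3/4"
      by (simp add: \<kappa>_def algebra_simps)
    moreover have "2 * (D + d) * (real CARD('m) + 1) \<ge> D * (2 * real CARD('m) + 2)"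
      "2 * (D + d) * (real CARD('m) + 1) \<ge> d * (2 * real CARD('m) + 2)"
      using pos by (simp_all add: algebra_simps)
    ultimately show "(\<kappa> - L) * B y z > D * (2 * real CARD('m) + 2)" "(\<kappa> - L) * B y z > d * (2 * real CARD('m) + 2)"
      by linarith+
  qed
  have \<kappa>0: "\<kappa> \<ge> 0" using pos by (auto simp: \<kappa>_def intro!: add_nonneg_nonneg mult_nonneg_nonneg)
  have M0: "M \<ge> 0" using bd[of 0 0] t by fastforce
  have main: "\<nu> * (X y1 t1 - \<delta> * exp (\<kappa> * t1) * B y1 z1) < u y1 z1 t1 \<and> \<mu> * (X y1 t1 - \<delta> * exp (\<kappa> * t1) * B y1 z1) < v y1 z1 t1"
    if \<delta>: "\<delta> > 0" for \<delta>
  proof -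
    \<comment> \<open>\<open>R\<close> is so large that on the lateral boundary the penalty exceeds
      \<open>W\<close>; there \<open>\<nu> * \<omega>\<close> and \<open>\<mu> * \<omega>\<close>
      fall below \<open>- M\<close>, hence below the solution. The summands \<open>norm y1\<close>
      and \<open>\<bar>z1\<bar>\<close> put the target point into \<open>K\<close>.\<close>
    define W where "W = \<bar>C\<bar> + M / \<nu> + M / \<mu>"
    define R where "R = 2 + W / \<delta> + norm y1 + \<bar>z1\<bar>"
    have W0: "W \<ge> 0" using M0 pos by (auto simp: W_def)
    have Rge: "R \<ge> 2" "R \<ge> norm y1" "R \<ge> \<bar>z1\<bar>" using W0 \<delta> by (auto simp: R_def)
    have "\<delta> * R \<ge> W" using \<delta> W0 by (auto simp: R_def algebra_simps)
    have RR: "\<delta> * (R\<^sup>2 - R + 3/4) > W"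
    proof -
      have "R\<^sup>2 \<ge> 2 * R" using Rge by (simp add: power2_eq_square)
      then have "R < R\<^sup>2 - R + 3/4" using Rge by linarith
      then have "\<delta> * R < \<delta> * (R\<^sup>2 - R + 3/4)" using \<delta> by (intro mult_strict_left_mono)
      then show ?thesis using \<open>\<delta> * R \<ge> W\<close> by linarith
    qed
    define \<omega> where "\<omega> y z t = X y t - \<delta> * exp (\<kappa> * t) * B y z" for y z t
    define K where "K = cball (0::real^'m) R \<times> {-R..0} \<times> {0..T}"
    have KD: "(y, z, t) \<in> K \<longleftrightarrow> norm y \<le> R \<and> - R \<le> z \<and> z \<le> 0 \<and> 0 \<le> t \<and> t \<le> T" for y z t
      by (auto simp: K_def)
    have \<omega>X: "\<omega> y z t < X y t" for y z t
    proof -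
      have "0 < \<delta> * exp (\<kappa> * t) * B y z" using \<delta> B34[of y z] by (intro mult_pos_pos) auto
      then show ?thesis by (simp add: \<omega>_def)
    qed
    have low: "\<nu> * \<omega> y z t < - M \<and> \<mu> * \<omega> y z t < - M" if "(y, z, t) \<in> K" "norm y = R \<or> z = - R" for y z t
    proof -
      have Bg: "B y z \<ge> R\<^sup>2 - R + 3/4"
      proof -
        have "(norm y)\<^sup>2 \<ge> 0" "z\<^sup>2 + z \<ge> - 1/4"
          using zero_le_power2[of "z + 1/2"] by (auto simp: power2_eq_square algebra_simps)
        then show ?thesis using that(2) Rge unfolding B_def by auto
      qed
      have "\<delta> * (R\<^sup>2 - R + 3/4) \<le> \<delta> * B y z" using Bg \<delta> by simp
      also have "\<dots> \<le> \<delta> * exp (\<kappa> * t) * B y z"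
        using that KD \<kappa>0 \<delta> B34[of y z] by (intro mult_right_mono) auto
      finally have "\<omega> y z t < C - W" using RR XC[of y t] by (simp add: \<omega>_def)
      then have c: "\<omega> y z t < - (M / \<nu>)" "\<omega> y z t < - (M / \<mu>)"
        using M0 pos divide_nonneg_nonneg[of M \<nu>] divide_nonneg_nonneg[of M \<mu>] unfolding W_def by linarith+
      then show ?thesis using pos by (simp add: field_simps)
    qed
    \<comment> \<open>At a contact the solution has the value \<open>c * \<omega>\<close>, which is
      below \<open>c * X\<close>. The inequality for \<open>X\<close> is therefore used at that
      smaller value; the loss \<open>L * (c * X - c * \<omega>)\<close> is \<open>L\<close> times
      the penalty and is absorbed by the growth rate \<kappa>.\<close>
    have hop: "\<exists>a. heat_op E (\<lambda>y z t. c * \<omega> y z t) y z t a \<and> a < h (c * \<omega> y z t)"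
      if "(y, z, t) \<in> K" "t > 0" "c > 0" "E > 0" "(\<kappa> - L) * B y z > E * (2 * real CARD('m) + 2)" "\<bar>c * \<omega> y z t\<bar> \<le> M"
        and dt: "((\<lambda>t. X y t) has_real_derivative pt) (at t)" and dy: "\<And>i. has_d2 (\<lambda>s. X (y + s *\<^sub>R axis i 1) t) 0 (py i)"
        and hh: "\<And>s. \<bar>s\<bar> \<le> M \<Longrightarrow> s \<le> c * X y t \<Longrightarrow> c * (pt - E * (\<Sum>i\<in>UNIV. py i)) \<le> h s + L * (c * X y t - s)"
      for y z t E c pt py h
    proof (intro exI conjI)
      let ?e = "\<delta> * exp (\<kappa> * t)"
      show "heat_op E (\<lambda>y z t. c * \<omega> y z t) y z t
          (c * (pt - E * (\<Sum>i\<in>UNIV. py i)) - c * ?e * (\<kappa> * B y z - E * (2 * real CARD('m) + 2)))"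
      proof (rule heat_opI)
        show "((\<lambda>s. c * \<omega> y z s) has_real_derivative c * (pt - \<kappa> * ?e * B y z)) (at t)"
          unfolding \<omega>_def using dt by (auto intro!: derivative_eq_intros)
        show "has_d2 (\<lambda>s. c * \<omega> (y + s *\<^sub>R axis i 1) z t) 0 (c * (py i - 2 * ?e))" for i
        proof (rule has_d2_cmult)
          have "has_d2 (\<lambda>s. X (y + s *\<^sub>R axis i 1) t - (?e * B y z + (?e * 2 * y $ i) * s + ?e * s\<^sup>2)) 0 (py i - 2 * ?e)"
            by (intro has_d2_diff has_d2_quadratic dy)
          then show "has_d2 (\<lambda>s. \<omega> (y + s *\<^sub>R axis i 1) z t) 0 (py i - 2 * ?e)"
            unfolding \<omega>_def B_def norm_line_sq by (simp add: algebra_simps)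
        qed
        have "has_d2 (\<lambda>s. c * (X y t - (?e * (1 + (norm y)\<^sup>2) + ?e * s + ?e * s\<^sup>2))) z (c * (0 - 2 * ?e))"
          by (intro has_d2_cmult has_d2_diff has_d2_quadratic has_d2_const)
        then show "has_d2 (\<lambda>s. c * \<omega> y s t) z (c * (- 2 * ?e))"
          unfolding \<omega>_def B_def by (simp add: algebra_simps)
        show "c * (pt - \<kappa> * ?e * B y z) - E * ((\<Sum>i\<in>UNIV. c * (py i - 2 * ?e)) + c * (- 2 * ?e)) =
          c * (pt - E * (\<Sum>i\<in>UNIV. py i)) - c * ?e * (\<kappa> * B y z - E * (2 * real CARD('m) + 2))"
          by (simp add: sum_subtractf sum_distrib_left[symmetric] algebra_simps)
      qed
      have "c * \<omega> y z t \<le> c * X y t" using \<omega>X[of y z t] that(3) by simp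
      then have "c * (pt - E * (\<Sum>i\<in>UNIV. py i)) \<le> h (c * \<omega> y z t) + L * (c * X y t - c * \<omega> y z t)"
        using hh that(6) by blast
      also have "L * (c * X y t - c * \<omega> y z t) = c * ?e * (L * B y z)" by (simp add: \<omega>_def algebra_simps)
      finally have 1: "c * (pt - E * (\<Sum>i\<in>UNIV. py i)) \<le> h (c * \<omega> y z t) + c * ?e * (L * B y z)" .
      have "L * B y z < \<kappa> * B y z - E * (2 * real CARD('m) + 2)" using that(5) by (simp add: algebra_simps)
      moreover have "c * ?e > 0" using that \<delta> by simp
      ultimately have "c * ?e * (L * B y z) < c * ?e * (\<kappa> * B y z - E * (2 * real CARD('m) + 2))"
        by (intro mult_strict_left_mono)
      with 1 show "c * (pt - E * (\<Sum>i\<in>UNIV. py i)) - c * ?e * (\<kappa> * B y z - E * (2 * real CARD('m) + 2)) < h (c * \<omega> y z t)"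
        by linarith
    qed
    have flux: "((\<lambda>s. c * \<omega> y s t) has_real_derivative - c * \<delta> * exp (\<kappa> * t)) (at 0 within {..0})" for c y t
      unfolding \<omega>_def B_def by (auto intro!: derivative_eq_intros)
    have cont: "continuous_on K (\<lambda>(y, z, t). c * \<omega> y z t)" for c
    proof -
      have "continuous_on K (\<lambda>p. (\<lambda>(y, t). X y t) (fst p, snd (snd p)))"
        by (rule continuous_on_compose2[OF Xc]) (auto intro!: continuous_intros)
      then show ?thesis unfolding \<omega>_def B_def split_beta by (auto intro!: continuous_intros)
    qed
    have nb: "t > 0 \<and> (\<exists>N. open N \<and> (y, z, t) \<in> N \<and> (\<forall>y' z' t'. (y', z', t') \<in> N \<longrightarrow> z' \<le> 0 \<longrightarrow> t' \<le> t \<longrightarrow> (y', z', t') \<in> K))"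
      if P: "(y, z, t) \<in> K" and le: "w y z t \<le> c * \<omega> y z t" and c: "c > 0" and ini: "\<And>y z. z \<le> 0 \<Longrightarrow> c * X y 0 \<le> w y z 0"
        and b: "\<bar>w y z t\<bar> \<le> M" and lo: "norm y = R \<or> z = - R \<Longrightarrow> c * \<omega> y z t < - M" for y z t w c
    proof (rule conjI)
      have "c * \<omega> y z t < c * X y t" using \<omega>X c by simp
      then have "t \<noteq> 0" using le ini[of z y] P KD by force
      then show "t > 0" using P KD by force
      have "norm y \<noteq> R" "z \<noteq> - R" using lo le b by linarith+
      then show "\<exists>N. open N \<and> (y, z, t) \<in> N \<and> (\<forall>y' z' t'. (y', z', t') \<in> N \<longrightarrow> z' \<le> 0 \<longrightarrow> t' \<le> t \<longrightarrow> (y', z', t') \<in> K)"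
        using P \<open>t > 0\<close> KD
        by (intro exI[of _ "ball 0 R \<times> {-R<..} \<times> {0<..}"]) (force intro!: open_Times)
    qed
    have "(\<forall>y z t. (y, z, t) \<in> K \<longrightarrow> \<nu> * \<omega> y z t < u y z t) \<and> (\<forall>y z t. (y, z, t) \<in> K \<longrightarrow> \<mu> * \<omega> y z t < v y z t)"
    proof (rule first_contact[OF hu pos(1) hv pos(2), of K K "\<lambda>y z t. \<nu> * \<omega> y z t" "\<lambda>y z t. \<mu> * \<omega> y z t"])
      show "compact K" unfolding K_def by (intro compact_Times) auto
      then show "compact K" .
      show "K \<subseteq> {p. fst (snd p) \<le> 0 \<and> 0 \<le> snd (snd p)}" by (auto simp: K_def)
      then show "K \<subseteq> {p. fst (snd p) \<le> 0 \<and> 0 \<le> snd (snd p)}" .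
      show "continuous_on K (\<lambda>(y, z, t). \<nu> * \<omega> y z t)" "continuous_on K (\<lambda>(y, z, t). \<mu> * \<omega> y z t)" by (fact cont)+
      fix y z t assume P: "(y, z, t) \<in> K"
      then have tt: "z \<le> 0" "0 \<le> t" "t \<le> T" using KD by auto
      note b = bd[OF tt, of y]
      show "t > 0 \<and> (\<exists>N. open N \<and> (y, z, t) \<in> N \<and> (\<forall>y' z' t'. (y', z', t') \<in> N \<longrightarrow> z' \<le> 0 \<longrightarrow> t' \<le> t \<longrightarrow> (y', z', t') \<in> K))"
        if "u y z t \<le> \<nu> * \<omega> y z t"
        by (rule nb[where w = u and c = \<nu>, OF P that pos(4)]) (use init b low[OF P] in auto)
      show "t > 0 \<and> (\<exists>N. open N \<and> (y, z, t) \<in> N \<and> (\<forall>y' z' t'. (y', z', t') \<in> N \<longrightarrow> z' \<le> 0 \<longrightarrow> t' \<le> t \<longrightarrow> (y', z', t') \<in> K))"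
        if "v y z t \<le> \<mu> * \<omega> y z t"
        by (rule nb[where w = v and c = \<mu>, OF P that pos(3)]) (use init b low[OF P] in auto)
      assume t0: "t > 0"
      obtain pt py where X: "((\<lambda>t. X y t) has_real_derivative pt) (at t)" "\<And>i. has_d2 (\<lambda>s. X (y + s *\<^sub>R axis i 1) t) 0 (py i)"
        "\<And>s. \<bar>s\<bar> \<le> M \<Longrightarrow> s \<le> \<nu> * X y t \<Longrightarrow> \<nu> * (pt - D * (\<Sum>i\<in>UNIV. py i)) \<le> g s + L * (\<nu> * X y t - s)"
        "\<And>s. \<bar>s\<bar> \<le> M \<Longrightarrow> s \<le> \<mu> * X y t \<Longrightarrow> \<mu> * (pt - d * (\<Sum>i\<in>UNIV. py i)) \<le> f s + L * (\<mu> * X y t - s)"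
        using Xeq[of t y] t0 tt by blast
      show "\<exists>a. heat_op D (\<lambda>y z t. \<nu> * \<omega> y z t) y z t a \<and> a < g (\<nu> * \<omega> y z t)" if "u y z t = \<nu> * \<omega> y z t"
        by (rule hop[OF P t0 pos(4,1) \<kappa>B(1) _ X(1,2,3)]) (use b that in auto)
      show "\<exists>a. heat_op d (\<lambda>y z t. \<mu> * \<omega> y z t) y z t a \<and> a < f (\<mu> * \<omega> y z t)" if "v y z t = \<mu> * \<omega> y z t"
        by (rule hop[OF P t0 pos(3,2) \<kappa>B(2) _ X(1,2,4)]) (use b that in auto)
    next
      \<comment> \<open>The pair (\<nu>\<omega>, \<mu>\<omega>) balances the exchange at the
        interface exactly: with \<open>u = \<nu> * \<omega>\<close> and
        \<open>v \<ge> \<mu> * \<omega>\<close> the flux into the lower medium is non-negative,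
        while the penalty gives the test function a negative slope.\<close>
      fix y t assume P: "(y, 0, t) \<in> K" and e: "u y 0 t = \<nu> * \<omega> y 0 t" and "(y, 0, t) \<in> K \<Longrightarrow> \<mu> * \<omega> y 0 t \<le> v y 0 t"
      then have "\<nu> * (\<mu> * \<omega> y 0 t) \<le> \<nu> * v y 0 t" using pos by simp
      then have "0 \<le> \<nu> * v y 0 t - \<mu> * u y 0 t" using e by (simp add: algebra_simps)
      moreover have "D * (- \<nu> * \<delta> * exp (\<kappa> * t)) < 0" using pos \<delta> by simp
      ultimately show "\<exists>b. ((\<lambda>s. \<nu> * \<omega> y s t) has_real_derivative b) (at 0 within {..0}) \<and> D * b < \<nu> * v y 0 t - \<mu> * u y 0 t"
        using flux[of \<nu> y t] by force
    next
      fix y t assume P: "(y, 0, t) \<in> K" and e: "v y 0 t = \<mu> * \<omega> y 0 t" and "(y, 0, t) \<in> K \<Longrightarrow> \<nu> * \<omega> y 0 t \<le> u y 0 t"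
      then have "\<mu> * (\<nu> * \<omega> y 0 t) \<le> \<mu> * u y 0 t" using pos by simp
      then have "0 \<le> \<mu> * u y 0 t - \<nu> * v y 0 t" using e by (simp add: algebra_simps)
      moreover have "d * (- \<mu> * \<delta> * exp (\<kappa> * t)) < 0" using pos \<delta> by simp
      ultimately show "\<exists>b. ((\<lambda>s. \<mu> * \<omega> y s t) has_real_derivative b) (at 0 within {..0}) \<and> d * b < \<mu> * u y 0 t - \<nu> * v y 0 t"
        using flux[of \<mu> y t] by force
    qed
    moreover have "(y1, z1, t1) \<in> K" using KD Rge t z1 by auto
    ultimately show ?thesis unfolding \<omega>_def by blast
  qed
  have lim: "((\<lambda>\<delta>. c * (X y1 t1 - \<delta> * exp (\<kappa> * t1) * B y1 z1)) \<longlongrightarrow> c * (X y1 t1 - 0 * exp (\<kappa> * t1) * B y1 z1)) (at_right 0)" for c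
    by (intro tendsto_intros)
  have "\<forall>\<^sub>F \<delta> in at_right (0::real). \<delta> > 0" by (simp add: eventually_at_right_less)
  then have "\<forall>\<^sub>F \<delta> in at_right 0. \<nu> * (X y1 t1 - \<delta> * exp (\<kappa> * t1) * B y1 z1) \<le> u y1 z1 t1"
    "\<forall>\<^sub>F \<delta> in at_right 0. \<mu> * (X y1 t1 - \<delta> * exp (\<kappa> * t1) * B y1 z1) \<le> v y1 z1 t1"
    by (eventually_elim, use main in \<open>simp add: less_imp_le\<close>)+
  then have "\<nu> * X y1 t1 \<le> u y1 z1 t1" "\<mu> * X y1 t1 \<le> v y1 z1 t1"
    using tendsto_upperbound[OF lim[of \<nu>], of "u y1 z1 t1"] tendsto_upperbound[OF lim[of \<mu>], of "v y1 z1 t1"]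
    by auto
  then show ?thesis by simp
qed

lemma has_d2_shift:
  assumes "has_d2 (\<lambda>x. c (a + x)) 0 k"
  shows "has_d2 c a k"
proof -
  obtain c' where c: "\<forall>\<^sub>F x in nhds 0. ((\<lambda>x. c (a + x)) has_real_derivative c' x) (at x)" "(c' has_real_derivative k) (at 0)"
    using assms unfolding has_d2_def by blast
  have "\<forall>\<^sub>F s in nhds a. ((\<lambda>x. c (a + x)) has_real_derivative c' (s - a)) (at (s - a))"
  proof -
    have "((\<lambda>s. s - a) \<longlongrightarrow> 0) (nhds a)" using tendsto_diff[OF filterlim_ident tendsto_const, of a a] by simp
    then show ?thesis by (rule eventually_compose_filterlim[OF c(1)])
  qed
  then have "\<forall>\<^sub>F s in nhds a. (c has_real_derivative c' (s - a)) (at s)"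
  proof eventually_elim
    case (elim s)
    then have "((\<lambda>x. c (a + (x + (- a)))) has_real_derivative c' (s - a)) (at s)"
      using DERIV_shift[of "\<lambda>x. c (a + x)" "c' (s - a)" s "-a"] by simp
    then show ?case by simp
  qed
  moreover have "((\<lambda>s. c' (s - a)) has_real_derivative k) (at a)"
    using c(2) DERIV_shift[of c' k a "-a"] by simp
  ultimately show ?thesis unfolding has_d2_def by (intro exI[of _ "\<lambda>s. c' (s - a)"]) simp
qed

text \<open>The restriction of \<open>hump\<close> to a coordinate line through a point of its
  support: \<open>b\<close> is the component of the tilt, \<open>p\<close> the coordinate of the
  point relative to the centre, \<rho> the value of the unsquared factor.\<close>

lemma has_d2_exp_square:
  "has_d2 (\<lambda>x. exp (a - b * x) * (\<rho> - 2 * p * x - x\<^sup>2)\<^sup>2) 0 (exp a * (b\<^sup>2 * \<rho>\<^sup>2 + 8 * b * p * \<rho> + 8 * p\<^sup>2 - 4 * \<rho>))"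
proof (rule has_d2I)
  show "((\<lambda>x. exp (a - b * x) * (\<rho> - 2 * p * x - x\<^sup>2)\<^sup>2) has_real_derivative
      exp (a - b * x) * (- b * (\<rho> - 2 * p * x - x\<^sup>2)\<^sup>2 + 2 * (\<rho> - 2 * p * x - x\<^sup>2) * (- 2 * p - 2 * x))) (at x)" for x
    by (auto intro!: derivative_eq_intros simp: algebra_simps)
  show "((\<lambda>x. exp (a - b * x) * (- b * (\<rho> - 2 * p * x - x\<^sup>2)\<^sup>2 + 2 * (\<rho> - 2 * p * x - x\<^sup>2) * (- 2 * p - 2 * x)))
      has_real_derivative exp a * (b\<^sup>2 * \<rho>\<^sup>2 + 8 * b * p * \<rho> + 8 * p\<^sup>2 - 4 * \<rho>)) (at 0)"
    by (auto intro!: derivative_eq_intros simp: algebra_simps power2_eq_square)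
qed

text \<open>A bump of radius \<open>R\<close> whose centre moves with velocity
  \<open>(s, \<sigma>)\<close> and whose amplitude evolves at rate \<open>l\<close>. No cut-off is
  built in: the expression is used only where the base of the square is non-negative.\<close>

definition hump :: "real \<Rightarrow> real \<Rightarrow> real^'m::finite \<Rightarrow> real \<Rightarrow> real \<Rightarrow> real^'m \<Rightarrow> real \<Rightarrow> real \<Rightarrow> real" where
  "hump D l s \<sigma> R y z t = exp (l * t - (s \<bullet> (y - t *\<^sub>R s) + \<sigma> * (z - t * \<sigma>)) / (2 * D))
     * (R\<^sup>2 - (norm (y - t *\<^sub>R s))\<^sup>2 - (z - t * \<sigma>)\<^sup>2)\<^sup>2"

section \<open>Compactly supported subsolutions in a half-space\<close>

text \<open>The exponential tilt removes the drift in the moving frame; what remains is the heat operator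
  applied to \<open>\<rho>\<^sup>2\<close> with \<open>\<rho> = R\<^sup>2 - |x|\<^sup>2\<close>, which is negative near the boundary of the ball.\<close>

lemma heat_op_hump:
  fixes y y0 s :: "real^'m::finite" and z t z0 t0 \<sigma> R l \<eta> \<zeta> :: real
  assumes D: "D > 0"
  defines "Y \<equiv> y - y0 - (t - t0) *\<^sub>R s" and "Z \<equiv> z - z0 - (t - t0) * \<sigma>"
  defines "\<rho> \<equiv> R\<^sup>2 - (norm Y)\<^sup>2 - Z\<^sup>2"
  defines "E \<equiv> exp (l * (t - t0) - (s \<bullet> Y + \<sigma> * Z) / (2 * D))"
  shows "heat_op D (\<lambda>y z t. \<eta> * hump D l s \<sigma> R (y - y0) (z - z0) (t - t0) - \<zeta>) y z t
     (\<eta> * E * ((l + ((norm s)\<^sup>2 + \<sigma>\<^sup>2) / (4 * D)) * \<rho>\<^sup>2 - 8 * D * R\<^sup>2 + D * (12 + 4 * real CARD('m)) * \<rho>))"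
proof (rule heat_opI)
  define N where "N = (norm s)\<^sup>2 + \<sigma>\<^sup>2"
  define I where "I = s \<bullet> Y + \<sigma> * Z"
  have eqt: "hump D l s \<sigma> R (y - y0) (z - z0) (x - t0) =
     exp (l * (x - t0) - (I - (x - t) * N) / (2 * D)) * (\<rho> + 2 * (x - t) * I - (x - t)\<^sup>2 * N)\<^sup>2" for x
  proof -
    have a: "y - y0 - (x - t0) *\<^sub>R s = Y - (x - t) *\<^sub>R s" and b: "z - z0 - (x - t0) * \<sigma> = Z - (x - t) * \<sigma>"
      by (simp_all add: Y_def Z_def algebra_simps)
    have c: "s \<bullet> (Y - (x - t) *\<^sub>R s) + \<sigma> * (Z - (x - t) * \<sigma>) = I - (x - t) * N"
      by (simp add: I_def N_def inner_diff_right power2_norm_eq_inner power2_eq_square[of \<sigma>] algebra_simps)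
    have d: "(norm (Y - (x - t) *\<^sub>R s))\<^sup>2 = (norm Y)\<^sup>2 - 2 * (x - t) * (s \<bullet> Y) + (x - t)\<^sup>2 * (norm s)\<^sup>2"
      unfolding power2_norm_eq_inner by (simp add: inner_diff_right inner_diff_left inner_commute power2_eq_square algebra_simps)
    have "R\<^sup>2 - (norm (Y - (x - t) *\<^sub>R s))\<^sup>2 - (Z - (x - t) * \<sigma>)\<^sup>2 = \<rho> + 2 * (x - t) * I - (x - t)\<^sup>2 * N"
      unfolding d \<rho>_def I_def N_def by (simp add: power2_eq_square algebra_simps)
    then show ?thesis unfolding hump_def a b c by simp
  qed
  show "((\<lambda>x. \<eta> * hump D l s \<sigma> R (y - y0) (z - z0) (x - t0) - \<zeta>) has_real_derivative
     \<eta> * E * ((l + N / (2 * D)) * \<rho>\<^sup>2 + 4 * \<rho> * I)) (at t)"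
    unfolding eqt E_def I_def[symmetric] using D
    by (auto intro!: derivative_eq_intros simp: algebra_simps)
  have eqy: "hump D l s \<sigma> R (y + x *\<^sub>R axis i 1 - y0) (z - z0) (t - t0) =
     exp ((l * (t - t0) - I / (2 * D)) - (s $ i / (2 * D)) * x) * (\<rho> - 2 * (Y $ i) * x - x\<^sup>2)\<^sup>2" for x i
  proof -
    have a: "y + x *\<^sub>R axis i 1 - y0 - (t - t0) *\<^sub>R s = Y + x *\<^sub>R axis i 1" by (simp add: Y_def)
    have c: "s \<bullet> (Y + x *\<^sub>R axis i 1) + \<sigma> * Z = I + x * s $ i"
      by (simp add: I_def inner_add_right inner_axis)
    show ?thesis unfolding hump_def a c norm_line_sq Z_def[symmetric] \<rho>_def
      by (simp add: add_divide_distrib algebra_simps)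
  qed
  show "has_d2 (\<lambda>x. \<eta> * hump D l s \<sigma> R (y + x *\<^sub>R axis i 1 - y0) (z - z0) (t - t0) - \<zeta>) 0
     (\<eta> * (E * ((s $ i / (2 * D))\<^sup>2 * \<rho>\<^sup>2 + 8 * (s $ i / (2 * D)) * (Y $ i) * \<rho> + 8 * (Y $ i)\<^sup>2 - 4 * \<rho>)) - 0)" for i
    unfolding eqy E_def I_def[symmetric] by (intro has_d2_diff has_d2_cmult has_d2_exp_square has_d2_const)
  have eqz: "hump D l s \<sigma> R (y - y0) (z + x - z0) (t - t0) =
     exp ((l * (t - t0) - I / (2 * D)) - (\<sigma> / (2 * D)) * x) * (\<rho> - 2 * Z * x - x\<^sup>2)\<^sup>2" for x
  proof -
    have a: "z + x - z0 - (t - t0) * \<sigma> = Z + x" by (simp add: Z_def)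
    show ?thesis unfolding hump_def a Y_def[symmetric] \<rho>_def I_def
      by (simp add: add_divide_distrib power2_eq_square algebra_simps)
  qed
  show "has_d2 (\<lambda>x. \<eta> * hump D l s \<sigma> R (y - y0) (x - z0) (t - t0) - \<zeta>) z
     (\<eta> * (E * ((\<sigma> / (2 * D))\<^sup>2 * \<rho>\<^sup>2 + 8 * (\<sigma> / (2 * D)) * Z * \<rho> + 8 * Z\<^sup>2 - 4 * \<rho>)) - 0)"
    by (rule has_d2_shift)
      (unfold eqz E_def I_def[symmetric], intro has_d2_diff has_d2_cmult has_d2_exp_square has_d2_const)
  have S: "(\<Sum>i\<in>UNIV. \<eta> * (E * ((s $ i / (2 * D))\<^sup>2 * \<rho>\<^sup>2 + 8 * (s $ i / (2 * D)) * (Y $ i) * \<rho> + 8 * (Y $ i)\<^sup>2 - 4 * \<rho>)) - 0)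
     = \<eta> * (E * ((norm s)\<^sup>2 / (4 * D\<^sup>2) * \<rho>\<^sup>2 + 4 / D * (s \<bullet> Y) * \<rho> + 8 * (norm Y)\<^sup>2 - 4 * real CARD('m) * \<rho>))"
  proof -
    have e1: "(s $ i / (2 * D))\<^sup>2 * \<rho>\<^sup>2 + 8 * (s $ i / (2 * D)) * (Y $ i) * \<rho> + 8 * (Y $ i)\<^sup>2 - 4 * \<rho>
      = (1 / (4 * D\<^sup>2) * \<rho>\<^sup>2) * (s $ i)\<^sup>2 + (4 / D * \<rho>) * (s $ i * Y $ i) + 8 * (Y $ i)\<^sup>2 - 4 * \<rho>" for i
      using D by (simp add: power2_eq_square field_simps)
    have e2: "(\<Sum>i\<in>UNIV. a * (s $ i)\<^sup>2 + b * (s $ i * Y $ i) + 8 * (Y $ i)\<^sup>2 - 4 * \<rho>)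
      = a * (norm s)\<^sup>2 + b * (s \<bullet> Y) + 8 * (norm Y)\<^sup>2 - 4 * real CARD('m) * \<rho>" for a b
      by (simp add: sum_distrib_left[symmetric] sum.distrib sum_subtractf sum_sq_norm inner_vec_def)
    have e3: "(\<Sum>i\<in>UNIV. \<eta> * (E * X i) - 0) = \<eta> * (E * (\<Sum>i\<in>UNIV. X i))" for X :: "'m \<Rightarrow> real"
      by (simp add: sum_distrib_left)
    show ?thesis unfolding e3 e1 e2 by (simp add: mult.commute mult.left_commute)
  qed
  \<comment> \<open>The terms linear in \<open>I\<close>, one from the motion and one from the tilt,
    cancel. Substituting \<open>R\<^sup>2 - \<rho>\<close> for the squared distance from the centre
    then leaves an expression in \<rho> alone.\<close>
  show "\<eta> * E * ((l + N / (2 * D)) * \<rho>\<^sup>2 + 4 * \<rho> * I) -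
     D * ((\<Sum>i\<in>UNIV. \<eta> * (E * ((s $ i / (2 * D))\<^sup>2 * \<rho>\<^sup>2 + 8 * (s $ i / (2 * D)) * (Y $ i) * \<rho> + 8 * (Y $ i)\<^sup>2 - 4 * \<rho>)) - 0) +
       (\<eta> * (E * ((\<sigma> / (2 * D))\<^sup>2 * \<rho>\<^sup>2 + 8 * (\<sigma> / (2 * D)) * Z * \<rho> + 8 * Z\<^sup>2 - 4 * \<rho>)) - 0)) =
     \<eta> * E * ((l + ((norm s)\<^sup>2 + \<sigma>\<^sup>2) / (4 * D)) * \<rho>\<^sup>2 - 8 * D * R\<^sup>2 + D * (12 + 4 * real CARD('m)) * \<rho>)"
  proof -
    have r: "(norm Y)\<^sup>2 = R\<^sup>2 - Z\<^sup>2 - \<rho>" by (simp add: \<rho>_def)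
    show ?thesis unfolding S r N_def I_def using D
      by (simp add: field_simps power2_eq_square)
  qed
qed

definition lower_on_ball :: "(real^'m::finite \<Rightarrow> real \<Rightarrow> real \<Rightarrow> real) \<Rightarrow> real^'m \<Rightarrow> real \<Rightarrow> real \<Rightarrow> real \<Rightarrow> real \<Rightarrow> bool" where
  "lower_on_ball u y0 z0 R t \<delta> \<longleftrightarrow> (\<forall>y z. z \<le> 0 \<longrightarrow> (norm (y - y0))\<^sup>2 + (z - z0)\<^sup>2 \<le> R\<^sup>2 \<longrightarrow> \<delta> \<le> u y z t)"

text \<open>The derivative \<open>gp = g'(0)\<close> enters the lower bounds only through the assumption \<open>growth\<close>.\<close>

locale half_pos =
  fixes D \<mu> gp :: real and g :: "real \<Rightarrow> real" and u :: "real^'m::finite \<Rightarrow> real \<Rightarrow> real \<Rightarrow> real"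
    and q :: "real^'m \<Rightarrow> real \<Rightarrow> real"
  assumes hu: "half D g u q" and D: "D > 0" and \<mu>: "\<mu> > 0"
    and nonneg: "\<And>y z t. z \<le> 0 \<Longrightarrow> 0 \<le> t \<Longrightarrow> 0 \<le> u y z t"
    and flux: "\<And>y t. t > 0 \<Longrightarrow> - \<mu> * u y 0 t \<le> q y t"
    and growth: "\<And>k. k < gp \<Longrightarrow> \<exists>s0>0. \<forall>x. 0 \<le> x \<longrightarrow> x \<le> s0 \<longrightarrow> k * x \<le> g x"
begin

text \<open>\<open>gap\<close> says that the quadratic
  \<open>c * r\<^sup>2 - b * r + 8 * D * R\<^sup>2\<close> has negative discriminant, which makes
  the bump a strict subsolution of the equation with reaction \<open>k * x\<close>;
  \<open>amp\<close> keeps it in the range where \<open>g x \<ge> k * x\<close>.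
  \<open>centre\<close> offers two ways to control the interface: either the ball stays in the lower
  half-space, or its centre rises and stays at depth at least 1. In the second case the part above
  depth 0 has \<rho> at most \<open>R\<^sup>2 - 1\<close>, and
  \<open>\<mu> * (R\<^sup>2 - 1) \<le> 4 * D\<close> lets the decrease of the bump towards the
  interface outweigh the outflow \<open>- \<mu> * u\<close>.\<close>

lemma hump_below:
  fixes s y0 :: "real^'m"
  assumes R: "R > 0" and \<eta>: "\<eta> > 0" and V: "V \<ge> 0" "(norm s)\<^sup>2 + \<sigma>\<^sup>2 \<le> V\<^sup>2"
    and gr: "\<And>x. 0 \<le> x \<Longrightarrow> x \<le> s0 \<Longrightarrow> k * x \<le> g x"
    and gap: "D * (12 + 4 * real CARD('m))\<^sup>2 < 32 * R\<^sup>2 * (k - l - V\<^sup>2 / (4 * D))"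
    and t: "t0 \<ge> 0" "T \<ge> 0"
    and centre: "(z0 \<le> - R \<and> z0 + T * \<sigma> \<le> - R) \<or> (\<sigma> \<ge> 0 \<and> z0 + T * \<sigma> \<le> - 1 \<and> \<mu> * (R\<^sup>2 - 1) \<le> 4 * D)"
    and amp: "\<And>\<tau>. 0 \<le> \<tau> \<Longrightarrow> \<tau> \<le> T \<Longrightarrow> \<eta> * exp (l * \<tau>) * exp (V * R / (2 * D)) * R ^ 4 \<le> s0"
    and init: "\<And>y z. z \<le> 0 \<Longrightarrow> (norm (y - y0))\<^sup>2 + (z - z0)\<^sup>2 \<le> R\<^sup>2 \<Longrightarrow> \<eta> * exp (V * R / (2 * D)) * R ^ 4 < u y z t0"
    and z1: "z1 \<le> 0" and in1: "(norm (y1 - y0 - T *\<^sub>R s))\<^sup>2 + (z1 - z0 - T * \<sigma>)\<^sup>2 \<le> R\<^sup>2"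
  shows "\<eta> * hump D l s \<sigma> R (y1 - y0) (z1 - z0) T \<le> u y1 z1 (t0 + T)"
proof -
  define \<rho> where "\<rho> y z t = R\<^sup>2 - (norm (y - y0 - (t - t0) *\<^sub>R s))\<^sup>2 - (z - z0 - (t - t0) * \<sigma>)\<^sup>2" for y z t
  define J where "J y z t = (s \<bullet> (y - y0 - (t - t0) *\<^sub>R s) + \<sigma> * (z - z0 - (t - t0) * \<sigma>)) / (2 * D)" for y z t
  define w where "w y z t = \<eta> * hump D l s \<sigma> R (y - y0) (z - z0) (t - t0)" for y z t
  have w: "w y z t = \<eta> * exp (l * (t - t0) - J y z t) * (\<rho> y z t)\<^sup>2" for y z t
    by (simp add: w_def hump_def \<rho>_def J_def)
  have Jb: "\<bar>J y z t\<bar> \<le> V * R / (2 * D)" if "\<rho> y z t \<ge> 0" for y z t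
  proof -
    define Y Z where "Y = y - y0 - (t - t0) *\<^sub>R s" and "Z = z - z0 - (t - t0) * \<sigma>"
    have "\<bar>(s, \<sigma>) \<bullet> (Y, Z)\<bar> \<le> norm (s, \<sigma>) * norm (Y, Z)" by (rule Cauchy_Schwarz_ineq2)
    also have "\<dots> \<le> V * R"
    proof (rule mult_mono)
      show "norm (s, \<sigma>) \<le> V" using V by (auto simp: norm_Pair intro!: real_le_lsqrt)
      show "norm (Y, Z) \<le> R" using R that by (auto simp: norm_Pair \<rho>_def Y_def Z_def intro!: real_le_lsqrt)
    qed (use V in auto)
    finally have "\<bar>s \<bullet> Y + \<sigma> * Z\<bar> \<le> V * R" by (simp add: inner_Pair)
    moreover have "J y z t = (s \<bullet> Y + \<sigma> * Z) / (2 * D)" by (simp add: J_def Y_def Z_def)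
    ultimately show ?thesis using D by (simp add: abs_divide divide_right_mono)
  qed
  have wb: "w y z t \<le> \<eta> * exp (l * (t - t0)) * exp (V * R / (2 * D)) * R ^ 4" if "\<rho> y z t \<ge> 0" for y z t
  proof -
    have "exp (l * (t - t0) - J y z t) \<le> exp (l * (t - t0)) * exp (V * R / (2 * D))"
      using Jb[OF that] by (simp add: exp_add[symmetric])
    moreover have "(\<rho> y z t)\<^sup>2 \<le> (R\<^sup>2)\<^sup>2"
      by (rule power_mono) (use that in \<open>auto simp: \<rho>_def\<close>)
    ultimately have "exp (l * (t - t0) - J y z t) * (\<rho> y z t)\<^sup>2 \<le> exp (l * (t - t0)) * exp (V * R / (2 * D)) * (R\<^sup>2)\<^sup>2"
      by (intro mult_mono) auto
    then have "\<eta> * (exp (l * (t - t0) - J y z t) * (\<rho> y z t)\<^sup>2) \<le> \<eta> * (exp (l * (t - t0)) * exp (V * R / (2 * D)) * (R\<^sup>2)\<^sup>2)"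
      using \<eta> by simp
    then show ?thesis unfolding w by (simp add: mult.assoc)
  qed
  define K where "K = {p. t0 \<le> snd (snd p) \<and> snd (snd p) \<le> t0 + T \<and> fst (snd p) \<le> 0 \<and> 0 \<le> \<rho> (fst p) (fst (snd p)) (snd (snd p))}"
  have KD: "(y, z, t) \<in> K \<longleftrightarrow> t0 \<le> t \<and> t \<le> t0 + T \<and> z \<le> 0 \<and> 0 \<le> \<rho> y z t" for y z t by (auto simp: K_def)
  have Kc: "compact K"
  proof (rule compact_eq_bounded_closed[THEN iffD2], intro conjI)
    show "closed K" unfolding K_def \<rho>_def
      by (intro closed_Collect_conj closed_Collect_le continuous_intros)
    show "bounded K"
    proof -
      have "K \<subseteq> cball y0 (R + T * norm s) \<times> cball z0 (R + T * \<bar>\<sigma>\<bar>) \<times> {t0..t0 + T}"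
      proof
        fix p assume "p \<in> K"
        moreover obtain y z t where pe: "p = (y, z, t)" by (cases p) auto
        ultimately have "(y, z, t) \<in> K" by simp
        then have a: "t0 \<le> t" "t \<le> t0 + T" "0 \<le> \<rho> y z t" using KD by auto
        have "(norm (y - y0 - (t - t0) *\<^sub>R s))\<^sup>2 \<le> R\<^sup>2" "(z - z0 - (t - t0) * \<sigma>)\<^sup>2 \<le> R\<^sup>2"
          using a(3) unfolding \<rho>_def by (smt (verit) zero_le_power2)+
        then have b: "norm (y - y0 - (t - t0) *\<^sub>R s) \<le> R" "\<bar>z - z0 - (t - t0) * \<sigma>\<bar> \<le> R"
          using R by (auto simp: power2_le_iff_abs_le)
        have "norm ((t - t0) *\<^sub>R s) \<le> T * norm s" "\<bar>(t - t0) * \<sigma>\<bar> \<le> T * \<bar>\<sigma>\<bar>"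
          using a by (auto simp: abs_mult intro!: mult_right_mono)
        then have "norm (y - y0) \<le> R + T * norm s" "\<bar>z - z0\<bar> \<le> R + T * \<bar>\<sigma>\<bar>"
          using b norm_triangle_ineq[of "y - y0 - (t - t0) *\<^sub>R s" "(t - t0) *\<^sub>R s"] by auto
        then show "p \<in> cball y0 (R + T * norm s) \<times> cball z0 (R + T * \<bar>\<sigma>\<bar>) \<times> {t0..t0 + T}"
          using a by (auto simp: pe dist_norm norm_minus_commute)
      qed
      moreover have "bounded (cball y0 (R + T * norm s) \<times> cball z0 (R + T * \<bar>\<sigma>\<bar>) \<times> {t0..t0 + T})"
        by (intro bounded_Times bounded_cball bounded_closed_interval)
      ultimately show "bounded K" using bounded_subset by blast
    qed
  qed
  have Ks: "K \<subseteq> {p. fst (snd p) \<le> 0 \<and> snd (snd p) \<ge> 0}" using t by (auto simp: K_def)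
  define b c where "b = D * (12 + 4 * real CARD('m))" and "c = k - l - V\<^sup>2 / (4 * D)"
  have gap': "b\<^sup>2 < 32 * D * R\<^sup>2 * c"
  proof -
    have "D * (D * (12 + 4 * real CARD('m))\<^sup>2) < D * (32 * R\<^sup>2 * c)"
      using gap D unfolding c_def by (rule mult_strict_left_mono)
    then show ?thesis by (simp add: b_def power_mult_distrib power2_eq_square mult_ac)
  qed
  have c0: "c > 0"
  proof (rule ccontr)
    assume "\<not> c > 0"
    then have "32 * D * R\<^sup>2 * c \<le> 0" using D by (simp add: mult_nonneg_nonpos)
    then show False using gap' by (smt (verit) zero_le_power2)
  qed
  \<comment> \<open>The minimum over all \<open>r\<close> of
    \<open>c * r\<^sup>2 - b * r + 8 * D * R\<^sup>2\<close>, positive by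
    \<open>gap'\<close>.\<close>
  define \<beta> where "\<beta> = 8 * D * R\<^sup>2 - b\<^sup>2 / (4 * c)"
  have \<beta>0: "\<beta> > 0" using gap' c0 by (simp add: \<beta>_def field_simps)
  have \<beta>le: "\<beta> \<le> c * r\<^sup>2 - b * r + 8 * D * R\<^sup>2" for r
  proof -
    have "0 \<le> (2 * c * r - b)\<^sup>2 / (4 * c)" using c0 by simp
    also have "\<dots> = c * r\<^sup>2 - b * r + b\<^sup>2 / (4 * c)" using c0 by (simp add: power2_eq_square field_simps)
    finally show ?thesis by (simp add: \<beta>_def)
  qed
  define \<epsilon> where "\<epsilon> = \<eta> * exp (- \<bar>l\<bar> * T - V * R / (2 * D)) * \<beta> / (\<bar>k\<bar> + 1)"
  have \<epsilon>0: "\<epsilon> > 0" using \<eta> \<beta>0 by (simp add: \<epsilon>_def)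
  \<comment> \<open>Lowering by \<zeta> makes the test function negative on the sphere \<rho> = 0,
    where the solution is non-negative, so contacts occur only inside the ball. The bound \<epsilon>
    is chosen so that the margin \<beta> pays for \<open>k * \<zeta>\<close>.\<close>
  have main: "w y1 z1 (t0 + T) - \<zeta> < u y1 z1 (t0 + T)" if \<zeta>: "0 < \<zeta>" "\<zeta> < \<epsilon>" for \<zeta>
  proof (rule first_contact_single[OF hu D Kc Ks])
    show "continuous_on K (\<lambda>(y, z, t). w y z t - \<zeta>)"
      unfolding w \<rho>_def J_def split_beta using D by (intro continuous_intros) auto
    show "(y1, z1, t0 + T) \<in> K" using KD z1 in1 t by (simp add: \<rho>_def)
  next
    fix y z t assume P: "(y, z, t) \<in> K" and le: "u y z t \<le> w y z t - \<zeta>"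
    have p: "t0 \<le> t" "t \<le> t0 + T" "z \<le> 0" "0 \<le> \<rho> y z t" using P KD by auto
    then have "0 \<le> u y z t" using nonneg t by auto
    then have "w y z t > 0" using le \<zeta> by simp
    then have \<rho>0: "\<rho> y z t > 0" using p w by (cases "\<rho> y z t = 0") auto
    have "t \<noteq> t0"
    proof
      assume e: "t = t0"
      have "w y z t \<le> \<eta> * exp (V * R / (2 * D)) * R ^ 4" using wb[OF p(4)] e by simp
      also have "\<dots> < u y z t" using init[of z y] p e by (simp add: \<rho>_def)
      finally show False using le \<zeta> by simp
    qed
    then have t0t: "t0 < t" using p by simp
    define N where "N = {p. t0 < snd (snd p) \<and> 0 < \<rho> (fst p) (fst (snd p)) (snd (snd p))}"
    have "open N" unfolding N_def \<rho>_def by (intro open_Collect_conj open_Collect_less continuous_intros)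
    then show "t > 0 \<and> (\<exists>N. open N \<and> (y, z, t) \<in> N \<and> (\<forall>y' z' t'. (y', z', t') \<in> N \<longrightarrow> z' \<le> 0 \<longrightarrow> t' \<le> t \<longrightarrow> (y', z', t') \<in> K))"
      using t0t \<rho>0 t p KD by (intro conjI exI[of _ N]) (auto simp: N_def)
  next
    fix y z t assume P: "(y, z, t) \<in> K" and e: "u y z t = w y z t - \<zeta>" and t': "t > 0" and z: "z < 0"
    have p: "t0 \<le> t" "t \<le> t0 + T" "z \<le> 0" "0 \<le> \<rho> y z t" using P KD by auto
    define E where "E = exp (l * (t - t0) - J y z t)"
    let ?a = "\<eta> * E * ((l + ((norm s)\<^sup>2 + \<sigma>\<^sup>2) / (4 * D)) * (\<rho> y z t)\<^sup>2 - 8 * D * R\<^sup>2 + b * \<rho> y z t)"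
    have 1: "heat_op D (\<lambda>y z t. w y z t - \<zeta>) y z t ?a"
      unfolding w_def E_def J_def b_def \<rho>_def using heat_op_hump[OF D] by blast
    have u0: "0 \<le> u y z t" using nonneg t p by auto
    have "w y z t \<le> s0" using wb[OF p(4)] amp[of "t - t0"] p by simp
    then have "k * (w y z t - \<zeta>) \<le> g (w y z t - \<zeta>)" using u0 e \<zeta> by (intro gr) auto
    moreover have "?a < k * (w y z t - \<zeta>)"
    proof -
      have "(l + ((norm s)\<^sup>2 + \<sigma>\<^sup>2) / (4 * D)) * (\<rho> y z t)\<^sup>2 \<le> (k - c) * (\<rho> y z t)\<^sup>2"
        using V D unfolding c_def by (intro mult_right_mono) (auto simp: divide_right_mono)
      then have "(l + ((norm s)\<^sup>2 + \<sigma>\<^sup>2) / (4 * D)) * (\<rho> y z t)\<^sup>2 - 8 * D * R\<^sup>2 + b * \<rho> y z t \<le> k * (\<rho> y z t)\<^sup>2 - \<beta>"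
        using \<beta>le[of "\<rho> y z t"] by (simp add: algebra_simps)
      then have "?a \<le> \<eta> * E * (k * (\<rho> y z t)\<^sup>2 - \<beta>)"
        using \<eta> by (intro mult_left_mono) (auto simp: E_def)
      also have "\<dots> = k * w y z t - \<eta> * E * \<beta>" by (simp add: w E_def algebra_simps)
      finally have 2: "?a \<le> k * w y z t - \<eta> * E * \<beta>" .
      have "l * (t - t0) \<ge> - \<bar>l\<bar> * T"
      proof -
        have "\<bar>l * (t - t0)\<bar> \<le> \<bar>l\<bar> * T" using p by (auto simp: abs_mult intro!: mult_left_mono)
        then show ?thesis by simp
      qed
      then have "exp (- \<bar>l\<bar> * T - V * R / (2 * D)) \<le> E"
        using Jb[OF p(4)] unfolding E_def by (subst exp_le_cancel_iff) linarith
      then have "\<eta> * exp (- \<bar>l\<bar> * T - V * R / (2 * D)) * \<beta> \<le> \<eta> * E * \<beta>"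
        using \<eta> \<beta>0 by (intro mult_right_mono mult_left_mono) auto
      moreover have "(\<bar>k\<bar> + 1) * \<zeta> < \<eta> * exp (- \<bar>l\<bar> * T - V * R / (2 * D)) * \<beta>"
        using \<zeta>(2) unfolding \<epsilon>_def by (simp add: field_simps)
      moreover have "k * \<zeta> \<le> (\<bar>k\<bar> + 1) * \<zeta>" using \<zeta> by (intro mult_right_mono) auto
      ultimately have "k * \<zeta> < \<eta> * E * \<beta>" by linarith
      with 2 show ?thesis by (simp add: algebra_simps)
    qed
    ultimately show "\<exists>a. heat_op D (\<lambda>y z t. w y z t - \<zeta>) y z t a \<and> a < g (w y z t - \<zeta>)"
      using 1 by force
  next
    fix y t assume P: "(y, 0, t) \<in> K" and e: "u y 0 t = w y 0 t - \<zeta>" and t': "t > 0"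
    have p: "t0 \<le> t" "t \<le> t0 + T" "0 \<le> \<rho> y 0 t" using P KD by auto
    define Z where "Z = - z0 - (t - t0) * \<sigma>"
    define E where "E = exp (l * (t - t0) - J y 0 t)"
    have wz: "w y x t = \<eta> * exp (l * (t - t0) - (J y 0 t + \<sigma> * x / (2 * D))) * (\<rho> y 0 t - 2 * x * Z - x\<^sup>2)\<^sup>2" for x
      unfolding w \<rho>_def J_def Z_def using D by (simp add: field_simps power2_eq_square)
    have d: "((\<lambda>x. w y x t - \<zeta>) has_real_derivative \<eta> * E * (- \<sigma> / (2 * D) * (\<rho> y 0 t)\<^sup>2 - 4 * Z * \<rho> y 0 t)) (at 0 within {..0})"
      unfolding wz E_def using D by (auto intro!: derivative_eq_intros simp: algebra_simps)
    have key: "D * (- \<sigma> / (2 * D) * (\<rho> y 0 t)\<^sup>2 - 4 * Z * \<rho> y 0 t) + \<mu> * (\<rho> y 0 t)\<^sup>2 \<le> 0"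
    proof (cases "\<rho> y 0 t = 0")
      case False
      then have \<rho>0: "\<rho> y 0 t > 0" using p by simp
      have \<rho>le: "\<rho> y 0 t \<le> R\<^sup>2 - Z\<^sup>2" unfolding \<rho>_def Z_def by simp
      have "\<not> (z0 \<le> - R \<and> z0 + T * \<sigma> \<le> - R)"
      proof
        assume a: "z0 \<le> - R \<and> z0 + T * \<sigma> \<le> - R"
        have "z0 + (t - t0) * \<sigma> \<le> - R"
        proof (cases "\<sigma> \<ge> 0")
          case True
          then have "(t - t0) * \<sigma> \<le> T * \<sigma>" using p by (intro mult_right_mono) auto
          then show ?thesis using a by simp
        next
          case False
          then have "(t - t0) * \<sigma> \<le> 0" using p by (intro mult_nonneg_nonpos) auto
          then show ?thesis using a by simp
        qed
        then have "R \<le> Z" by (simp add: Z_def)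
        then have "R\<^sup>2 \<le> Z\<^sup>2" using R by (intro power_mono) auto
        then show False using \<rho>le \<rho>0 by simp
      qed
      then have a: "\<sigma> \<ge> 0" "z0 + T * \<sigma> \<le> - 1" "\<mu> * (R\<^sup>2 - 1) \<le> 4 * D" using centre by auto
      have "(t - t0) * \<sigma> \<le> T * \<sigma>" using p a by (intro mult_right_mono) auto
      then have Z1: "Z \<ge> 1" using a by (simp add: Z_def)
      then have "Z\<^sup>2 \<ge> 1" by (simp add: one_le_power)
      then have "\<mu> * \<rho> y 0 t \<le> \<mu> * (R\<^sup>2 - 1)" using \<rho>le \<mu> by (intro mult_left_mono) auto
      also have "\<dots> \<le> 4 * D * Z" using a(3) Z1 D by (smt (verit) mult_left_mono mult_cancel_left1)
      finally have "\<mu> * \<rho> y 0 t - 4 * D * Z \<le> 0" by simp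
      moreover have "\<sigma> / 2 * \<rho> y 0 t \<ge> 0" using a \<rho>0 by simp
      ultimately have "\<rho> y 0 t * (\<mu> * \<rho> y 0 t - 4 * D * Z - \<sigma> / 2 * \<rho> y 0 t) \<le> 0"
        using \<rho>0 by (intro mult_nonneg_nonpos) auto
      then show ?thesis using D by (simp add: power2_eq_square algebra_simps)
    qed simp
    have "D * (\<eta> * E * (- \<sigma> / (2 * D) * (\<rho> y 0 t)\<^sup>2 - 4 * Z * \<rho> y 0 t)) + \<mu> * w y 0 t
       = \<eta> * E * (D * (- \<sigma> / (2 * D) * (\<rho> y 0 t)\<^sup>2 - 4 * Z * \<rho> y 0 t) + \<mu> * (\<rho> y 0 t)\<^sup>2)"
      unfolding w E_def by (simp add: algebra_simps)
    also have "\<dots> \<le> 0" using key \<eta> by (intro mult_nonneg_nonpos) (auto simp: E_def)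
    finally have "D * (\<eta> * E * (- \<sigma> / (2 * D) * (\<rho> y 0 t)\<^sup>2 - 4 * Z * \<rho> y 0 t)) \<le> - \<mu> * w y 0 t" by simp
    also have "- \<mu> * w y 0 t < - \<mu> * u y 0 t" using e \<zeta> \<mu> by simp
    also have "\<dots> \<le> q y t" by (rule flux[OF t'])
    finally show "\<exists>b. ((\<lambda>x. w y x t - \<zeta>) has_real_derivative b) (at 0 within {..0}) \<and> D * b < q y t"
      using d by blast
  qed
  have "w y1 z1 (t0 + T) \<le> u y1 z1 (t0 + T)"
  proof (rule field_le_epsilon)
    fix e :: real assume "e > 0"
    define \<zeta> where "\<zeta> = min e \<epsilon> / 2"
    have "0 < \<zeta>" "\<zeta> < \<epsilon>" "\<zeta> \<le> e" using \<open>e > 0\<close> \<epsilon>0 by (auto simp: \<zeta>_def min_def)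
    then show "w y1 z1 (t0 + T) \<le> u y1 z1 (t0 + T) + e" using main[of \<zeta>] by linarith
  qed
  then show ?thesis by (simp add: w_def)
qed

section \<open>Propagation of lower bounds in one medium\<close>

text \<open>Normalised form of \<open>hump_below\<close>: \<open>B\<close> bounds the initial bump
  of unit amplitude, so \<open>\<eta> = \<delta> / 2 / B\<close> starts at most at \<delta>/2. The
  tilt costs \<open>exp (V * R / (2 * D))\<close> twice, in the normalisation and at the final
  point; neither loss depends on \<open>T\<close>.\<close>

lemma run:
  fixes s y0 :: "real^'m"
  assumes R: "R > 0" and \<delta>: "\<delta> > 0" and V: "V \<ge> 0" "(norm s)\<^sup>2 + \<sigma>\<^sup>2 \<le> V\<^sup>2"
    and gr: "\<And>x. 0 \<le> x \<Longrightarrow> x \<le> s0 \<Longrightarrow> k * x \<le> g x"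
    and gap: "D * (12 + 4 * real CARD('m))\<^sup>2 < 32 * R\<^sup>2 * (k - l - V\<^sup>2 / (4 * D))"
    and t: "t0 \<ge> 0" "T \<ge> 0"
    and centre: "(z0 \<le> - R \<and> z0 + T * \<sigma> \<le> - R) \<or> (\<sigma> \<ge> 0 \<and> z0 + T * \<sigma> \<le> - 1 \<and> \<mu> * (R\<^sup>2 - 1) \<le> 4 * D)"
    and amp: "\<delta> * exp (max l 0 * T) \<le> s0"
    and init: "lower_on_ball u y0 z0 R t0 \<delta>"
    and z1: "z1 \<le> 0" and in1: "\<rho> \<le> R\<^sup>2 - (norm (y1 - y0 - T *\<^sub>R s))\<^sup>2 - (z1 - z0 - T * \<sigma>)\<^sup>2" "0 \<le> \<rho>"
  shows "\<delta> / 2 * exp (l * T) * exp (- (V * R / D)) * (\<rho> / R\<^sup>2)\<^sup>2 \<le> u y1 z1 (t0 + T)"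
proof -
  define B where "B = exp (V * R / (2 * D)) * R ^ 4"
  have B0: "B > 0" using R by (simp add: B_def)
  define \<eta> where "\<eta> = \<delta> / 2 / B"
  have \<eta>0: "\<eta> > 0" and \<eta>B: "\<eta> * B = \<delta> / 2" using \<delta> B0 by (auto simp: \<eta>_def)
  have ball: "(norm (y1 - y0 - T *\<^sub>R s))\<^sup>2 + (z1 - z0 - T * \<sigma>)\<^sup>2 \<le> R\<^sup>2" using in1 by simp
  have *: "\<eta> * hump D l s \<sigma> R (y1 - y0) (z1 - z0) T \<le> u y1 z1 (t0 + T)"
  proof (rule hump_below[OF R \<eta>0 V gr gap t centre _ _ z1 ball])
    fix \<tau> :: real assume \<tau>: "0 \<le> \<tau>" "\<tau> \<le> T"
    have "l * \<tau> \<le> max l 0 * T" using \<tau> by (intro mult_mono) auto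
    then have "\<delta> / 2 * exp (l * \<tau>) \<le> \<delta> * exp (max l 0 * T)" using \<delta> by (intro mult_mono) auto
    moreover have "\<eta> * exp (l * \<tau>) * exp (V * R / (2 * D)) * R ^ 4 = \<eta> * B * exp (l * \<tau>)" by (simp add: B_def)
    ultimately show "\<eta> * exp (l * \<tau>) * exp (V * R / (2 * D)) * R ^ 4 \<le> s0" using amp unfolding \<eta>B by linarith
  next
    fix y z assume "z \<le> 0" "(norm (y - y0))\<^sup>2 + (z - z0)\<^sup>2 \<le> R\<^sup>2"
    then have "\<delta> \<le> u y z t0" using init by (simp add: lower_on_ball_def)
    moreover have "\<eta> * exp (V * R / (2 * D)) * R ^ 4 = \<delta> / 2" using \<eta>B by (simp add: B_def mult.assoc)
    ultimately show "\<eta> * exp (V * R / (2 * D)) * R ^ 4 < u y z t0" using \<delta> by simp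
  qed (auto)
  define I where "I = (s \<bullet> (y1 - y0 - T *\<^sub>R s) + \<sigma> * (z1 - z0 - T * \<sigma>)) / (2 * D)"
  define r where "r = R\<^sup>2 - (norm (y1 - y0 - T *\<^sub>R s))\<^sup>2 - (z1 - z0 - T * \<sigma>)\<^sup>2"
  have I: "I \<le> V * R / (2 * D)"
  proof -
    have "(s, \<sigma>) \<bullet> (y1 - y0 - T *\<^sub>R s, z1 - z0 - T * \<sigma>) \<le> norm (s, \<sigma>) * norm (y1 - y0 - T *\<^sub>R s, z1 - z0 - T * \<sigma>)"
      by (rule norm_cauchy_schwarz)
    also have "\<dots> \<le> V * R"
    proof (rule mult_mono)
      show "norm (s, \<sigma>) \<le> V" using V by (auto simp: norm_Pair intro!: real_le_lsqrt)
      show "norm (y1 - y0 - T *\<^sub>R s, z1 - z0 - T * \<sigma>) \<le> R"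
        using R ball by (auto simp: norm_Pair intro!: real_le_lsqrt)
    qed (use V in auto)
    finally show ?thesis using D by (simp add: inner_Pair I_def divide_right_mono)
  qed
  have "\<delta> / 2 * exp (l * T) * exp (- (V * R / D)) * (\<rho> / R\<^sup>2)\<^sup>2 = \<eta> * exp (l * T - V * R / (2 * D)) * \<rho>\<^sup>2"
  proof -
    have "exp (- (V * R / D)) = exp (- (V * R / (2 * D))) / exp (V * R / (2 * D))"
      by (simp add: exp_diff[symmetric])
    moreover have "(\<rho> / R\<^sup>2)\<^sup>2 = \<rho>\<^sup>2 / R ^ 4" by (simp add: power_divide power_mult[symmetric])
    ultimately have "\<delta> / 2 * exp (l * T) * exp (- (V * R / D)) * (\<rho> / R\<^sup>2)\<^sup>2
        = \<delta> / 2 * exp (l * T) * exp (- (V * R / (2 * D))) * \<rho>\<^sup>2 / B"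
      by (simp add: B_def)
    also have "\<dots> = \<eta> * (exp (l * T) * exp (- (V * R / (2 * D)))) * \<rho>\<^sup>2" by (simp add: \<eta>_def)
    also have "exp (l * T) * exp (- (V * R / (2 * D))) = exp (l * T - V * R / (2 * D))"
      by (simp add: exp_add[symmetric])
    finally show ?thesis .
  qed
  also have "\<dots> \<le> \<eta> * exp (l * T - I) * r\<^sup>2"
    using \<eta>0 I in1 unfolding r_def[symmetric] by (intro mult_mono power_mono) auto
  also have "\<dots> = \<eta> * hump D l s \<sigma> R (y1 - y0) (z1 - z0) T" by (simp add: hump_def I_def r_def)
  finally show ?thesis using * by simp
qed

text \<open>A sufficiently negative rate \<open>l\<close> satisfies the gap condition for any radius
  and any speed \<Lambda>/T. Within a fixed time, a bound on a small ball thus reaches every point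
  within distance \<Lambda>, at the price of a factor that depends only on \<open>r\<close>,
  \<Lambda> and \<open>T\<close>.\<close>

lemma spread:
  assumes r: "r > 0" and \<Lambda>: "\<Lambda> \<ge> 0" and T: "T > 0"
  shows "\<exists>\<kappa>>0. \<exists>\<delta>0>0. \<forall>y0 z0 y1 z1 t0 \<delta>. 0 < \<delta> \<longrightarrow> \<delta> \<le> \<delta>0 \<longrightarrow> 0 \<le> t0 \<longrightarrow> z0 \<le> - r \<longrightarrow> z1 \<le> - r \<longrightarrow>
    (norm (y1 - y0))\<^sup>2 + (z1 - z0)\<^sup>2 \<le> \<Lambda>\<^sup>2 \<longrightarrow> lower_on_ball u y0 z0 r t0 \<delta> \<longrightarrow> \<kappa> * \<delta> \<le> u y1 z1 (t0 + T)"
proof -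
  obtain s0 where s0: "s0 > 0" "\<And>x. 0 \<le> x \<Longrightarrow> x \<le> s0 \<Longrightarrow> (gp - 1) * x \<le> g x"
    using growth[of "gp - 1"] by auto
  define V where "V = \<Lambda> / T"
  define a where "a = D * (12 + 4 * real CARD('m))\<^sup>2 / (32 * r\<^sup>2)"
  define l where "l = min 0 (gp - 1 - V\<^sup>2 / (4 * D) - a - 1)"
  define \<kappa> where "\<kappa> = 1 / 2 * exp (l * T) * exp (- (V * r / D))"
  have gap: "D * (12 + 4 * real CARD('m))\<^sup>2 < 32 * r\<^sup>2 * (gp - 1 - l - V\<^sup>2 / (4 * D))"
  proof -
    have "a < gp - 1 - l - V\<^sup>2 / (4 * D)" unfolding l_def by linarith
    then have "32 * r\<^sup>2 * a < 32 * r\<^sup>2 * (gp - 1 - l - V\<^sup>2 / (4 * D))" using r by (intro mult_strict_left_mono) auto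
    then show ?thesis using r by (simp add: a_def)
  qed
  have main: "\<kappa> * \<delta> \<le> u y1 z1 (t0 + T)" if h: "0 < \<delta>" "\<delta> \<le> s0" "0 \<le> t0" "z0 \<le> - r" "z1 \<le> - r"
    "(norm (y1 - y0))\<^sup>2 + (z1 - z0)\<^sup>2 \<le> \<Lambda>\<^sup>2" "lower_on_ball u y0 z0 r t0 \<delta>" for y0 z0 y1 z1 t0 \<delta>
  proof -
    define s where "s = (1 / T) *\<^sub>R (y1 - y0)"
    define \<sigma> where "\<sigma> = (z1 - z0) / T"
    have Ts: "T *\<^sub>R s = y1 - y0" "T * \<sigma> = z1 - z0" using T by (auto simp: s_def \<sigma>_def)
    have "\<delta> / 2 * exp (l * T) * exp (- (V * r / D)) * (r\<^sup>2 / r\<^sup>2)\<^sup>2 \<le> u y1 z1 (t0 + T)"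
    proof (rule run[OF r h(1) _ _ s0(2) gap h(3) _ _ _ h(7)])
      show "V \<ge> 0" using \<Lambda> T by (simp add: V_def)
      have "(norm s)\<^sup>2 + \<sigma>\<^sup>2 = ((norm (y1 - y0))\<^sup>2 + (z1 - z0)\<^sup>2) / T\<^sup>2"
        using T by (simp add: s_def \<sigma>_def power_divide add_divide_distrib)
      also have "\<dots> \<le> \<Lambda>\<^sup>2 / T\<^sup>2" using h(6) by (intro divide_right_mono) auto
      finally show "(norm s)\<^sup>2 + \<sigma>\<^sup>2 \<le> V\<^sup>2" by (simp add: V_def power_divide)
      show "(z0 \<le> - r \<and> z0 + T * \<sigma> \<le> - r) \<or> (\<sigma> \<ge> 0 \<and> z0 + T * \<sigma> \<le> - 1 \<and> \<mu> * (r\<^sup>2 - 1) \<le> 4 * D)"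
        using h Ts by simp
      show "\<delta> * exp (max l 0 * T) \<le> s0" using h by (simp add: l_def)
      show "z1 \<le> 0" using h r by simp
    qed (use T Ts in auto)
    then show ?thesis using r by (simp add: \<kappa>_def mult_ac)
  qed
  have "\<kappa> > 0" by (simp add: \<kappa>_def)
  then show ?thesis using s0(1) main by blast
qed

text \<open>This uses the second alternative of \<open>centre\<close>: the bump is steered so that
  its centre ends at depth 1 below or above nothing but the target column \<open>y1\<close>. With
  radius squared \<open>1 + r0\<close>, every point of that column between depth 1 and the interface
  then has \<rho> at least \<open>r0\<close>.\<close>

lemma reach_interface:
  assumes \<Lambda>: "\<Lambda> \<ge> 2"
  shows "\<exists>\<kappa>>0. \<exists>\<delta>0>0. \<forall>y0 z0 y1 z1 t0 T \<delta>. 0 < \<delta> \<longrightarrow> \<delta> \<le> \<delta>0 \<longrightarrow> 0 \<le> t0 \<longrightarrow> - \<Lambda> \<le> z0 \<longrightarrow> z0 \<le> - 2 \<longrightarrow>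
    norm (y1 - y0) \<le> \<Lambda> \<longrightarrow> 1 \<le> T \<longrightarrow> T \<le> 2 \<longrightarrow> lower_on_ball u y0 z0 2 t0 \<delta> \<longrightarrow> - 1 \<le> z1 \<longrightarrow> z1 \<le> 0 \<longrightarrow> \<kappa> * \<delta> \<le> u y1 z1 (t0 + T)"
proof -
  obtain s0 where s0: "s0 > 0" "\<And>x. 0 \<le> x \<Longrightarrow> x \<le> s0 \<Longrightarrow> (gp - 1) * x \<le> g x"
    using growth[of "gp - 1"] by auto
  \<comment> \<open>The bound 3 keeps \<open>R\<close> at most 2, so the given ball contains the
    bump; the bound \<open>4 * D / \<mu>\<close> is the flux condition of
    \<open>hump_below\<close>.\<close>
  define r0 where "r0 = min 3 (4 * D / \<mu>)"
  have r0: "r0 > 0" "r0 \<le> 3" "\<mu> * r0 \<le> 4 * D" using D \<mu> by (auto simp: r0_def min_def field_simps)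
  define R where "R = sqrt (1 + r0)"
  have R2: "R\<^sup>2 = 1 + r0" and R0: "R > 0" using r0 by (auto simp: R_def)
  have R4: "R\<^sup>2 \<le> 2\<^sup>2" using r0 R2 by simp
  define V where "V = 2 * \<Lambda>"
  define a where "a = D * (12 + 4 * real CARD('m))\<^sup>2 / (32 * R\<^sup>2)"
  define l where "l = min 0 (gp - 1 - V\<^sup>2 / (4 * D) - a - 1)"
  define \<kappa> where "\<kappa> = 1 / 2 * exp (l * 2) * exp (- (V * R / D)) * (r0 / R\<^sup>2)\<^sup>2"
  have gap: "D * (12 + 4 * real CARD('m))\<^sup>2 < 32 * R\<^sup>2 * (gp - 1 - l - V\<^sup>2 / (4 * D))"
  proof -
    have "a < gp - 1 - l - V\<^sup>2 / (4 * D)" unfolding l_def by linarith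
    then have "32 * R\<^sup>2 * a < 32 * R\<^sup>2 * (gp - 1 - l - V\<^sup>2 / (4 * D))" using R0 by (intro mult_strict_left_mono) auto
    then show ?thesis using R0 by (simp add: a_def)
  qed
  have main: "\<kappa> * \<delta> \<le> u y1 z1 (t0 + T)" if h: "0 < \<delta>" "\<delta> \<le> s0" "0 \<le> t0" "- \<Lambda> \<le> z0" "z0 \<le> - 2"
    "norm (y1 - y0) \<le> \<Lambda>" "1 \<le> T" "T \<le> 2" "lower_on_ball u y0 z0 2 t0 \<delta>" "- 1 \<le> z1" "z1 \<le> 0" for y0 z0 y1 z1 t0 T \<delta>
  proof -
    define s where "s = (1 / T) *\<^sub>R (y1 - y0)"
    define \<sigma> where "\<sigma> = (- 1 - z0) / T"
    have Ts: "T *\<^sub>R s = y1 - y0" "T * \<sigma> = - 1 - z0" using h by (auto simp: s_def \<sigma>_def)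
    have lob: "lower_on_ball u y0 z0 R t0 \<delta>" using h(9) R4 unfolding lower_on_ball_def by fastforce
    have "\<delta> / 2 * exp (l * T) * exp (- (V * R / D)) * (r0 / R\<^sup>2)\<^sup>2 \<le> u y1 z1 (t0 + T)"
    proof (rule run[OF R0 h(1) _ _ s0(2) gap h(3) _ _ _ lob])
      show "V \<ge> 0" using \<Lambda> by (simp add: V_def)
      have "norm s \<le> \<Lambda>"
      proof -
        have "norm (y1 - y0) \<le> T * \<Lambda>" using h \<Lambda> mult_right_mono[of 1 T \<Lambda>] by linarith
        then show ?thesis using h unfolding s_def norm_scaleR by (simp add: field_simps)
      qed
      then have "(norm s)\<^sup>2 \<le> \<Lambda>\<^sup>2" by (intro power_mono) auto
      moreover have "0 \<le> \<sigma>" "\<sigma> \<le> \<Lambda>"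
      proof -
        show "0 \<le> \<sigma>" using h by (simp add: \<sigma>_def)
        have "- 1 - z0 \<le> T * \<Lambda>" using h \<Lambda> mult_right_mono[of 1 T \<Lambda>] by linarith
        then show "\<sigma> \<le> \<Lambda>" using h by (simp add: \<sigma>_def field_simps)
      qed
      moreover from this have "\<sigma>\<^sup>2 \<le> \<Lambda>\<^sup>2" by (intro power_mono) auto
      moreover have "V\<^sup>2 = 4 * \<Lambda>\<^sup>2" by (simp add: V_def power_mult_distrib)
      ultimately show "(norm s)\<^sup>2 + \<sigma>\<^sup>2 \<le> V\<^sup>2" using zero_le_power2[of \<Lambda>] by linarith
      show "(z0 \<le> - R \<and> z0 + T * \<sigma> \<le> - R) \<or> (\<sigma> \<ge> 0 \<and> z0 + T * \<sigma> \<le> - 1 \<and> \<mu> * (R\<^sup>2 - 1) \<le> 4 * D)"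
        using Ts r0 R2 \<open>0 \<le> \<sigma>\<close> by simp
      show "\<delta> * exp (max l 0 * T) \<le> s0" using h by (simp add: l_def)
      show "z1 \<le> 0" using h by simp
      have "(z1 + 1)\<^sup>2 \<le> 1" using h by (simp add: power_le_one)
      then show "r0 \<le> R\<^sup>2 - (norm (y1 - y0 - T *\<^sub>R s))\<^sup>2 - (z1 - z0 - T * \<sigma>)\<^sup>2"
        unfolding Ts R2 by (simp add: algebra_simps)
    qed (use h r0 in auto)
    moreover have "\<kappa> * \<delta> \<le> \<delta> / 2 * exp (l * T) * exp (- (V * R / D)) * (r0 / R\<^sup>2)\<^sup>2"
    proof -
      have "l * 2 \<le> l * T" using h by (intro mult_left_mono_neg) (auto simp: l_def)
      then have "exp (l * 2) * (\<delta> / 2 * exp (- (V * R / D)) * (r0 / R\<^sup>2)\<^sup>2) \<le> exp (l * T) * (\<delta> / 2 * exp (- (V * R / D)) * (r0 / R\<^sup>2)\<^sup>2)"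
        using h by (intro mult_right_mono) auto
      then show ?thesis by (simp add: \<kappa>_def mult_ac)
    qed
    ultimately show ?thesis by simp
  qed
  have "\<kappa> > 0" using r0 R0 by (simp add: \<kappa>_def)
  then show ?thesis using s0(1) main by blast
qed

text \<open>Inflow through the interface makes the density positive next to it, even from zero. The
  barrier is steep in \<open>z\<close>, so that on its positive part
  \<open>D * A\<^sup>2 * exp (A * z)\<close> dominates all other terms of the equation, while its
  flux at \<open>z = 0\<close> is affordable by the third bound on \<eta>.\<close>

lemma inflow:
  assumes gr: "\<And>x. 0 \<le> x \<Longrightarrow> x \<le> s0 \<Longrightarrow> k * x \<le> g x"
    and A: "A \<ge> 1" "5 / 8 * D * A\<^sup>2 > 1 + 2 * D * real CARD('m) + \<bar>k\<bar>"
    and \<eta>: "\<eta> > 0" "\<eta> \<le> s0" "\<eta> * (D * A + \<mu> / 2) < c" and t1: "t1 \<ge> 0"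
    and infl: "\<And>y t. norm (y - y0) \<le> 1 \<Longrightarrow> t1 \<le> t \<Longrightarrow> t \<le> t1 + 1 / 2 \<Longrightarrow> c - \<mu> * u y 0 t \<le> q y t"
    and z1: "z1 \<le> 0"
  shows "\<eta> * (exp (A * z1) - 5 / 8) \<le> u y0 z1 (t1 + 1 / 2)"
proof (cases "z1 < - 2")
  case True
  have "exp (A * z1) \<le> exp (- 1)" using True A mult_mono[of 1 A 2 "- z1"] by simp
  also have "\<dots> \<le> 5/8"
    using exp_ge_add_one_self[of 1] by (simp add: exp_minus field_simps)
  finally have "\<eta> * (exp (A * z1) - 5 / 8) \<le> 0" using \<eta> by (intro mult_nonneg_nonpos) auto
  then show ?thesis using nonneg[OF z1, of "t1 + 1/2" y0] t1 by simp
next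
  case False
  \<comment> \<open>The constant 9/8 makes \<open>w\<close> negative at the time \<open>t1\<close>,
    at distance 1 from \<open>y0\<close> and at \<open>z = - 2\<close>, so contacts avoid these
    parts of the boundary. Where \<open>w\<close> is non-negative, \<open>exp (A * z)\<close> is at
    least 9/8 - 1/2 = 5/8.\<close>
  define w where "w y z t = \<eta> * (t - t1 - (norm (y - y0))\<^sup>2 - 9 / 8 + exp (A * z))" for y and z t :: real
  define K where "K = cball y0 1 \<times> {-2..(0::real)} \<times> {t1..t1 + 1 / 2}"
  have KD: "(y, z, t) \<in> K \<longleftrightarrow> norm (y - y0) \<le> 1 \<and> - 2 \<le> z \<and> z \<le> 0 \<and> t1 \<le> t \<and> t \<le> t1 + 1 / 2" for y z t
    by (auto simp: K_def dist_norm norm_minus_commute)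
  have "w y0 z1 (t1 + 1 / 2) < u y0 z1 (t1 + 1 / 2)"
  proof (rule first_contact_single[OF hu D, of K])
    show "compact K" unfolding K_def by (intro compact_Times) auto
    show "K \<subseteq> {p. fst (snd p) \<le> 0 \<and> snd (snd p) \<ge> 0}" using t1 by (auto simp: K_def)
    show "continuous_on K (\<lambda>(y, z, t). w y z t)" unfolding w_def split_beta by (intro continuous_intros)
    show "(y0, z1, t1 + 1 / 2) \<in> K" using KD z1 False by simp
  next
    fix y z t assume P: "(y, z, t) \<in> K" and le: "u y z t \<le> w y z t"
    have p: "norm (y - y0) \<le> 1" "- 2 \<le> z" "z \<le> 0" "t1 \<le> t" "t \<le> t1 + 1 / 2" using P KD by auto
    have "0 \<le> u y z t" using nonneg t1 p by auto
    then have ge: "0 \<le> t - t1 - (norm (y - y0))\<^sup>2 - 9 / 8 + exp (A * z)"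
      using order_trans[OF _ le, of 0] \<eta>(1) unfolding w_def by (simp add: zero_le_mult_iff)
    have e1: "exp (A * z) \<le> 1" using A p by (simp add: mult_nonneg_nonpos)
    have a: "t \<noteq> t1"
    proof
      assume "t = t1"
      then show False using ge e1 zero_le_power2[of "norm (y - y0)"] by linarith
    qed
    have b: "norm (y - y0) \<noteq> 1"
    proof
      assume "norm (y - y0) = 1"
      then have "(norm (y - y0))\<^sup>2 = 1" by simp
      then show False using ge e1 p by linarith
    qed
    have c: "z \<noteq> - 2"
    proof
      assume "z = - 2"
      then have "exp (A * z) \<le> exp (- 1)" using A by simp
      also have "\<dots> \<le> 1/2"
        using exp_ge_add_one_self[of 1] by (simp add: exp_minus field_simps)
      finally have "exp (A * z) \<le> 1 / 2" .
      then show False using ge p zero_le_power2[of "norm (y - y0)"] by linarith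
    qed
    show "t > 0 \<and> (\<exists>N. open N \<and> (y, z, t) \<in> N \<and> (\<forall>y' z' t'. (y', z', t') \<in> N \<longrightarrow> z' \<le> 0 \<longrightarrow> t' \<le> t \<longrightarrow> (y', z', t') \<in> K))"
    proof (intro conjI exI)
      show "t > 0" using a p t1 by simp
      show "open (ball y0 1 \<times> {-(2::real)<..} \<times> {t1<..})" by (intro open_Times) auto
      show "(y, z, t) \<in> ball y0 1 \<times> {-(2::real)<..} \<times> {t1<..}"
        using a b c p by (simp add: dist_norm norm_minus_commute)
      show "\<forall>y' z' t'. (y', z', t') \<in> ball y0 1 \<times> {-(2::real)<..} \<times> {t1<..} \<longrightarrow> z' \<le> 0 \<longrightarrow> t' \<le> t \<longrightarrow> (y', z', t') \<in> K"
        using p by (auto simp: KD dist_norm norm_minus_commute)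
    qed
  next
    fix y z t assume P: "(y, z, t) \<in> K" and e: "u y z t = w y z t" and "t > 0" "z < 0"
    have p: "norm (y - y0) \<le> 1" "- 2 \<le> z" "z \<le> 0" "t1 \<le> t" "t \<le> t1 + 1 / 2" using P KD by auto
    have w0: "0 \<le> w y z t" using e nonneg[of z t y] t1 p by auto
    then have ge: "0 \<le> t - t1 - (norm (y - y0))\<^sup>2 - 9 / 8 + exp (A * z)"
      using \<eta>(1) unfolding w_def by (simp add: zero_le_mult_iff)
    have e1: "exp (A * z) \<le> 1" using A p by (simp add: mult_nonneg_nonpos)
    have e2: "5 / 8 \<le> exp (A * z)" using ge p zero_le_power2[of "norm (y - y0)"] by linarith
    have w1: "w y z t \<le> \<eta> * 1"
      unfolding w_def using \<eta> e1 p zero_le_power2[of "norm (y - y0)"] by (intro mult_left_mono) linarith+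
    let ?a = "\<eta> * (1 + 2 * D * real CARD('m) - D * A\<^sup>2 * exp (A * z))"
    have "heat_op D w y z t ?a"
    proof (rule heat_opI)
      show "((\<lambda>t. w y z t) has_real_derivative \<eta>) (at t)"
        unfolding w_def by (auto intro!: derivative_eq_intros)
      show "has_d2 (\<lambda>s. w (y + s *\<^sub>R axis i 1) z t) 0 (\<eta> * (2 * (- 1)))" for i
      proof -
        have eq: "w (y + s *\<^sub>R axis i 1) z t = \<eta> * ((t - t1 - (norm (y - y0))\<^sup>2 - 9 / 8 + exp (A * z)) + (- 2 * (y - y0) $ i) * s + (- 1) * s\<^sup>2)" for s
        proof -
          have "y + s *\<^sub>R axis i 1 - y0 = y - y0 + s *\<^sub>R axis i 1" by simp
          then show ?thesis unfolding w_def by (simp only: norm_line_sq) (simp add: algebra_simps)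
        qed
        show ?thesis unfolding eq by (intro has_d2_cmult has_d2_quadratic)
      qed
      show "has_d2 (\<lambda>s. w y s t) z (\<eta> * A\<^sup>2 * exp (A * z))"
        unfolding w_def
        by (rule has_d2I[where c' = "\<lambda>s. \<eta> * A * exp (A * s)"])
          (auto intro!: derivative_eq_intros simp: power2_eq_square)
      show "\<eta> - D * ((\<Sum>i\<in>(UNIV::'m set). \<eta> * (2 * (- 1))) + \<eta> * A\<^sup>2 * exp (A * z)) = ?a"
        by (simp add: algebra_simps)
    qed
    moreover have "?a < k * w y z t"
    proof -
      have "5 / 8 * (D * A\<^sup>2) \<le> exp (A * z) * (D * A\<^sup>2)" using e2 D by (intro mult_right_mono) auto
      then have "?a < \<eta> * (- \<bar>k\<bar>)" using A(2) \<eta> by (intro mult_strict_left_mono) (simp_all add: algebra_simps)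
      moreover have "\<bar>k * w y z t\<bar> \<le> \<bar>k\<bar> * \<eta>" using w0 w1 by (auto simp: abs_mult intro!: mult_left_mono)
      ultimately show ?thesis by (simp add: mult.commute)
    qed
    moreover have "k * w y z t \<le> g (w y z t)" using w0 w1 \<eta> by (intro gr) auto
    ultimately show "\<exists>a. heat_op D w y z t a \<and> a < g (w y z t)" by force
  next
    fix y t assume P: "(y, 0, t) \<in> K" and e: "u y 0 t = w y 0 t" and "t > 0"
    have p: "norm (y - y0) \<le> 1" "t1 \<le> t" "t \<le> t1 + 1 / 2" using P KD by auto
    have d: "((\<lambda>z. w y z t) has_real_derivative \<eta> * A) (at 0 within {..0})"
      unfolding w_def by (auto intro!: derivative_eq_intros)
    have "t - t1 - (norm (y - y0))\<^sup>2 - 9 / 8 + exp (A * 0) \<le> 1 / 2"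
      using p zero_le_power2[of "norm (y - y0)"] unfolding mult_zero_right exp_zero by linarith
    then have "w y 0 t \<le> \<eta> * (1 / 2)" unfolding w_def using \<eta>(1) by (intro mult_left_mono) auto
    then have "\<mu> * u y 0 t \<le> \<mu> * (\<eta> * (1 / 2))" using \<mu> e by simp
    then have "D * (\<eta> * A) < c - \<mu> * u y 0 t" using \<eta>(3) by (simp add: algebra_simps)
    also have "\<dots> \<le> q y t" using infl p by blast
    finally show "\<exists>b. ((\<lambda>z. w y z t) has_real_derivative b) (at 0 within {..0}) \<and> D * b < q y t"
      using d by blast
  qed
  then show ?thesis by (simp add: w_def)
qed

end

section \<open>Spreading in the coupled system\<close>

locale pair_pos = U: half_pos D \<mu> gp g u "\<lambda>y t. \<nu> * v y 0 t - \<mu> * u y 0 t"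
    + V: half_pos d \<nu> fp f v "\<lambda>y t. \<mu> * u y 0 t - \<nu> * v y 0 t"
  for D \<mu> gp g and u :: "real^'m::finite \<Rightarrow> real \<Rightarrow> real \<Rightarrow> real" and d \<nu> fp f v
begin

lemma swap: "pair_pos d \<nu> fp f v D \<mu> gp g u"
  by (rule pair_pos.intro; unfold_locales)

text \<open>The two units of time split into 1 for the lower density to become positive at the
  interface, 1/2 for the inflow to build up the upper density next to it, and 1/2 to spread from
  there. Each bound is proportional to \<delta>, which makes the crossing repeatable.\<close>

lemma transfer:
  assumes \<Lambda>: "\<Lambda> \<ge> 2"
  shows "\<exists>\<kappa>>0. \<exists>\<delta>0>0. \<forall>y0 z0 y1 z1 t0 \<delta>. 0 < \<delta> \<longrightarrow> \<delta> \<le> \<delta>0 \<longrightarrow> 0 \<le> t0 \<longrightarrow> - \<Lambda> \<le> z0 \<longrightarrow> z0 \<le> - 2 \<longrightarrow>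
    norm (y1 - y0) \<le> \<Lambda> \<longrightarrow> - \<Lambda> \<le> z1 \<longrightarrow> z1 \<le> - 1 \<longrightarrow> lower_on_ball u y0 z0 2 t0 \<delta> \<longrightarrow> \<kappa> * \<delta> \<le> v y1 z1 (t0 + 2)"
proof -
  obtain \<kappa>1 \<delta>1 where k1: "\<kappa>1 > 0" "\<delta>1 > 0" and K1: "\<And>y0 z0 y1 z1 t0 T \<delta>. 0 < \<delta> \<Longrightarrow> \<delta> \<le> \<delta>1 \<Longrightarrow> 0 \<le> t0 \<Longrightarrow> - (\<Lambda> + 2) \<le> z0 \<Longrightarrow> z0 \<le> - 2 \<Longrightarrow>
    norm (y1 - y0) \<le> \<Lambda> + 2 \<Longrightarrow> 1 \<le> T \<Longrightarrow> T \<le> 2 \<Longrightarrow> lower_on_ball u y0 z0 2 t0 \<delta> \<Longrightarrow> - 1 \<le> z1 \<Longrightarrow> z1 \<le> 0 \<Longrightarrow> \<kappa>1 * \<delta> \<le> u y1 z1 (t0 + T)"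
    using U.reach_interface[of "\<Lambda> + 2"] \<Lambda> by (auto simp del: minus_add_distrib)
  obtain s0 where s0: "s0 > 0" "\<And>x. 0 \<le> x \<Longrightarrow> x \<le> s0 \<Longrightarrow> (fp - 1) * x \<le> f x"
    using V.growth[of "fp - 1"] by auto
  define c where "c = 1 + 2 * d * real CARD('m) + \<bar>fp - 1\<bar>"
  define A where "A = 1 + 8 / 5 * c / d"
  have c0: "c > 0" using V.D by (simp add: c_def add_pos_nonneg)
  have A1: "A \<ge> 1" using c0 V.D by (simp add: A_def)
  have A2: "5 / 8 * d * A\<^sup>2 > c"
  proof -
    have "A * 1 \<le> A * A" using A1 by (intro mult_left_mono) auto
    then have "8 / 5 * c / d < A\<^sup>2" by (simp add: A_def power2_eq_square)
    then show ?thesis using V.D by (simp add: field_simps)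
  qed
  \<comment> \<open>On the ball of radius \<open>r\<close> about depth \<open>r\<close> one has
    \<open>z \<ge> - 2 * r\<close>, hence \<open>exp (A * z) \<ge> 3/4\<close>; the barrier of
    \<open>inflow\<close> is then at least 3/4 - 5/8 = 1/8 of its amplitude.\<close>
  define r where "r = min 1 (ln (4 / 3) / A) / 2"
  have r: "r > 0" "r \<le> 1/2" "A * (2 * r) \<le> ln (4/3)"
    using A1 by (auto simp: r_def min_def field_simps)
  obtain \<kappa>2 \<delta>2 where k2: "\<kappa>2 > 0" "\<delta>2 > 0" and K2: "\<And>y0 z0 y1 z1 t0 \<delta>. 0 < \<delta> \<Longrightarrow> \<delta> \<le> \<delta>2 \<Longrightarrow> 0 \<le> t0 \<Longrightarrow> z0 \<le> - r \<Longrightarrow> z1 \<le> - r \<Longrightarrow>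
    (norm (y1 - y0))\<^sup>2 + (z1 - z0)\<^sup>2 \<le> (\<Lambda> + 1)\<^sup>2 \<Longrightarrow> lower_on_ball v y0 z0 r t0 \<delta> \<Longrightarrow> \<kappa>2 * \<delta> \<le> v y1 z1 (t0 + 1/2)"
    using V.spread[of r "\<Lambda> + 1" "1/2"] \<Lambda> r by auto
  \<comment> \<open>The amplitude \<open>\<xi> * \<delta>\<close> uses half of the inflow
    \<open>\<mu> * \<kappa>1 * \<delta>\<close>, which gives the strict inequality required by
    \<open>inflow\<close>.\<close>
  define \<xi> where "\<xi> = \<mu> * \<kappa>1 / (2 * (d * A + \<nu> / 2))"
  have dA: "d * A + \<nu> / 2 > 0" using V.D V.\<mu> A1 by (intro add_pos_pos mult_pos_pos) auto
  have \<xi>: "\<xi> > 0" using U.\<mu> k1 dA by (simp add: \<xi>_def)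
  have \<xi>2: "\<xi> * (d * A + \<nu> / 2) = \<mu> * \<kappa>1 / 2"
  proof -
    have "\<mu> * \<kappa>1 / (2 * X) * X = \<mu> * \<kappa>1 / 2" if "X > 0" for X using that by simp
    then show ?thesis unfolding \<xi>_def using dA by blast
  qed
  define \<delta>0 where "\<delta>0 = min \<delta>1 (min (s0 / \<xi>) (8 * \<delta>2 / \<xi>))"
  have \<delta>0: "\<delta>0 > 0" using k1 k2 s0 \<xi> by (simp add: \<delta>0_def)
  have main: "(\<kappa>2 * \<xi> / 8) * \<delta> \<le> v y1 z1 (t0 + 2)" if h: "0 < \<delta>" "\<delta> \<le> \<delta>0" "0 \<le> t0" "- \<Lambda> \<le> z0" "z0 \<le> - 2"
    "norm (y1 - y0) \<le> \<Lambda>" "- \<Lambda> \<le> z1" "z1 \<le> - 1" "lower_on_ball u y0 z0 2 t0 \<delta>" for y0 z0 y1 z1 t0 \<delta>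
  proof -
    have hd: "\<delta> \<le> \<delta>1" "\<xi> * \<delta> \<le> s0" "\<xi> * \<delta> / 8 \<le> \<delta>2"
      using h(2) \<xi> by (auto simp: \<delta>0_def field_simps)
    have lob: "lower_on_ball v y1 (- r) r (t0 + 3/2) (\<xi> * \<delta> / 8)"
      unfolding lower_on_ball_def
    proof (intro allI impI)
      fix y z assume z: "z \<le> 0" and yz: "(norm (y - y1))\<^sup>2 + (z - - r)\<^sup>2 \<le> r\<^sup>2"
      have "(norm (y - y1))\<^sup>2 \<le> r\<^sup>2" "(z + r)\<^sup>2 \<le> r\<^sup>2"
        using yz zero_le_power2[of "norm (y - y1)"] zero_le_power2[of "z + r"] unfolding diff_minus_eq_add by linarith+
      then have n: "norm (y - y1) \<le> r" "\<bar>z + r\<bar> \<le> r" using r by (auto simp: power2_le_iff_abs_le)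
      have "(\<xi> * \<delta>) * (exp (A * z) - 5 / 8) \<le> v y z (t0 + 1 + 1/2)"
      proof (rule V.inflow[where ?s0.0 = s0 and \<eta> = "\<xi> * \<delta>" and c = "\<mu> * (\<kappa>1 * \<delta>)", OF _ A1 A2[unfolded c_def]])
        show "(fp - 1) * x \<le> f x" if "0 \<le> x" "x \<le> s0" for x by (rule s0(2)[OF that])
        show "0 < \<xi> * \<delta>" "\<xi> * \<delta> \<le> s0" "0 \<le> t0 + 1" "z \<le> 0" using \<xi> h hd z by auto
        have F: "\<xi> * \<delta> * (d * A + \<nu> / 2) = \<mu> * \<kappa>1 / 2 * \<delta>" using \<xi>2 by (simp add: mult_ac)
        have "0 < \<mu> * \<kappa>1 * \<delta>" using h k1 U.\<mu> by simp
        then show "\<xi> * \<delta> * (d * A + \<nu> / 2) < \<mu> * (\<kappa>1 * \<delta>)" unfolding F by (simp add: mult.assoc mult.left_commute mult.commute)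
        fix y' t assume yt: "norm (y' - y) \<le> 1" "t0 + 1 \<le> t" "t \<le> t0 + 1 + 1 / 2"
        have "norm (y' - y0) \<le> norm (y' - y) + norm (y - y1) + norm (y1 - y0)"
          using norm_triangle_ineq[of "y' - y" "y - y0"] norm_triangle_ineq[of "y - y1" "y1 - y0"] by simp
        then have "norm (y' - y0) \<le> \<Lambda> + 2" using yt n r h by linarith
        then have "\<kappa>1 * \<delta> \<le> u y' 0 (t0 + (t - t0))" using h hd yt by (intro K1) auto
        then show "\<mu> * (\<kappa>1 * \<delta>) - \<nu> * v y' 0 t \<le> \<mu> * u y' 0 t - \<nu> * v y' 0 t" using U.\<mu> by simp
      qed
      moreover have "3/4 \<le> exp (A * z)"
      proof -
        have "- (2 * r) \<le> z" using n by simp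
        then have "A * (- (2 * r)) \<le> A * z" using A1 by (intro mult_left_mono) auto
        then have "- ln (4/3) \<le> A * z" using r by simp
        then have "exp (- ln (4/3)) \<le> exp (A * z)" by simp
        then show ?thesis by (simp add: exp_minus)
      qed
      then have "(\<xi> * \<delta>) * (1/8) \<le> (\<xi> * \<delta>) * (exp (A * z) - 5 / 8)" using \<xi> h by (intro mult_left_mono) auto
      ultimately show "\<xi> * \<delta> / 8 \<le> v y z (t0 + 3/2)" by (simp add: add.assoc)
    qed
    have "(z1 - - r)\<^sup>2 \<le> (\<Lambda> + 1)\<^sup>2" using h r by (intro power2_le_iff_abs_le[THEN iffD2]) auto
    then have "\<kappa>2 * (\<xi> * \<delta> / 8) \<le> v y1 z1 (t0 + 3/2 + 1/2)"
      using h hd r \<xi> by (intro K2[OF _ _ _ _ _ _ lob]) auto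
    then show ?thesis by (simp add: add.assoc)
  qed
  have "\<kappa>2 * \<xi> / 8 > 0" using k2 \<xi> by simp
  then show ?thesis using \<delta>0 main by blast
qed

end

section \<open>The critical speed and its optimal path\<close>

text \<open>\<open>sqrt A\<close> is the exponent at which the two dispersion curves
  \<open>D * \<alpha> + gp / \<alpha>\<close> and \<open>d * \<alpha> + fp / \<alpha>\<close> cross.
  The two negated conditions force \<open>D - d\<close> and \<open>fp - gp\<close> to have the same
  sign, so the crossing exists, and the critical speed is the common value there.\<close>

lemma cstar_inf_anomalous:
  assumes pos: "D > 0" "d > 0" "gp > 0" "fp > 0"
    and ano: "\<not> D / d \<le> 2 - gp / fp" "\<not> d / D \<le> 2 - fp / gp"
  defines "A \<equiv> (fp - gp) / (D - d)"
  shows "A > 0" "D - d \<noteq> 0" "cstar_inf D d fp gp * sqrt A = D * A + gp"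
proof -
  have a1: "D * fp + d * gp > 2 * (d * fp)" and a2: "D * fp + d * gp > 2 * (D * gp)"
    using ano pos by (simp_all add: field_simps)
  have "(D > d \<and> fp > gp) \<or> (D < d \<and> fp < gp)"
  proof (cases "D > d")
    case True
    then have "gp * (D - d) > 0" using pos by simp
    then have "D * (fp - gp) > 0" using a2 by (simp add: algebra_simps)
    then show ?thesis using True pos by (simp add: zero_less_mult_iff)
  next
    case False
    then have "fp * (D - d) \<le> 0" using pos by (simp add: mult_nonneg_nonpos)
    then have "d * (fp - gp) < 0" using a1 by (simp add: algebra_simps)
    then have f: "fp < gp" using pos by (simp add: mult_less_0_iff)
    then have "D * (fp - gp) < 0" using pos by (simp add: mult_less_0_iff)
    then have "gp * (D - d) < 0" using a2 by (simp add: algebra_simps)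
    then show ?thesis using f pos by (simp add: mult_less_0_iff)
  qed
  then show A: "A > 0" and Dd: "D - d \<noteq> 0" by (auto simp: A_def divide_neg_neg)
  have AD: "A * (D - d) = fp - gp" using Dd by (simp add: A_def)
  have "sqrt ((D - d) * (fp - gp)) = \<bar>D - d\<bar> * sqrt A"
  proof -
    have "(D - d) * (fp - gp) = (D - d)\<^sup>2 * A" unfolding AD[symmetric] by (simp add: power2_eq_square)
    then show ?thesis by (simp add: real_sqrt_mult)
  qed
  moreover have "D * fp - d * gp = (D - d) * (D * A + gp)"
  proof -
    have "(D - d) * (D * A + gp) = D * (A * (D - d)) + gp * (D - d)" by (simp add: algebra_simps)
    then show ?thesis unfolding AD by (simp add: algebra_simps)
  qed
  ultimately have "cstar_inf D d fp gp = \<bar>(D - d) * (D * A + gp)\<bar> / (\<bar>D - d\<bar> * sqrt A)"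
    using ano by (simp add: cstar_inf_def)
  also have "\<dots> = (D * A + gp) / sqrt A"
  proof -
    have "D * A + gp > 0" using A pos by (intro add_pos_pos mult_pos_pos)
    then show ?thesis using Dd by (simp add: abs_mult)
  qed
  finally show "cstar_inf D d fp gp * sqrt A = D * A + gp" using A by simp
qed

text \<open>In the anomalous regime the optimal path alternates between the two media: a fraction \<open>\<theta>\<close> of
  the time in the upper half-space at speed \<open>2d\<alpha>\<close> and the rest in the lower one at speed \<open>2D\<alpha>\<close>,
  where \<open>\<alpha>\<^sup>2 = (fp - gp) / (D - d)\<close>.\<close>

lemma cstar_inf_speeds:
  assumes pos: "D > 0" "d > 0" "gp > 0" "fp > 0" and c: "0 < c" "c < cstar_inf D d fp gp"
  obtains \<theta> V1 V2 l1 l2 where "0 \<le> \<theta>" "\<theta> \<le> 1" "0 \<le> V1" "0 \<le> V2"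
    "l1 + V1\<^sup>2 / (4 * d) < fp" "l2 + V2\<^sup>2 / (4 * D) < gp" "0 < \<theta> * l1 + (1 - \<theta>) * l2"
    "c < \<theta> * V1 + (1 - \<theta>) * V2"
proof -
  have one: "\<exists>V l. 0 \<le> V \<and> l + V\<^sup>2 / (4 * a) < b \<and> 0 < l \<and> c < V"
    if ab: "a > 0" "b > 0" and lt: "c < 2 * sqrt (a * b)" for a b
  proof -
    define V where "V = (c + 2 * sqrt (a * b)) / 2"
    have V: "c < V" "0 \<le> V" "V < 2 * sqrt (a * b)" using lt c by (auto simp: V_def)
    have "V\<^sup>2 < (2 * sqrt (a * b))\<^sup>2" using V by (intro power_strict_mono) auto
    also have "\<dots> = 4 * (a * b)" using ab by (simp add: power_mult_distrib)
    finally have "V\<^sup>2 / (4 * a) < b" using ab by (simp add: field_simps)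
    then show ?thesis using V by (intro exI[of _ V] exI[of _ "(b - V\<^sup>2 / (4 * a)) / 2"]) (auto simp: field_simps)
  qed
  consider "D / d \<le> 2 - gp / fp" | "\<not> D / d \<le> 2 - gp / fp" "d / D \<le> 2 - fp / gp"
    | "\<not> D / d \<le> 2 - gp / fp" "\<not> d / D \<le> 2 - fp / gp" by blast
  then show ?thesis
  proof cases
    case 1
    then have "c < 2 * sqrt (d * fp)" using c by (simp add: cstar_inf_def)
    then obtain V l where "0 \<le> V" "l + V\<^sup>2 / (4 * d) < fp" "0 < l" "c < V" using one[of d fp] pos by auto
    then show ?thesis using pos by (intro that[of 1 V 0 l 0]) auto
  next
    case 2
    then have "c < 2 * sqrt (D * gp)" using c by (simp add: cstar_inf_def)
    then obtain V l where "0 \<le> V" "l + V\<^sup>2 / (4 * D) < gp" "0 < l" "c < V" using one[of D gp] pos by auto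
    then show ?thesis using pos by (intro that[of 0 0 V 0 l]) auto
  next
    case 3
    define ca where "ca = cstar_inf D d fp gp"
    have a1: "D * fp + d * gp > 2 * (d * fp)" and a2: "D * fp + d * gp > 2 * (D * gp)"
      using 3 pos by (simp_all add: field_simps)
    define A where "A = (fp - gp) / (D - d)"
    define \<alpha> where "\<alpha> = sqrt A"
    note ano = cstar_inf_anomalous[OF pos 3, folded A_def]
    have A0: "A > 0" and Dd: "D - d \<noteq> 0" and caA: "ca * \<alpha> = D * A + gp"
      using ano by (simp_all add: ca_def \<alpha>_def)
    have \<alpha>: "\<alpha> > 0" "\<alpha>\<^sup>2 = A" using A0 by (auto simp: \<alpha>_def)
    have AD: "A * (D - d) = fp - gp" using Dd by (simp add: A_def)
    have caA': "ca * \<alpha> = d * A + fp" using caA AD by (simp add: algebra_simps)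
    \<comment> \<open>This fraction makes the mean of the two speeds equal to the critical speed
      (\<open>avg\<close>); the inequalities \<open>a1\<close> and \<open>a2\<close> of the
      anomalous regime say that it lies between 0 and 1.\<close>
    define \<theta> where "\<theta> = (D * A - gp) / (2 * (A * (D - d)))"
    have f1: "(fp - d * A) * (D - d) = D * fp + d * gp - 2 * (d * fp)"
      and f2: "(D * A - gp) * (D - d) = D * fp + d * gp - 2 * (D * gp)"
    proof -
      have "(fp - d * A) * (D - d) = fp * (D - d) - d * (A * (D - d))" by (simp add: algebra_simps)
      then show "(fp - d * A) * (D - d) = D * fp + d * gp - 2 * (d * fp)" unfolding AD by (simp add: algebra_simps)
      have "(D * A - gp) * (D - d) = D * (A * (D - d)) - gp * (D - d)" by (simp add: algebra_simps)
      then show "(D * A - gp) * (D - d) = D * fp + d * gp - 2 * (D * gp)" unfolding AD by (simp add: algebra_simps)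
    qed
    have \<theta>eq: "\<theta> = (D * A - gp) * (D - d) / (2 * A * (D - d)\<^sup>2)"
      using Dd by (simp add: \<theta>_def power2_eq_square)
    have \<theta>0: "0 \<le> \<theta>" unfolding \<theta>eq f2 using a2 A0 by simp
    have \<theta>1: "1 - \<theta> = (fp - d * A) * (D - d) / (2 * A * (D - d)\<^sup>2)"
    proof -
      have "2 * A * (D - d)\<^sup>2 = 2 * (A * (D - d)) * (D - d)" by (simp add: power2_eq_square)
      also have "2 * (A * (D - d)) = D * A - gp + (fp - d * A)" using AD by (simp add: algebra_simps)
      also have "\<dots> * (D - d) = (D * A - gp) * (D - d) + (fp - d * A) * (D - d)" by (rule distrib_right)
      finally have eq: "2 * A * (D - d)\<^sup>2 = (D * A - gp) * (D - d) + (fp - d * A) * (D - d)" .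
      have nz: "2 * A * (D - d)\<^sup>2 \<noteq> 0" using A0 Dd by simp
      have "1 = ((D * A - gp) * (D - d) + (fp - d * A) * (D - d)) / (2 * A * (D - d)\<^sup>2)"
        unfolding eq[symmetric] using divide_self[OF nz] by (rule sym)
      then show ?thesis unfolding \<theta>eq by (simp add: add_divide_distrib)
    qed
    have "0 \<le> 1 - \<theta>" unfolding \<theta>1 f1 using a1 A0 by (intro divide_nonneg_nonneg mult_nonneg_nonneg) auto
    then have \<theta>2: "\<theta> \<le> 1" by simp
    \<comment> \<open>At full speed the mean growth rate along the path is exactly zero. Slowing
      both runs by the factor \<open>r\<close> keeps the mean speed above \<open>c\<close> and
      leaves the mean rate \<open>(1 - r\<^sup>2) * w\<close>.\<close>
    define r where "r = (c + ca) / (2 * ca)"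
    have ca0: "c < ca" "ca > 0" using c by (auto simp: ca_def)
    have r: "0 < r" "r < 1" "r * ca > c" using ca0 c by (auto simp: r_def field_simps)
    have avg: "\<theta> * (2 * d * A) + (1 - \<theta>) * (2 * D * A) = ca * \<alpha>"
    proof -
      have "\<theta> * (2 * (A * (D - d))) = D * A - gp" using A0 Dd by (simp add: \<theta>_def)
      then have "2 * D * A - \<theta> * (2 * (A * (D - d))) = D * A + gp" by simp
      then show ?thesis unfolding caA by (simp add: algebra_simps)
    qed
    define w where "w = \<theta> * fp + (1 - \<theta>) * gp"
    have w0: "w > 0" unfolding w_def using pos \<theta>0 \<theta>2
      by (cases "\<theta> = 0") (auto intro!: add_pos_nonneg)
    \<comment> \<open>Half of the gained rate is given up to make the two growth conditions strict;
      the other half remains as net growth.\<close>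
    define \<eta> where "\<eta> = (1 - r\<^sup>2) * w / 2"
    have r2: "r\<^sup>2 < 1" using r by (simp add: power_less_one_iff)
    have \<eta>0: "\<eta> > 0" using r2 w0 by (simp add: \<eta>_def)
    have net: "\<theta> * (fp - r\<^sup>2 * (d * A)) + (1 - \<theta>) * (gp - r\<^sup>2 * (D * A)) = 2 * \<eta>"
    proof -
      have "\<theta> * fp + (1 - \<theta>) * gp = \<theta> * (ca * \<alpha> - d * A) + (1 - \<theta>) * (ca * \<alpha> - D * A)"
        using caA caA' by simp
      also have "\<dots> = ca * \<alpha> - (\<theta> * (2 * d * A) + (1 - \<theta>) * (2 * D * A)) / 2" by (simp add: field_simps)
      finally have "w = ca * \<alpha> / 2" unfolding avg w_def by simp
      moreover have "\<theta> * (d * A) + (1 - \<theta>) * (D * A) = ca * \<alpha> / 2" using avg by simp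
      ultimately have "\<theta> * (d * A) + (1 - \<theta>) * (D * A) = w" by simp
      then have "w - r\<^sup>2 * (\<theta> * (d * A) + (1 - \<theta>) * (D * A)) = 2 * \<eta>" by (simp add: \<eta>_def algebra_simps)
      then show ?thesis by (simp add: w_def algebra_simps)
    qed
    have sq: "(r * (2 * d * \<alpha>))\<^sup>2 / (4 * d) = r\<^sup>2 * (d * A)" "(r * (2 * D * \<alpha>))\<^sup>2 / (4 * D) = r\<^sup>2 * (D * A)"
      using pos \<alpha> by (simp_all add: power_mult_distrib power2_eq_square[of d] power2_eq_square[of D])
    show ?thesis
    proof (rule that[of \<theta> "r * (2 * d * \<alpha>)" "r * (2 * D * \<alpha>)" "fp - r\<^sup>2 * (d * A) - \<eta>" "gp - r\<^sup>2 * (D * A) - \<eta>"])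
      have "\<theta> * (fp - r\<^sup>2 * (d * A) - \<eta>) + (1 - \<theta>) * (gp - r\<^sup>2 * (D * A) - \<eta>) = \<eta>"
        using net by (simp add: algebra_simps)
      then show "0 < \<theta> * (fp - r\<^sup>2 * (d * A) - \<eta>) + (1 - \<theta>) * (gp - r\<^sup>2 * (D * A) - \<eta>)" using \<eta>0 by simp
      have "(\<theta> * (r * (2 * d * \<alpha>)) + (1 - \<theta>) * (r * (2 * D * \<alpha>))) * \<alpha> = r * (\<theta> * (2 * d * A) + (1 - \<theta>) * (2 * D * A))"
        unfolding \<alpha>(2)[symmetric] by (simp add: power2_eq_square algebra_simps)
      also have "\<dots> = r * ca * \<alpha>" unfolding avg by simp
      finally show "c < \<theta> * (r * (2 * d * \<alpha>)) + (1 - \<theta>) * (r * (2 * D * \<alpha>))" using r \<alpha> by simp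
    qed (use \<theta>0 \<theta>2 r \<alpha> pos sq \<eta>0 in auto)
  qed
qed

section \<open>Propagation over long times and across the interface\<close>

lemma lower_on_ball_mono:
  assumes "lower_on_ball u y z R t \<delta>" "R' \<le> R" "0 \<le> R'" "\<delta>' \<le> \<delta>"
  shows "lower_on_ball u y z R' t \<delta>'"
proof -
  have "R'\<^sup>2 \<le> R\<^sup>2" using assms by (intro power_mono) auto
  then show ?thesis using assms unfolding lower_on_ball_def by (meson order_trans)
qed

lemma in_ballD:
  assumes "(norm (y - y0))\<^sup>2 + (z - z0)\<^sup>2 \<le> R\<^sup>2" "R \<ge> (0::real)"
  shows "norm (y - y0) \<le> R" "\<bar>z - z0\<bar> \<le> R"
proof -
  have "(norm (y - y0))\<^sup>2 \<le> R\<^sup>2" "(z - z0)\<^sup>2 \<le> R\<^sup>2"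
    using assms(1) zero_le_power2[of "norm (y - y0)"] zero_le_power2[of "z - z0"] by linarith+
  then show "norm (y - y0) \<le> R" "\<bar>z - z0\<bar> \<le> R" using assms(2) by (auto simp: power2_le_iff_abs_le)
qed

context half_pos
begin

text \<open>For large radius the geometric term
  \<open>D * (12 + 4 * CARD('m))\<^sup>2 / (32 * R\<^sup>2)\<close> in the gap condition becomes
  negligible, so any rate below \<open>gp - V\<^sup>2 / (4 * D)\<close> is attained. From
  \<open>R \<ge> 3\<close> the inner ball of radius 2 has \<rho> at least
  \<open>R\<^sup>2 / 2\<close>, which explains the factor 1/8. Besides \<open>exp (l * T)\<close>
  the loss does not depend on \<open>T\<close>.\<close>

lemma run_ball:
  assumes l: "l + V\<^sup>2 / (4 * D) < gp" and V: "V \<ge> 0"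
  shows "\<exists>R0. \<forall>R\<ge>R0. \<exists>s0>0. \<forall>\<delta> T y0 z0 t0 s \<sigma>. 0 < \<delta> \<longrightarrow> 0 \<le> T \<longrightarrow> 0 \<le> t0 \<longrightarrow> (norm s)\<^sup>2 + \<sigma>\<^sup>2 \<le> V\<^sup>2 \<longrightarrow>
     z0 \<le> - R \<longrightarrow> z0 + T * \<sigma> \<le> - R \<longrightarrow> \<delta> * exp (max l 0 * T) \<le> s0 \<longrightarrow> lower_on_ball u y0 z0 R t0 \<delta> \<longrightarrow>
     lower_on_ball u (y0 + T *\<^sub>R s) (z0 + T * \<sigma>) 2 (t0 + T) (exp (- (V * R / D)) / 8 * exp (l * T) * \<delta>)"
proof -
  define k where "k = (gp + (l + V\<^sup>2 / (4 * D))) / 2"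
  define G where "G = k - l - V\<^sup>2 / (4 * D)"
  have k: "k < gp" "G > 0"
  proof -
    have "(gp + (l + x)) / 2 < gp \<and> 0 < (gp + (l + x)) / 2 - l - x" if "l + x < gp" for x
      using that by (simp add: field_simps)
    then show "k < gp" "G > 0" using l unfolding k_def G_def by blast+
  qed
  obtain s0 where s0: "s0 > 0" "\<And>x. 0 \<le> x \<Longrightarrow> x \<le> s0 \<Longrightarrow> k * x \<le> g x" using growth[OF k(1)] by auto
  define a where "a = D * (12 + 4 * real CARD('m))\<^sup>2 / (32 * G)"
  have main: "lower_on_ball u (y0 + T *\<^sub>R s) (z0 + T * \<sigma>) 2 (t0 + T) (exp (- (V * R / D)) / 8 * exp (l * T) * \<delta>)"
    if R: "R \<ge> max 3 (a + 1)" and h: "0 < \<delta>" "0 \<le> T" "0 \<le> t0" "(norm s)\<^sup>2 + \<sigma>\<^sup>2 \<le> V\<^sup>2" "z0 \<le> - R" "z0 + T * \<sigma> \<le> - R"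
      "\<delta> * exp (max l 0 * T) \<le> s0" "lower_on_ball u y0 z0 R t0 \<delta>" for R \<delta> T y0 z0 t0 s \<sigma>
    unfolding lower_on_ball_def
  proof (intro allI impI)
    fix y z assume z: "z \<le> 0" and yz: "(norm (y - (y0 + T *\<^sub>R s)))\<^sup>2 + (z - (z0 + T * \<sigma>))\<^sup>2 \<le> 2\<^sup>2"
    have R3: "R \<ge> 3" "R > a" using R by auto
    have "R * 3 \<le> R * R" using R3 by (intro mult_left_mono) auto
    then have R9: "R\<^sup>2 \<ge> 9" "a < R\<^sup>2" using R3 unfolding power2_eq_square by linarith+
    have gap: "D * (12 + 4 * real CARD('m))\<^sup>2 < 32 * R\<^sup>2 * (k - l - V\<^sup>2 / (4 * D))"
    proof -
      have "32 * G * a < 32 * G * R\<^sup>2" using R9 k by (intro mult_strict_left_mono) auto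
      then show ?thesis using k by (simp add: a_def G_def mult_ac)
    qed
    have "\<delta> / 2 * exp (l * T) * exp (- (V * R / D)) * ((R\<^sup>2 - 4) / R\<^sup>2)\<^sup>2 \<le> u y z (t0 + T)"
    proof (rule run[OF _ h(1) V h(4) s0(2) gap h(3,2) _ h(7,8) z])
      show "(z0 \<le> - R \<and> z0 + T * \<sigma> \<le> - R) \<or> (\<sigma> \<ge> 0 \<and> z0 + T * \<sigma> \<le> - 1 \<and> \<mu> * (R\<^sup>2 - 1) \<le> 4 * D)" using h by simp
      show "R\<^sup>2 - 4 \<le> R\<^sup>2 - (norm (y - y0 - T *\<^sub>R s))\<^sup>2 - (z - z0 - T * \<sigma>)\<^sup>2"
        using yz by (simp add: algebra_simps)
    qed (use R3 R9 in auto)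
    moreover have "1 / 2 \<le> (R\<^sup>2 - 4) / R\<^sup>2" using R9(1) by (subst pos_le_divide_eq) (linarith+)
    then have "(1/2)\<^sup>2 \<le> ((R\<^sup>2 - 4) / R\<^sup>2)\<^sup>2" by (intro power_mono) auto
    then have "\<delta> / 2 * exp (l * T) * exp (- (V * R / D)) * (1/2)\<^sup>2 \<le> \<delta> / 2 * exp (l * T) * exp (- (V * R / D)) * ((R\<^sup>2 - 4) / R\<^sup>2)\<^sup>2"
      using h by (intro mult_left_mono) auto
    ultimately have "\<delta> / 2 * exp (l * T) * exp (- (V * R / D)) * (1/2)\<^sup>2 \<le> u y z (t0 + T)" by linarith
    then show "exp (- (V * R / D)) / 8 * exp (l * T) * \<delta> \<le> u y z (t0 + T)"
      by (simp add: power2_eq_square mult_ac)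
  qed
  show ?thesis
    by (rule exI[of _ "max 3 (a + 1)"], intro allI impI, rule exI[of _ s0]) (use s0(1) main in blast)
qed

text \<open>Restores the radius \<open>R\<close> that \<open>run_ball\<close> needs at its start but
  does not return.\<close>

lemma spread_ball:
  assumes R: "R \<ge> 2"
  shows "\<exists>\<kappa>>0. \<exists>\<delta>0>0. \<forall>y0 t0 \<delta>. 0 < \<delta> \<longrightarrow> \<delta> \<le> \<delta>0 \<longrightarrow> 0 \<le> t0 \<longrightarrow> lower_on_ball u y0 (- R - 1) 2 t0 \<delta> \<longrightarrow>
     lower_on_ball u y0 (- R - 1) R (t0 + 2) (\<kappa> * \<delta>)"
proof -
  obtain \<kappa> \<delta>0 where k: "\<kappa> > 0" "\<delta>0 > 0" and K: "\<And>y0 z0 y1 z1 t0 \<delta>. 0 < \<delta> \<Longrightarrow> \<delta> \<le> \<delta>0 \<Longrightarrow> 0 \<le> t0 \<Longrightarrow> z0 \<le> - 1 \<Longrightarrow> z1 \<le> - 1 \<Longrightarrow>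
    (norm (y1 - y0))\<^sup>2 + (z1 - z0)\<^sup>2 \<le> R\<^sup>2 \<Longrightarrow> lower_on_ball u y0 z0 1 t0 \<delta> \<Longrightarrow> \<kappa> * \<delta> \<le> u y1 z1 (t0 + 2)"
    using spread[of 1 R 2] R by auto
  have "lower_on_ball u y0 (- R - 1) R (t0 + 2) (\<kappa> * \<delta>)"
    if h: "0 < \<delta>" "\<delta> \<le> \<delta>0" "0 \<le> t0" "lower_on_ball u y0 (- R - 1) 2 t0 \<delta>" for y0 t0 \<delta>
    unfolding lower_on_ball_def
  proof (intro allI impI)
    fix y z assume "z \<le> 0" and yz: "(norm (y - y0))\<^sup>2 + (z - (- R - 1))\<^sup>2 \<le> R\<^sup>2"
    then have "\<bar>z - (- R - 1)\<bar> \<le> R" using in_ballD[OF yz] R by auto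
    then have "z \<le> - 1" by linarith
    then show "\<kappa> * \<delta> \<le> u y z (t0 + 2)"
      by (intro K[OF h(1,2,3) _ _ yz]) (use R lower_on_ball_mono[OF h(4)] in auto)
  qed
  then show ?thesis using k by blast
qed

end

context pair_pos
begin

lemma transfer_ball:
  assumes R: "R \<ge> 2"
  shows "\<exists>\<kappa>>0. \<exists>\<delta>0>0. \<forall>y0 t0 \<delta>. 0 < \<delta> \<longrightarrow> \<delta> \<le> \<delta>0 \<longrightarrow> 0 \<le> t0 \<longrightarrow> lower_on_ball u y0 (- R - 1) 2 t0 \<delta> \<longrightarrow>
     lower_on_ball v y0 (- R - 1) R (t0 + 2) (\<kappa> * \<delta>)"
proof -
  obtain \<kappa> \<delta>0 where k: "\<kappa> > 0" "\<delta>0 > 0" and K: "\<And>y0 z0 y1 z1 t0 \<delta>. 0 < \<delta> \<Longrightarrow> \<delta> \<le> \<delta>0 \<Longrightarrow> 0 \<le> t0 \<Longrightarrow> - (2 * R + 3) \<le> z0 \<Longrightarrow> z0 \<le> - 2 \<Longrightarrow>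
    norm (y1 - y0) \<le> 2 * R + 3 \<Longrightarrow> - (2 * R + 3) \<le> z1 \<Longrightarrow> z1 \<le> - 1 \<Longrightarrow> lower_on_ball u y0 z0 2 t0 \<delta> \<Longrightarrow> \<kappa> * \<delta> \<le> v y1 z1 (t0 + 2)"
    using transfer[of "2 * R + 3"] R by (auto simp del: minus_add_distrib)
  have "lower_on_ball v y0 (- R - 1) R (t0 + 2) (\<kappa> * \<delta>)"
    if h: "0 < \<delta>" "\<delta> \<le> \<delta>0" "0 \<le> t0" "lower_on_ball u y0 (- R - 1) 2 t0 \<delta>" for y0 t0 \<delta>
    unfolding lower_on_ball_def
  proof (intro allI impI)
    fix y z assume "z \<le> 0" and yz: "(norm (y - y0))\<^sup>2 + (z - (- R - 1))\<^sup>2 \<le> R\<^sup>2"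
    then have "norm (y - y0) \<le> R" "\<bar>z - (- R - 1)\<bar> \<le> R" using in_ballD[OF yz] R by auto
    then show "\<kappa> * \<delta> \<le> v y z (t0 + 2)"
      by (intro K[OF h(1,2,3) _ _ _ _ _ h(4)]) (use R in linarith)+
  qed
  then show ?thesis using k by blast
qed

text \<open>One round trip starting and ending in the upper medium: cross, run for
  \<open>(1 - \<theta>) * T\<close>, cross back, run for \<open>\<theta> * T\<close>, widen the
  ball. Crossings and widening last 6 and cost a factor \<open>K\<close> free of \<open>T\<close>,
  whereas the runs contribute \<open>exp (w * T)\<close> with \<open>w > 0\<close>. For large
  \<open>T\<close> the amplitude is at least restored, so the step can be iterated without
  end.\<close>

lemma zigzag_step:
  assumes \<theta>: "0 \<le> \<theta>" "\<theta> \<le> 1" and V: "0 \<le> V1" "0 \<le> V2"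
    and l: "l1 + V1\<^sup>2 / (4 * d) < fp" "l2 + V2\<^sup>2 / (4 * D) < gp" and net: "0 < \<theta> * l1 + (1 - \<theta>) * l2"
    and C: "0 \<le> C" "C < \<theta> * V1 + (1 - \<theta>) * V2"
  shows "\<exists>\<tau>>0. \<exists>R\<ge>2. \<exists>\<epsilon>0>0. \<forall>\<epsilon> y0 t0 s. 0 < \<epsilon> \<longrightarrow> \<epsilon> \<le> \<epsilon>0 \<longrightarrow> 0 \<le> t0 \<longrightarrow> norm s \<le> C \<longrightarrow>
     lower_on_ball v y0 (- R - 1) R t0 \<epsilon> \<longrightarrow> lower_on_ball v (y0 + \<tau> *\<^sub>R s) (- R - 1) R (t0 + \<tau>) \<epsilon>"
proof -
  interpret S: pair_pos d \<nu> fp f v D \<mu> gp g u by (rule swap)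
  obtain Ra where Ra: "\<And>R. R \<ge> Ra \<Longrightarrow> \<exists>s0>0. \<forall>\<delta> T y0 z0 t0 s \<sigma>. 0 < \<delta> \<longrightarrow> 0 \<le> T \<longrightarrow> 0 \<le> t0 \<longrightarrow> (norm s)\<^sup>2 + \<sigma>\<^sup>2 \<le> V1\<^sup>2 \<longrightarrow>
     z0 \<le> - R \<longrightarrow> z0 + T * \<sigma> \<le> - R \<longrightarrow> \<delta> * exp (max l1 0 * T) \<le> s0 \<longrightarrow> lower_on_ball v y0 z0 R t0 \<delta> \<longrightarrow>
     lower_on_ball v (y0 + T *\<^sub>R s) (z0 + T * \<sigma>) 2 (t0 + T) (exp (- (V1 * R / d)) / 8 * exp (l1 * T) * \<delta>)"
    using V.run_ball[OF l(1) V(1)] by blast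
  obtain Rb where Rb: "\<And>R. R \<ge> Rb \<Longrightarrow> \<exists>s0>0. \<forall>\<delta> T y0 z0 t0 s \<sigma>. 0 < \<delta> \<longrightarrow> 0 \<le> T \<longrightarrow> 0 \<le> t0 \<longrightarrow> (norm s)\<^sup>2 + \<sigma>\<^sup>2 \<le> V2\<^sup>2 \<longrightarrow>
     z0 \<le> - R \<longrightarrow> z0 + T * \<sigma> \<le> - R \<longrightarrow> \<delta> * exp (max l2 0 * T) \<le> s0 \<longrightarrow> lower_on_ball u y0 z0 R t0 \<delta> \<longrightarrow>
     lower_on_ball u (y0 + T *\<^sub>R s) (z0 + T * \<sigma>) 2 (t0 + T) (exp (- (V2 * R / D)) / 8 * exp (l2 * T) * \<delta>)"
    using U.run_ball[OF l(2) V(2)] by blast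
  define R where "R = max 2 (max Ra Rb)"
  have R2: "R \<ge> 2" and RR: "R \<ge> Ra" "R \<ge> Rb" by (simp_all add: R_def)
  obtain s1 where s1: "s1 > 0" and run1: "\<And>\<delta> T y0 t0 s. 0 < \<delta> \<Longrightarrow> 0 \<le> T \<Longrightarrow> 0 \<le> t0 \<Longrightarrow> norm s \<le> V1 \<Longrightarrow>
     \<delta> * exp (max l1 0 * T) \<le> s1 \<Longrightarrow> lower_on_ball v y0 (- R - 1) R t0 \<delta> \<Longrightarrow>
     lower_on_ball v (y0 + T *\<^sub>R s) (- R - 1) 2 (t0 + T) (exp (- (V1 * R / d)) / 8 * exp (l1 * T) * \<delta>)"
  proof -
    obtain s1 where s1: "s1 > 0" and *: "\<And>\<delta> T y0 z0 t0 s \<sigma>. 0 < \<delta> \<Longrightarrow> 0 \<le> T \<Longrightarrow> 0 \<le> t0 \<Longrightarrow> (norm s)\<^sup>2 + \<sigma>\<^sup>2 \<le> V1\<^sup>2 \<Longrightarrow>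
     z0 \<le> - R \<Longrightarrow> z0 + T * \<sigma> \<le> - R \<Longrightarrow> \<delta> * exp (max l1 0 * T) \<le> s1 \<Longrightarrow> lower_on_ball v y0 z0 R t0 \<delta> \<Longrightarrow>
     lower_on_ball v (y0 + T *\<^sub>R s) (z0 + T * \<sigma>) 2 (t0 + T) (exp (- (V1 * R / d)) / 8 * exp (l1 * T) * \<delta>)"
      using Ra[OF RR(1)] by blast
    show ?thesis
    proof (rule that[OF s1])
      fix \<delta> T y0 t0 and s :: "real^'m"
      assume "0 < \<delta>" "0 \<le> T" "0 \<le> t0" "norm s \<le> V1" "\<delta> * exp (max l1 0 * T) \<le> s1" "lower_on_ball v y0 (- R - 1) R t0 \<delta>"
      then show "lower_on_ball v (y0 + T *\<^sub>R s) (- R - 1) 2 (t0 + T) (exp (- (V1 * R / d)) / 8 * exp (l1 * T) * \<delta>)"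
        using *[of \<delta> T t0 s 0 "- R - 1" y0] power_mono[of "norm s" V1 2] by simp
    qed
  qed
  obtain s2 where s2: "s2 > 0" and run2: "\<And>\<delta> T y0 t0 s. 0 < \<delta> \<Longrightarrow> 0 \<le> T \<Longrightarrow> 0 \<le> t0 \<Longrightarrow> norm s \<le> V2 \<Longrightarrow>
     \<delta> * exp (max l2 0 * T) \<le> s2 \<Longrightarrow> lower_on_ball u y0 (- R - 1) R t0 \<delta> \<Longrightarrow>
     lower_on_ball u (y0 + T *\<^sub>R s) (- R - 1) 2 (t0 + T) (exp (- (V2 * R / D)) / 8 * exp (l2 * T) * \<delta>)"
  proof -
    obtain s2 where s2: "s2 > 0" and *: "\<And>\<delta> T y0 z0 t0 s \<sigma>. 0 < \<delta> \<Longrightarrow> 0 \<le> T \<Longrightarrow> 0 \<le> t0 \<Longrightarrow> (norm s)\<^sup>2 + \<sigma>\<^sup>2 \<le> V2\<^sup>2 \<Longrightarrow>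
     z0 \<le> - R \<Longrightarrow> z0 + T * \<sigma> \<le> - R \<Longrightarrow> \<delta> * exp (max l2 0 * T) \<le> s2 \<Longrightarrow> lower_on_ball u y0 z0 R t0 \<delta> \<Longrightarrow>
     lower_on_ball u (y0 + T *\<^sub>R s) (z0 + T * \<sigma>) 2 (t0 + T) (exp (- (V2 * R / D)) / 8 * exp (l2 * T) * \<delta>)"
      using Rb[OF RR(2)] by blast
    show ?thesis
    proof (rule that[OF s2])
      fix \<delta> T y0 t0 and s :: "real^'m"
      assume "0 < \<delta>" "0 \<le> T" "0 \<le> t0" "norm s \<le> V2" "\<delta> * exp (max l2 0 * T) \<le> s2" "lower_on_ball u y0 (- R - 1) R t0 \<delta>"
      then show "lower_on_ball u (y0 + T *\<^sub>R s) (- R - 1) 2 (t0 + T) (exp (- (V2 * R / D)) / 8 * exp (l2 * T) * \<delta>)"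
        using *[of \<delta> T t0 s 0 "- R - 1" y0] power_mono[of "norm s" V2 2] by simp
    qed
  qed
  obtain ka da where ka: "ka > 0" "da > 0" and Ka: "\<And>y0 t0 \<delta>. 0 < \<delta> \<Longrightarrow> \<delta> \<le> da \<Longrightarrow> 0 \<le> t0 \<Longrightarrow>
     lower_on_ball v y0 (- R - 1) 2 t0 \<delta> \<Longrightarrow> lower_on_ball u y0 (- R - 1) R (t0 + 2) (ka * \<delta>)"
    using S.transfer_ball[OF R2] by blast
  obtain kb db where kb: "kb > 0" "db > 0" and Kb: "\<And>y0 t0 \<delta>. 0 < \<delta> \<Longrightarrow> \<delta> \<le> db \<Longrightarrow> 0 \<le> t0 \<Longrightarrow>
     lower_on_ball u y0 (- R - 1) 2 t0 \<delta> \<Longrightarrow> lower_on_ball v y0 (- R - 1) R (t0 + 2) (kb * \<delta>)"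
    using transfer_ball[OF R2] by blast
  obtain kc dc where kc: "kc > 0" "dc > 0" and Kc: "\<And>y0 t0 \<delta>. 0 < \<delta> \<Longrightarrow> \<delta> \<le> dc \<Longrightarrow> 0 \<le> t0 \<Longrightarrow>
     lower_on_ball v y0 (- R - 1) 2 t0 \<delta> \<Longrightarrow> lower_on_ball v y0 (- R - 1) R (t0 + 2) (kc * \<delta>)"
    using V.spread_ball[OF R2] by blast
  define C' where "C' = \<theta> * V1 + (1 - \<theta>) * V2"
  define e1 e2 where "e1 = exp (- (V1 * R / d)) / 8" and "e2 = exp (- (V2 * R / D)) / 8"
  have e: "e1 > 0" "e2 > 0" by (auto simp: e1_def e2_def)
  define w where "w = \<theta> * l1 + (1 - \<theta>) * l2"
  define K where "K = kc * e1 * kb * e2 * ka"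
  have K0: "K > 0" using e ka kb kc by (simp add: K_def)
  \<comment> \<open>The second summand makes the idle time 6 affordable in speed
    (\<open>TC\<close>), the third makes the growth outweigh the losses (\<open>TK\<close>).\<close>
  define T where "T = 1 + 6 * C / (C' - C) + \<bar>ln K\<bar> / w"
  have w0: "w > 0" using net by (simp add: w_def)
  have CC: "C' - C > 0" using C by (simp add: C'_def)
  have T1: "T \<ge> 1" using C CC w0 by (simp add: T_def)
  have TC: "(6 + T) * C \<le> T * C'"
  proof -
    have "6 * C / (C' - C) \<le> T" using w0 by (simp add: T_def)
    then have "6 * C \<le> T * (C' - C)" using CC by (simp add: field_simps)
    then show ?thesis by (simp add: algebra_simps)
  qed
  have TK: "1 \<le> K * exp (w * T)"
  proof -
    have "\<bar>ln K\<bar> / w \<le> T" using C CC by (simp add: T_def)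
    then have "- ln K \<le> w * T" using w0 by (simp add: field_simps)
    then have "exp (- ln K) \<le> exp (w * T)" by simp
    then show ?thesis using K0 by (simp add: exp_minus field_simps)
  qed
  define T1 where "T1 = \<theta> * T"
  define T2 where "T2 = (1 - \<theta>) * T"
  have T12: "T1 \<ge> 0" "T2 \<ge> 0" "T1 + T2 = T" using \<theta> T1 by (auto simp: T1_def T2_def algebra_simps)
  define m2 where "m2 = e2 * exp (l2 * T2) * ka"
  define m1 where "m1 = e1 * exp (l1 * T1) * (kb * m2)"
  have m: "m1 > 0" "m2 > 0" using e ka kb by (auto simp: m1_def m2_def)
  \<comment> \<open>After each stage the amplitude is a fixed multiple of \<epsilon>; the five
    bounds make it admissible as input of the next stage.\<close>
  define \<epsilon>0 where "\<epsilon>0 = min da (min (s2 / (ka * exp (max l2 0 * T2))) (min (db / m2)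
    (min (s1 / (kb * m2 * exp (max l1 0 * T1))) (dc / m1))))"
  have \<epsilon>0: "\<epsilon>0 > 0" unfolding \<epsilon>0_def min_less_iff_conj using ka kb kc s1 s2 m by simp
  have "lower_on_ball v (y0 + (6 + T) *\<^sub>R s) (- R - 1) R (t0 + (6 + T)) \<epsilon>"
    if h: "0 < \<epsilon>" "\<epsilon> \<le> \<epsilon>0" "0 \<le> t0" "norm s \<le> C" "lower_on_ball v y0 (- R - 1) R t0 \<epsilon>" for \<epsilon> y0 t0 s
  proof -
    have le: "\<epsilon> \<le> da" "\<epsilon> \<le> s2 / (ka * exp (max l2 0 * T2))" "\<epsilon> \<le> db / m2" "\<epsilon> \<le> s1 / (kb * m2 * exp (max l1 0 * T1))" "\<epsilon> \<le> dc / m1"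
      using h(2) unfolding \<epsilon>0_def min.bounded_iff by blast+
    have C'0: "C' > 0" using C by (simp add: C'_def)
    \<comment> \<open>The displacement for \<open>6 + T\<close> time units has to be covered during
      the two runs alone, so the velocity \<open>s\<close> is rescaled; \<open>TC\<close> is what
      keeps the norm of \<open>n\<close> at most 1.\<close>
    define n where "n = ((6 + T) / (T * C')) *\<^sub>R s"
    have nn: "norm n \<le> 1"
    proof -
      have "(6 + T) * norm s \<le> (6 + T) * C" using h T1 by (intro mult_left_mono) auto
      then have "(6 + T) * norm s \<le> T * C'" using TC by simp
      then show ?thesis using T1 C'0 by (simp add: n_def field_simps)
    qed
    have lb1: "lower_on_ball u y0 (- R - 1) R (t0 + 2) (ka * \<epsilon>)"
      by (rule Ka[OF h(1) le(1) h(3)]) (rule lower_on_ball_mono[OF h(5)], use R2 in auto)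
    have lb2: "lower_on_ball u (y0 + T2 *\<^sub>R (V2 *\<^sub>R n)) (- R - 1) 2 (t0 + 2 + T2) (e2 * exp (l2 * T2) * (ka * \<epsilon>))"
      unfolding e2_def
    proof (rule run2[OF _ T12(2) _ _ _ lb1])
      show "norm (V2 *\<^sub>R n) \<le> V2" using V nn by (simp add: mult_left_le)
      show "ka * \<epsilon> * exp (max l2 0 * T2) \<le> s2" using le(2) ka by (simp add: pos_le_divide_eq mult_ac)
    qed (use h ka in auto)
    have lb3: "lower_on_ball v (y0 + T2 *\<^sub>R (V2 *\<^sub>R n)) (- R - 1) R (t0 + 2 + T2 + 2) (kb * (e2 * exp (l2 * T2) * (ka * \<epsilon>)))"
    proof (rule Kb[OF _ _ _ lb2])
      show "e2 * exp (l2 * T2) * (ka * \<epsilon>) \<le> db" using le(3) m by (simp add: pos_le_divide_eq m2_def mult_ac)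
    qed (use h ka e T12 in auto)
    have lb4: "lower_on_ball v (y0 + T2 *\<^sub>R (V2 *\<^sub>R n) + T1 *\<^sub>R (V1 *\<^sub>R n)) (- R - 1) 2 (t0 + 2 + T2 + 2 + T1)
        (e1 * exp (l1 * T1) * (kb * (e2 * exp (l2 * T2) * (ka * \<epsilon>))))"
      unfolding e1_def
    proof (rule run1[OF _ T12(1) _ _ _ lb3])
      show "norm (V1 *\<^sub>R n) \<le> V1" using V nn by (simp add: mult_left_le)
      show "kb * (e2 * exp (l2 * T2) * (ka * \<epsilon>)) * exp (max l1 0 * T1) \<le> s1"
      proof -
        have "0 < kb * m2 * exp (max l1 0 * T1)" using kb m by simp
        then have "\<epsilon> * (kb * m2 * exp (max l1 0 * T1)) \<le> s1" using le(4) by (simp only: pos_le_divide_eq)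
        then show ?thesis by (simp add: m2_def mult_ac)
      qed
    qed (use h ka kb e T12 in auto)
    have lb5: "lower_on_ball v (y0 + T2 *\<^sub>R (V2 *\<^sub>R n) + T1 *\<^sub>R (V1 *\<^sub>R n)) (- R - 1) R (t0 + 2 + T2 + 2 + T1 + 2)
        (kc * (e1 * exp (l1 * T1) * (kb * (e2 * exp (l2 * T2) * (ka * \<epsilon>)))))"
    proof (rule Kc[OF _ _ _ lb4])
      show "e1 * exp (l1 * T1) * (kb * (e2 * exp (l2 * T2) * (ka * \<epsilon>))) \<le> dc"
        using le(5) m by (simp add: pos_le_divide_eq m1_def m2_def mult_ac)
    qed (use h ka kb e T12 in auto)
    have "T2 * V2 + T1 * V1 = T * C'" by (simp add: T1_def T2_def C'_def algebra_simps)
    moreover have "T2 *\<^sub>R (V2 *\<^sub>R n) + T1 *\<^sub>R (V1 *\<^sub>R n) = (T2 * V2 + T1 * V1) *\<^sub>R n" by (simp add: scaleR_add_left)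
    ultimately have "T2 *\<^sub>R (V2 *\<^sub>R n) + T1 *\<^sub>R (V1 *\<^sub>R n) = (T * C') *\<^sub>R n" by simp
    also have "\<dots> = (6 + T) *\<^sub>R s" using T1 C'0 by (simp add: n_def)
    finally have pe: "y0 + T2 *\<^sub>R (V2 *\<^sub>R n) + T1 *\<^sub>R (V1 *\<^sub>R n) = y0 + (6 + T) *\<^sub>R s" by (simp add: add.assoc)
    have te: "t0 + 2 + T2 + 2 + T1 + 2 = t0 + (6 + T)" using T12(3) by simp
    have "exp (l1 * T1) * exp (l2 * T2) = exp (w * T)"
      by (simp add: exp_add[symmetric] T1_def T2_def w_def algebra_simps)
    then have "kc * (e1 * exp (l1 * T1) * (kb * (e2 * exp (l2 * T2) * (ka * \<epsilon>)))) = K * exp (w * T) * \<epsilon>"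
      by (simp add: K_def mult_ac)
    then have "\<epsilon> \<le> kc * (e1 * exp (l1 * T1) * (kb * (e2 * exp (l2 * T2) * (ka * \<epsilon>))))"
      using TK h by simp
    then show ?thesis using lower_on_ball_mono[OF lb5, of R \<epsilon>] R2 unfolding pe te by simp
  qed
  then show ?thesis using \<epsilon>0 R2 T1 by (intro exI[of _ "6 + T"] conjI exI[of _ R] exI[of _ \<epsilon>0]) auto
qed

end

section \<open>Positivity behind the front\<close>

text \<open>The only properties of the region behind the front that the squeezing uses: it is
  nontrivial, time tends to infinity in it, and what holds eventually also holds eventually on whole
  neighbourhoods of any fixed size. The last one permits time shifts and comparison on a space-time
  cylinder around each point.\<close>

definition thick :: "((real^'m::finite) \<times> real) filter \<Rightarrow> bool" where
  "thick F \<longleftrightarrow> F \<noteq> bot \<and> (\<forall>T. eventually (\<lambda>(y, t). T \<le> t) F)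
     \<and> (\<forall>P r. eventually P F \<longrightarrow> eventually (\<lambda>(y, t). \<forall>y' t'. norm (y' - y) \<le> r \<longrightarrow> \<bar>t' - t\<bar> \<le> r \<longrightarrow> P (y', t')) F)"

lemma thick_late: "thick F \<Longrightarrow> eventually (\<lambda>(y, t). T \<le> t) F"
  by (simp add: thick_def)

lemma thick_near:
  "thick F \<Longrightarrow> eventually P F \<Longrightarrow> eventually (\<lambda>(y, t). \<forall>y' t'. norm (y' - y) \<le> r \<longrightarrow> \<bar>t' - t\<bar> \<le> r \<longrightarrow> P (y', t')) F"
  unfolding thick_def by blast

lemma thick_shift:
  assumes "thick F" "eventually P F"
  shows "eventually (\<lambda>(y, t). P (y, t - a)) F"
  using thick_near[OF assms, of "\<bar>a\<bar>"] by (rule eventually_mono) auto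

text \<open>The slope \<open>c'\<close> exceeds \<open>c\<close> by an unspecified amount. This
  margin absorbs bounded displacements, which makes the filter thick.\<close>

definition cone :: "real \<Rightarrow> ((real^'m::finite) \<times> real) filter" where
  "cone c = Abs_filter (\<lambda>P. \<exists>c'>c. \<exists>T. \<forall>t\<ge>T. \<forall>y. norm y \<le> c' * t \<longrightarrow> P (y, t))"

lemma eventually_cone:
  "eventually P (cone c) \<longleftrightarrow> (\<exists>c'>c. \<exists>T. \<forall>t\<ge>T. \<forall>y. norm y \<le> c' * t \<longrightarrow> P (y, t))"
  unfolding cone_def
proof (rule eventually_Abs_filter, rule is_filter.intro)
  show "\<exists>c'>c. \<exists>T. \<forall>t\<ge>T. \<forall>y::real^'a. norm y \<le> c' * t \<longrightarrow> True" by (intro exI[of _ "c + 1"]) auto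
next
  fix P Q :: "(real^'a) \<times> real \<Rightarrow> bool"
  assume "\<exists>c'>c. \<exists>T. \<forall>t\<ge>T. \<forall>y. norm y \<le> c' * t \<longrightarrow> P (y, t)" "\<exists>c'>c. \<exists>T. \<forall>t\<ge>T. \<forall>y. norm y \<le> c' * t \<longrightarrow> Q (y, t)"
  then obtain c1 T1 c2 T2 where 1: "c1 > c" "\<And>t y. t \<ge> T1 \<Longrightarrow> norm y \<le> c1 * t \<Longrightarrow> P (y, t)"
    and 2: "c2 > c" "\<And>t y. t \<ge> T2 \<Longrightarrow> norm y \<le> c2 * t \<Longrightarrow> Q (y, t)" by blast
  have "P (y, t) \<and> Q (y, t)" if t: "max 0 (max T1 T2) \<le> t" and y: "norm y \<le> min c1 c2 * t" for t y
  proof -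
    have "min c1 c2 * t \<le> c1 * t" "min c1 c2 * t \<le> c2 * t" using t by (auto intro!: mult_right_mono)
    then show ?thesis using 1 2 t y by auto
  qed
  moreover have "c < min c1 c2" using 1 2 by simp
  ultimately show "\<exists>c'>c. \<exists>T. \<forall>t\<ge>T. \<forall>y. norm y \<le> c' * t \<longrightarrow> P (y, t) \<and> Q (y, t)" by blast
next
  fix P Q :: "(real^'a) \<times> real \<Rightarrow> bool"
  assume "\<forall>x. P x \<longrightarrow> Q x" "\<exists>c'>c. \<exists>T. \<forall>t\<ge>T. \<forall>y. norm y \<le> c' * t \<longrightarrow> P (y, t)"
  then show "\<exists>c'>c. \<exists>T. \<forall>t\<ge>T. \<forall>y. norm y \<le> c' * t \<longrightarrow> Q (y, t)" by blast
qed

lemma thick_cone: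
  assumes c: "c \<ge> 0"
  shows "thick (cone c :: ((real^'a::finite) \<times> real) filter)"
  unfolding thick_def
proof (intro conjI allI impI)
  show "cone c \<noteq> (bot :: ((real^'a) \<times> real) filter)"
  proof
    assume "cone c = (bot :: ((real^'a) \<times> real) filter)"
    then have "eventually (\<lambda>_. False) (cone c :: ((real^'a) \<times> real) filter)" by simp
    then obtain c' T where c': "c' > c" "\<And>t y. t \<ge> T \<Longrightarrow> norm (y::real^'a) \<le> c' * t \<Longrightarrow> False"
      unfolding eventually_cone by blast
    then show False using c'(2)[of "max T 0" 0] c by auto
  qed
  show "eventually (\<lambda>(y, t). T \<le> t) (cone c :: ((real^'a) \<times> real) filter)" for T
    unfolding eventually_cone by (intro exI[of _ "c + 1"]) auto
  fix P :: "(real^'a) \<times> real \<Rightarrow> bool" and r :: real assume "eventually P (cone c)"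
  then obtain c' T where c': "c' > c" "\<And>t y. t \<ge> T \<Longrightarrow> norm y \<le> c' * t \<Longrightarrow> P (y, t)"
    unfolding eventually_cone by blast
  \<comment> \<open>Half of the margin is kept; the other half, \<open>(c' - c'') * t\<close>,
    eventually exceeds the displacement \<open>r + c' * r\<close>.\<close>
  define c'' where "c'' = (c + c') / 2"
  have c'': "c < c''" "c'' < c'" using c' by (auto simp: c''_def)
  have "P (y', t')" if t: "max (T + r) ((r + c' * r) / (c' - c'')) \<le> t" and y: "norm y \<le> c'' * t"
    and y': "norm (y' - y) \<le> r" and t': "\<bar>t' - t\<bar> \<le> r" for t y y' t'
  proof -
    have "r + c' * r \<le> (c' - c'') * t" using t c'' by (simp add: field_simps)
    moreover have "norm y' \<le> norm y + r" using y' norm_triangle_ineq[of "y' - y" y] by simp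
    moreover have "c' * (t - r) \<le> c' * t'" using t' c c' by (intro mult_left_mono) auto
    ultimately have "norm y' \<le> c' * t'" using y by (simp add: algebra_simps)
    moreover have "T \<le> t'" using t t' by auto
    ultimately show ?thesis using c'(2) by blast
  qed
  then show "eventually (\<lambda>(y, t). \<forall>y' t'. norm (y' - y) \<le> r \<longrightarrow> \<bar>t' - t\<bar> \<le> r \<longrightarrow> P (y', t')) (cone c)"
    unfolding eventually_cone split_conv using c''(1) by blast
qed

context half_pos
begin

lemma continuous_at_time:
  assumes "t \<ge> 0" "z0 \<le> 0" "u y0 z0 t > a"
  shows "\<exists>r>0. \<forall>y z. z \<le> 0 \<longrightarrow> norm (y - y0) \<le> r \<longrightarrow> \<bar>z - z0\<bar> \<le> r \<longrightarrow> u y z t > a"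
proof -
  let ?S = "{p::(real^'m) \<times> real \<times> real. fst (snd p) \<le> 0 \<and> snd (snd p) \<ge> 0}"
  have "continuous_on ?S (\<lambda>(y, z, t). u y z t)" using hu by (simp add: half_def)
  then have "\<exists>d>0. \<forall>x\<in>?S. dist x (y0, z0, t) < d \<longrightarrow> dist ((\<lambda>(y, z, t). u y z t) x) (u y0 z0 t) < u y0 z0 t - a"
    using assms unfolding continuous_on_iff by (fastforce dest: bspec[where x = "(y0, z0, t)"])
  then obtain d where d: "d > 0" "\<And>y z. z \<le> 0 \<Longrightarrow> dist (y, z, t) (y0, z0, t) < d \<Longrightarrow> dist (u y z t) (u y0 z0 t) < u y0 z0 t - a"
    using assms by fastforce
  show ?thesis
  proof (intro exI[of _ "d / 3"] conjI allI impI)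
    fix y z assume h: "z \<le> 0" "norm (y - y0) \<le> d / 3" "\<bar>z - z0\<bar> \<le> d / 3"
    have "dist (y, z, t) (y0, z0, t) \<le> dist y y0 + dist z z0"
      unfolding dist_Pair_Pair by (simp add: sqrt_sum_squares_le_sum)
    also have "\<dots> < d" using h d by (simp add: dist_norm)
    finally have "\<bar>u y z t - u y0 z0 t\<bar> < u y0 z0 t - a" using d(2)[OF h(1)] by (simp add: dist_real_def)
    then show "u y z t > a" by linarith
  qed (use d in auto)
qed

text \<open>The strong maximum principle, obtained from moving bumps: \<open>spread\<close> reaches
  any interior point in any positive time, however short, from any ball on which the solution is
  positive.\<close>

lemma positive_later:
  assumes "t0 \<ge> 0" "z0 \<le> 0" "u y0 z0 t0 > 0" and z: "z < 0" and t: "t > t0"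
  shows "u y z t > 0"
proof -
  obtain r where r: "r > 0" "\<And>y z. z \<le> 0 \<Longrightarrow> norm (y - y0) \<le> r \<Longrightarrow> \<bar>z - z0\<bar> \<le> r \<Longrightarrow> u y z t0 > u y0 z0 t0 / 2"
    using continuous_at_time[OF assms(1,2), of "u y0 z0 t0 / 2" y0] assms(3) by auto
  define z1 where "z1 = z0 - r / 2"
  define r1 where "r1 = min (r / 2) (- z)"
  define \<delta> where "\<delta> = u y0 z0 t0 / 2"
  have r1: "r1 > 0" "r1 \<le> r / 2" "z \<le> - r1" "z1 \<le> - r1" using r z assms by (auto simp: r1_def z1_def)
  have lob: "lower_on_ball u y0 z1 r1 t0 \<delta>"
    unfolding lower_on_ball_def
  proof (intro allI impI)
    fix y z assume "z \<le> 0" "(norm (y - y0))\<^sup>2 + (z - z1)\<^sup>2 \<le> r1\<^sup>2"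
    moreover from this have "norm (y - y0) \<le> r1" "\<bar>z - z1\<bar> \<le> r1" using in_ballD[of y y0 z z1 r1] r1(1) by auto
    moreover from this have "norm (y - y0) \<le> r" "\<bar>z - z0\<bar> \<le> r" using r1 r(1) unfolding z1_def by linarith+
    ultimately show "\<delta> \<le> u y z t0" using r(2)[of z y] by (simp add: \<delta>_def)
  qed
  define \<Lambda> where "\<Lambda> = norm (y - y0) + \<bar>z - z1\<bar>"
  have "(norm (y - y0))\<^sup>2 + (z - z1)\<^sup>2 \<le> \<Lambda>\<^sup>2" by (simp add: \<Lambda>_def power2_sum)
  moreover obtain \<kappa> \<delta>0 where k: "\<kappa> > 0" "\<delta>0 > 0" and K: "\<And>y0 z0 y1 z1 tt \<delta>. 0 < \<delta> \<Longrightarrow> \<delta> \<le> \<delta>0 \<Longrightarrow> 0 \<le> tt \<Longrightarrow> z0 \<le> - r1 \<Longrightarrow> z1 \<le> - r1 \<Longrightarrow>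
    (norm (y1 - y0))\<^sup>2 + (z1 - z0)\<^sup>2 \<le> \<Lambda>\<^sup>2 \<Longrightarrow> lower_on_ball u y0 z0 r1 tt \<delta> \<Longrightarrow> \<kappa> * \<delta> \<le> u y1 z1 (tt + (t - t0))"
    using spread[of r1 \<Lambda> "t - t0"] r1 t by (auto simp: \<Lambda>_def)
  ultimately have "\<kappa> * min \<delta> \<delta>0 \<le> u y z (t0 + (t - t0))"
    using assms r1 lower_on_ball_mono[OF lob, of r1 "min \<delta> \<delta>0"] by (intro K[of _ t0 z1 z y y0]) (auto simp: \<delta>_def)
  moreover have "0 < \<kappa> * min \<delta> \<delta>0" using k assms by (simp add: \<delta>_def)
  ultimately show ?thesis by simp
qed

lemma positive_on_compact:
  assumes pos: "\<And>y z t. z \<le> - 1 \<Longrightarrow> a \<le> t \<Longrightarrow> 0 < u y z t" and a: "0 \<le> a" "a \<le> b" and R: "0 \<le> R"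
  shows "\<exists>\<epsilon>>0. \<forall>t. a \<le> t \<longrightarrow> t \<le> b \<longrightarrow> lower_on_ball u y0 (- R - 1) R t \<epsilon>"
proof -
  define K where "K = cball y0 R \<times> {- 2 * R - 1..- 1} \<times> {a..b}"
  have "compact K" unfolding K_def by (intro compact_Times) auto
  moreover have "(y0, - 1, a) \<in> K" using a R by (auto simp: K_def)
  moreover have "continuous_on K (\<lambda>(y, z, t). u y z t)"
    by (rule continuous_on_subset[of "{p. fst (snd p) \<le> 0 \<and> snd (snd p) \<ge> 0}"]) (use hu a in \<open>auto simp: half_def K_def\<close>)
  ultimately obtain p where p: "p \<in> K" "\<And>p'. p' \<in> K \<Longrightarrow> (\<lambda>(y, z, t). u y z t) p \<le> (\<lambda>(y, z, t). u y z t) p'"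
    using continuous_attains_inf[of K "\<lambda>(y, z, t). u y z t"] by blast
  obtain y1 z1 t1 where pe: "p = (y1, z1, t1)" by (cases p) auto
  have "0 < u y1 z1 t1" using p(1) pos[of z1 t1 y1] by (auto simp: pe K_def)
  moreover have "lower_on_ball u y0 (- R - 1) R t (u y1 z1 t1)" if t: "a \<le> t" "t \<le> b" for t
    unfolding lower_on_ball_def
  proof (intro allI impI)
    fix y z assume "z \<le> 0" and yz: "(norm (y - y0))\<^sup>2 + (z - (- R - 1))\<^sup>2 \<le> R\<^sup>2"
    have "(y, z, t) \<in> K" using in_ballD[OF yz R] t unfolding K_def by (auto simp: dist_norm norm_minus_commute)
    then show "u y1 z1 t1 \<le> u y z t" using p(2)[of "(y, z, t)"] pe by simp
  qed
  ultimately show ?thesis by blast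
qed

text \<open>The point is that \<epsilon>0 is independent of the depth \<open>Z\<close>. Near the
  interface and at moderate depth the bound is transported in bounded time. To greater depth a bump
  of growth rate 0 sinks at constant speed; it loses a fixed factor, not one that grows with the
  distance, and \<open>thick_near\<close> supplies its earlier starting time.\<close>

lemma uniformly_positive:
  assumes F: "thick F" and gp: "gp > 0" and R: "R \<ge> 2" and \<epsilon>: "\<epsilon> > 0"
    and ev: "eventually (\<lambda>(y, t). lower_on_ball u y (- R - 1) 2 t \<epsilon>) F"
  shows "\<exists>\<epsilon>0>0. \<forall>Z. eventually (\<lambda>(y, t). \<forall>z. - Z \<le> z \<longrightarrow> z \<le> 0 \<longrightarrow> \<epsilon>0 \<le> u y z t) F"
proof -
  \<comment> \<open>With this speed \<open>V\<^sup>2 / (4 * D) = gp / 2\<close>, strictly below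
    \<open>gp\<close>, so the rate \<open>l = 0\<close> is allowed.\<close>
  define V where "V = sqrt (2 * D * gp)"
  have V: "V > 0" "V\<^sup>2 = 2 * D * gp" using D gp by (auto simp: V_def)
  have "0 + V\<^sup>2 / (4 * D) < gp" using D gp unfolding V by simp
  then obtain R0 where R0: "\<And>R. R \<ge> R0 \<Longrightarrow> \<exists>s0>0. \<forall>\<delta> T y0 z0 t0 s \<sigma>. 0 < \<delta> \<longrightarrow> 0 \<le> T \<longrightarrow> 0 \<le> t0 \<longrightarrow> (norm s)\<^sup>2 + \<sigma>\<^sup>2 \<le> V\<^sup>2 \<longrightarrow>
     z0 \<le> - R \<longrightarrow> z0 + T * \<sigma> \<le> - R \<longrightarrow> \<delta> * exp (max 0 0 * T) \<le> s0 \<longrightarrow> lower_on_ball u y0 z0 R t0 \<delta> \<longrightarrow>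
     lower_on_ball u (y0 + T *\<^sub>R s) (z0 + T * \<sigma>) 2 (t0 + T) (exp (- (V * R / D)) / 8 * exp (0 * T) * \<delta>)"
    using run_ball[of 0 V] V by auto
  define R1 where "R1 = max R0 (max R 2)"
  have R1: "R1 \<ge> R0" "R1 \<ge> R" "R1 \<ge> 2" by (simp_all add: R1_def)
  obtain s0 where s0: "s0 > 0" and run: "\<And>\<delta> T y0 z0 t0 s \<sigma>. 0 < \<delta> \<Longrightarrow> 0 \<le> T \<Longrightarrow> 0 \<le> t0 \<Longrightarrow> (norm s)\<^sup>2 + \<sigma>\<^sup>2 \<le> V\<^sup>2 \<Longrightarrow>
     z0 \<le> - R1 \<Longrightarrow> z0 + T * \<sigma> \<le> - R1 \<Longrightarrow> \<delta> * exp (max 0 0 * T) \<le> s0 \<Longrightarrow> lower_on_ball u y0 z0 R1 t0 \<delta> \<Longrightarrow>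
     lower_on_ball u (y0 + T *\<^sub>R s) (z0 + T * \<sigma>) 2 (t0 + T) (exp (- (V * R1 / D)) / 8 * exp (0 * T) * \<delta>)"
    using R0[OF R1(1)] by blast
  obtain \<kappa>1 \<delta>1 where k1: "\<kappa>1 > 0" "\<delta>1 > 0" and K1: "\<And>y0 z0 y1 z1 t0 T \<delta>. 0 < \<delta> \<Longrightarrow> \<delta> \<le> \<delta>1 \<Longrightarrow> 0 \<le> t0 \<Longrightarrow> - (R + 2) \<le> z0 \<Longrightarrow> z0 \<le> - 2 \<Longrightarrow>
    norm (y1 - y0) \<le> R + 2 \<Longrightarrow> 1 \<le> T \<Longrightarrow> T \<le> 2 \<Longrightarrow> lower_on_ball u y0 z0 2 t0 \<delta> \<Longrightarrow> - 1 \<le> z1 \<Longrightarrow> z1 \<le> 0 \<Longrightarrow> \<kappa>1 * \<delta> \<le> u y1 z1 (t0 + T)"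
    using reach_interface[of "R + 2"] R by (auto simp del: minus_add_distrib)
  obtain \<kappa>2 \<delta>2 where k2: "\<kappa>2 > 0" "\<delta>2 > 0" and K2: "\<And>y0 z0 y1 z1 t0 \<delta>. 0 < \<delta> \<Longrightarrow> \<delta> \<le> \<delta>2 \<Longrightarrow> 0 \<le> t0 \<Longrightarrow> z0 \<le> - 1 \<Longrightarrow> z1 \<le> - 1 \<Longrightarrow>
    (norm (y1 - y0))\<^sup>2 + (z1 - z0)\<^sup>2 \<le> (4 * R1)\<^sup>2 \<Longrightarrow> lower_on_ball u y0 z0 1 t0 \<delta> \<Longrightarrow> \<kappa>2 * \<delta> \<le> u y1 z1 (t0 + 1)"
    using spread[of 1 "4 * R1" 1] R1 by auto
  define a1 where "a1 = \<kappa>1 * min \<epsilon> \<delta>1"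
  define a2 where "a2 = min (\<kappa>2 * min \<epsilon> \<delta>2) s0"
  define a3 where "a3 = exp (- (V * R1 / D)) / 8 * a2"
  have a: "a1 > 0" "a2 > 0" "a3 > 0" using k1 k2 s0 \<epsilon> by (auto simp: a1_def a2_def a3_def)
  have ev0: "eventually (\<lambda>(y, t). 1 \<le> t) F" by (rule thick_late[OF F])
  note ev1 = thick_shift[OF F ev, of 1]
  have near: "eventually (\<lambda>(y, t). \<forall>z. - 1 \<le> z \<longrightarrow> z \<le> 0 \<longrightarrow> a1 \<le> u y z t) F"
    using ev1 ev0
  proof eventually_elim
    case (elim p)
    obtain y t where p: "p = (y, t)" by (cases p)
    have l: "lower_on_ball u y (- R - 1) 2 (t - 1) (min \<epsilon> \<delta>1)" using elim p lower_on_ball_mono[of u y "- R - 1" 2 "t - 1" \<epsilon>] by auto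
    have "\<kappa>1 * min \<epsilon> \<delta>1 \<le> u y z (t - 1 + 1)" if "- 1 \<le> z" "z \<le> 0" for z
      by (rule K1[OF _ _ _ _ _ _ _ _ l]) (use \<epsilon> k1 elim p R that in auto)
    then show ?case using p by (simp add: a1_def)
  qed
  have mid: "eventually (\<lambda>(y, t). 0 \<le> t \<and> lower_on_ball u y (- R1 - 1) R1 t a2) F"
    using ev1 ev0
  proof eventually_elim
    case (elim p)
    obtain y t where p: "p = (y, t)" by (cases p)
    have l: "lower_on_ball u y (- R - 1) 1 (t - 1) (min \<epsilon> \<delta>2)" using elim p lower_on_ball_mono[of u y "- R - 1" 2 "t - 1" \<epsilon> 1] by auto
    have "a2 \<le> u y' z t" if z: "z \<le> 0" and yz: "(norm (y' - y))\<^sup>2 + (z - (- R1 - 1))\<^sup>2 \<le> R1\<^sup>2" for y' z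
    proof -
      have b: "norm (y' - y) \<le> R1" "\<bar>z - (- R1 - 1)\<bar> \<le> R1" using in_ballD[OF yz] R1 by auto
      have "(norm (y' - y))\<^sup>2 \<le> R1\<^sup>2" using b by (intro power_mono) auto
      have "\<bar>z - (- R - 1)\<bar> \<le> 2 * R1" using b R1 R by linarith
      then have "(z - (- R - 1))\<^sup>2 \<le> (2 * R1)\<^sup>2" using R1 by (intro power2_le_iff_abs_le[THEN iffD2]) auto
      have "(norm (y' - y))\<^sup>2 + (z - (- R - 1))\<^sup>2 \<le> (4 * R1)\<^sup>2"
      proof -
        have "(2 * R1)\<^sup>2 = 4 * R1\<^sup>2" "(4 * R1)\<^sup>2 = 16 * R1\<^sup>2" by (simp_all add: power_mult_distrib)
        then show ?thesis using zero_le_power2[of R1] \<open>(norm (y' - y))\<^sup>2 \<le> R1\<^sup>2\<close> \<open>(z - (- R - 1))\<^sup>2 \<le> (2 * R1)\<^sup>2\<close> by linarith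
      qed
      then have "\<kappa>2 * min \<epsilon> \<delta>2 \<le> u y' z (t - 1 + 1)"
        by (intro K2[OF _ _ _ _ _ _ l]) (use \<epsilon> k2 elim p R b in auto)
      then show ?thesis by (simp add: a2_def)
    qed
    then show ?case using p elim by (auto simp: lower_on_ball_def)
  qed
  have far: "eventually (\<lambda>(y, t). \<forall>z. - Z \<le> z \<longrightarrow> z \<le> - R1 - 1 \<longrightarrow> a3 \<le> u y z t) F" for Z
    using thick_near[OF F mid, of "\<bar>Z\<bar> / V"]
  proof eventually_elim
    case (elim p)
    obtain y t where p: "p = (y, t)" by (cases p)
    have "a3 \<le> u y z t" if z: "- Z \<le> z" "z \<le> - R1 - 1" for z
    proof -
      define T where "T = (- R1 - 1 - z) / V"
      have T: "0 \<le> T" "T \<le> \<bar>Z\<bar> / V" "T * V = - R1 - 1 - z"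
        using V z R1 by (auto simp: T_def intro!: divide_right_mono)
      have "norm (y - y) \<le> \<bar>Z\<bar> / V" "\<bar>t - T - t\<bar> \<le> \<bar>Z\<bar> / V" using T V by auto
      then have l: "0 \<le> t - T" "lower_on_ball u y (- R1 - 1) R1 (t - T) a2"
        using elim unfolding p split_conv by blast+
      have "lower_on_ball u (y + T *\<^sub>R 0) ((- R1 - 1) + T * (- V)) 2 (t - T + T) (exp (- (V * R1 / D)) / 8 * exp (0 * T) * a2)"
        by (rule run[OF a(2) T(1) l(1) _ _ _ _ l(2)]) (use T z in \<open>auto simp: a2_def\<close>)
      moreover have "(- R1 - 1) + T * (- V) = z" using T by simp
      ultimately show ?thesis using z R1 by (auto simp: lower_on_ball_def a3_def)
    qed
    then show ?case using p by simp
  qed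
  have "eventually (\<lambda>(y, t). \<forall>z. - Z \<le> z \<longrightarrow> z \<le> 0 \<longrightarrow> min a1 (min a2 a3) \<le> u y z t) F" for Z
    using near mid far[of Z]
  proof eventually_elim
    case (elim p)
    obtain y t where p: "p = (y, t)" by (cases p)
    have "min a1 (min a2 a3) \<le> u y z t" if z: "- Z \<le> z" "z \<le> 0" for z
    proof -
      consider "- 1 \<le> z" | "z \<le> - R1 - 1" | "z \<le> - 1" "- R1 - 1 \<le> z" by linarith
      then show ?thesis
      proof cases
        case 1 then show ?thesis using elim(1) p z by (auto simp: min_le_iff_disj)
      next
        case 2 then show ?thesis using elim(3) p z by (auto simp: min_le_iff_disj)
      next
        case 3
        then have "(z + R1 + 1)\<^sup>2 \<le> R1\<^sup>2" by (intro power_mono) auto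
        then have "(norm (y - y))\<^sup>2 + (z - (- R1 - 1))\<^sup>2 \<le> R1\<^sup>2" by (simp add: algebra_simps)
        then show ?thesis using elim(2) p z unfolding lower_on_ball_def by (auto simp: min_le_iff_disj)
      qed
    qed
    then show ?case using p by simp
  qed
  then show ?thesis using a by (intro exI[of _ "min a1 (min a2 a3)"]) auto
qed

end

context pair_pos
begin

text \<open>If only the lower density is positive initially, it is positive at depth 1 or more from
  time 1 on, and a crossing takes 2 more units of time; hence the bound
  \<open>3 \<le> t\<close>.\<close>

lemma upper_positive_later:
  assumes init: "(\<exists>y z. z \<le> 0 \<and> 0 < u y z 0) \<or> (\<exists>y z. z \<le> 0 \<and> 0 < v y z 0)" and t: "3 \<le> t" and z: "z \<le> - 1"
  shows "0 < v y z t"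
proof (cases "\<exists>y z. z \<le> 0 \<and> 0 < v y z 0")
  case True
  then obtain y0 z0 where yz: "z0 \<le> 0" "0 < v y0 z0 0" by blast
  show ?thesis by (rule V.positive_later[of 0 z0 y0]) (use t z yz in auto)
next
  case False
  then obtain y0 z0 where yz: "z0 \<le> 0" "0 < u y0 z0 0" using init by blast
  have pos: "0 < u y z t" if "z \<le> - 1" "1 \<le> t" for y z t
    by (rule U.positive_later[of 0 z0 y0]) (use that yz in auto)
  obtain \<epsilon> where e: "\<epsilon> > 0" "lower_on_ball u y (- 2 - 1) 2 (t - 2) \<epsilon>"
    using U.positive_on_compact[of "t - 2" "t - 2" 2 y] pos t by auto
  define \<Lambda> where "\<Lambda> = max 3 (- z)"
  have \<Lambda>: "\<Lambda> \<ge> 2" "\<Lambda> \<ge> 3" "\<Lambda> \<ge> - z" by (simp_all add: \<Lambda>_def)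
  obtain \<kappa> \<delta>0 where k: "\<kappa> > 0" "\<delta>0 > 0" and K: "\<And>y0 z0 y1 z1 t0 \<delta>. 0 < \<delta> \<Longrightarrow> \<delta> \<le> \<delta>0 \<Longrightarrow> 0 \<le> t0 \<Longrightarrow> - \<Lambda> \<le> z0 \<Longrightarrow> z0 \<le> - 2 \<Longrightarrow>
    norm (y1 - y0) \<le> \<Lambda> \<Longrightarrow> - \<Lambda> \<le> z1 \<Longrightarrow> z1 \<le> - 1 \<Longrightarrow> lower_on_ball u y0 z0 2 t0 \<delta> \<Longrightarrow> \<kappa> * \<delta> \<le> v y1 z1 (t0 + 2)"
    using transfer[OF \<Lambda>(1)] by blast
  have "\<kappa> * min \<epsilon> \<delta>0 \<le> v y z (t - 2 + 2)"
    by (rule K[OF _ _ _ _ _ _ _ _ lower_on_ball_mono[OF e(2), of 2 "min \<epsilon> \<delta>0"]]) (use e k t z \<Lambda> in auto)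
  moreover have "0 < \<kappa> * min \<epsilon> \<delta>0" using e k by simp
  ultimately show ?thesis by simp
qed

text \<open>Since \<open>zigzag_step\<close> accepts every velocity of norm at most
  \<open>C\<close>, iterating it from the column over 0 reaches each point of the cone exactly: the
  velocity is chosen from the point, and the start time is adjusted within one period.\<close>

lemma persistence:
  assumes init: "(\<exists>y z. z \<le> 0 \<and> 0 < u y z 0) \<or> (\<exists>y z. z \<le> 0 \<and> 0 < v y z 0)"
    and pos: "fp > 0" "gp > 0" and c: "0 < c" "c < cstar_inf D d fp gp"
  shows "\<exists>R\<ge>2. \<exists>\<epsilon>>0. eventually (\<lambda>(y, t). lower_on_ball v y (- R - 1) R t \<epsilon>) (cone c)"
proof -
  obtain \<theta> V1 V2 l1 l2 where sp: "0 \<le> \<theta>" "\<theta> \<le> 1" "0 \<le> V1" "0 \<le> V2"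
    "l1 + V1\<^sup>2 / (4 * d) < fp" "l2 + V2\<^sup>2 / (4 * D) < gp" "0 < \<theta> * l1 + (1 - \<theta>) * l2"
    "c < \<theta> * V1 + (1 - \<theta>) * V2"
    using cstar_inf_speeds[OF U.D V.D pos(2,1) c] by blast
  define C where "C = (c + (\<theta> * V1 + (1 - \<theta>) * V2)) / 2"
  have C: "c < C" "C < \<theta> * V1 + (1 - \<theta>) * V2"
  proof -
    have "c < (c + x) / 2 \<and> (c + x) / 2 < x" if "c < x" for x using that by auto
    then show "c < C" "C < \<theta> * V1 + (1 - \<theta>) * V2" using sp(8) unfolding C_def by blast+
  qed
  then have "0 \<le> C" using c by simp
  then obtain \<tau> R \<epsilon>0 where \<tau>: "\<tau> > 0" "R \<ge> 2" "\<epsilon>0 > 0" and step: "\<And>\<epsilon> y0 t0 s. 0 < \<epsilon> \<Longrightarrow> \<epsilon> \<le> \<epsilon>0 \<Longrightarrow> 0 \<le> t0 \<Longrightarrow> norm s \<le> C \<Longrightarrow>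
     lower_on_ball v y0 (- R - 1) R t0 \<epsilon> \<Longrightarrow> lower_on_ball v (y0 + \<tau> *\<^sub>R s) (- R - 1) R (t0 + \<tau>) \<epsilon>"
    using zigzag_step[OF sp(1-7) _ C(2)] by blast
  obtain \<epsilon>1 where e1: "\<epsilon>1 > 0" "\<And>t. 3 \<le> t \<Longrightarrow> t \<le> 3 + \<tau> \<Longrightarrow> lower_on_ball v 0 (- R - 1) R t \<epsilon>1"
    using V.positive_on_compact[of 3 "3 + \<tau>" R 0] upper_positive_later[OF init] \<tau> by auto
  define \<epsilon> where "\<epsilon> = min \<epsilon>0 \<epsilon>1"
  have e: "\<epsilon> > 0" "\<epsilon> \<le> \<epsilon>0" "\<epsilon> \<le> \<epsilon>1" using e1 \<tau> by (auto simp: \<epsilon>_def)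
  have iter: "lower_on_ball v ((real n * \<tau>) *\<^sub>R s) (- R - 1) R (t + real n * \<tau>) \<epsilon>"
    if s: "norm s \<le> C" and t: "3 \<le> t" "t \<le> 3 + \<tau>" for n s t
  proof (induction n)
    case 0
    then show ?case using lower_on_ball_mono[OF e1(2)[OF t], of R \<epsilon>] e \<tau> by simp
  next
    case (Suc n)
    have "lower_on_ball v ((real n * \<tau>) *\<^sub>R s + \<tau> *\<^sub>R s) (- R - 1) R (t + real n * \<tau> + \<tau>) \<epsilon>"
      by (rule step[OF e(1,2) _ s Suc]) (use t \<tau> in auto)
    then show ?case by (simp add: algebra_simps)
  qed
  define c' where "c' = (c + C) / 2"
  have c': "c < c'" "c' < C" using C by (auto simp: c'_def)
  have "lower_on_ball v y (- R - 1) R t \<epsilon>"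
    if t: "t \<ge> max (3 + \<tau>) (C * (3 + \<tau>) / (C - c'))" and y: "norm y \<le> c' * t" for t y
  proof -
    \<comment> \<open>The number of complete steps. The remainder \<open>t - n * \<tau>\<close> lies
      between 3 and 3 + \<tau>, where \<open>e1\<close> provides the initial bound.\<close>
    define n where "n = nat \<lfloor>(t - 3) / \<tau>\<rfloor>"
    have q1: "1 \<le> (t - 3) / \<tau>" using t \<tau> by (simp add: field_simps)
    then have n1: "real n \<le> (t - 3) / \<tau>" "(t - 3) / \<tau> < real n + 1" "n \<ge> 1" unfolding n_def by linarith+
    then have n2: "real n * \<tau> \<le> t - 3" "t - 3 < real n * \<tau> + \<tau>" using \<tau> by (auto simp: field_simps)
    have n3: "real n * \<tau> > 0" using n1 \<tau> by simp
    define s where "s = (1 / (real n * \<tau>)) *\<^sub>R y"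
    have "C * (3 + \<tau>) \<le> (C - c') * t" using t c' by (simp add: field_simps)
    then have "c' * t \<le> C * (t - 3 - \<tau>)" by (simp add: algebra_simps)
    also have "\<dots> \<le> C * (real n * \<tau>)" using n2 \<open>0 \<le> C\<close> by (intro mult_left_mono) auto
    finally have "norm y \<le> C * (real n * \<tau>)" using y by simp
    then have "norm s \<le> C" using n3 unfolding s_def norm_scaleR by (simp add: field_simps)
    then have "lower_on_ball v ((real n * \<tau>) *\<^sub>R s) (- R - 1) R ((t - real n * \<tau>) + real n * \<tau>) \<epsilon>"
      by (rule iter) (use n2 in auto)
    moreover have "m * (1 / m) = 1" if "m > 0" for m :: real using that by simp
    from this[OF n3] have "(real n * \<tau>) *\<^sub>R s = y" unfolding s_def scaleR_scaleR by simp
    ultimately show ?thesis by simp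
  qed
  then have "eventually (\<lambda>(y, t). lower_on_ball v y (- R - 1) R t \<epsilon>) (cone c)"
    unfolding eventually_cone using c' by blast
  then show ?thesis using \<tau> e by blast
qed

lemma uniformly_positive_pair:
  assumes F: "thick F" and pos: "fp > 0" "gp > 0" and R: "R \<ge> 2" and \<epsilon>: "\<epsilon> > 0"
    and ev: "eventually (\<lambda>(y, t). lower_on_ball v y (- R - 1) R t \<epsilon>) F"
  shows "\<exists>\<epsilon>0>0. \<forall>Z. eventually (\<lambda>(y, t). \<forall>z. - Z \<le> z \<longrightarrow> z \<le> 0 \<longrightarrow> \<epsilon>0 \<le> u y z t \<and> \<epsilon>0 \<le> v y z t) F"
proof -
  interpret S: pair_pos d \<nu> fp f v D \<mu> gp g u by (rule swap)
  have ev2: "eventually (\<lambda>(y, t). lower_on_ball v y (- R - 1) 2 t \<epsilon>) F"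
    using ev by eventually_elim (use R lower_on_ball_mono in \<open>auto intro: lower_on_ball_mono\<close>)
  obtain \<kappa> \<delta>0 where k: "\<kappa> > 0" "\<delta>0 > 0" and K: "\<And>y0 t0 \<delta>. 0 < \<delta> \<Longrightarrow> \<delta> \<le> \<delta>0 \<Longrightarrow> 0 \<le> t0 \<Longrightarrow>
     lower_on_ball v y0 (- R - 1) 2 t0 \<delta> \<Longrightarrow> lower_on_ball u y0 (- R - 1) R (t0 + 2) (\<kappa> * \<delta>)"
    using S.transfer_ball[OF R] by blast
  have ev3: "eventually (\<lambda>(y, t). lower_on_ball u y (- R - 1) 2 t (\<kappa> * min \<epsilon> \<delta>0)) F"
    using thick_shift[OF F ev2, of 2] thick_late[OF F, of 2]
  proof eventually_elim
    case (elim p)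
    obtain y t where p: "p = (y, t)" by (cases p)
    have "lower_on_ball v y (- R - 1) 2 (t - 2) (min \<epsilon> \<delta>0)"
      using elim p by (auto intro: lower_on_ball_mono)
    then have "lower_on_ball u y (- R - 1) R (t - 2 + 2) (\<kappa> * min \<epsilon> \<delta>0)"
      by (intro K) (use elim p \<epsilon> k in auto)
    then show ?case using p R by (auto intro: lower_on_ball_mono)
  qed
  obtain a where a: "a > 0" "\<And>Z. eventually (\<lambda>(y, t). \<forall>z. - Z \<le> z \<longrightarrow> z \<le> 0 \<longrightarrow> a \<le> v y z t) F"
    using V.uniformly_positive[OF F pos(1) R \<epsilon> ev2] by blast
  have "\<kappa> * min \<epsilon> \<delta>0 > 0" using k \<epsilon> by simp
  then obtain b where b: "b > 0" "\<And>Z. eventually (\<lambda>(y, t). \<forall>z. - Z \<le> z \<longrightarrow> z \<le> 0 \<longrightarrow> b \<le> u y z t) F"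
    using U.uniformly_positive[OF F pos(2) R _ ev3] by blast
  have "eventually (\<lambda>(y, t). \<forall>z. - Z \<le> z \<longrightarrow> z \<le> 0 \<longrightarrow> min a b \<le> u y z t \<and> min a b \<le> v y z t) F" for Z
    using a(2)[of Z] b(2)[of Z] by eventually_elim (auto simp: min_le_iff_disj)
  then show ?thesis using a b by (intro exI[of _ "min a b"]) auto
qed

end

section \<open>Lifting stationary subsolutions\<close>

lemma loc_lipschitz_on:
  assumes "loc_lipschitz h"
  shows "\<exists>L\<ge>0. \<forall>x y. \<bar>x\<bar> \<le> R \<longrightarrow> \<bar>y\<bar> \<le> R \<longrightarrow> \<bar>h x - h y\<bar> \<le> L * \<bar>x - y\<bar>"
proof -
  obtain L where "\<And>x y. \<bar>x\<bar> \<le> R \<Longrightarrow> \<bar>y\<bar> \<le> R \<Longrightarrow> \<bar>h x - h y\<bar> \<le> L * \<bar>x - y\<bar>"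
    using assms unfolding loc_lipschitz_def by blast
  moreover have "L * \<bar>x - y\<bar> \<le> max L 0 * \<bar>x - y\<bar>" for x y by (intro mult_right_mono) auto
  ultimately show ?thesis by (intro exI[of _ "max L 0"]) (metis order_trans max.cobounded2)
qed

lemma loc_lipschitz_isCont:
  assumes "loc_lipschitz h"
  shows "isCont h x"
proof -
  obtain L where L: "L \<ge> 0" "\<And>a b. \<bar>a\<bar> \<le> \<bar>x\<bar> + 1 \<Longrightarrow> \<bar>b\<bar> \<le> \<bar>x\<bar> + 1 \<Longrightarrow> \<bar>h a - h b\<bar> \<le> L * \<bar>a - b\<bar>"
    using loc_lipschitz_on[OF assms, of "\<bar>x\<bar> + 1"] by blast
  have "\<forall>\<^sub>F a in at x. a \<in> ball x 1" using eventually_at_ball[of 1 x UNIV] by simp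
  then have ev: "\<forall>\<^sub>F a in at x. \<bar>h a - h x\<bar> \<le> L * \<bar>a - x\<bar>"
    by eventually_elim (intro L, auto simp: dist_real_def)
  have lim: "((\<lambda>a. L * \<bar>a - x\<bar>) \<longlongrightarrow> 0) (at x)"
    by (rule tendsto_eq_rhs) (auto intro!: tendsto_eq_intros)
  have "((\<lambda>a. h a - h x) \<longlongrightarrow> 0) (at x)"
    by (rule Lim_null_comparison[OF _ lim]) (use ev in simp)
  then show ?thesis by (simp add: isCont_def LIM_zero_iff)
qed

lemma has_d2_add_const: "has_d2 c x k \<Longrightarrow> has_d2 (\<lambda>s. c s + a) x k"
  using has_d2_diff[of c x k "\<lambda>s. - a" 0] has_d2_const[of "-a" x] by simp

text \<open>If the lift were impossible, lowering the subsolution by a paraboloid would create a first contact.\<close>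

lemma lift_subsolution:
  fixes u :: "real^'m::finite \<Rightarrow> real \<Rightarrow> real \<Rightarrow> real"
  assumes hu: "half D g u q" and D: "D > 0" and F: "thick F" and lip: "loc_lipschitz g"
    and z: "z1 < z2" "z2 \<le> 0" and \<phi>: "continuous_on {z1..z2} \<phi>"
    and below: "\<And>e. e > 0 \<Longrightarrow> eventually (\<lambda>(y, t). \<forall>z\<in>{z1..z2}. \<phi> z - e \<le> u y z t) F"
    and \<delta>: "\<delta> > 0"
    and strict: "eventually (\<lambda>(y, t). \<forall>z\<in>{z1..z2}. \<phi> z + \<delta> \<le> u y z t
        \<or> (z1 < z \<and> z < z2 \<and> (\<exists>k. has_d2 \<phi> z k \<and> \<delta> \<le> D * k + g (\<phi> z)))
        \<or> (z = 0 \<and> z2 = 0 \<and> (\<exists>b. (\<phi> has_real_derivative b) (at 0 within {..0}) \<and> D * b + \<delta> \<le> q y t))) F"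
  shows "\<exists>\<theta>>0. eventually (\<lambda>(y, t). \<forall>z\<in>{z1..z2}. \<phi> z + \<theta> \<le> u y z t) F"
proof -
  have "bounded (\<phi> ` {z1..z2})" by (intro compact_imp_bounded compact_continuous_image \<phi>) auto
  then obtain B where B: "\<And>z. z1 \<le> z \<Longrightarrow> z \<le> z2 \<Longrightarrow> \<bar>\<phi> z\<bar> \<le> B" unfolding bounded_iff by force
  obtain L where L: "L \<ge> 0" "\<And>a b. \<bar>a\<bar> \<le> B + 2 \<Longrightarrow> \<bar>b\<bar> \<le> B + 2 \<Longrightarrow> \<bar>g a - g b\<bar> \<le> L * \<bar>a - b\<bar>"
    using loc_lipschitz_on[OF lip] by blast
  \<comment> \<open>Three losses are collected: the time derivative 3\<theta> of the paraboloid, its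
    Laplacian in \<open>y\<close>, and the change of \<open>g\<close> over a distance of at most
    2\<theta>. Taking 4 instead of 3 leaves a margin.\<close>
  define c where "c = 4 + 6 * D * real CARD('m) + 2 * L"
  have c: "c \<ge> 4" using D L by (simp add: c_def)
  define \<theta> where "\<theta> = min 1 (\<delta> / (2 * c))"
  have \<theta>: "\<theta> > 0" "\<theta> \<le> 1" using \<delta> c by (auto simp: \<theta>_def)
  have \<theta>c: "\<theta> * c < \<delta>"
  proof -
    have "\<theta> \<le> \<delta> / (2 * c)" by (simp add: \<theta>_def)
    then have "\<theta> * c \<le> \<delta> / 2" using c by (simp add: field_simps)
    then show ?thesis using \<delta> by simp
  qed
  have \<theta>2: "2 * \<theta> < \<delta>"
  proof -
    have "2 * \<theta> \<le> \<theta> * c" using \<theta> c by (simp add: mult.commute)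
    then show ?thesis using \<theta>c by simp
  qed
  note ev1 = thick_near[OF F below[of "\<theta> / 2"], of 1] and ev2 = thick_near[OF F strict, of 1]
  have "eventually (\<lambda>(y, t). \<forall>z\<in>{z1..z2}. \<phi> z + \<theta> \<le> u y z t) F"
    using ev1[simplified half_gt_zero_iff, OF \<theta>(1)] ev2 thick_late[OF F, of 2]
  proof eventually_elim
    case (elim p)
    obtain y0 t0 where p: "p = (y0, t0)" by (cases p)
    have t2: "t0 \<ge> 2" using elim(3) p by simp
    have lo: "\<phi> z - \<theta> / 2 \<le> u y z t" if "norm (y - y0) \<le> 1" "\<bar>t - t0\<bar> \<le> 1" "z1 \<le> z" "z \<le> z2" for y z t
      using elim(1) that unfolding p split_conv by auto
    have st: "\<phi> z + \<delta> \<le> u y z t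
        \<or> (z1 < z \<and> z < z2 \<and> (\<exists>k. has_d2 \<phi> z k \<and> \<delta> \<le> D * k + g (\<phi> z)))
        \<or> (z = 0 \<and> z2 = 0 \<and> (\<exists>b. (\<phi> has_real_derivative b) (at 0 within {..0}) \<and> D * b + \<delta> \<le> q y t))"
      if "norm (y - y0) \<le> 1" "\<bar>t - t0\<bar> \<le> 1" "z1 \<le> z" "z \<le> z2" for y z t
      using elim(2) that unfolding p split_conv by auto
    \<comment> \<open>At the vertex \<open>(y0, t0)\<close> the test function is \<phi> + 2\<theta>.
      At distance 1 in \<open>y\<close>, or one unit of time earlier, it is at most \<phi> -
      \<theta>, below the bound \<phi> - \<theta>/2 already known there.\<close>
    define w where "w y z t = \<phi> z + (2 * \<theta> - 3 * \<theta> * ((norm (y - y0))\<^sup>2 + (t0 - t)))" for y and z t :: real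
    define K where "K = cball y0 1 \<times> {z1..z2} \<times> {t0 - 1..t0}"
    have KD: "(y, z, t) \<in> K \<longleftrightarrow> norm (y - y0) \<le> 1 \<and> z1 \<le> z \<and> z \<le> z2 \<and> t0 - 1 \<le> t \<and> t \<le> t0" for y z t
      by (auto simp: K_def dist_norm norm_minus_commute)
    have w2: "w y z t \<le> \<phi> z + 2 * \<theta>" if "(y, z, t) \<in> K" for y z t
      using that \<theta>(1) unfolding w_def KD by (simp add: add_nonneg_nonneg)
    have key: "w y0 z t0 < u y0 z t0" if zz: "z1 \<le> z" "z \<le> z2" for z
    proof (rule first_contact_single[OF hu D, of K])
      show "compact K" unfolding K_def by (intro compact_Times) auto
      show "K \<subseteq> {p. fst (snd p) \<le> 0 \<and> snd (snd p) \<ge> 0}" using z t2 by (auto simp: K_def)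
      have "continuous_on K (\<lambda>p. \<phi> (fst (snd p)))"
        by (rule continuous_on_compose2[OF \<phi>]) (auto simp: K_def intro!: continuous_intros)
      then show "continuous_on K (\<lambda>(y, z, t). w y z t)"
        unfolding w_def split_beta by (intro continuous_intros)
      show "(y0, z, t0) \<in> K" using zz KD by simp
    next
      fix y z t assume P: "(y, z, t) \<in> K" and le: "u y z t \<le> w y z t"
      have q: "norm (y - y0) \<le> 1" "\<bar>t - t0\<bar> \<le> 1" "z1 \<le> z" "z \<le> z2" "t0 - 1 \<le> t" "t \<le> t0" using P KD by auto
      have "\<phi> z - \<theta> / 2 \<le> w y z t" using lo[OF q(1-4)] le by simp
      then have "3 * \<theta> * ((norm (y - y0))\<^sup>2 + (t0 - t)) \<le> 5 / 2 * \<theta>" unfolding w_def by (simp add: field_simps)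
      then have "\<theta> * (3 * ((norm (y - y0))\<^sup>2 + (t0 - t))) < \<theta> * 3" using \<theta>(1) by (simp add: algebra_simps)
      then have b: "(norm (y - y0))\<^sup>2 + (t0 - t) < 1" using \<theta>(1) by simp
      have n1: "norm (y - y0) \<noteq> 1" "t \<noteq> t0 - 1" using b q(6) zero_le_power2[of "norm (y - y0)"]
        by (auto simp del: zero_le_power2)
      have "u y z t < \<phi> z + \<delta>" using le w2[OF P] \<theta>2 by simp
      then consider "z1 < z \<and> z < z2" | "z = 0 \<and> z2 = 0" using st[OF q(1-4)] by fastforce
      then have "\<exists>I. open I \<and> z \<in> I \<and> (\<forall>z'\<in>I. z' \<le> 0 \<longrightarrow> z1 \<le> z' \<and> z' \<le> z2)"
      proof cases
        case 1 then show ?thesis by (intro exI[of _ "{z1<..<z2}"]) auto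
      next
        case 2 then show ?thesis using z by (intro exI[of _ "{z1<..}"]) auto
      qed
      then obtain I where I: "open I" "z \<in> I" "\<And>z'. z' \<in> I \<Longrightarrow> z' \<le> 0 \<Longrightarrow> z1 \<le> z' \<and> z' \<le> z2" by blast
      show "t > 0 \<and> (\<exists>N. open N \<and> (y, z, t) \<in> N \<and> (\<forall>y' z' t'. (y', z', t') \<in> N \<longrightarrow> z' \<le> 0 \<longrightarrow> t' \<le> t \<longrightarrow> (y', z', t') \<in> K))"
      proof (intro conjI exI)
        show "t > 0" using q t2 by simp
        show "open (ball y0 1 \<times> I \<times> {t0 - 1<..})" by (intro open_Times I) auto
        show "(y, z, t) \<in> ball y0 1 \<times> I \<times> {t0 - 1<..}"
          using n1 q I by (simp add: dist_norm norm_minus_commute)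
        show "\<forall>y' z' t'. (y', z', t') \<in> ball y0 1 \<times> I \<times> {t0 - 1<..} \<longrightarrow> z' \<le> 0 \<longrightarrow> t' \<le> t \<longrightarrow> (y', z', t') \<in> K"
          using q I(3) by (auto simp: KD dist_norm norm_minus_commute)
      qed
    next
      fix y z t assume P: "(y, z, t) \<in> K" and e: "u y z t = w y z t" and "t > 0" and z0: "z < 0"
      have q: "norm (y - y0) \<le> 1" "\<bar>t - t0\<bar> \<le> 1" "z1 \<le> z" "z \<le> z2" using P KD by auto
      have "u y z t < \<phi> z + \<delta>" using e w2[OF P] \<theta>2 by simp
      then obtain k where k: "has_d2 \<phi> z k" "\<delta> \<le> D * k + g (\<phi> z)" using st[OF q] z0 by fastforce
      have "heat_op D w y z t (3 * \<theta> + 6 * \<theta> * D * real CARD('m) - D * k)"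
      proof (rule heat_opI)
        show "((\<lambda>t. w y z t) has_real_derivative 3 * \<theta>) (at t)"
          unfolding w_def by (auto intro!: derivative_eq_intros)
        show "has_d2 (\<lambda>s. w (y + s *\<^sub>R axis i 1) z t) 0 (2 * (- 3 * \<theta>))" for i
        proof -
          have eq: "w (y + s *\<^sub>R axis i 1) z t = (\<phi> z + (2 * \<theta> - 3 * \<theta> * ((norm (y - y0))\<^sup>2 + (t0 - t)))) + (- 6 * \<theta> * (y - y0) $ i) * s + (- 3 * \<theta>) * s\<^sup>2" for s
          proof -
            have "y + s *\<^sub>R axis i 1 - y0 = y - y0 + s *\<^sub>R axis i 1" by simp
            then show ?thesis unfolding w_def by (simp only: norm_line_sq) (simp add: algebra_simps)
          qed
          show ?thesis unfolding eq by (rule has_d2_quadratic)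
        qed
        show "has_d2 (\<lambda>s. w y s t) z k" unfolding w_def by (rule has_d2_add_const[OF k(1)])
        show "3 * \<theta> - D * ((\<Sum>i\<in>(UNIV::'m set). 2 * (- 3 * \<theta>)) + k) = 3 * \<theta> + 6 * \<theta> * D * real CARD('m) - D * k"
          by (simp add: algebra_simps)
      qed
      moreover have "3 * \<theta> + 6 * \<theta> * D * real CARD('m) - D * k < g (w y z t)"
      proof -
        have "\<phi> z - \<theta> / 2 \<le> w y z t" using lo[OF q] e by simp
        then have d: "\<bar>w y z t - \<phi> z\<bar> \<le> 2 * \<theta>" using w2[OF P] \<theta>(1) by (intro abs_leI) linarith+
        have "\<bar>\<phi> z\<bar> \<le> B" using B q by simp
        then have "\<bar>g (w y z t) - g (\<phi> z)\<bar> \<le> L * \<bar>w y z t - \<phi> z\<bar>" using d \<theta> by (intro L) linarith+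
        also have "\<dots> \<le> L * (2 * \<theta>)" using d L by (intro mult_left_mono)
        finally have "g (w y z t) \<ge> g (\<phi> z) - 2 * L * \<theta>" by (simp add: abs_le_iff)
        moreover have "\<theta> * c = 4 * \<theta> + 6 * \<theta> * D * real CARD('m) + 2 * L * \<theta>" by (simp add: c_def algebra_simps)
        ultimately show ?thesis using k(2) \<theta>c \<theta>(1) by linarith
      qed
      ultimately show "\<exists>a. heat_op D w y z t a \<and> a < g (w y z t)" by blast
    next
      fix y t assume P: "(y, 0, t) \<in> K" and e: "u y 0 t = w y 0 t" and "t > 0"
      have q: "norm (y - y0) \<le> 1" "\<bar>t - t0\<bar> \<le> 1" "z1 \<le> 0" "0 \<le> z2" using P KD by auto
      have "u y 0 t < \<phi> 0 + \<delta>" using e w2[OF P] \<theta>2 by simp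
      then obtain b where b: "(\<phi> has_real_derivative b) (at 0 within {..0})" "D * b + \<delta> \<le> q y t"
        using st[OF q] z by fastforce
      have "((\<lambda>s. w y s t) has_real_derivative b) (at 0 within {..0})"
        unfolding w_def using b(1) by (auto intro!: derivative_eq_intros)
      then show "\<exists>b. ((\<lambda>s. w y s t) has_real_derivative b) (at 0 within {..0}) \<and> D * b < q y t"
        using b(2) \<delta> by force
    qed
    show ?case unfolding p split_conv
    proof
      fix z assume "z \<in> {z1..z2}"
      then have "w y0 z t0 < u y0 z t0" using key by simp
      then show "\<phi> z + \<theta> \<le> u y0 z t0" using \<theta>(1) by (simp add: w_def)
    qed
  qed
  then show ?thesis using \<theta>(1) by blast
qed

text \<open>Continuous induction. It is used to slide a family of subsolutions upwards through its
  parameter: \<open>closed\<close> is a limit argument, \<open>step\<close> comes from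
  \<open>lift_subsolution\<close>.\<close>

lemma real_continuation:
  fixes P :: "real \<Rightarrow> bool"
  assumes ab: "a \<le> b" and start: "P a"
    and closed: "\<And>h. a < h \<Longrightarrow> h \<le> b \<Longrightarrow> (\<And>h'. a \<le> h' \<Longrightarrow> h' < h \<Longrightarrow> P h') \<Longrightarrow> P h"
    and step: "\<And>h. a \<le> h \<Longrightarrow> h < b \<Longrightarrow> P h \<Longrightarrow> \<exists>\<theta>>0. \<forall>h'. h \<le> h' \<longrightarrow> h' \<le> h + \<theta> \<longrightarrow> P h'"
  shows "P b"
proof -
  define S where "S = {h. a \<le> h \<and> h \<le> b \<and> (\<forall>h'. a \<le> h' \<longrightarrow> h' \<le> h \<longrightarrow> P h')}"
  define c where "c = Sup S"
  have aS: "a \<in> S" using ab start by (auto simp: S_def intro: antisym)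
  have bdd: "bdd_above S" by (auto simp: S_def bdd_above_def)
  have c: "a \<le> c" "c \<le> b" using aS bdd unfolding c_def
    by (auto simp: S_def intro!: cSup_upper cSup_least)
  have Pl: "P h'" if ah: "a \<le> h'" "h' < c" for h'
  proof -
    have "S \<noteq> {}" using aS by auto
    then obtain h where "h \<in> S" "h' < h" using ah(2) less_cSup_iff[OF _ bdd, of h'] unfolding c_def by blast
    then show ?thesis using ah by (auto simp: S_def)
  qed
  have Pc: "P c" using closed[of c] c Pl start by (cases "a = c") auto
  show ?thesis
  proof (cases "c = b")
    case False
    then obtain \<theta> where \<theta>: "\<theta> > 0" "\<And>h'. c \<le> h' \<Longrightarrow> h' \<le> c + \<theta> \<Longrightarrow> P h'"
      using step[of c] c Pc by auto
    define d where "d = min b (c + \<theta>)"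
    have "P h'" if "a \<le> h'" "h' \<le> d" for h'
      using Pl[of h'] \<theta>(2)[of h'] that by (cases "h' < c") (auto simp: d_def)
    then have "d \<in> S" using c \<theta> by (auto simp: S_def d_def)
    then have "d \<le> c" unfolding c_def by (rule cSup_upper[OF _ bdd])
    then show ?thesis using False c \<theta> by (auto simp: d_def)
  qed (use Pc in simp)
qed

text \<open>A concave cap around depth \<open>Z\<close> is raised from \<open>lo\<close> to
  \<open>s\<close>. Its ends never exceed \<open>lo\<close>, where the solution is known to be
  larger, and its curvature costs only half of the minimum of \<open>g\<close> over the range, so
  the cap is a strict subsolution at every height. For \<open>Z \<ge> w\<close> it does not reach
  beyond the interface.\<close>

lemma lower_bound_far:
  fixes u :: "real^'m::finite \<Rightarrow> real \<Rightarrow> real \<Rightarrow> real"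
  assumes hu: "half D g u q" and D: "D > 0" and F: "thick F" and lip: "loc_lipschitz g"
    and lo: "lo < s" and g: "\<And>x. lo \<le> x \<Longrightarrow> x \<le> s \<Longrightarrow> 0 < g x"
    and \<eta>: "\<eta> > 0" and lb: "\<And>Z. eventually (\<lambda>(y, t). \<forall>z. - Z \<le> z \<longrightarrow> z \<le> 0 \<longrightarrow> lo + \<eta> \<le> u y z t) F"
  shows "\<exists>Z0\<ge>0. \<forall>Z\<ge>Z0. eventually (\<lambda>(y, t). s \<le> u y (- Z) t) F"
proof -
  have "continuous_on {lo..s} g" using loc_lipschitz_isCont[OF lip] by (simp add: continuous_at_imp_continuous_on)
  then obtain x0 where x0: "x0 \<in> {lo..s}" "\<And>x. x \<in> {lo..s} \<Longrightarrow> g x0 \<le> g x"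
    using continuous_attains_inf[of "{lo..s}" g] lo by auto
  define m where "m = g x0"
  have m: "m > 0" "\<And>x. lo \<le> x \<Longrightarrow> x \<le> s \<Longrightarrow> m \<le> g x" using x0 g by (auto simp: m_def)
  \<comment> \<open>The cap has second derivative \<open>- 2 * k\<close>, so \<open>D\<close> times
    it equals \<open>- m / 2\<close>; the width \<open>w\<close> then makes the cap of height
    \<open>s\<close> end exactly at \<open>lo\<close>.\<close>
  define k where "k = m / (4 * D)"
  have k: "k > 0" using m D by (simp add: k_def)
  define w where "w = sqrt ((s - lo) / k)"
  have w: "w > 0" "k * w\<^sup>2 = s - lo" using k lo by (auto simp: w_def)
  have "eventually (\<lambda>(y, t). s \<le> u y (- Z) t) F" if Z: "Z \<ge> w" for Z
  proof -
    define \<phi> where "\<phi> h z = h - k * (z + Z)\<^sup>2" for h z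
    define P where "P h \<longleftrightarrow> (\<forall>e>0. eventually (\<lambda>(y, t). \<forall>z\<in>{- Z - w..- Z + w}. \<phi> h z - e \<le> u y z t) F)" for h
    have lbI: "eventually (\<lambda>(y, t). \<forall>z\<in>{- Z - w..- Z + w}. lo + \<eta> \<le> u y z t) F"
      using lb[of "Z + w"] by (rule eventually_mono) (use Z in auto)
    have lift: "\<exists>\<theta>>0. eventually (\<lambda>(y, t). \<forall>z\<in>{- Z - w..- Z + w}. \<phi> h z + \<theta> \<le> u y z t) F"
      if h: "h \<le> s" "P h" for h
    proof (rule lift_subsolution[OF hu D F lip, where \<delta> = "min \<eta> (m / 2)"])
      show "continuous_on {- Z - w..- Z + w} (\<phi> h)" unfolding \<phi>_def by (intro continuous_intros)
      show "eventually (\<lambda>(y, t). \<forall>z\<in>{- Z - w..- Z + w}. \<phi> h z - e \<le> u y z t) F" if "e > 0" for e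
        using h(2) that by (simp add: P_def)
      have alt: "\<phi> h z \<le> lo \<or> (- Z - w < z \<and> z < - Z + w \<and> (\<exists>l. has_d2 (\<phi> h) z l \<and> m / 2 \<le> D * l + g (\<phi> h z)))"
        if zz: "- Z - w \<le> z" "z \<le> - Z + w" for z
      proof (cases "\<phi> h z \<le> lo")
        case False
        have "z \<noteq> - Z - w" "z \<noteq> - Z + w" using False w h by (auto simp: \<phi>_def)
        moreover have "has_d2 (\<lambda>z. h - k * Z\<^sup>2 + (- 2 * k * Z) * z + (- k) * z\<^sup>2) z (2 * (- k))" by (rule has_d2_quadratic)
        then have "has_d2 (\<phi> h) z (2 * (- k))" unfolding \<phi>_def by (simp add: power2_eq_square algebra_simps)
        moreover have "m \<le> g (\<phi> h z)"
        proof (rule m(2))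
          show "lo \<le> \<phi> h z" using False by simp
          show "\<phi> h z \<le> s"
          proof -
            have "0 \<le> k * (z + Z)\<^sup>2" using k by simp
            then show ?thesis using h unfolding \<phi>_def by linarith
          qed
        qed
        moreover have "D * (2 * (- k)) = - m / 2" using D by (simp add: k_def)
        ultimately show ?thesis using zz by force
      qed simp
      show "eventually (\<lambda>(y, t). \<forall>z\<in>{- Z - w..- Z + w}. \<phi> h z + min \<eta> (m / 2) \<le> u y z t
        \<or> (- Z - w < z \<and> z < - Z + w \<and> (\<exists>k. has_d2 (\<phi> h) z k \<and> min \<eta> (m / 2) \<le> D * k + g (\<phi> h z)))
        \<or> (z = 0 \<and> - Z + w = 0 \<and> (\<exists>b. (\<phi> h has_real_derivative b) (at 0 within {..0}) \<and> D * b + min \<eta> (m / 2) \<le> q y t))) F"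
        using lbI
      proof eventually_elim
        case (elim p)
        obtain y t where p: "p = (y, t)" by (cases p)
        show ?case unfolding p split_conv
        proof
          fix z assume z: "z \<in> {- Z - w..- Z + w}"
          then have "lo + \<eta> \<le> u y z t" using elim p by auto
          then show "\<phi> h z + min \<eta> (m / 2) \<le> u y z t
        \<or> (- Z - w < z \<and> z < - Z + w \<and> (\<exists>k. has_d2 (\<phi> h) z k \<and> min \<eta> (m / 2) \<le> D * k + g (\<phi> h z)))
        \<or> (z = 0 \<and> - Z + w = 0 \<and> (\<exists>b. (\<phi> h has_real_derivative b) (at 0 within {..0}) \<and> D * b + min \<eta> (m / 2) \<le> q y t))"
            using alt[of z] z by (auto simp: min_def split: if_splits)
        qed
      qed
    qed (use w Z \<eta> m in auto)
    have "P s"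
    proof (rule real_continuation[of lo s P])
      show "lo \<le> s" using lo by simp
      show "P lo" unfolding P_def
      proof (intro allI impI)
        fix e :: real assume "e > 0"
        show "eventually (\<lambda>(y, t). \<forall>z\<in>{- Z - w..- Z + w}. \<phi> lo z - e \<le> u y z t) F"
          using lbI
        proof eventually_elim
          case (elim p)
          have "\<phi> lo z \<le> lo" for z using k by (simp add: \<phi>_def)
          then show ?case using elim \<eta> \<open>e > 0\<close> by (auto split: prod.splits intro: order_trans) (smt (verit) atLeastAtMost_iff)
        qed
      qed
      show "P h" if h: "lo < h" "h \<le> s" "\<And>h'. lo \<le> h' \<Longrightarrow> h' < h \<Longrightarrow> P h'" for h
        unfolding P_def
      proof (intro allI impI)
        fix e :: real assume e: "e > 0"
        define h' where "h' = max lo (h - e / 2)"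
        have h': "lo \<le> h'" "h' < h" "h - h' \<le> e / 2" using h(1) e unfolding h'_def by linarith+
        have "eventually (\<lambda>(y, t). \<forall>z\<in>{- Z - w..- Z + w}. \<phi> h' z - e / 2 \<le> u y z t) F"
          using h(3)[OF h'(1,2)] e unfolding P_def by simp
        then show "eventually (\<lambda>(y, t). \<forall>z\<in>{- Z - w..- Z + w}. \<phi> h z - e \<le> u y z t) F"
          by eventually_elim (use h' in \<open>force simp: \<phi>_def\<close>)
      qed
      show "\<exists>\<theta>>0. \<forall>h'. h \<le> h' \<longrightarrow> h' \<le> h + \<theta> \<longrightarrow> P h'" if h: "lo \<le> h" "h < s" "P h" for h
      proof -
        obtain \<theta> where \<theta>: "\<theta> > 0" "eventually (\<lambda>(y, t). \<forall>z\<in>{- Z - w..- Z + w}. \<phi> h z + \<theta> \<le> u y z t) F"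
          using lift[of h] h by auto
        have "P h'" if "h \<le> h'" "h' \<le> h + \<theta>" for h'
          unfolding P_def
        proof (intro allI impI)
          fix e :: real assume e: "e > 0"
          show "eventually (\<lambda>(y, t). \<forall>z\<in>{- Z - w..- Z + w}. \<phi> h' z - e \<le> u y z t) F"
            using \<theta>(2) by eventually_elim (use that e in \<open>force simp: \<phi>_def\<close>)
        qed
        then show ?thesis using \<theta>(1) by blast
      qed
    qed
    then obtain \<theta> where \<theta>: "\<theta> > 0" "eventually (\<lambda>(y, t). \<forall>z\<in>{- Z - w..- Z + w}. \<phi> s z + \<theta> \<le> u y z t) F"
      using lift[of s] by auto
    have m: "- Z \<in> {- Z - w..- Z + w}" and e: "\<phi> s (- Z) = s" using w by (auto simp: \<phi>_def)
    have "s \<le> u y (- Z) t" if h: "\<forall>z\<in>{- Z - w..- Z + w}. \<phi> s z + \<theta> \<le> u y z t" for y t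
      using bspec[OF h m] \<theta>(1) unfolding e by linarith
    then show ?thesis using \<theta>(2) by (auto elim!: eventually_mono)
  qed
  then show ?thesis using w by (intro exI[of _ w]) auto
qed

section \<open>Global orbits of a scalar autonomous equation\<close>

lemma continuous_antiderivative:
  fixes \<gamma> :: "real \<Rightarrow> real"
  assumes "\<And>x. isCont \<gamma> x"
  shows "\<exists>\<Gamma>. \<forall>x. (\<Gamma> has_real_derivative \<gamma> x) (at x)"
proof -
  have "\<exists>F. \<forall>x. -\<infinity> < ereal x \<longrightarrow> ereal x < \<infinity> \<longrightarrow> (F has_vector_derivative \<gamma> x) (at x)"
    by (rule einterval_antiderivative) (use assms in auto)
  then show ?thesis by (simp add: has_real_derivative_iff_has_vector_derivative)
qed

lemma nondecreasing_of_derivative: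
  fixes f :: "real \<Rightarrow> real"
  assumes "a \<le> b" and "\<And>x. a \<le> x \<Longrightarrow> x \<le> b \<Longrightarrow> \<exists>y. (f has_real_derivative y) (at x) \<and> 0 \<le> y"
  shows "f a \<le> f b"
  using DERIV_nonneg_imp_nondecreasing[OF assms(1)] assms(2) by blast

text \<open>The orbit is the inverse of the travel time, an antiderivative of \<open>1 / P\<close>.
  The bound \<open>P x \<le> C * (x - s)\<close> makes the travel time diverge both towards
  \<open>s\<close> and towards infinity; hence it is onto, and the orbit exists for all
  \<open>z\<close> without ever reaching \<open>s\<close>.\<close>

lemma orbit_right:
  fixes P :: "real \<Rightarrow> real"
  assumes P: "\<And>x. isCont P x" and pos: "\<And>x. s < x \<Longrightarrow> 0 < P x" and C: "C > 0" "\<And>x. s < x \<Longrightarrow> P x \<le> C * (x - s)"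
    and a: "s < a"
  shows "\<exists>\<Psi>. \<Psi> 0 = a \<and> (\<forall>z. (\<Psi> has_real_derivative P (\<Psi> z)) (at z)) \<and> (\<forall>z. s < \<Psi> z)
     \<and> (\<forall>\<eta>>0. \<exists>Z. \<forall>z\<le>-Z. \<Psi> z < s + \<eta>)"
proof -
  have "\<exists>F. \<forall>x. ereal s < ereal x \<longrightarrow> ereal x < \<infinity> \<longrightarrow> (F has_vector_derivative 1 / P x) (at x)"
    by (rule einterval_antiderivative) (use P pos in \<open>auto intro!: continuous_intros simp: less_imp_neq[symmetric]\<close>)
  then obtain F where F: "\<And>x. s < x \<Longrightarrow> (F has_real_derivative 1 / P x) (at x)"
    by (auto simp: has_real_derivative_iff_has_vector_derivative)
  define T where "T x = F x - F a" for x
  have T: "(T has_real_derivative 1 / P x) (at x)" if "s < x" for x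
    unfolding T_def using F[OF that] by (auto intro!: derivative_eq_intros)
  have Tmono: "T x < T y" if "s < x" "x < y" for x y
  proof (rule DERIV_pos_imp_increasing[OF that(2)])
    fix w assume "x \<le> w" "w \<le> y"
    then show "\<exists>l. (T has_real_derivative l) (at w) \<and> 0 < l"
      using T[of w] pos[of w] that by (intro exI[of _ "1 / P w"]) auto
  qed
  have Tinj: "x = y" if "s < x" "s < y" "T x = T y" for x y
    using Tmono[of x y] Tmono[of y x] that by (cases x y rule: linorder_cases) auto
  have cmp: "T x - ln (x - s) / C \<le> T y - ln (y - s) / C" if "s < x" "x \<le> y" for x y
  proof (rule nondecreasing_of_derivative[OF that(2)])
    fix w assume w: "x \<le> w" "w \<le> y"
    have "1 / (C * (w - s)) \<le> 1 / P w" using pos[of w] C(2)[of w] w that by (intro divide_left_mono) auto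
    then have "0 \<le> 1 / P w - 1 / (w - s) / C" by (simp add: mult.commute)
    moreover have "((\<lambda>w. T w - ln (w - s) / C) has_real_derivative 1 / P w - 1 / (w - s) / C) (at w)"
      using w that C by (auto intro!: derivative_eq_intros T)
    ultimately show "\<exists>l. ((\<lambda>w. T w - ln (w - s) / C) has_real_derivative l) (at w) \<and> 0 \<le> l" by blast
  qed
  have surj: "\<exists>x>s. T x = \<tau>" for \<tau>
  proof -
    \<comment> \<open>By \<open>cmp\<close> the travel time dominates \<open>ln (x - s) / C\<close>
      up to a constant; \<open>h\<close> and \<open>l\<close> are the points at which this
      comparison yields at least \<bar>\<tau>\<bar> and at most -\<bar>\<tau>\<bar>.\<close>
    define h where "h = s + (a - s) * exp (C * \<bar>\<tau>\<bar>)"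
    define l where "l = s + (a - s) * exp (- C * \<bar>\<tau>\<bar>)"
    have "1 \<le> exp (C * \<bar>\<tau>\<bar>)" "exp (- C * \<bar>\<tau>\<bar>) \<le> 1" using C by auto
    moreover have "a \<le> s + (a - s) * x" if "1 \<le> x" for x using mult_left_mono[OF that less_imp_le, of "a - s"] a by (simp add: algebra_simps)
    moreover have "s + (a - s) * x \<le> a" if "x \<le> 1" for x using mult_left_mono[OF that less_imp_le, of "a - s"] a by (simp add: algebra_simps)
    ultimately have hl: "a \<le> h" "l \<le> a" unfolding h_def l_def by blast+
    have hl': "s < l" using a by (simp add: l_def)
    note hl = hl hl'
    have "ln (h - s) = ln (a - s) + C * \<bar>\<tau>\<bar>" "ln (l - s) = ln (a - s) - C * \<bar>\<tau>\<bar>"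
      using a by (simp_all add: h_def l_def ln_mult)
    moreover have "ln (a - s) / C + \<bar>\<tau>\<bar> = (ln (a - s) + C * \<bar>\<tau>\<bar>) / C" "ln (a - s) / C - \<bar>\<tau>\<bar> = (ln (a - s) - C * \<bar>\<tau>\<bar>) / C"
      using C by (auto simp: add_divide_distrib diff_divide_distrib)
    moreover have "T a = 0" by (simp add: T_def)
    ultimately have "\<bar>\<tau>\<bar> \<le> T h" "T l \<le> - \<bar>\<tau>\<bar>"
      using cmp[of a h] cmp[of l a] a hl by auto
    then have "T l \<le> \<tau>" "\<tau> \<le> T h" by auto
    moreover have "\<forall>x. l \<le> x \<and> x \<le> h \<longrightarrow> isCont T x"
      using hl(3) DERIV_isCont[OF T] less_le_trans by blast
    ultimately obtain x where "l \<le> x" "x \<le> h" "T x = \<tau>" using IVT[of T l \<tau> h] hl by auto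
    then show ?thesis using hl by (intro exI[of _ x]) auto
  qed
  define \<Psi> where "\<Psi> z = (SOME x. s < x \<and> T x = z)" for z
  have \<Psi>: "s < \<Psi> z" "T (\<Psi> z) = z" for z
    using someI_ex[of "\<lambda>x. s < x \<and> T x = z"] surj[of z] unfolding \<Psi>_def by auto
  have inv: "\<Psi> (T x) = x" if "s < x" for x using Tinj[OF \<Psi>(1) that] \<Psi>(2) by simp
  have \<Psi>mono: "\<Psi> x \<le> \<Psi> y" if "x \<le> y" for x y
  proof (rule ccontr)
    assume "\<not> \<Psi> x \<le> \<Psi> y"
    then have "T (\<Psi> y) < T (\<Psi> x)" by (intro Tmono \<Psi>) auto
    then show False using \<Psi>(2) that by simp
  qed
  have cont: "isCont \<Psi> z" for z
  proof -
    define d where "d = (\<Psi> z - s) / 2"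
    have d: "d > 0" using \<Psi>(1)[of z] by (simp add: d_def)
    have "isCont \<Psi> (T (\<Psi> z))"
    proof (rule isCont_inverse_function[where f = T and x = "\<Psi> z", OF d])
      show "\<Psi> (T x) = x" if "\<bar>x - \<Psi> z\<bar> \<le> d" for x
      proof (rule inv)
        have "\<Psi> z - x \<le> d" using that by simp
        then show "s < x" using \<Psi>(1)[of z] unfolding d_def by (simp add: field_simps)
      qed
      show "isCont T x" if "\<bar>x - \<Psi> z\<bar> \<le> d" for x
      proof (rule DERIV_isCont[OF T])
        have "\<Psi> z - x \<le> d" using that by simp
        then show "s < x" using \<Psi>(1)[of z] unfolding d_def by (simp add: field_simps)
      qed
    qed
    then show ?thesis by (simp add: \<Psi>)
  qed
  have der: "(\<Psi> has_real_derivative P (\<Psi> z)) (at z)" for z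
  proof -
    have "(\<Psi> has_real_derivative inverse (1 / P (\<Psi> z))) (at z)"
      by (rule DERIV_inverse_function[where f = T and a = "z - 1" and b = "z + 1"])
        (use T[OF \<Psi>(1)] pos[OF \<Psi>(1)] \<Psi>(2) cont less_imp_neq[OF pos[OF \<Psi>(1)]] in auto)
    then show ?thesis by simp
  qed
  have "\<exists>Z. \<forall>z\<le>-Z. \<Psi> z < s + \<eta>" if "\<eta> > 0" for \<eta>
  proof (intro exI allI impI)
    fix z assume "z \<le> - (- T (s + \<eta> / 2))"
    then have "\<Psi> z \<le> \<Psi> (T (s + \<eta> / 2))" by (intro \<Psi>mono) simp
    also have "\<dots> = s + \<eta> / 2" using that by (intro inv) simp
    finally show "\<Psi> z < s + \<eta>" using that by simp
  qed
  moreover have "\<Psi> 0 = a" using inv[OF a] by (simp add: T_def)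
  ultimately show ?thesis using der \<Psi>(1) by blast
qed

section \<open>Stationary profiles\<close>

text \<open>Profiles are the solutions of \<open>\<Psi>' = P(\<Psi>)\<close>, where \<open>P\<close> is given by the energy of
  \<open>D\<Psi>'' + \<gamma>(\<Psi>) = 0\<close> at the rest point \<open>s\<close>.  The choice in \<open>primitive\<close> is meaningful for
  continuous \<open>\<gamma>\<close> only.\<close>

definition primitive :: "(real \<Rightarrow> real) \<Rightarrow> real \<Rightarrow> real" where
  "primitive \<gamma> = (SOME \<Gamma>. \<forall>x. (\<Gamma> has_real_derivative \<gamma> x) (at x))"

lemma primitive: "(\<And>x. isCont \<gamma> x) \<Longrightarrow> (primitive \<gamma> has_real_derivative \<gamma> x) (at x)"
  unfolding primitive_def by (rule someI2_ex[OF continuous_antiderivative]) auto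

text \<open>The sign selects the branch on which orbits move away from \<open>s\<close> as
  \<open>z\<close> increases, so that they tend to \<open>s\<close> for \<open>z\<close> going to
  minus infinity, that is, deep in the medium.\<close>

definition slope :: "real \<Rightarrow> (real \<Rightarrow> real) \<Rightarrow> real \<Rightarrow> real \<Rightarrow> real" where
  "slope D \<gamma> s x = sgn (x - s) * sqrt (2 / D * (primitive \<gamma> s - primitive \<gamma> x))"

text \<open>The linear bound \<open>lip\<close> near \<open>s\<close> makes the energy difference
  quadratic and hence the slope linear, so that \<open>s\<close> is approached only in the
  limit.\<close>

locale profile =
  fixes D :: real and \<gamma> :: "real \<Rightarrow> real" and lo s hi :: real
  assumes D: "D > 0" and cont: "\<And>x. isCont \<gamma> x" and lo: "lo < s" and hi: "s < hi"
    and pos: "\<And>x. lo \<le> x \<Longrightarrow> x < s \<Longrightarrow> 0 < \<gamma> x" and neg: "\<And>x. s < x \<Longrightarrow> x \<le> hi \<Longrightarrow> \<gamma> x < 0"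
    and lip: "\<exists>K. \<forall>x. lo \<le> x \<longrightarrow> x \<le> hi \<longrightarrow> \<bar>\<gamma> x\<bar> \<le> K * \<bar>x - s\<bar>"
begin

abbreviation "Q x \<equiv> primitive \<gamma> s - primitive \<gamma> x"

lemma zero: "\<gamma> s = 0"
proof -
  obtain K where "\<And>x. lo \<le> x \<Longrightarrow> x \<le> hi \<Longrightarrow> \<bar>\<gamma> x\<bar> \<le> K * \<bar>x - s\<bar>" using lip by blast
  from this[of s] show ?thesis using lo hi by simp
qed

lemma dQ: "((\<lambda>x. Q x) has_real_derivative - \<gamma> x) (at x)"
  using primitive[OF cont] by (auto intro!: derivative_eq_intros)

lemma Q_left: "Q y < Q x" if "lo \<le> x" "x < y" "y \<le> s" for x y
proof (rule DERIV_neg_imp_decreasing_open[OF that(2)])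
  show "\<exists>l. ((\<lambda>x. Q x) has_real_derivative l) (at w) \<and> l < 0" if "x < w" "w < y" for w
    using dQ[of w] pos[of w] that \<open>lo \<le> x\<close> \<open>y \<le> s\<close> by (intro exI[of _ "- \<gamma> w"]) auto
  show "continuous_on {x..y} (\<lambda>x. Q x)" using dQ DERIV_isCont by (intro continuous_at_imp_continuous_on) blast
qed

lemma Q_right: "Q x < Q y" if "s \<le> x" "x < y" "y \<le> hi" for x y
proof (rule DERIV_pos_imp_increasing_open[OF that(2)])
  show "\<exists>l. ((\<lambda>x. Q x) has_real_derivative l) (at w) \<and> l > 0" if "x < w" "w < y" for w
    using dQ[of w] neg[of w] that \<open>s \<le> x\<close> \<open>y \<le> hi\<close> by (intro exI[of _ "- \<gamma> w"]) auto
  show "continuous_on {x..y} (\<lambda>x. Q x)" using dQ DERIV_isCont by (intro continuous_at_imp_continuous_on) blast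
qed

lemma Q_nonneg: "lo \<le> x \<Longrightarrow> x \<le> hi \<Longrightarrow> 0 \<le> Q x"
  using Q_left[of x s] Q_right[of s x] by (cases x s rule: linorder_cases) auto

lemma Q_bound: "\<exists>K>0. \<forall>x. lo \<le> x \<longrightarrow> x \<le> hi \<longrightarrow> Q x \<le> K * (x - s)\<^sup>2"
proof -
  obtain K0 where K0: "\<And>x. lo \<le> x \<Longrightarrow> x \<le> hi \<Longrightarrow> \<bar>\<gamma> x\<bar> \<le> K0 * \<bar>x - s\<bar>" using lip by blast
  define K where "K = max K0 1"
  have K: "\<bar>\<gamma> x\<bar> \<le> K * \<bar>x - s\<bar>" if "lo \<le> x" "x \<le> hi" for x
    by (rule order_trans[OF K0[OF that]]) (auto simp: K_def intro!: mult_right_mono)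
  have d: "((\<lambda>x. K * (x - s)\<^sup>2 - Q x) has_real_derivative 2 * K * (x - s) + \<gamma> x) (at x)" for x
    by (auto intro!: derivative_eq_intros primitive[OF cont])
  have "Q x \<le> K * (x - s)\<^sup>2" if x: "lo \<le> x" "x \<le> hi" for x
  proof (cases "x \<le> s")
    case True
    have "- (K * (x - s)\<^sup>2 - Q x) \<le> - (K * (s - s)\<^sup>2 - Q s)"
    proof (rule nondecreasing_of_derivative[OF True])
      fix w assume w: "x \<le> w" "w \<le> s"
      have "\<bar>\<gamma> w\<bar> \<le> K * (s - w)" using K[of w] w x hi by simp
      moreover have "K * (s - w) \<ge> 0" using w by (simp add: K_def)
      ultimately have "0 \<le> - (2 * K * (w - s) + \<gamma> w)" by (simp add: algebra_simps)
      then show "\<exists>y. ((\<lambda>x. - (K * (x - s)\<^sup>2 - Q x)) has_real_derivative y) (at w) \<and> 0 \<le> y"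
        using DERIV_minus[OF d[of w]] by blast
    qed
    then show ?thesis by simp
  next
    case False
    have "K * (s - s)\<^sup>2 - Q s \<le> K * (x - s)\<^sup>2 - Q x"
    proof (rule nondecreasing_of_derivative[of s x "\<lambda>x. K * (x - s)\<^sup>2 - Q x"])
      fix w assume w: "s \<le> w" "w \<le> x"
      have "\<bar>\<gamma> w\<bar> \<le> K * (w - s)" using K[of w] w x lo by simp
      moreover have "K * (w - s) \<ge> 0" using w by (simp add: K_def)
      ultimately have "0 \<le> 2 * K * (w - s) + \<gamma> w" by (simp add: algebra_simps)
      then show "\<exists>y. ((\<lambda>x. K * (x - s)\<^sup>2 - Q x) has_real_derivative y) (at w) \<and> 0 \<le> y"
        using d[of w] by blast
    qed (use False in simp)
    then show ?thesis by simp
  qed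
  then show ?thesis by (intro exI[of _ K]) (auto simp: K_def)
qed

text \<open>Clamping the argument gives a function on the whole line that is continuous,
  nondecreasing and linearly bounded, so orbits exist for every start value. They satisfy the
  second-order equation only while they stay between \<open>lo\<close> and
  \<open>hi\<close>.\<close>

definition P :: "real \<Rightarrow> real" where "P x = slope D \<gamma> s (max lo (min hi x))"

lemma P_eq: "lo \<le> x \<Longrightarrow> x \<le> hi \<Longrightarrow> P x = slope D \<gamma> s x"
  by (simp add: P_def)

lemma slope_pos: "s < x \<Longrightarrow> x \<le> hi \<Longrightarrow> 0 < slope D \<gamma> s x"
  using Q_right[of s x] D by (simp add: slope_def)

lemma slope_neg: "lo \<le> x \<Longrightarrow> x < s \<Longrightarrow> slope D \<gamma> s x < 0"
  using Q_left[of x s] D by (simp add: slope_def)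

text \<open>The energy difference grows away from \<open>s\<close> on both sides, and the sign turns
  this into an increasing function. Uniqueness of the interface values rests on this
  monotonicity.\<close>

lemma slope_mono: "slope D \<gamma> s x < slope D \<gamma> s y" if "lo \<le> x" "x < y" "y \<le> hi"
proof -
  consider "y \<le> s" | "x < s" "s < y" | "s \<le> x" using that by linarith
  then show ?thesis
  proof cases
    case 1
    have "Q y < Q x" using Q_left that 1 by auto
    then have "sqrt (2 / D * Q y) < sqrt (2 / D * Q x)" using D by (intro real_sqrt_less_mono mult_strict_left_mono) auto
    then show ?thesis using 1 that by (cases "y = s") (auto simp: slope_def)
  next
    case 2 then show ?thesis using slope_pos[of y] slope_neg[of x] that by simp
  next
    case 3
    have "Q x < Q y" using Q_right that 3 by auto
    then have "sqrt (2 / D * Q x) < sqrt (2 / D * Q y)" using D by (intro real_sqrt_less_mono mult_strict_left_mono) auto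
    then show ?thesis using 3 that by (cases "x = s") (auto simp: slope_def)
  qed
qed

lemma P_mono: "x \<le> y \<Longrightarrow> P x \<le> P y"
proof -
  assume "x \<le> y"
  define v w where "v = max lo (min hi x)" and "w = max lo (min hi y)"
  have "v \<le> w" "lo \<le> v" "w \<le> hi" using \<open>x \<le> y\<close> lo hi by (auto simp: v_def w_def)
  then have "slope D \<gamma> s v \<le> slope D \<gamma> s w" using slope_mono[of v w] by (cases "v = w") auto
  then show ?thesis by (simp add: P_def v_def w_def)
qed

lemma P_pos: "s < x \<Longrightarrow> 0 < P x"
  unfolding P_def using lo hi by (intro slope_pos) auto

lemma P_neg: "x < s \<Longrightarrow> P x < 0"
  unfolding P_def using lo hi by (intro slope_neg) auto

lemma P_s: "P s = 0"
  using lo hi by (simp add: P_def slope_def)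

lemma P_bound: "\<exists>C>0. \<forall>x. \<bar>P x\<bar> \<le> C * \<bar>x - s\<bar>"
proof -
  obtain K where K: "K > 0" "\<And>x. lo \<le> x \<Longrightarrow> x \<le> hi \<Longrightarrow> Q x \<le> K * (x - s)\<^sup>2" using Q_bound by blast
  define C where "C = sqrt (2 / D * K)"
  have C: "C > 0" using K D by (simp add: C_def)
  have "\<bar>P x\<bar> \<le> C * \<bar>x - s\<bar>" for x
  proof -
    define w where "w = max lo (min hi x)"
    have w: "lo \<le> w" "w \<le> hi" "\<bar>w - s\<bar> \<le> \<bar>x - s\<bar>" using lo hi by (auto simp: w_def)
    have "\<bar>slope D \<gamma> s w\<bar> \<le> sqrt (2 / D * Q w)"
      using Q_nonneg[OF w(1,2)] D by (auto simp: slope_def abs_mult abs_sgn_eq)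
    also have "\<dots> \<le> sqrt (2 / D * (K * (w - s)\<^sup>2))" using K(2)[OF w(1,2)] D by (intro real_sqrt_le_mono mult_left_mono) auto
    also have "\<dots> = C * \<bar>w - s\<bar>"
    proof -
      have "2 / D * (K * (w - s)\<^sup>2) = (2 / D * K) * (w - s)\<^sup>2" by simp
      then show ?thesis unfolding C_def by (simp only: real_sqrt_mult[of "2 / D * K"] real_sqrt_abs)
    qed
    also have "\<dots> \<le> C * \<bar>x - s\<bar>" using w C by (intro mult_left_mono) auto
    finally show ?thesis by (simp add: P_def w_def)
  qed
  then show ?thesis using C by blast
qed

lemma slope_deriv: "(slope D \<gamma> s has_real_derivative - \<gamma> x / (D * slope D \<gamma> s x)) (at x)" if "lo \<le> x" "x \<le> hi" "x \<noteq> s"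
proof -
  define e where "e = sgn (x - s)"
  have e: "e * e = 1" using that by (auto simp: e_def sgn_if)
  have Qx: "Q x > 0" using Q_left[of x s] Q_right[of s x] that by (cases x s rule: linorder_cases) auto
  define r where "r = sqrt (2 / D * Q x)"
  have r: "r > 0" using Qx D by (simp add: r_def)
  have 1: "((\<lambda>x. e * sqrt (2 / D * Q x)) has_real_derivative e * ((2 / D * (- \<gamma> x)) * (inverse r / 2))) (at x)"
    unfolding r_def using Qx D
    by (intro DERIV_cmult) (auto intro!: derivative_eq_intros primitive[OF cont] simp: field_simps)
  have "open (if s < x then {s<..} else {..<s})" "x \<in> (if s < x then {s<..} else {..<s})" using that by auto
  then have "(slope D \<gamma> s has_real_derivative e * ((2 / D * (- \<gamma> x)) * (inverse r / 2))) (at x)"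
  proof (rule has_field_derivative_transform_within_open[OF 1])
    fix y assume "y \<in> (if s < x then {s<..} else {..<s})"
    then have "sgn (y - s) = e" using that by (auto simp: e_def sgn_if split: if_splits)
    then show "e * sqrt (2 / D * Q y) = slope D \<gamma> s y" by (simp add: slope_def)
  qed
  moreover have "e * ((2 / D * (- \<gamma> x)) * (inverse r / 2)) = - \<gamma> x / (D * slope D \<gamma> s x)"
  proof -
    have sl: "slope D \<gamma> s x = e * r" by (simp add: slope_def e_def r_def)
    have "e = 1 \<or> e = - 1" using that by (auto simp: e_def sgn_if)
    then show ?thesis unfolding sl using r D by (auto simp: field_simps)
  qed
  ultimately show ?thesis by simp
qed

lemma P_isCont: "isCont P x"
proof -
  have s: "isCont (slope D \<gamma> s) s"
  proof -
    obtain C where C: "C > 0" "\<And>x. \<bar>P x\<bar> \<le> C * \<bar>x - s\<bar>" using P_bound by blast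
    have "\<forall>\<^sub>F x in at s. x \<in> {lo<..<hi}" using lo hi by (intro eventually_at_in_open') auto
    then have "\<forall>\<^sub>F x in at s. norm (slope D \<gamma> s x) \<le> C * \<bar>x - s\<bar>"
    proof eventually_elim
      case (elim x)
      then have "P x = slope D \<gamma> s x" by (intro P_eq) auto
      then show ?case using C(2)[of x] by simp
    qed
    moreover have "((\<lambda>x. C * \<bar>x - s\<bar>) \<longlongrightarrow> 0) (at s)" by (rule tendsto_eq_rhs) (auto intro!: tendsto_eq_intros)
    ultimately have "(slope D \<gamma> s \<longlongrightarrow> 0) (at s)" by (rule Lim_null_comparison)
    then show ?thesis by (simp add: isCont_def slope_def)
  qed
  have "isCont (slope D \<gamma> s) x" if "lo \<le> x" "x \<le> hi" for x
    using s DERIV_isCont[OF slope_deriv[OF that]] by (cases "x = s") auto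
  then have "isCont (slope D \<gamma> s) (max lo (min hi x))" using lo hi by auto
  moreover have "isCont (\<lambda>x. max lo (min hi x)) x" by (intro continuous_intros)
  ultimately have "isCont (\<lambda>x. slope D \<gamma> s (max lo (min hi x))) x"
    using isCont_o2[where f = "\<lambda>x. max lo (min hi x)" and g = "slope D \<gamma> s"] by blast
  then show ?thesis by (simp add: P_def[abs_def])
qed

lemma orbit_exists:
  "\<exists>\<Psi>. \<Psi> 0 = a \<and> (\<forall>z. (\<Psi> has_real_derivative P (\<Psi> z)) (at z))
     \<and> (\<forall>z. (s < a \<longrightarrow> s < \<Psi> z) \<and> (a < s \<longrightarrow> \<Psi> z < s) \<and> (a = s \<longrightarrow> \<Psi> z = s))
     \<and> (\<forall>\<eta>>0. \<exists>Z. \<forall>z\<le>-Z. \<bar>\<Psi> z - s\<bar> < \<eta>)"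
proof -
  obtain C where C: "C > 0" "\<And>x. \<bar>P x\<bar> \<le> C * \<bar>x - s\<bar>" using P_bound by blast
  consider "s < a" | "a = s" | "a < s" by linarith
  then show ?thesis
  proof cases
    case 1
    have "\<exists>\<Psi>. \<Psi> 0 = a \<and> (\<forall>z. (\<Psi> has_real_derivative P (\<Psi> z)) (at z)) \<and> (\<forall>z. s < \<Psi> z) \<and> (\<forall>\<eta>>0. \<exists>Z. \<forall>z\<le>-Z. \<Psi> z < s + \<eta>)"
    proof (rule orbit_right[OF P_isCont P_pos C(1) _ 1])
      show "P x \<le> C * (x - s)" if "s < x" for x using C(2)[of x] that abs_ge_self[of "P x"] by simp
    qed
    then obtain \<Psi> where p: "\<Psi> 0 = a" "\<And>z. (\<Psi> has_real_derivative P (\<Psi> z)) (at z)" "\<And>z. s < \<Psi> z"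
      "\<And>\<eta>. \<eta> > 0 \<Longrightarrow> \<exists>Z. \<forall>z\<le>-Z. \<Psi> z < s + \<eta>" by blast
    have "\<exists>Z. \<forall>z\<le>-Z. \<bar>\<Psi> z - s\<bar> < \<eta>" if \<eta>: "\<eta> > 0" for \<eta>
    proof -
      obtain Z where "\<And>z. z \<le> - Z \<Longrightarrow> \<Psi> z < s + \<eta>" using p(4)[OF \<eta>] by blast
      moreover have "\<bar>\<Psi> z - s\<bar> = \<Psi> z - s" "\<bar>2 * s - \<Psi> z - s\<bar> = \<Psi> z - s" for z using p(3)[of z] by auto
      ultimately show ?thesis by (intro exI[of _ Z]) (auto simp: diff_less_eq add.commute)
    qed
    then show ?thesis using p(1-3) 1 by (intro exI[of _ \<Psi>]) auto
  next
    case 2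
    then show ?thesis using P_s by (intro exI[of _ "\<lambda>_. s"]) auto
  next
    case 3
    \<comment> \<open>Starts below \<open>s\<close> are reduced to starts above by reflecting the
      line in \<open>s\<close>.\<close>
    define R where "R x = - P (2 * s - x)" for x
    have "\<exists>\<Psi>. \<Psi> 0 = 2 * s - a \<and> (\<forall>z. (\<Psi> has_real_derivative R (\<Psi> z)) (at z)) \<and> (\<forall>z. s < \<Psi> z) \<and> (\<forall>\<eta>>0. \<exists>Z. \<forall>z\<le>-Z. \<Psi> z < s + \<eta>)"
    proof (rule orbit_right)
      show "isCont R x" for x
        unfolding R_def[abs_def] by (intro isCont_minus isCont_o2[OF _ P_isCont, where f = "\<lambda>x. 2 * s - x"] continuous_intros)
      show "0 < R x" if "s < x" for x unfolding R_def using P_neg[of "2 * s - x"] that by simp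
      show "R x \<le> C * (x - s)" if "s < x" for x using C(2)[of "2 * s - x"] that by (simp add: R_def abs_le_iff)
    qed (use C 3 in auto)
    then obtain \<Psi> where p: "\<Psi> 0 = 2 * s - a" "\<And>z. (\<Psi> has_real_derivative R (\<Psi> z)) (at z)" "\<And>z. s < \<Psi> z"
      "\<And>\<eta>. \<eta> > 0 \<Longrightarrow> \<exists>Z. \<forall>z\<le>-Z. \<Psi> z < s + \<eta>" by blast
    have "((\<lambda>z. 2 * s - \<Psi> z) has_real_derivative P (2 * s - \<Psi> z)) (at z)" for z
      using p(2)[of z] by (auto intro!: derivative_eq_intros simp: R_def)
    moreover have "\<exists>Z. \<forall>z\<le>-Z. \<bar>2 * s - \<Psi> z - s\<bar> < \<eta>" if \<eta>: "\<eta> > 0" for \<eta>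
    proof -
      obtain Z where "\<And>z. z \<le> - Z \<Longrightarrow> \<Psi> z < s + \<eta>" using p(4)[OF \<eta>] by blast
      moreover have "\<bar>\<Psi> z - s\<bar> = \<Psi> z - s" "\<bar>2 * s - \<Psi> z - s\<bar> = \<Psi> z - s" for z using p(3)[of z] by auto
      ultimately show ?thesis by (intro exI[of _ Z]) (auto simp: diff_less_eq add.commute)
    qed
    ultimately show ?thesis using p 3 by (intro exI[of _ "\<lambda>z. 2 * s - \<Psi> z"]) auto
  qed
qed

definition orbit :: "real \<Rightarrow> real \<Rightarrow> real" where
  "orbit a = (SOME \<Psi>. \<Psi> 0 = a \<and> (\<forall>z. (\<Psi> has_real_derivative P (\<Psi> z)) (at z))
     \<and> (\<forall>z. (s < a \<longrightarrow> s < \<Psi> z) \<and> (a < s \<longrightarrow> \<Psi> z < s) \<and> (a = s \<longrightarrow> \<Psi> z = s))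
     \<and> (\<forall>\<eta>>0. \<exists>Z. \<forall>z\<le>-Z. \<bar>\<Psi> z - s\<bar> < \<eta>))"

lemma orbit_0: "orbit a 0 = a"
  and orbit_deriv: "(orbit a has_real_derivative P (orbit a z)) (at z)"
  and orbit_side: "s < a \<Longrightarrow> s < orbit a z" "a < s \<Longrightarrow> orbit a z < s" "a = s \<Longrightarrow> orbit a z = s"
  and orbit_limit: "\<eta> > 0 \<Longrightarrow> \<exists>Z. \<forall>z\<le>-Z. \<bar>orbit a z - s\<bar> < \<eta>"
  using someI_ex[OF orbit_exists[of a]] unfolding orbit_def by blast+

text \<open>The second derivative is \<open>P' * P\<close> along the orbit, and differentiating the
  energy relation turns this into \<open>- \<gamma> / D\<close>. At \<open>s\<close> the root need
  not be differentiable; but an orbit meets \<open>s\<close> only if it is constant.\<close>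

lemma orbit_has_d2:
  assumes "lo < orbit a z" "orbit a z < hi"
  shows "has_d2 (orbit a) z (- \<gamma> (orbit a z) / D)"
proof (cases "a = s")
  case True
  then have "orbit a = (\<lambda>z. s)" using orbit_side(3) by blast
  then show ?thesis using has_d2_const zero by simp
next
  case False
  let ?x = "orbit a z"
  have ne: "?x \<noteq> s" using False orbit_side(1,2)[of a z] by (cases a s rule: linorder_cases) auto
  have Pd: "(P has_real_derivative - \<gamma> ?x / (D * slope D \<gamma> s ?x)) (at ?x)"
    by (rule has_field_derivative_transform_within_open[OF slope_deriv, of ?x "{lo<..<hi}"]) (use assms ne P_eq in auto)
  have sl: "slope D \<gamma> s ?x \<noteq> 0"
    using slope_pos[of ?x] slope_neg[of ?x] assms ne by (cases ?x s rule: linorder_cases) auto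
  have "((\<lambda>z. P (orbit a z)) has_real_derivative - \<gamma> ?x / (D * slope D \<gamma> s ?x) * P ?x) (at z)"
    by (rule DERIV_chain2[OF Pd orbit_deriv])
  moreover have "- \<gamma> ?x / (D * slope D \<gamma> s ?x) * P ?x = - \<gamma> ?x / D" using sl assms by (simp add: P_eq)
  ultimately show ?thesis using orbit_deriv by (intro has_d2I[where c' = "\<lambda>z. P (orbit a z)"]) auto
qed

text \<open>Since \<open>P\<close> is nondecreasing, orbits contract backwards.\<close>

lemma orbit_contract: "(orbit a z' - orbit b z')\<^sup>2 \<le> (orbit a z - orbit b z)\<^sup>2" if "z' \<le> z"
proof (rule nondecreasing_of_derivative[OF that, of "\<lambda>z. (orbit a z - orbit b z)\<^sup>2"])
  fix w
  have "((\<lambda>z. (orbit a z - orbit b z)\<^sup>2) has_real_derivative 2 * (orbit a w - orbit b w) * (P (orbit a w) - P (orbit b w))) (at w)"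
    by (auto intro!: derivative_eq_intros orbit_deriv)
  moreover have "0 \<le> (orbit a w - orbit b w) * (P (orbit a w) - P (orbit b w))"
    using P_mono[of "orbit a w" "orbit b w"] P_mono[of "orbit b w" "orbit a w"]
    by (cases "orbit a w \<le> orbit b w") (auto intro: mult_nonneg_nonneg mult_nonpos_nonpos)
  then have "0 \<le> 2 * (orbit a w - orbit b w) * (P (orbit a w) - P (orbit b w))"
    unfolding mult.assoc by (rule mult_nonneg_nonneg[OF zero_le_numeral])
  ultimately show "\<exists>y. ((\<lambda>z. (orbit a z - orbit b z)\<^sup>2) has_real_derivative y) (at w) \<and> 0 \<le> y" by blast
qed

lemma orbit_nonexpansive: "z \<le> 0 \<Longrightarrow> \<bar>orbit a z - orbit b z\<bar> \<le> \<bar>a - b\<bar>"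
  using orbit_contract[of z 0 a b] by (simp add: orbit_0 abs_le_square_iff)

text \<open>If the order were reversed at \<open>z\<close>, the two orbits would meet between
  \<open>z\<close> and 0, and by contraction they would coincide from there backwards.\<close>

lemma orbit_mono: "orbit a z \<le> orbit b z" if ab: "a \<le> b" and z: "z \<le> 0"
proof (rule ccontr)
  assume n: "\<not> orbit a z \<le> orbit b z"
  have "isCont (\<lambda>z. orbit b z - orbit a z) w" for w
    using orbit_deriv DERIV_isCont by (intro continuous_intros) blast+
  then obtain w where w: "z \<le> w" "w \<le> 0" "orbit b w - orbit a w = 0"
    using IVT[of "\<lambda>z. orbit b z - orbit a z" z 0 0] n ab z by (auto simp: orbit_0)
  then have "(orbit a z - orbit b z)\<^sup>2 \<le> 0" using orbit_contract[OF w(1), of a b] by simp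
  then show False using n by simp
qed

lemma orbit_upper: "orbit a z \<le> max s a" if "z \<le> 0"
proof (cases "s < a")
  case True
  have "orbit a z \<le> orbit a 0"
  proof (rule nondecreasing_of_derivative[OF that])
    fix w
    have "0 \<le> P (orbit a w)" using P_pos[OF orbit_side(1)[OF True, of w]] by simp
    then show "\<exists>y. (orbit a has_real_derivative y) (at w) \<and> 0 \<le> y" using orbit_deriv[of a w] by blast
  qed
  then show ?thesis by (simp add: orbit_0)
next
  case False
  then show ?thesis using orbit_side(2,3)[of a z] by (cases "a = s") auto
qed

lemma orbit_lower: "min s a \<le> orbit a z" if "z \<le> 0"
proof (cases "a < s")
  case True
  have "- orbit a z \<le> - orbit a 0"
  proof (rule nondecreasing_of_derivative[OF that])
    fix w
    have "0 \<le> - P (orbit a w)" using P_neg[OF orbit_side(2)[OF True, of w]] by simp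
    then show "\<exists>y. ((\<lambda>z. - orbit a z) has_real_derivative y) (at w) \<and> 0 \<le> y"
      using DERIV_minus[OF orbit_deriv[of a w]] by blast
  qed
  then show ?thesis by (simp add: orbit_0)
next
  case False
  then show ?thesis using orbit_side(1,3)[of a z] by (cases "a = s") auto
qed

text \<open>The alternatives of \<open>lift_subsolution\<close> for an orbit: where it is at most
  \<open>lo\<close>, and at the far end, the solution is larger anyway; inside, strictness comes
  from the positive minimum of \<open>g - \<gamma>\<close>; at \<open>z = 0\<close> either the level
  or the flux is assumed to have room.\<close>

lemma orbit_lift:
  fixes u :: "real^'m::finite \<Rightarrow> real \<Rightarrow> real \<Rightarrow> real"
  assumes hu: "half D g u q" and F: "thick F" and lipg: "loc_lipschitz g"
    and g\<gamma>: "\<And>x. lo \<le> x \<Longrightarrow> x \<le> hi \<Longrightarrow> \<gamma> x < g x" and \<eta>: "\<eta> > 0"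
    and lb: "\<And>Z. eventually (\<lambda>(y, t). \<forall>z. - Z \<le> z \<longrightarrow> z \<le> 0 \<longrightarrow> lo + \<eta> \<le> u y z t) F"
    and Z: "Z > 0" and far: "eventually (\<lambda>(y, t). s + \<eta> \<le> u y (- Z) t) F" "orbit a (- Z) \<le> s + \<eta> / 2"
    and a: "a < hi" and below: "\<And>e. e > 0 \<Longrightarrow> eventually (\<lambda>(y, t). \<forall>z\<in>{- Z..0}. orbit a z - e \<le> u y z t) F"
    and \<delta>: "\<delta> > 0" "eventually (\<lambda>(y, t). a + \<delta> \<le> u y 0 t \<or> D * P a + \<delta> \<le> q y t) F"
  shows "\<exists>\<theta>>0. eventually (\<lambda>(y, t). \<forall>z\<in>{- Z..0}. orbit a z + \<theta> \<le> u y z t) F"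
proof -
  have "continuous_on {lo..hi} (\<lambda>x. g x - \<gamma> x)"
    using loc_lipschitz_isCont[OF lipg] cont by (intro continuous_at_imp_continuous_on ballI continuous_intros) auto
  then obtain x0 where x0: "x0 \<in> {lo..hi}" "\<And>x. x \<in> {lo..hi} \<Longrightarrow> g x0 - \<gamma> x0 \<le> g x - \<gamma> x"
    using continuous_attains_inf[of "{lo..hi}" "\<lambda>x. g x - \<gamma> x"] lo hi by auto
  define m where "m = g x0 - \<gamma> x0"
  have m: "m > 0" "\<And>x. lo \<le> x \<Longrightarrow> x \<le> hi \<Longrightarrow> m \<le> g x - \<gamma> x" using x0 g\<gamma>[of x0] by (auto simp: m_def)
  define d where "d = min \<delta> (min (\<eta> / 2) m)"
  have d: "d > 0" "d \<le> \<delta>" "d \<le> \<eta> / 2" "d \<le> m" using \<delta> \<eta> m by (auto simp: d_def)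
  have lbZ: "eventually (\<lambda>(y, t). \<forall>z. - Z \<le> z \<longrightarrow> z \<le> 0 \<longrightarrow> lo + \<eta> \<le> u y z t) F" by (rule lb)
  show ?thesis
  proof (rule lift_subsolution[OF hu D F lipg _ _ _ below d(1)])
    show "- Z < 0" using Z by simp
    show "continuous_on {- Z..0} (orbit a)"
      using orbit_deriv DERIV_isCont by (intro continuous_at_imp_continuous_on) blast
    show "eventually (\<lambda>(y, t). \<forall>z\<in>{- Z..0}. orbit a z + d \<le> u y z t
        \<or> (- Z < z \<and> z < 0 \<and> (\<exists>k. has_d2 (orbit a) z k \<and> d \<le> D * k + g (orbit a z)))
        \<or> (z = 0 \<and> 0 = (0::real) \<and> (\<exists>b. (orbit a has_real_derivative b) (at 0 within {..0}) \<and> D * b + d \<le> q y t))) F"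
      using lbZ far(1) \<delta>(2)
    proof eventually_elim
      case (elim p)
      obtain y t where p: "p = (y, t)" by (cases p)
      have e: "\<And>z. - Z \<le> z \<Longrightarrow> z \<le> 0 \<Longrightarrow> lo + \<eta> \<le> u y z t" "s + \<eta> \<le> u y (- Z) t" "a + \<delta> \<le> u y 0 t \<or> D * P a + \<delta> \<le> q y t"
        using elim p by auto
      show ?case unfolding p split_conv
      proof
        fix z assume "z \<in> {- Z..0}"
        then have z: "- Z \<le> z" "z \<le> 0" by auto
        consider "orbit a z \<le> lo" | "z = - Z" | "z = 0" | "lo < orbit a z" "- Z < z" "z < 0" using z by linarith
        then show "orbit a z + d \<le> u y z t
          \<or> (- Z < z \<and> z < 0 \<and> (\<exists>k. has_d2 (orbit a) z k \<and> d \<le> D * k + g (orbit a z)))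
          \<or> (z = 0 \<and> 0 = (0::real) \<and> (\<exists>b. (orbit a has_real_derivative b) (at 0 within {..0}) \<and> D * b + d \<le> q y t))"
        proof cases
          case 1
          then show ?thesis using e(1)[OF z] d(3) \<eta> by linarith
        next
          case 2
          have "orbit a (- Z) + d \<le> u y (- Z) t" using e(2) far(2) d(3) by linarith
          then show ?thesis using 2 by simp
        next
          case 3
          from e(3) show ?thesis
          proof
            assume "a + \<delta> \<le> u y 0 t"
            then have "orbit a 0 + d \<le> u y 0 t" using d(2) by (simp add: orbit_0)
            then show ?thesis using 3 by simp
          next
            assume "D * P a + \<delta> \<le> q y t"
            moreover have "(orbit a has_real_derivative P a) (at 0 within {..0})"
              using has_field_derivative_at_within[OF orbit_deriv[of a 0]] by (simp add: orbit_0)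
            ultimately show ?thesis using 3 d(2) by force
          qed
        next
          case 4
          have "orbit a z < hi" using orbit_upper[OF z(2), of a] a hi by auto
          then have "has_d2 (orbit a) z (- \<gamma> (orbit a z) / D)" "m \<le> g (orbit a z) - \<gamma> (orbit a z)"
            using 4 orbit_has_d2 m(2) by auto
          then show ?thesis using 4 D d(4) by (intro disjI2 disjI1 conjI exI[of _ "- \<gamma> (orbit a z) / D"]) auto
        qed
      qed
    qed
  qed auto
qed

text \<open>The start value is raised from far below up to \<open>a1\<close>;
  \<open>orbit_lift\<close> opens each step and \<open>orbit_nonexpansive\<close> passes to nearby
  start values. For the second claim, a flux above \<open>D * P a1\<close> would permit one more
  lift at \<open>a1\<close> itself, and the eventual lower bound at the interface could be
  increased, contrary to its maximality.\<close>

lemma orbit_below: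
  fixes u :: "real^'m::finite \<Rightarrow> real \<Rightarrow> real \<Rightarrow> real"
  assumes hu: "half D g u q" and F: "thick F" and lipg: "loc_lipschitz g"
    and g\<gamma>: "\<And>x. lo \<le> x \<Longrightarrow> x \<le> hi \<Longrightarrow> \<gamma> x < g x" and \<eta>: "\<eta> > 0"
    and lb: "\<And>Z. eventually (\<lambda>(y, t). \<forall>z. - Z \<le> z \<longrightarrow> z \<le> 0 \<longrightarrow> lo + \<eta> \<le> u y z t) F"
    and far: "\<And>Z. Z \<ge> Z0 \<Longrightarrow> eventually (\<lambda>(y, t). s + \<eta> \<le> u y (- Z) t) F"
    and a1: "a1 < hi" and level: "\<And>a. a < a1 \<Longrightarrow> eventually (\<lambda>(y, t). a \<le> u y 0 t) F"
  shows "\<forall>Z e. e > 0 \<longrightarrow> eventually (\<lambda>(y, t). \<forall>z\<in>{- Z..0}. orbit a1 z - e \<le> u y z t) F"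
    and "(\<And>\<theta>. \<theta> > 0 \<Longrightarrow> \<not> eventually (\<lambda>(y, t). a1 + \<theta> \<le> u y 0 t) F) \<Longrightarrow> \<mu> \<ge> 0 \<Longrightarrow>
       (\<And>e. e > 0 \<Longrightarrow> eventually (\<lambda>(y, t). q0 - e - \<mu> * (u y 0 t - a1) \<le> q y t) F) \<Longrightarrow> q0 \<le> D * P a1"
proof -
  obtain Z1 where Z1: "\<And>z. z \<le> - Z1 \<Longrightarrow> \<bar>orbit a1 z - s\<bar> < \<eta> / 2" using orbit_limit[of "\<eta> / 2" a1] \<eta> by auto
  have main: "(\<forall>e>0. eventually (\<lambda>(y, t). \<forall>z\<in>{- Z..0}. orbit a1 z - e \<le> u y z t) F) \<and>
     orbit a1 (- Z) \<le> s + \<eta> / 2 \<and> eventually (\<lambda>(y, t). s + \<eta> \<le> u y (- Z) t) F"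
    if Z: "Z \<ge> max 1 (max Z0 Z1)" for Z
  proof -
    define R where "R a \<longleftrightarrow> (\<forall>e>0. eventually (\<lambda>(y, t). \<forall>z\<in>{- Z..0}. orbit a z - e \<le> u y z t) F)" for a
    \<comment> \<open>\<open>P\<close> is bounded below by \<open>P lo\<close>, so over a length
      \<open>Z\<close> an orbit rises backwards by at most \<open>\<bar>P lo\<bar> * Z\<close>.
      Started at \<open>a0\<close> it stays at most \<open>lo\<close>, below the solution.\<close>
    define a0 where "a0 = min a1 (lo - \<bar>P lo\<bar> * Z)"
    have farZ: "eventually (\<lambda>(y, t). s + \<eta> \<le> u y (- Z) t) F" using far Z by auto
    have oZ: "orbit a (- Z) \<le> s + \<eta> / 2" if "a \<le> a1" for a
    proof -
      have "orbit a (- Z) \<le> orbit a1 (- Z)" using that Z by (intro orbit_mono) auto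
      moreover have "\<bar>orbit a1 (- Z) - s\<bar> < \<eta> / 2" using Z by (intro Z1) auto
      ultimately show ?thesis by linarith
    qed
    have lbZ: "eventually (\<lambda>(y, t). \<forall>z\<in>{- Z..0}. lo + \<eta> \<le> u y z t) F"
      using lb[of Z] by (rule eventually_mono) auto
    have "R a1"
    proof (rule real_continuation[of a0 a1 R])
      show "a0 \<le> a1" by (simp add: a0_def)
      show "R a0" unfolding R_def
      proof (intro allI impI)
        fix e :: real assume "e > 0"
        have ol: "orbit a0 z \<le> lo" if z: "z \<in> {- Z..0}" for z
        proof -
          have "orbit a0 z + \<bar>P lo\<bar> * z \<le> orbit a0 0 + \<bar>P lo\<bar> * 0"
          proof (rule nondecreasing_of_derivative[of z 0 "\<lambda>z. orbit a0 z + \<bar>P lo\<bar> * z"])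
            fix w
            have "P lo \<le> P (orbit a0 w)"
            proof (cases "lo \<le> orbit a0 w")
              case False
              then show ?thesis using lo hi by (simp add: P_def min_def max_def)
            qed (rule P_mono)
            then have "0 \<le> P (orbit a0 w) + \<bar>P lo\<bar>" by linarith
            moreover have "((\<lambda>z. orbit a0 z + \<bar>P lo\<bar> * z) has_real_derivative P (orbit a0 w) + \<bar>P lo\<bar>) (at w)"
              by (auto intro!: derivative_eq_intros orbit_deriv)
            ultimately show "\<exists>y. ((\<lambda>z. orbit a0 z + \<bar>P lo\<bar> * z) has_real_derivative y) (at w) \<and> 0 \<le> y" by blast
          qed (use z in auto)
          moreover have "- \<bar>P lo\<bar> * z \<le> \<bar>P lo\<bar> * Z" using z mult_left_mono[of "- z" Z "\<bar>P lo\<bar>"] by simp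
          moreover have "a0 \<le> lo - \<bar>P lo\<bar> * Z" by (simp add: a0_def)
          ultimately show ?thesis by (simp add: orbit_0)
        qed
        show "eventually (\<lambda>(y, t). \<forall>z\<in>{- Z..0}. orbit a0 z - e \<le> u y z t) F"
          using lbZ by eventually_elim (use ol \<eta> \<open>e > 0\<close> in \<open>fastforce\<close>)
      qed
      show "R h" if h: "a0 < h" "h \<le> a1" "\<And>h'. a0 \<le> h' \<Longrightarrow> h' < h \<Longrightarrow> R h'" for h
        unfolding R_def
      proof (intro allI impI)
        fix e :: real assume e: "e > 0"
        define h' where "h' = max a0 (h - e / 2)"
        have h': "a0 \<le> h'" "h' < h" "h - h' \<le> e / 2" using h(1) e unfolding h'_def by linarith+
        have "orbit h z - e \<le> orbit h' z - e / 2" if "z \<le> 0" for z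
          using orbit_nonexpansive[OF that, of h h'] h' by linarith
        moreover have "eventually (\<lambda>(y, t). \<forall>z\<in>{- Z..0}. orbit h' z - e / 2 \<le> u y z t) F"
          using h(3)[OF h'(1,2)] e unfolding R_def by simp
        ultimately show "eventually (\<lambda>(y, t). \<forall>z\<in>{- Z..0}. orbit h z - e \<le> u y z t) F"
          by (auto elim!: eventually_mono) (meson atLeastAtMost_iff order_trans)
      qed
      show "\<exists>\<theta>>0. \<forall>h'. h \<le> h' \<longrightarrow> h' \<le> h + \<theta> \<longrightarrow> R h'" if h: "a0 \<le> h" "h < a1" "R h" for h
      proof -
        have "eventually (\<lambda>(y, t). (h + a1) / 2 \<le> u y 0 t) F" using h by (intro level) simp
        then have "eventually (\<lambda>(y, t). h + (a1 - h) / 2 \<le> u y 0 t \<or> D * P h + (a1 - h) / 2 \<le> q y t) F"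
          by eventually_elim (auto simp: field_simps)
        then have "\<exists>\<theta>>0. eventually (\<lambda>(y, t). \<forall>z\<in>{- Z..0}. orbit h z + \<theta> \<le> u y z t) F"
          by (intro orbit_lift[where \<eta> = \<eta> and \<delta> = "(a1 - h) / 2", OF hu F lipg])
            (use g\<gamma> \<eta> lb farZ oZ h Z a1 in \<open>auto simp: R_def\<close>)
        then obtain \<theta> where \<theta>: "\<theta> > 0" "eventually (\<lambda>(y, t). \<forall>z\<in>{- Z..0}. orbit h z + \<theta> \<le> u y z t) F" by blast
        have "R h'" if h': "h \<le> h'" "h' \<le> h + \<theta>" for h'
          unfolding R_def
        proof (intro allI impI)
          fix e :: real assume e: "e > 0"
          have "orbit h' z - e \<le> orbit h z + \<theta>" if "z \<le> 0" for z
            using orbit_nonexpansive[OF that, of h' h] h' e by linarith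
          then show "eventually (\<lambda>(y, t). \<forall>z\<in>{- Z..0}. orbit h' z - e \<le> u y z t) F"
            using \<theta>(2) by (auto elim!: eventually_mono) (meson atLeastAtMost_iff order_trans)
        qed
        then show ?thesis using \<theta>(1) by blast
      qed
    qed
    then show ?thesis using farZ oZ[of a1] by (simp add: R_def)
  qed
  show "\<forall>Z e. e > 0 \<longrightarrow> eventually (\<lambda>(y, t). \<forall>z\<in>{- Z..0}. orbit a1 z - e \<le> u y z t) F"
  proof (intro allI impI)
    fix Z e :: real assume "e > 0"
    then have "eventually (\<lambda>(y, t). \<forall>z\<in>{- (max Z (max 1 (max Z0 Z1)))..0}. orbit a1 z - e \<le> u y z t) F"
      using main[of "max Z (max 1 (max Z0 Z1))"] by simp
    then show "eventually (\<lambda>(y, t). \<forall>z\<in>{- Z..0}. orbit a1 z - e \<le> u y z t) F"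
      by (rule eventually_mono) auto
  qed
  assume top: "\<And>\<theta>. \<theta> > 0 \<Longrightarrow> \<not> eventually (\<lambda>(y, t). a1 + \<theta> \<le> u y 0 t) F" and \<mu>: "\<mu> \<ge> 0"
    and fl: "\<And>e. e > 0 \<Longrightarrow> eventually (\<lambda>(y, t). q0 - e - \<mu> * (u y 0 t - a1) \<le> q y t) F"
  show "q0 \<le> D * P a1"
  proof (rule ccontr)
    assume "\<not> q0 \<le> D * P a1"
    then have n: "q0 - D * P a1 > 0" by simp
    \<comment> \<open>While \<open>u\<close> is below \<open>a1 + \<delta>\<close>, the flux is at
      least \<open>q0 - \<delta> - \<mu> * \<delta>\<close>, which for this \<delta> equals
      \<open>D * P a1 + \<delta>\<close>.\<close>
    define \<delta> where "\<delta> = (q0 - D * P a1) / (2 + \<mu>)"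
    have \<delta>: "\<delta> > 0" using n \<mu> by (simp add: \<delta>_def)
    have \<delta>2: "(2 + \<mu>) * \<delta> = q0 - D * P a1" using \<mu> by (simp add: \<delta>_def)
    define Z where "Z = max 1 (max Z0 Z1)"
    have "eventually (\<lambda>(y, t). a1 + \<delta> \<le> u y 0 t \<or> D * P a1 + \<delta> \<le> q y t) F"
      using fl[OF \<delta>]
    proof eventually_elim
      case (elim p)
      obtain y t where p: "p = (y, t)" by (cases p)
      have f: "q0 - \<delta> - \<mu> * (u y 0 t - a1) \<le> q y t" using elim p by simp
      have "D * P a1 + \<delta> \<le> q y t" if "u y 0 t < a1 + \<delta>"
      proof -
        have "\<mu> * (u y 0 t - a1) \<le> \<mu> * \<delta>" using that \<mu> by (intro mult_left_mono) auto
        then show ?thesis using f \<delta>2 by (simp add: algebra_simps)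
      qed
      then show ?case using p by force
    qed
    moreover have Z: "Z \<ge> max 1 (max Z0 Z1)" by (simp add: Z_def)
    ultimately have "\<exists>\<theta>>0. eventually (\<lambda>(y, t). \<forall>z\<in>{- Z..0}. orbit a1 z + \<theta> \<le> u y z t) F"
      by (intro orbit_lift[where \<eta> = \<eta> and \<delta> = \<delta>, OF hu F lipg])
        (use g\<gamma> \<eta> lb main[OF Z] a1 \<delta> in \<open>auto\<close>)
    then obtain \<theta> where "\<theta> > 0" "eventually (\<lambda>(y, t). \<forall>z\<in>{- Z..0}. orbit a1 z + \<theta> \<le> u y z t) F" by blast
    moreover have "0 \<in> {- Z..0}" by (simp add: Z_def)
    ultimately have "eventually (\<lambda>(y, t). a1 + \<theta> \<le> u y 0 t) F"
      by (auto elim!: eventually_mono simp: orbit_0 dest!: bspec[where x = 0])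
    then show False using top \<open>\<theta> > 0\<close> by blast
  qed
qed

end

section \<open>Strictly lowered nonlinearities\<close>

definition sign_change :: "(real \<Rightarrow> real) \<Rightarrow> real \<Rightarrow> real \<Rightarrow> real \<Rightarrow> bool" where
  "sign_change g lo S hi \<longleftrightarrow> loc_lipschitz g \<and> lo < S \<and> S < hi \<and> g S = 0
     \<and> (\<forall>x. lo \<le> x \<longrightarrow> x < S \<longrightarrow> 0 < g x) \<and> (\<forall>x. S < x \<longrightarrow> x \<le> hi \<longrightarrow> g x < 0)"

text \<open>Lies strictly below \<open>g\<close>, with the zero moved from \<open>S\<close> to \<open>S - \<delta>\<close>; hence its profiles are strict
  subsolutions for \<open>g\<close>.\<close>

definition lowered :: "real \<Rightarrow> (real \<Rightarrow> real) \<Rightarrow> real \<Rightarrow> real \<Rightarrow> real" where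
  "lowered \<delta> g S x = max (g x) 0 * ((1 - \<delta>) * min 1 (max 0 ((S - \<delta> - x) / \<delta>))) + min (g x) 0 - \<delta> * max 0 (x - (S - \<delta>))"

lemma sign_change_lipschitz:
  assumes "sign_change g lo S hi"
  shows "\<exists>L\<ge>0. \<forall>x. lo \<le> x \<longrightarrow> x \<le> hi \<longrightarrow> \<bar>g x\<bar> \<le> L * \<bar>x - S\<bar>"
proof -
  have g: "loc_lipschitz g" "lo < S" "S < hi" "g S = 0" using assms by (auto simp: sign_change_def)
  obtain L where L: "L \<ge> 0" "\<And>x y. \<bar>x\<bar> \<le> \<bar>lo\<bar> + \<bar>hi\<bar> \<Longrightarrow> \<bar>y\<bar> \<le> \<bar>lo\<bar> + \<bar>hi\<bar> \<Longrightarrow> \<bar>g x - g y\<bar> \<le> L * \<bar>x - y\<bar>"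
    using loc_lipschitz_on[OF g(1)] by blast
  have "\<bar>g x\<bar> \<le> L * \<bar>x - S\<bar>" if "lo \<le> x" "x \<le> hi" for x
    using L(2)[of x S] that g by auto
  then show ?thesis using L(1) by blast
qed

lemma sign_change_bounded:
  assumes "sign_change g lo S hi"
  shows "\<exists>M\<ge>0. \<forall>x. lo \<le> x \<longrightarrow> x \<le> hi \<longrightarrow> \<bar>g x\<bar> \<le> M"
proof -
  have g: "lo < S" "S < hi" using assms by (auto simp: sign_change_def)
  obtain L where L: "L \<ge> 0" "\<And>x. lo \<le> x \<Longrightarrow> x \<le> hi \<Longrightarrow> \<bar>g x\<bar> \<le> L * \<bar>x - S\<bar>"
    using sign_change_lipschitz[OF assms] by blast
  have "\<bar>g x\<bar> \<le> L * (hi - lo)" if "lo \<le> x" "x \<le> hi" for x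
    by (rule order_trans[OF L(2)[OF that]]) (use L(1) g that in \<open>auto intro!: mult_left_mono\<close>)
  then show ?thesis using L(1) g by (intro exI[of _ "L * (hi - lo)"]) auto
qed

lemma profile_sign_change:
  assumes "sign_change g lo S hi" "D > 0"
  shows "profile D g lo S hi"
proof -
  obtain L where "\<And>x. lo \<le> x \<Longrightarrow> x \<le> hi \<Longrightarrow> \<bar>g x\<bar> \<le> L * \<bar>x - S\<bar>" using sign_change_lipschitz[OF assms(1)] by blast
  then show ?thesis using assms loc_lipschitz_isCont unfolding sign_change_def by unfold_locales auto
qed

lemma lowered_less:
  assumes g: "sign_change g lo S hi" and \<delta>: "0 < \<delta>" "\<delta> < 1" and x: "lo \<le> x" "x \<le> hi"
  shows "lowered \<delta> g S x < g x"
proof -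
  define m where "m = min 1 (max 0 ((S - \<delta> - x) / \<delta>))"
  have m: "0 \<le> m" "m \<le> 1" by (auto simp: m_def)
  have gs: "x < S \<Longrightarrow> 0 < g x" "g S = 0" "S < x \<Longrightarrow> g x < 0" using g x by (auto simp: sign_change_def)
  have eq: "lowered \<delta> g S x = max (g x) 0 * ((1 - \<delta>) * m) + min (g x) 0 - \<delta> * max 0 (x - (S - \<delta>))"
    by (simp add: lowered_def m_def)
  show ?thesis
  proof (cases "x < S")
    case True
    have "(1 - \<delta>) * m \<le> (1 - \<delta>) * 1" using m \<delta> by (intro mult_left_mono) auto
    then have "(1 - \<delta>) * m < 1" using \<delta> unfolding mult_1_right by linarith
    then have "g x * ((1 - \<delta>) * m) < g x * 1" using gs(1)[OF True] by (intro mult_strict_left_mono)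
    moreover have "0 \<le> \<delta> * max 0 (x - (S - \<delta>))" using \<delta> by simp
    moreover have e: "max (g x) 0 = g x" "min (g x) 0 = 0" using gs(1)[OF True] by auto
    ultimately show ?thesis unfolding eq e by linarith
  next
    case False
    then have "g x \<le> 0" using gs by (cases "x = S") auto
    moreover have "0 < \<delta> * max 0 (x - (S - \<delta>))" using \<delta> False by simp
    ultimately show ?thesis by (simp add: eq)
  qed
qed

text \<open>The linear cut-off makes the positive part vanish linearly at the new zero
  \<open>S - \<delta>\<close>, and the subtracted linear term makes the function negative right of
  it; both are at most linear there, as a profile requires.\<close>

lemma profile_lowered:
  assumes g: "sign_change g lo S hi" and D: "D > 0" and \<delta>: "0 < \<delta>" "\<delta> < 1" "\<delta> < S - lo"
  shows "profile D (lowered \<delta> g S) lo (S - \<delta>) hi"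
proof
  obtain M where M: "M \<ge> 0" "\<And>x. lo \<le> x \<Longrightarrow> x \<le> hi \<Longrightarrow> \<bar>g x\<bar> \<le> M" using sign_change_bounded[OF g] by blast
  obtain L where L: "L \<ge> 0" "\<And>x. lo \<le> x \<Longrightarrow> x \<le> hi \<Longrightarrow> \<bar>g x\<bar> \<le> L * \<bar>x - S\<bar>" using sign_change_lipschitz[OF g] by blast
  note gb = M(1) L(1) M(2) L(2)
  have gg: "loc_lipschitz g" "lo < S" "S < hi" "g S = 0" "\<And>x. lo \<le> x \<Longrightarrow> x < S \<Longrightarrow> 0 < g x" "\<And>x. S < x \<Longrightarrow> x \<le> hi \<Longrightarrow> g x < 0"
    using g by (auto simp: sign_change_def)
  show "D > 0" "lo < S - \<delta>" "S - \<delta> < hi" using D \<delta> gg by auto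
  show "isCont (lowered \<delta> g S) x" for x
    unfolding lowered_def[abs_def] using loc_lipschitz_isCont[OF gg(1)] \<delta> by (intro continuous_intros) auto
  show "0 < lowered \<delta> g S x" if x: "lo \<le> x" "x < S - \<delta>" for x
  proof -
    have "0 < min 1 (max 0 ((S - \<delta> - x) / \<delta>))" using x \<delta> by simp
    then show ?thesis using gg(5)[of x] x \<delta> by (simp add: lowered_def)
  qed
  have right: "lowered \<delta> g S x = min (g x) 0 - \<delta> * (x - (S - \<delta>))" if "S - \<delta> \<le> x" for x
  proof -
    have "(S - \<delta> - x) / \<delta> \<le> 0" using that \<delta> by (simp add: divide_nonpos_pos)
    then show ?thesis using that by (simp add: lowered_def)
  qed
  show "lowered \<delta> g S x < 0" if x: "S - \<delta> < x" "x \<le> hi" for x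
  proof -
    have "0 < \<delta> * (x - (S - \<delta>))" using x \<delta> by simp
    then show ?thesis using right[of x] x by simp
  qed
  show "\<exists>K. \<forall>x. lo \<le> x \<longrightarrow> x \<le> hi \<longrightarrow> \<bar>lowered \<delta> g S x\<bar> \<le> K * \<bar>x - (S - \<delta>)\<bar>"
  proof (intro exI allI impI)
    fix x assume x: "lo \<le> x" "x \<le> hi"
    have "\<bar>lowered \<delta> g S x\<bar> \<le> (M / \<delta> + L + \<delta>) * \<bar>x - (S - \<delta>)\<bar>"
    proof (cases "x < S - \<delta>")
      case True
      define m where "m = min 1 (max 0 ((S - \<delta> - x) / \<delta>))"
      have m: "0 \<le> m" "m \<le> (S - \<delta> - x) / \<delta>" using True \<delta> by (auto simp: m_def)
      have gx: "0 < g x" "g x \<le> M" using gg(5)[of x] gb(3)[OF x] True \<delta> x by auto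
      have "lowered \<delta> g S x = g x * ((1 - \<delta>) * m)" using gx True by (simp add: lowered_def m_def)
      moreover have "0 \<le> g x * ((1 - \<delta>) * m)" using gx m \<delta> by simp
      moreover have "g x * ((1 - \<delta>) * m) \<le> M * (1 * ((S - \<delta> - x) / \<delta>))"
        using gx m \<delta> gb by (intro mult_mono mult_nonneg_nonneg) auto
      moreover have "M * (1 * ((S - \<delta> - x) / \<delta>)) = M / \<delta> * \<bar>x - (S - \<delta>)\<bar>" using True by simp
      moreover have "M / \<delta> * \<bar>x - (S - \<delta>)\<bar> \<le> (M / \<delta> + L + \<delta>) * \<bar>x - (S - \<delta>)\<bar>"
        using gb \<delta> by (intro mult_right_mono) auto
      ultimately show ?thesis by linarith
    next
      case False
      have "\<bar>min (g x) 0\<bar> \<le> L * (x - (S - \<delta>))"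
      proof (cases "S < x")
        case True
        then have "\<bar>min (g x) 0\<bar> \<le> L * (x - S)" using gb(4)[OF x] gg(6)[OF True x(2)] by simp
        also have "\<dots> \<le> L * (x - (S - \<delta>))" using gb \<delta> by (intro mult_left_mono) auto
        finally show ?thesis .
      next
        case f: False
        then have "0 \<le> g x" using gg(4) gg(5)[of x] x f by (cases "x = S") (auto intro: less_imp_le)
        then show ?thesis using False gb by simp
      qed
      moreover have "\<bar>lowered \<delta> g S x\<bar> \<le> \<bar>min (g x) 0\<bar> + \<delta> * (x - (S - \<delta>))"
      proof -
        have "0 \<le> \<delta> * (x - (S - \<delta>))" using False \<delta> by simp
        moreover have "lowered \<delta> g S x = min (g x) 0 - \<delta> * (x - (S - \<delta>))" using right[of x] False by simp
        ultimately show ?thesis using abs_triangle_ineq4[of "min (g x) 0" "\<delta> * (x - (S - \<delta>))"] by simp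
      qed
      moreover have "0 \<le> M / \<delta> * (x - (S - \<delta>))" using gb \<delta> False by simp
      moreover have "\<bar>x - (S - \<delta>)\<bar> = x - (S - \<delta>)" using False by simp
      ultimately show ?thesis by (simp add: distrib_right)
    qed
    then show "\<bar>lowered \<delta> g S x\<bar> \<le> (M / \<delta> + L + \<delta>) * \<bar>x - (S - \<delta>)\<bar>" .
  qed
qed

text \<open>For \<open>x \<le> S - 2 * \<delta>\<close> the cut-off equals 1 and only the factor
  \<open>1 - \<delta>\<close> matters. Between there and \<open>S\<close> the cut-off changes much,
  but \<open>g\<close> itself is at most \<open>2 * L * \<delta>\<close> by its Lipschitz bound. The
  subtracted term is of order \<delta> everywhere.\<close>

lemma lowered_close:
  assumes g: "sign_change g lo S hi"
  shows "\<exists>C\<ge>0. \<forall>\<delta> x. 0 < \<delta> \<longrightarrow> \<delta> < 1 \<longrightarrow> \<delta> < S - lo \<longrightarrow> lo \<le> x \<longrightarrow> x \<le> hi \<longrightarrow> \<bar>lowered \<delta> g S x - g x\<bar> \<le> C * \<delta>"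
proof -
  obtain M where M: "M \<ge> 0" "\<And>x. lo \<le> x \<Longrightarrow> x \<le> hi \<Longrightarrow> \<bar>g x\<bar> \<le> M" using sign_change_bounded[OF g] by blast
  obtain L where L: "L \<ge> 0" "\<And>x. lo \<le> x \<Longrightarrow> x \<le> hi \<Longrightarrow> \<bar>g x\<bar> \<le> L * \<bar>x - S\<bar>" using sign_change_lipschitz[OF g] by blast
  note gb = M(1) L(1) M(2) L(2)
  have gg: "lo < S" "S < hi" "g S = 0" "\<And>x. lo \<le> x \<Longrightarrow> x < S \<Longrightarrow> 0 < g x" "\<And>x. S < x \<Longrightarrow> x \<le> hi \<Longrightarrow> g x < 0"
    using g by (auto simp: sign_change_def)
  have "\<bar>lowered \<delta> g S x - g x\<bar> \<le> (M + 2 * L + (hi - lo)) * \<delta>" if \<delta>: "0 < \<delta>" "\<delta> < 1" "\<delta> < S - lo" and x: "lo \<le> x" "x \<le> hi" for \<delta> x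
  proof -
    define m where "m = min 1 (max 0 ((S - \<delta> - x) / \<delta>))"
    define r where "r = \<delta> * max 0 (x - (S - \<delta>))"
    have m: "0 \<le> m" "m \<le> 1" by (auto simp: m_def)
    have r: "0 \<le> r" "r \<le> (hi - lo) * \<delta>"
    proof -
      show "0 \<le> r" using \<delta> by (simp add: r_def)
      have "max 0 (x - (S - \<delta>)) \<le> hi - lo" using x \<delta> gg by auto
      then show "r \<le> (hi - lo) * \<delta>" using \<delta> by (simp add: r_def mult.commute)
    qed
    have eq: "lowered \<delta> g S x = max (g x) 0 * ((1 - \<delta>) * m) + min (g x) 0 - r" by (simp add: lowered_def m_def r_def)
    have mp: "\<bar>max (g x) 0 - max (g x) 0 * ((1 - \<delta>) * m)\<bar> \<le> (M + 2 * L) * \<delta>"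
    proof (cases "x < S")
      case True
      have gx: "0 < g x" "g x \<le> M" "g x \<le> L * (S - x)" using gg(4)[OF x(1) True] gb(3,4)[OF x] True by auto
      have f: "0 \<le> (1 - \<delta>) * m" "(1 - \<delta>) * m \<le> 1" using m \<delta> by (auto intro: mult_le_one)
      show ?thesis
      proof (cases "x \<le> S - 2 * \<delta>")
        case True
        then have "1 \<le> (S - \<delta> - x) / \<delta>" using \<delta> by (simp add: field_simps)
        then have "m = 1" by (simp add: m_def)
        then have "max (g x) 0 - max (g x) 0 * ((1 - \<delta>) * m) = g x * \<delta>" using gx by (simp add: algebra_simps)
        moreover have "g x * \<delta> \<le> M * \<delta>" "0 \<le> g x * \<delta>" "0 \<le> 2 * L * \<delta>" using gx \<delta> gb by auto
        ultimately show ?thesis by (simp add: distrib_right)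
      next
        case False
        have "g x * ((1 - \<delta>) * m) \<le> g x * 1" "0 \<le> g x * ((1 - \<delta>) * m)" using gx f by (auto intro!: mult_left_mono)
        moreover have "g x \<le> 2 * L * \<delta>"
        proof -
          have "L * (S - x) \<le> L * (2 * \<delta>)" using False gb by (intro mult_left_mono) auto
          then show ?thesis using gx(3) by simp
        qed
        moreover have "0 \<le> M * \<delta>" using gb \<delta> by simp
        ultimately show ?thesis using gx by (simp add: distrib_right)
      qed
    next
      case False
      then have "g x \<le> 0" using gg(3) gg(5)[of x] x by (cases "x = S") auto
      then show ?thesis using gb \<delta> by simp
    qed
    have "g x = max (g x) 0 + min (g x) 0" by simp
    then have "\<bar>lowered \<delta> g S x - g x\<bar> \<le> (M + 2 * L) * \<delta> + (hi - lo) * \<delta>" using mp r eq by linarith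
    then show ?thesis by (simp add: distrib_right)
  qed
  moreover have "0 \<le> M + 2 * L + (hi - lo)" using gb gg by simp
  ultimately show ?thesis by blast
qed

lemma sqrt_diff_le: "0 \<le> a \<Longrightarrow> 0 \<le> b \<Longrightarrow> \<bar>a - b\<bar> \<le> c \<Longrightarrow> \<bar>sqrt a - sqrt b\<bar> \<le> sqrt c"
proof -
  have *: "sqrt b \<le> sqrt a + sqrt c" if "0 \<le> a" "0 \<le> b" "\<bar>a - b\<bar> \<le> c" for a b
  proof -
    have "sqrt b \<le> sqrt (a + c)" using that by (intro real_sqrt_le_mono) auto
    also have "\<dots> \<le> sqrt a + sqrt c" using that by (intro sqrt_add_le_add_sqrt) auto
    finally show ?thesis .
  qed
  assume "0 \<le> a" "0 \<le> b" "\<bar>a - b\<bar> \<le> c"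
  then show ?thesis using *[of a b] *[of b a] by (simp add: abs_minus_commute abs_le_iff)
qed

text \<open>The energy differences are within order \<delta>, so their roots are within order
  \<open>sqrt \<delta>\<close>. Between \<open>S - \<delta>\<close> and \<open>S\<close> the two
  slopes have opposite signs; there both are of order \<open>sqrt \<delta>\<close> by
  themselves.\<close>

lemma slope_lowered_close:
  assumes g: "sign_change g lo S hi" and D: "D > 0" and \<kappa>: "\<kappa> > 0"
  shows "\<exists>\<delta>0>0. \<forall>\<delta>. 0 < \<delta> \<longrightarrow> \<delta> < \<delta>0 \<longrightarrow> \<delta> < 1 \<and> \<delta> < S - lo \<and>
    (\<forall>x. lo \<le> x \<longrightarrow> x \<le> hi \<longrightarrow> \<bar>slope D (lowered \<delta> g S) (S - \<delta>) x - slope D g S x\<bar> \<le> \<kappa>)"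
proof -
  obtain M where M: "M \<ge> 0" "\<And>x. lo \<le> x \<Longrightarrow> x \<le> hi \<Longrightarrow> \<bar>g x\<bar> \<le> M" using sign_change_bounded[OF g] by blast
  obtain C where C: "C \<ge> 0" "\<And>\<delta> x. 0 < \<delta> \<Longrightarrow> \<delta> < 1 \<Longrightarrow> \<delta> < S - lo \<Longrightarrow> lo \<le> x \<Longrightarrow> x \<le> hi \<Longrightarrow> \<bar>lowered \<delta> g S x - g x\<bar> \<le> C * \<delta>"
    using lowered_close[OF g] by blast
  have gg: "lo < S" "S < hi" using g by (auto simp: sign_change_def)
  interpret G: profile D g lo S hi by (rule profile_sign_change[OF g D])
  define B where "B = C * (hi - lo) + 2 * M + 1"
  have B: "B > 0" using C M gg by (simp add: B_def add_nonneg_pos)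
  \<comment> \<open>The last bound makes \<open>sqrt (2 / D * (B * \<delta>))\<close> at most
    \<kappa>/2.\<close>
  define \<delta>0 where "\<delta>0 = min 1 (min (S - lo) (\<kappa>\<^sup>2 * D / (8 * B)))"
  have \<delta>0: "\<delta>0 > 0" using gg \<kappa> D B by (simp add: \<delta>0_def)
  have lipb: "\<bar>f x - f y\<bar> \<le> c * \<bar>x - y\<bar>"
    if d: "\<And>w. (f has_real_derivative f' w) (at w)" and b: "\<And>w. lo \<le> w \<Longrightarrow> w \<le> hi \<Longrightarrow> \<bar>f' w\<bar> \<le> c"
      and xy: "lo \<le> x" "x \<le> hi" "lo \<le> y" "y \<le> hi" for f f' :: "real \<Rightarrow> real" and c x y
  proof -
    have "norm (f x - f y) \<le> c * norm (x - y)"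
      by (rule field_differentiable_bound[of "{lo..hi}" f f'])
        (use that in \<open>auto intro: has_field_derivative_at_within\<close>)
    then show ?thesis by simp
  qed
  have "\<bar>slope D (lowered \<delta> g S) (S - \<delta>) x - slope D g S x\<bar> \<le> \<kappa>"
    if \<delta>: "0 < \<delta>" "\<delta> < \<delta>0" and x: "lo \<le> x" "x \<le> hi" for \<delta> x
  proof -
    have \<delta>1: "\<delta> < 1" "\<delta> < S - lo" "\<delta> < \<kappa>\<^sup>2 * D / (8 * B)" using \<delta> by (auto simp: \<delta>0_def)
    interpret H: profile D "lowered \<delta> g S" lo "S - \<delta>" hi by (rule profile_lowered[OF g D \<delta>(1) \<delta>1(1,2)])
    \<comment> \<open>Only differences of primitives enter, so the additive constants left open by
      \<open>primitive\<close> cancel.\<close>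
    have E: "\<bar>(primitive (lowered \<delta> g S) x - primitive g x) - (primitive (lowered \<delta> g S) y - primitive g y)\<bar> \<le> C * \<delta> * \<bar>x - y\<bar>"
      if "lo \<le> x" "x \<le> hi" "lo \<le> y" "y \<le> hi" for x y
      by (rule lipb[where f' = "\<lambda>w. lowered \<delta> g S w - g w"])
        (use that C(2)[OF \<delta>(1) \<delta>1(1,2)] in \<open>auto intro!: derivative_intros primitive[OF H.cont] primitive[OF G.cont]\<close>)
    have Gl: "\<bar>primitive g x - primitive g y\<bar> \<le> M * \<bar>x - y\<bar>" if "lo \<le> x" "x \<le> hi" "lo \<le> y" "y \<le> hi" for x y
      by (rule lipb[where f' = g]) (use that M(2) primitive[OF G.cont] in auto)
    have s1: "lo \<le> S - \<delta>" "S - \<delta> \<le> hi" using \<delta> \<delta>1 gg by auto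
    have QQ: "\<bar>H.Q x - G.Q x\<bar> \<le> (C * (hi - lo) + M) * \<delta>"
    proof -
      have "C * \<delta> * \<bar>(S - \<delta>) - x\<bar> \<le> C * \<delta> * (hi - lo)" using C \<delta> s1 x by (intro mult_left_mono) auto
      then have "\<bar>(primitive (lowered \<delta> g S) (S - \<delta>) - primitive g (S - \<delta>)) - (primitive (lowered \<delta> g S) x - primitive g x)\<bar> \<le> C * \<delta> * (hi - lo)"
        using E[OF s1 x] by linarith
      moreover have "\<bar>primitive g (S - \<delta>) - primitive g S\<bar> \<le> M * \<delta>" using Gl[OF s1, of S] gg \<delta> by simp
      ultimately have "\<bar>H.Q x - G.Q x\<bar> \<le> C * \<delta> * (hi - lo) + M * \<delta>" by linarith
      then show ?thesis by (simp add: algebra_simps)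
    qed
    have Q0: "0 \<le> H.Q x" "0 \<le> G.Q x" using H.Q_nonneg[OF x] G.Q_nonneg[OF x] by auto
    define w where "w = 2 / D * (B * \<delta>)"
    have w: "sqrt w \<le> \<kappa> / 2"
    proof -
      have "B * \<delta> \<le> \<kappa>\<^sup>2 * D / 8" using \<delta>1(3) B by (simp add: field_simps)
      then have "w \<le> 2 / D * (\<kappa>\<^sup>2 * D / 8)" unfolding w_def using D by (intro mult_left_mono) auto
      also have "\<dots> = (\<kappa> / 2)\<^sup>2" using D by (simp add: power_divide)
      finally show ?thesis using \<kappa> by (intro real_le_lsqrt) auto
    qed
    have sl: "slope D (lowered \<delta> g S) (S - \<delta>) x = sgn (x - (S - \<delta>)) * sqrt (2 / D * H.Q x)"
      "slope D g S x = sgn (x - S) * sqrt (2 / D * G.Q x)" by (simp_all add: slope_def)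
    show ?thesis
    proof (cases "S - \<delta> \<le> x \<and> x \<le> S")
      case True
      have "\<bar>G.Q x\<bar> \<le> M * \<bar>S - x\<bar>" using Gl[of S x] gg x by simp
      also have "\<dots> \<le> M * \<delta>" using True M by (intro mult_left_mono) auto
      finally have g1: "G.Q x \<le> M * \<delta>" by simp
      then have "H.Q x \<le> (C * (hi - lo) + M) * \<delta> + M * \<delta>" using QQ by linarith
      moreover have "B * \<delta> = (C * (hi - lo) + M) * \<delta> + M * \<delta> + \<delta>" by (simp add: B_def algebra_simps)
      ultimately have "H.Q x \<le> B * \<delta>" using \<delta> by linarith
      moreover have "G.Q x \<le> B * \<delta>"
      proof -
        have "0 \<le> C * (hi - lo) * \<delta>" "0 \<le> M * \<delta>" using C M gg \<delta> by auto
        moreover have "B * \<delta> = C * (hi - lo) * \<delta> + 2 * (M * \<delta>) + \<delta>" by (simp add: B_def algebra_simps)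
        ultimately show ?thesis using g1 \<delta> by linarith
      qed
      ultimately have "sqrt (2 / D * H.Q x) \<le> sqrt w" "sqrt (2 / D * G.Q x) \<le> sqrt w"
        unfolding w_def using D by (auto intro!: real_sqrt_le_mono mult_left_mono divide_right_mono)
      moreover have "\<bar>slope D (lowered \<delta> g S) (S - \<delta>) x\<bar> \<le> \<kappa> / 2" "\<bar>slope D g S x\<bar> \<le> \<kappa> / 2"
        if sw: "sqrt (2 / D * H.Q x) \<le> sqrt w" "sqrt (2 / D * G.Q x) \<le> sqrt w"
      proof -
        have "\<bar>sgn c * sqrt r\<bar> \<le> \<kappa> / 2" if "0 \<le> r" "sqrt r \<le> sqrt w" for c r
        proof -
          have "sqrt r \<le> \<kappa> / 2" using that(2) w by linarith
          then show ?thesis using that(1) \<kappa> by (cases "c = 0") (auto simp: abs_mult abs_sgn_eq)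
        qed
        moreover have "0 \<le> 2 / D * H.Q x" "0 \<le> 2 / D * G.Q x" using Q0 D by auto
        ultimately show "\<bar>slope D (lowered \<delta> g S) (S - \<delta>) x\<bar> \<le> \<kappa> / 2" "\<bar>slope D g S x\<bar> \<le> \<kappa> / 2"
          unfolding sl using sw by blast+
      qed
      ultimately show ?thesis by linarith
    next
      case False
      then have sg: "sgn (x - (S - \<delta>)) = sgn (x - S)" "\<bar>sgn (x - S)\<bar> = 1" using \<delta> by (auto simp: sgn_if)
      have "\<bar>H.Q x - G.Q x\<bar> \<le> B * \<delta>"
      proof -
        have "0 \<le> M * \<delta>" using M \<delta> by simp
        moreover have "B * \<delta> = (C * (hi - lo) + M) * \<delta> + M * \<delta> + \<delta>" by (simp add: B_def algebra_simps)
        ultimately show ?thesis using QQ \<delta> by linarith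
      qed
      then have "2 / D * \<bar>H.Q x - G.Q x\<bar> \<le> w" unfolding w_def using D by (intro mult_left_mono) auto
      moreover have "\<bar>2 / D * a - 2 / D * b\<bar> = 2 / D * \<bar>a - b\<bar>" for a b
      proof -
        have "2 / D * a - 2 / D * b = 2 / D * (a - b)" by (simp only: right_diff_distrib)
        moreover have "\<bar>2 / D\<bar> = 2 / D" using D by simp
        ultimately show ?thesis by (simp only: abs_mult)
      qed
      ultimately have "\<bar>2 / D * H.Q x - 2 / D * G.Q x\<bar> \<le> w" by metis
      then have "\<bar>sqrt (2 / D * H.Q x) - sqrt (2 / D * G.Q x)\<bar> \<le> sqrt w"
        using Q0 D by (intro sqrt_diff_le) auto
      moreover have "\<bar>slope D (lowered \<delta> g S) (S - \<delta>) x - slope D g S x\<bar> = \<bar>sgn (x - S)\<bar> * \<bar>sqrt (2 / D * H.Q x) - sqrt (2 / D * G.Q x)\<bar>"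
        unfolding sl sg(1) abs_mult[symmetric] by (simp add: right_diff_distrib)
      ultimately show ?thesis using w \<kappa> sg(2) by simp
    qed
  qed
  then show ?thesis using \<delta>0 by (intro exI[of _ \<delta>0]) (auto simp: \<delta>0_def)
qed

section \<open>Trapping the solution between profiles\<close>

definition lower_env :: "real \<Rightarrow> (real \<Rightarrow> real) \<Rightarrow> real \<Rightarrow> real \<Rightarrow> real \<Rightarrow> real \<Rightarrow> real \<Rightarrow> real \<Rightarrow> real" where
  "lower_env D g lo S hi \<delta> a = profile.orbit D (lowered \<delta> g S) lo (S - \<delta>) hi a"

text \<open>Lowering moves the rest point to \<open>S - \<delta>\<close>. Deep in the medium the
  solution exceeds even \<open>S - \<delta> + \<eta>'\<close>, which is still below
  \<open>S\<close>, by \<open>lower_bound_far\<close>; that is the strict inequality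
  \<open>orbit_below\<close> needs at the far end.\<close>

lemma lower_env_below:
  fixes u :: "real^'m::finite \<Rightarrow> real \<Rightarrow> real \<Rightarrow> real"
  assumes D: "D > 0" and hu: "half D g u q" and F: "thick F" and g: "sign_change g lo S hi" and \<eta>: "\<eta> > 0"
    and lb: "\<And>Z. eventually (\<lambda>(y, t). \<forall>z. - Z \<le> z \<longrightarrow> z \<le> 0 \<longrightarrow> lo + \<eta> \<le> u y z t) F"
    and a: "a < hi" and level: "\<And>x. x < a \<Longrightarrow> eventually (\<lambda>(y, t). x \<le> u y 0 t) F"
    and \<delta>: "0 < \<delta>" "\<delta> < 1" "\<delta> < S - lo"
  shows "e > 0 \<Longrightarrow> eventually (\<lambda>(y, t). \<forall>z\<in>{- Z..0}. lower_env D g lo S hi \<delta> a z - e \<le> u y z t) F"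
    and "(\<And>\<theta>. \<theta> > 0 \<Longrightarrow> \<not> eventually (\<lambda>(y, t). a + \<theta> \<le> u y 0 t) F) \<Longrightarrow> \<mu> \<ge> 0 \<Longrightarrow> lo \<le> a \<Longrightarrow>
       (\<And>e. e > 0 \<Longrightarrow> eventually (\<lambda>(y, t). q0 - e - \<mu> * (u y 0 t - a) \<le> q y t) F) \<Longrightarrow>
       q0 \<le> D * slope D (lowered \<delta> g S) (S - \<delta>) a"
proof -
  interpret profile D "lowered \<delta> g S" lo "S - \<delta>" hi by (rule profile_lowered[OF g D \<delta>])
  have gg: "loc_lipschitz g" "lo < S" "S < hi" "\<And>x. lo \<le> x \<Longrightarrow> x < S \<Longrightarrow> 0 < g x" using g by (auto simp: sign_change_def)
  define \<eta>' where "\<eta>' = min \<eta> (\<delta> / 2)"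
  have \<eta>': "\<eta>' > 0" "\<eta>' \<le> \<eta>" "\<eta>' \<le> \<delta> / 2" using \<eta> \<delta> by (auto simp: \<eta>'_def)
  have lb': "eventually (\<lambda>(y, t). \<forall>z. - Z \<le> z \<longrightarrow> z \<le> 0 \<longrightarrow> lo + \<eta>' \<le> u y z t) F" for Z
    using lb[of Z] by (rule eventually_mono) (use \<eta>' in force)
  obtain Z0 where Z0: "\<And>Z. Z \<ge> Z0 \<Longrightarrow> eventually (\<lambda>(y, t). S - \<delta> + \<eta>' \<le> u y (- Z) t) F"
  proof -
    have "\<exists>Z0\<ge>0. \<forall>Z\<ge>Z0. eventually (\<lambda>(y, t). S - \<delta> + \<eta>' \<le> u y (- Z) t) F"
    proof (rule lower_bound_far[OF hu D F gg(1) _ _ \<eta>'(1) lb'])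
      show "lo < S - \<delta> + \<eta>'" using \<delta> \<eta>' by simp
      show "0 < g x" if "lo \<le> x" "x \<le> S - \<delta> + \<eta>'" for x using gg(4)[of x] that \<delta> \<eta>' by simp
    qed
    then show ?thesis using that by blast
  qed
  have less: "lowered \<delta> g S x < g x" if "lo \<le> x" "x \<le> hi" for x by (rule lowered_less[OF g \<delta>(1,2) that])
  note ob = orbit_below[OF hu F gg(1) less \<eta>'(1) lb' Z0 a level]
  show "eventually (\<lambda>(y, t). \<forall>z\<in>{- Z..0}. lower_env D g lo S hi \<delta> a z - e \<le> u y z t) F" if "e > 0"
    unfolding lower_env_def using ob(1) that by blast
  show "q0 \<le> D * slope D (lowered \<delta> g S) (S - \<delta>) a"
    if "\<And>\<theta>. \<theta> > 0 \<Longrightarrow> \<not> eventually (\<lambda>(y, t). a + \<theta> \<le> u y 0 t) F" "\<mu> \<ge> 0" "lo \<le> a"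
      "\<And>e. e > 0 \<Longrightarrow> eventually (\<lambda>(y, t). q0 - e - \<mu> * (u y 0 t - a) \<le> q y t) F"
  proof -
    have "q0 \<le> D * P a" by (rule ob(2)[where \<mu> = \<mu>]) (use that in auto)
    then show ?thesis using P_eq[of a] that a by simp
  qed
qed

text \<open>By \<open>level\<close> and \<open>top\<close>, \<open>a\<close> is the best eventual
  lower bound at the interface. The profile of the lowered equation through \<open>a\<close> must
  then be steep enough to carry the flux \<open>q0\<close>, and the lowering is removed in the
  limit.\<close>

lemma slope_ge_of_level:
  fixes u :: "real^'m::finite \<Rightarrow> real \<Rightarrow> real \<Rightarrow> real"
  assumes D: "D > 0" and hu: "half D g u q" and F: "thick F" and g: "sign_change g lo S hi" and \<eta>: "\<eta> > 0"
    and lb: "\<And>Z. eventually (\<lambda>(y, t). \<forall>z. - Z \<le> z \<longrightarrow> z \<le> 0 \<longrightarrow> lo + \<eta> \<le> u y z t) F"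
    and a: "lo \<le> a" "a < hi" and level: "\<And>x. x < a \<Longrightarrow> eventually (\<lambda>(y, t). x \<le> u y 0 t) F"
    and top: "\<And>\<theta>. \<theta> > 0 \<Longrightarrow> \<not> eventually (\<lambda>(y, t). a + \<theta> \<le> u y 0 t) F" and \<mu>: "\<mu> \<ge> 0"
    and fl: "\<And>e. e > 0 \<Longrightarrow> eventually (\<lambda>(y, t). q0 - e - \<mu> * (u y 0 t - a) \<le> q y t) F"
  shows "q0 \<le> D * slope D g S a"
proof (rule field_le_epsilon)
  fix e :: real assume "e > 0"
  then obtain \<delta>0 where \<delta>0: "\<delta>0 > 0" "\<And>\<delta>. 0 < \<delta> \<Longrightarrow> \<delta> < \<delta>0 \<Longrightarrow> \<delta> < 1 \<and> \<delta> < S - lo \<and>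
    (\<forall>x. lo \<le> x \<longrightarrow> x \<le> hi \<longrightarrow> \<bar>slope D (lowered \<delta> g S) (S - \<delta>) x - slope D g S x\<bar> \<le> e / D)"
    using slope_lowered_close[OF g D, of "e / D"] D by auto
  define \<delta> where "\<delta> = \<delta>0 / 2"
  have \<delta>: "0 < \<delta>" "\<delta> < 1" "\<delta> < S - lo" and c: "\<bar>slope D (lowered \<delta> g S) (S - \<delta>) a - slope D g S a\<bar> \<le> e / D"
    using \<delta>0(2)[of \<delta>] \<delta>0(1) a by (auto simp: \<delta>_def)
  have "q0 \<le> D * slope D (lowered \<delta> g S) (S - \<delta>) a"
    by (rule lower_env_below(2)[OF D hu F g \<eta> lb a(2) level \<delta> top \<mu> a(1) fl])
  also have "\<dots> \<le> D * (slope D g S a + e / D)" using c D by (intro mult_left_mono) auto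
  also have "\<dots> = D * slope D g S a + e" using D by (simp add: distrib_left)
  finally show "q0 \<le> D * slope D g S a + e" .
qed

text \<open>The inferior limit along \<open>F\<close>, written as the supremum of the eventual lower
  bounds; nontriviality of \<open>F\<close> bounds it by \<open>h\<close>.\<close>

lemma level_exists:
  assumes F: "thick F" and lb: "eventually (\<lambda>(y, t). l \<le> (w y t :: real)) F" and ub: "eventually (\<lambda>(y, t). w y t \<le> h) F"
  shows "\<exists>a. l \<le> a \<and> a \<le> h \<and> (\<forall>x<a. eventually (\<lambda>(y, t). x \<le> w y t) F)
    \<and> (\<forall>\<theta>>0. \<not> eventually (\<lambda>(y, t). a + \<theta> \<le> w y t) F)"
proof -
  define A where "A = {x. eventually (\<lambda>(y, t). x \<le> w y t) F}"
  have l: "l \<in> A" using lb by (simp add: A_def)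
  have Ah: "x \<le> h" if "x \<in> A" for x
  proof -
    have "eventually (\<lambda>_. x \<le> h) F"
      using that ub unfolding A_def mem_Collect_eq by eventually_elim (auto split: prod.splits)
    then show ?thesis using F by (simp add: thick_def)
  qed
  have bdd: "bdd_above A" using Ah by (auto simp: bdd_above_def)
  show ?thesis
  proof (intro exI[of _ "Sup A"] conjI allI impI)
    show "l \<le> Sup A" by (rule cSup_upper[OF l bdd])
    show "Sup A \<le> h" using l Ah by (intro cSup_least) auto
    show "eventually (\<lambda>(y, t). x \<le> w y t) F" if x: "x < Sup A" for x
    proof -
      have "A \<noteq> {}" using l by auto
      then obtain x' where "x' \<in> A" "x < x'" using x less_cSup_iff[OF _ bdd] by blast
      then show ?thesis unfolding A_def by (auto elim!: eventually_mono)
    qed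
    show "\<not> eventually (\<lambda>(y, t). Sup A + \<theta> \<le> w y t) F" if "\<theta> > 0" for \<theta>
    proof
      assume "eventually (\<lambda>(y, t). Sup A + \<theta> \<le> w y t) F"
      then have "Sup A + \<theta> \<le> Sup A" by (intro cSup_upper[OF _ bdd]) (simp add: A_def)
      then show False using that by simp
    qed
  qed
qed

text \<open>The eventual lower bounds \<open>a'\<close> and \<open>b'\<close> at the interface
  satisfy both flux balances as inequalities \<open>su\<close> and \<open>sv\<close>, whose sum says
  that the two weighted slopes add up to something non-negative. At the root the sum is 0. If
  \<open>a' < a\<close>, then \<open>su\<close> forces \<open>b' < b\<close>, and strict
  monotonicity of both slopes makes the sum negative. Hence \<open>a \<le> a'\<close>, and
  \<open>sv\<close> then yields \<open>b \<le> b'\<close>.\<close>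

lemma pair_lower:
  fixes u v :: "real^'m::finite \<Rightarrow> real \<Rightarrow> real \<Rightarrow> real"
  assumes pos: "D > 0" "d > 0" "\<mu> > 0" "\<nu> > 0"
    and hu: "half D g u (\<lambda>y t. \<nu> * v y 0 t - \<mu> * u y 0 t)" and hv: "half d f v (\<lambda>y t. \<mu> * u y 0 t - \<nu> * v y 0 t)"
    and F: "thick F" and g: "sign_change g lo S hi" and f: "sign_change f lo S' hi" and \<eta>: "\<eta> > 0"
    and lb: "\<And>Z. eventually (\<lambda>(y, t). \<forall>z. - Z \<le> z \<longrightarrow> z \<le> 0 \<longrightarrow> lo + \<eta> \<le> u y z t \<and> lo + \<eta> \<le> v y z t) F"
    and ub: "eventually (\<lambda>(y, t). u y 0 t \<le> hi - \<eta> \<and> v y 0 t \<le> hi - \<eta>) F"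
    and ab: "lo \<le> a" "a < hi" "lo \<le> b" "b < hi"
    and root: "D * slope D g S a = \<nu> * b - \<mu> * a" "d * slope d f S' b = \<mu> * a - \<nu> * b"
    and \<delta>: "0 < \<delta>" "\<delta> < 1" "\<delta> < S - lo" "\<delta> < S' - lo" and e: "e > 0"
  shows "eventually (\<lambda>(y, t). \<forall>z\<in>{- Z..0}. lower_env D g lo S hi \<delta> a z - e \<le> u y z t \<and> lower_env d f lo S' hi \<delta> b z - e \<le> v y z t) F"
proof -
  interpret G: profile D g lo S hi by (rule profile_sign_change[OF g pos(1)])
  interpret H: profile d f lo S' hi by (rule profile_sign_change[OF f pos(2)])
  have lbu: "eventually (\<lambda>(y, t). \<forall>z. - Z \<le> z \<longrightarrow> z \<le> 0 \<longrightarrow> lo + \<eta> \<le> u y z t) F"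
    and lbv: "eventually (\<lambda>(y, t). \<forall>z. - Z \<le> z \<longrightarrow> z \<le> 0 \<longrightarrow> lo + \<eta> \<le> v y z t) F" for Z
    by (rule eventually_mono[OF lb[of Z]], auto)+
  have "eventually (\<lambda>(y, t). lo + \<eta> \<le> u y 0 t) F" "eventually (\<lambda>(y, t). u y 0 t \<le> hi - \<eta>) F"
    by (rule eventually_mono[OF lbu[of 0]], auto) (rule eventually_mono[OF ub], auto)
  then obtain a' where a': "lo + \<eta> \<le> a'" "a' \<le> hi - \<eta>" "\<And>x. x < a' \<Longrightarrow> eventually (\<lambda>(y, t). x \<le> u y 0 t) F"
    "\<And>\<theta>. \<theta> > 0 \<Longrightarrow> \<not> eventually (\<lambda>(y, t). a' + \<theta> \<le> u y 0 t) F"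
    using level_exists[OF F, of "lo + \<eta>" "\<lambda>y t. u y 0 t" "hi - \<eta>"] by blast
  have "eventually (\<lambda>(y, t). lo + \<eta> \<le> v y 0 t) F" "eventually (\<lambda>(y, t). v y 0 t \<le> hi - \<eta>) F"
    by (rule eventually_mono[OF lbv[of 0]], auto) (rule eventually_mono[OF ub], auto)
  then obtain b' where b': "lo + \<eta> \<le> b'" "b' \<le> hi - \<eta>" "\<And>x. x < b' \<Longrightarrow> eventually (\<lambda>(y, t). x \<le> v y 0 t) F"
    "\<And>\<theta>. \<theta> > 0 \<Longrightarrow> \<not> eventually (\<lambda>(y, t). b' + \<theta> \<le> v y 0 t) F"
    using level_exists[OF F, of "lo + \<eta>" "\<lambda>y t. v y 0 t" "hi - \<eta>"] by blast
  have su: "\<nu> * b' - \<mu> * a' \<le> D * slope D g S a'"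
  proof (rule slope_ge_of_level[OF pos(1) hu F g \<eta> lbu _ _ a'(3,4)])
    fix e :: real assume "e > 0"
    then have "eventually (\<lambda>(y, t). b' - e / \<nu> \<le> v y 0 t) F" using pos by (intro b'(3)) simp
    then show "eventually (\<lambda>(y, t). \<nu> * b' - \<mu> * a' - e - \<mu> * (u y 0 t - a') \<le> \<nu> * v y 0 t - \<mu> * u y 0 t) F"
      by eventually_elim (use pos in \<open>auto simp: field_simps\<close>)
  qed (use a' \<eta> pos in auto)
  have sv: "\<mu> * a' - \<nu> * b' \<le> d * slope d f S' b'"
  proof (rule slope_ge_of_level[OF pos(2) hv F f \<eta> lbv _ _ b'(3,4)])
    fix e :: real assume "e > 0"
    then have "eventually (\<lambda>(y, t). a' - e / \<mu> \<le> u y 0 t) F" using pos by (intro a'(3)) simp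
    then show "eventually (\<lambda>(y, t). \<mu> * a' - \<nu> * b' - e - \<nu> * (v y 0 t - b') \<le> \<mu> * u y 0 t - \<nu> * v y 0 t) F"
      by eventually_elim (use pos in \<open>auto simp: field_simps\<close>)
  qed (use b' \<eta> pos in auto)
  have aa: "a \<le> a'"
  proof (rule ccontr)
    assume "\<not> a \<le> a'"
    then have "slope D g S a' < slope D g S a" using a' ab \<eta> by (intro G.slope_mono) auto
    then have 1: "D * slope D g S a' < D * slope D g S a" using pos by simp
    moreover have "\<mu> * a' < \<mu> * a" using \<open>\<not> a \<le> a'\<close> pos by simp
    ultimately have "\<nu> * b' < \<nu> * b" using su root(1) by linarith
    then have "slope d f S' b' < slope d f S' b" using pos b' ab \<eta> by (intro H.slope_mono) auto
    then have "d * slope d f S' b' < d * slope d f S' b" using pos by simp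
    then show False using 1 su sv root by linarith
  qed
  have bb: "b \<le> b'"
  proof (rule ccontr)
    assume "\<not> b \<le> b'"
    then have "slope d f S' b' < slope d f S' b" using b' ab \<eta> by (intro H.slope_mono) auto
    then have 1: "d * slope d f S' b' < d * slope d f S' b" using pos by simp
    moreover have "\<nu> * b' < \<nu> * b" using \<open>\<not> b \<le> b'\<close> pos by simp
    ultimately have "\<mu> * a' < \<mu> * a" using sv root(2) by linarith
    then show False using aa pos by simp
  qed
  have "eventually (\<lambda>(y, t). \<forall>z\<in>{- Z..0}. lower_env D g lo S hi \<delta> a z - e \<le> u y z t) F"
    by (rule lower_env_below(1)[OF pos(1) hu F g \<eta> lbu ab(2) _ \<delta>(1-3) e]) (use a'(3) aa in auto)
  moreover have "eventually (\<lambda>(y, t). \<forall>z\<in>{- Z..0}. lower_env d f lo S' hi \<delta> b z - e \<le> v y z t) F"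
    by (rule lower_env_below(1)[OF pos(2) hv F f \<eta> lbv ab(4) _ \<delta>(1,2,4) e]) (use b'(3) bb in auto)
  ultimately show ?thesis by eventually_elim auto
qed

text \<open>Upper bounds are lower bounds for \<open>-u\<close>, which solves the problem with nonlinearity \<open>-g(-\<cdot>)\<close>.\<close>

definition flip :: "(real \<Rightarrow> real) \<Rightarrow> real \<Rightarrow> real" where "flip g x = - g (- x)"

lemma sign_change_flip:
  assumes "sign_change g lo S hi"
  shows "sign_change (flip g) (- hi) (- S) (- lo)"
proof -
  have "loc_lipschitz (flip g)"
    unfolding loc_lipschitz_def
  proof
    fix R
    obtain L where L: "\<And>x y. \<bar>x\<bar> \<le> R \<Longrightarrow> \<bar>y\<bar> \<le> R \<Longrightarrow> \<bar>g x - g y\<bar> \<le> L * \<bar>x - y\<bar>"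
      using assms unfolding sign_change_def loc_lipschitz_def by blast
    have "\<bar>flip g x - flip g y\<bar> \<le> L * \<bar>x - y\<bar>" if "\<bar>x\<bar> \<le> R" "\<bar>y\<bar> \<le> R" for x y
      using L[of "- x" "- y"] that unfolding flip_def by (simp add: abs_minus_commute)
    then show "\<exists>L. \<forall>x y. \<bar>x\<bar> \<le> R \<longrightarrow> \<bar>y\<bar> \<le> R \<longrightarrow> \<bar>flip g x - flip g y\<bar> \<le> L * \<bar>x - y\<bar>" by blast
  qed
  then show ?thesis using assms unfolding sign_change_def flip_def by (auto simp: minus_le_iff le_minus_iff)
qed

lemma slope_flip:
  assumes "\<And>x. isCont g x"
  shows "slope D (flip g) (- S) (- x) = - slope D g S x"
proof -
  have c: "isCont (flip g) x" for x
    unfolding flip_def[abs_def] by (intro isCont_minus isCont_o2[OF _ assms, where f = uminus] continuous_intros)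
  have "((\<lambda>x. primitive (flip g) x - primitive g (- x)) has_real_derivative 0) (at x)" for x
  proof -
    have "((\<lambda>x. primitive g (- x)) has_real_derivative g (- x) * (- 1)) (at x)"
      by (rule DERIV_chain2[OF primitive[OF assms]]) (auto intro!: derivative_eq_intros)
    then show ?thesis using DERIV_diff[OF primitive[OF c]] by (fastforce simp: flip_def)
  qed
  then have "primitive (flip g) (- S) - primitive g S = primitive (flip g) (- x) - primitive g x"
    using DERIV_isconst_all[of "\<lambda>x. primitive (flip g) x - primitive g (- x)" "- S" "- x"] by simp
  then have "primitive (flip g) (- S) - primitive (flip g) (- x) = primitive g S - primitive g x" by simp
  moreover have "sgn (- x - - S) = - sgn (x - S)" by (simp add: sgn_if)
  ultimately show ?thesis unfolding slope_def by simp
qed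

text \<open>Both envelopes start at \<open>a\<close> and follow slopes within \<kappa> of the same
  nondecreasing function. Monotonicity contributes with the favourable sign, so the difference
  \<open>e\<close> satisfies \<open>e * e' \<ge> - 2 * \<kappa> * \<bar>e\<bar>\<close>, and
  \<open>(e\<^sup>2 + 4 * \<kappa>\<^sup>2) * exp z\<close> is nondecreasing: a backward Gronwall
  estimate.\<close>

lemma env_gap:
  assumes g: "sign_change g lo S hi" and D: "D > 0" and a: "lo < a" "a < hi" and \<epsilon>: "\<epsilon> > 0"
  shows "\<exists>\<delta>0>0. \<forall>\<delta>. 0 < \<delta> \<longrightarrow> \<delta> < \<delta>0 \<longrightarrow> \<delta> < 1 \<and> \<delta> < S - lo \<and> \<delta> < hi - S \<and>
     (\<forall>z\<in>{- Z..0}. - lower_env D (flip g) (- hi) (- S) (- lo) \<delta> (- a) z - lower_env D g lo S hi \<delta> a z \<le> \<epsilon>)"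
proof -
  have gg: "lo < S" "S < hi" "loc_lipschitz g" using g by (auto simp: sign_change_def)
  note gf = sign_change_flip[OF g]
  \<comment> \<open>Over the length \<open>Z\<close> the Gronwall factor for \<open>e\<close> is
    \<open>exp (\<bar>Z\<bar> / 2)\<close>.\<close>
  define \<kappa> where "\<kappa> = \<epsilon> / (2 * exp (\<bar>Z\<bar> / 2))"
  have \<kappa>: "\<kappa> > 0" using \<epsilon> by (simp add: \<kappa>_def)
  obtain \<delta>1 where \<delta>1: "\<delta>1 > 0" "\<And>\<delta>. 0 < \<delta> \<Longrightarrow> \<delta> < \<delta>1 \<Longrightarrow> \<delta> < 1 \<and> \<delta> < S - lo \<and>
    (\<forall>x. lo \<le> x \<longrightarrow> x \<le> hi \<longrightarrow> \<bar>slope D (lowered \<delta> g S) (S - \<delta>) x - slope D g S x\<bar> \<le> \<kappa>)"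
    using slope_lowered_close[OF g D \<kappa>] by blast
  obtain \<delta>2 where \<delta>2: "\<delta>2 > 0" "\<And>\<delta>. 0 < \<delta> \<Longrightarrow> \<delta> < \<delta>2 \<Longrightarrow> \<delta> < 1 \<and> \<delta> < - S - - hi \<and>
    (\<forall>x. - hi \<le> x \<longrightarrow> x \<le> - lo \<longrightarrow> \<bar>slope D (lowered \<delta> (flip g) (- S)) (- S - \<delta>) x - slope D (flip g) (- S) x\<bar> \<le> \<kappa>)"
    using slope_lowered_close[OF gf D \<kappa>] by blast
  interpret G: profile D g lo S hi by (rule profile_sign_change[OF g D])
  have main: "- lower_env D (flip g) (- hi) (- S) (- lo) \<delta> (- a) z - lower_env D g lo S hi \<delta> a z \<le> \<epsilon>"
    if \<delta>: "0 < \<delta>" "\<delta> < min \<delta>1 \<delta>2" and z: "- Z \<le> z" "z \<le> 0" for \<delta> z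
  proof -
    have d1: "\<delta> < 1" "\<delta> < S - lo" "\<And>x. lo \<le> x \<Longrightarrow> x \<le> hi \<Longrightarrow> \<bar>slope D (lowered \<delta> g S) (S - \<delta>) x - slope D g S x\<bar> \<le> \<kappa>"
      and d2: "\<delta> < - S - - hi" "\<And>x. - hi \<le> x \<Longrightarrow> x \<le> - lo \<Longrightarrow> \<bar>slope D (lowered \<delta> (flip g) (- S)) (- S - \<delta>) x - slope D (flip g) (- S) x\<bar> \<le> \<kappa>"
      using \<delta>1(2)[of \<delta>] \<delta>2(2)[of \<delta>] \<delta> by auto
    interpret L: profile D "lowered \<delta> g S" lo "S - \<delta>" hi by (rule profile_lowered[OF g D \<delta>(1) d1(1,2)])
    interpret U: profile D "lowered \<delta> (flip g) (- S)" "- hi" "- S - \<delta>" "- lo" by (rule profile_lowered[OF gf D \<delta>(1) d1(1) d2(1)])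
    define x y e where "x w = - U.orbit (- a) w" and "y w = L.orbit a w" and "e w = x w - y w" for w
    have e0: "e 0 = 0" by (simp add: e_def x_def y_def U.orbit_0 L.orbit_0)
    have rng: "lo \<le> x w" "x w \<le> hi" "lo \<le> y w" "y w \<le> hi" if "w \<le> 0" for w
      using U.orbit_upper[OF that, of "- a"] U.orbit_lower[OF that, of "- a"] L.orbit_upper[OF that, of a] L.orbit_lower[OF that, of a] a gg \<delta> d1 d2
      by (auto simp: x_def y_def)
    have de: "(e has_real_derivative - U.P (- x w) - L.P (y w)) (at w)" for w
      unfolding e_def[abs_def] x_def y_def by (auto intro!: derivative_eq_intros U.orbit_deriv L.orbit_deriv)
    have "(e z)\<^sup>2 + 4 * \<kappa>\<^sup>2 \<le> 4 * \<kappa>\<^sup>2 * exp (- z)"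
    proof -
      have "((e z)\<^sup>2 + 4 * \<kappa>\<^sup>2) * exp z \<le> ((e 0)\<^sup>2 + 4 * \<kappa>\<^sup>2) * exp 0"
      proof (rule nondecreasing_of_derivative[OF z(2), of "\<lambda>w. ((e w)\<^sup>2 + 4 * \<kappa>\<^sup>2) * exp w"])
        fix w assume w: "z \<le> w" "w \<le> 0"
        define r where "r = - U.P (- x w) - L.P (y w)"
        note rw = rng[OF w(2)]
        have UP: "U.P (- x w) = slope D (lowered \<delta> (flip g) (- S)) (- S - \<delta>) (- x w)" using rw by (intro U.P_eq) auto
        have LP: "L.P (y w) = slope D (lowered \<delta> g S) (S - \<delta>) (y w)" using rw by (intro L.P_eq) auto
        have sf: "slope D (flip g) (- S) (- x w) = - slope D g S (x w)" by (rule slope_flip[OF loc_lipschitz_isCont[OF gg(3)]])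
        have "\<bar>U.P (- x w) + slope D g S (x w)\<bar> \<le> \<kappa>" using d2(2)[of "- x w"] rw sf UP by simp
        moreover have "\<bar>L.P (y w) - slope D g S (y w)\<bar> \<le> \<kappa>" using d1(3)[of "y w"] rw LP by simp
        ultimately have rb: "\<bar>r - (slope D g S (x w) - slope D g S (y w))\<bar> \<le> 2 * \<kappa>" unfolding r_def by linarith
        have mono: "0 \<le> e w * (slope D g S (x w) - slope D g S (y w))"
        proof (cases "x w" "y w" rule: linorder_cases)
          case less
          then show ?thesis using G.slope_mono[of "x w" "y w"] rw unfolding e_def by (intro mult_nonpos_nonpos) auto
        next
          case greater
          then show ?thesis using G.slope_mono[of "y w" "x w"] rw unfolding e_def by (intro mult_nonneg_nonneg) auto
        qed (simp add: e_def)
        have "\<bar>e w * (r - (slope D g S (x w) - slope D g S (y w)))\<bar> \<le> \<bar>e w\<bar> * (2 * \<kappa>)"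
          unfolding abs_mult using rb by (intro mult_left_mono) auto
        moreover have "e w * r = e w * (r - (slope D g S (x w) - slope D g S (y w))) + e w * (slope D g S (x w) - slope D g S (y w))"
          by (simp add: algebra_simps)
        ultimately have er: "- (2 * \<kappa> * \<bar>e w\<bar>) \<le> e w * r" using mono by (simp add: abs_le_iff mult.commute)
        have "(\<bar>e w\<bar> - 2 * \<kappa>)\<^sup>2 = (e w)\<^sup>2 - 4 * \<kappa> * \<bar>e w\<bar> + 4 * \<kappa>\<^sup>2" by (simp add: power2_diff power_mult_distrib)
        then have "0 \<le> (e w)\<^sup>2 - 4 * \<kappa> * \<bar>e w\<bar> + 4 * \<kappa>\<^sup>2" by (metis zero_le_power2)
        then have "0 \<le> 2 * (e w * r) + (e w)\<^sup>2 + 4 * \<kappa>\<^sup>2" using er by simp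
        then have "0 \<le> (2 * (e w * r) + (e w)\<^sup>2 + 4 * \<kappa>\<^sup>2) * exp w" by simp
        moreover have "((\<lambda>w. ((e w)\<^sup>2 + 4 * \<kappa>\<^sup>2) * exp w) has_real_derivative (2 * (e w * r) + (e w)\<^sup>2 + 4 * \<kappa>\<^sup>2) * exp w) (at w)"
          using de[of w] unfolding r_def[symmetric] by (auto intro!: derivative_eq_intros simp: algebra_simps)
        ultimately show "\<exists>l. ((\<lambda>w. ((e w)\<^sup>2 + 4 * \<kappa>\<^sup>2) * exp w) has_real_derivative l) (at w) \<and> 0 \<le> l" by blast
      qed
      then have "((e z)\<^sup>2 + 4 * \<kappa>\<^sup>2) * exp z * exp (- z) \<le> 4 * \<kappa>\<^sup>2 * exp (- z)" unfolding e0 by (intro mult_right_mono) auto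
      then show ?thesis by (simp add: mult.assoc exp_minus)
    qed
    also have "\<dots> \<le> 4 * \<kappa>\<^sup>2 * exp \<bar>Z\<bar>" using z by (intro mult_left_mono) auto
    also have "exp \<bar>Z\<bar> = (exp (\<bar>Z\<bar> / 2))\<^sup>2" by (simp add: exp_double[symmetric])
    also have "4 * \<kappa>\<^sup>2 * (exp (\<bar>Z\<bar> / 2))\<^sup>2 = \<epsilon>\<^sup>2"
    proof -
      have "2 * \<kappa> * exp (\<bar>Z\<bar> / 2) = \<epsilon>" by (simp add: \<kappa>_def)
      then have "(2 * \<kappa> * exp (\<bar>Z\<bar> / 2))\<^sup>2 = \<epsilon>\<^sup>2" by simp
      then show ?thesis by (simp add: power_mult_distrib)
    qed
    finally have "(e z)\<^sup>2 \<le> \<epsilon>\<^sup>2" using zero_le_power2[of \<kappa>] by linarith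
    then have "\<bar>e z\<bar> \<le> \<epsilon>" using \<epsilon> by (simp add: power2_le_iff_abs_le)
    then show ?thesis unfolding lower_env_def by (simp add: e_def x_def y_def)
  qed
  show ?thesis
  proof (intro exI[of _ "min \<delta>1 \<delta>2"] conjI allI impI)
    fix \<delta> assume \<delta>: "0 < \<delta>" "\<delta> < min \<delta>1 \<delta>2"
    then show "\<delta> < 1" "\<delta> < S - lo" "\<delta> < hi - S" using \<delta>1(2)[of \<delta>] \<delta>2(2)[of \<delta>] by auto
    show "\<forall>z\<in>{- Z..0}. - lower_env D (flip g) (- hi) (- S) (- lo) \<delta> (- a) z - lower_env D g lo S hi \<delta> a z \<le> \<epsilon>"
      using main[OF \<delta>] by auto
  qed (use \<delta>1 \<delta>2 in auto)
qed

text \<open>The upper envelopes are those of the negated pair: flipping exchanges the roles of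
  \<open>lo\<close> and \<open>hi\<close>, and since slopes are odd under it,
  \<open>(- a, - b)\<close> solves the flipped interface equations.\<close>

lemma pair_sandwich:
  fixes u v :: "real^'m::finite \<Rightarrow> real \<Rightarrow> real \<Rightarrow> real"
  assumes pos: "D > 0" "d > 0" "\<mu> > 0" "\<nu> > 0"
    and hu: "half D g u (\<lambda>y t. \<nu> * v y 0 t - \<mu> * u y 0 t)" and hv: "half d f v (\<lambda>y t. \<mu> * u y 0 t - \<nu> * v y 0 t)"
    and F: "thick F" and g: "sign_change g lo S hi" and f: "sign_change f lo S' hi" and \<eta>: "\<eta> > 0"
    and bd: "\<And>Z. eventually (\<lambda>(y, t). \<forall>z. - Z \<le> z \<longrightarrow> z \<le> 0 \<longrightarrow> lo + \<eta> \<le> u y z t \<and> lo + \<eta> \<le> v y z t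
        \<and> u y z t \<le> hi - \<eta> \<and> v y z t \<le> hi - \<eta>) F"
    and ab: "lo < a" "a < hi" "lo < b" "b < hi"
    and root: "D * slope D g S a = \<nu> * b - \<mu> * a" "d * slope d f S' b = \<mu> * a - \<nu> * b"
    and \<delta>: "0 < \<delta>" "\<delta> < 1" "\<delta> < S - lo" "\<delta> < S' - lo" "\<delta> < hi - S" "\<delta> < hi - S'" and e: "e > 0"
  shows "eventually (\<lambda>(y, t). \<forall>z\<in>{- Z..0}. lower_env D g lo S hi \<delta> a z - e \<le> u y z t \<and> lower_env d f lo S' hi \<delta> b z - e \<le> v y z t
     \<and> u y z t \<le> - lower_env D (flip g) (- hi) (- S) (- lo) \<delta> (- a) z + e
     \<and> v y z t \<le> - lower_env d (flip f) (- hi) (- S') (- lo) \<delta> (- b) z + e) F"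
proof -
  have lips: "loc_lipschitz g" "loc_lipschitz f" using g f by (auto simp: sign_change_def)
  have 1: "eventually (\<lambda>(y, t). \<forall>z\<in>{- Z..0}. lower_env D g lo S hi \<delta> a z - e \<le> u y z t \<and> lower_env d f lo S' hi \<delta> b z - e \<le> v y z t) F"
  proof (rule pair_lower[OF pos hu hv F g f \<eta> _ _ _ ab(2) _ ab(4) root \<delta>(1-4) e])
    show "eventually (\<lambda>(y, t). \<forall>z. - Z \<le> z \<longrightarrow> z \<le> 0 \<longrightarrow> lo + \<eta> \<le> u y z t \<and> lo + \<eta> \<le> v y z t) F" for Z
      by (rule eventually_mono[OF bd[of Z]]) auto
    show "eventually (\<lambda>(y, t). u y 0 t \<le> hi - \<eta> \<and> v y 0 t \<le> hi - \<eta>) F"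
      by (rule eventually_mono[OF bd[of 0]]) auto
  qed (use ab in auto)
  have hu': "half D (flip g) (\<lambda>y z t. - u y z t) (\<lambda>y t. \<nu> * (- v y 0 t) - \<mu> * (- u y 0 t))"
    using half_uminus[OF hu] by (simp add: flip_def[abs_def])
  have hv': "half d (flip f) (\<lambda>y z t. - v y z t) (\<lambda>y t. \<mu> * (- u y 0 t) - \<nu> * (- v y 0 t))"
    using half_uminus[OF hv] by (simp add: flip_def[abs_def])
  have 2: "eventually (\<lambda>(y, t). \<forall>z\<in>{- Z..0}. lower_env D (flip g) (- hi) (- S) (- lo) \<delta> (- a) z - e \<le> - u y z t
     \<and> lower_env d (flip f) (- hi) (- S') (- lo) \<delta> (- b) z - e \<le> - v y z t) F"
  proof (rule pair_lower[OF pos hu' hv' F sign_change_flip[OF g] sign_change_flip[OF f] \<eta>])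
    show "eventually (\<lambda>(y, t). \<forall>z. - Z \<le> z \<longrightarrow> z \<le> 0 \<longrightarrow> - hi + \<eta> \<le> - u y z t \<and> - hi + \<eta> \<le> - v y z t) F" for Z
      by (rule eventually_mono[OF bd[of Z]]) force
    show "eventually (\<lambda>(y, t). - u y 0 t \<le> - lo - \<eta> \<and> - v y 0 t \<le> - lo - \<eta>) F"
      by (rule eventually_mono[OF bd[of 0]]) force
    show "D * slope D (flip g) (- S) (- a) = \<nu> * (- b) - \<mu> * (- a)"
      unfolding slope_flip[OF loc_lipschitz_isCont[OF lips(1)]] using root by simp
    show "d * slope d (flip f) (- S') (- b) = \<mu> * (- a) - \<nu> * (- b)"
      unfolding slope_flip[OF loc_lipschitz_isCont[OF lips(2)]] using root by simp
  qed (use ab \<delta> e in auto)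
  show ?thesis using 1 2 by eventually_elim fastforce
qed

section \<open>Solutions of (H) in reflected form\<close>

lemma has_d2_deriv:
  assumes "has_d2 c x k"
  shows "(c has_real_derivative deriv c x) (at x)" "(deriv c has_real_derivative k) (at x)"
proof -
  obtain c' where c: "\<forall>\<^sub>F s in nhds x. (c has_real_derivative c' s) (at s)" "(c' has_real_derivative k) (at x)"
    using assms unfolding has_d2_def by blast
  show "(c has_real_derivative deriv c x) (at x)"
    using eventually_nhds_x_imp_x[OF c(1)] DERIV_imp_deriv by metis
  have ev: "\<forall>\<^sub>F s in nhds x. c' s = deriv c s" using c(1) by eventually_elim (simp add: DERIV_imp_deriv)
  show "(deriv c has_real_derivative k) (at x)"
    using DERIV_cong_ev[OF refl ev refl] c(2) by simp
qed

lemma has_d2_of_deriv: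
  assumes "open S" "x \<in> S" "\<And>s. s \<in> S \<Longrightarrow> c differentiable (at s)" "deriv c differentiable (at x)"
  shows "has_d2 c x (deriv (deriv c) x)"
  unfolding has_d2_def
proof (intro exI conjI)
  have "\<forall>\<^sub>F s in nhds x. s \<in> S" using assms(1,2) by (rule eventually_nhds_in_open)
  then show "\<forall>\<^sub>F s in nhds x. (c has_real_derivative deriv c s) (at s)"
    by eventually_elim (use assms(3) in \<open>simp add: DERIV_deriv_iff_real_differentiable\<close>)
  show "(deriv c has_real_derivative deriv (deriv c) x) (at x)"
    using assms(4) by (simp add: DERIV_deriv_iff_real_differentiable)
qed

lemma has_d2_reflect:
  assumes "has_d2 c (- x) k"
  shows "has_d2 (\<lambda>s. c (- s)) x k"
proof -
  obtain c' where c: "\<forall>\<^sub>F s in nhds (- x). (c has_real_derivative c' s) (at s)" "(c' has_real_derivative k) (at (- x))"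
    using assms unfolding has_d2_def by blast
  have "filterlim uminus (nhds (- x)) (nhds x)" by (rule tendsto_minus[OF filterlim_ident])
  then have "\<forall>\<^sub>F s in nhds x. (c has_real_derivative c' (- s)) (at (- s))"
    by (rule eventually_compose_filterlim[OF c(1)])
  then have "\<forall>\<^sub>F s in nhds x. ((\<lambda>s. c (- s)) has_real_derivative - c' (- s)) (at s)"
    by eventually_elim (simp add: DERIV_mirror)
  moreover have "((\<lambda>s. c' (- s)) has_real_derivative - k) (at x)" using c(2) by (simp add: DERIV_mirror)
  then have "((\<lambda>s. - c' (- s)) has_real_derivative k) (at x)" using DERIV_minus by fastforce
  ultimately show ?thesis unfolding has_d2_def by (intro exI[of _ "\<lambda>s. - c' (- s)"] conjI)
qed

lemma has_real_derivative_reflect_within: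
  assumes "(c has_real_derivative b) (at 0 within {0..})"
  shows "((\<lambda>s. c (- s)) has_real_derivative - b) (at 0 within {..0})"
proof -
  have im: "uminus ` {..0} = {0::real..}"
  proof (intro equalityI subsetI)
    fix x :: real assume "x \<in> {0..}"
    then show "x \<in> uminus ` {..0}" by (intro image_eqI[of _ _ "- x"]) auto
  qed auto
  have "(c has_real_derivative b) (at (- 0) within uminus ` {..0})" using assms unfolding im by simp
  moreover have "(uminus has_real_derivative - 1) (at (0::real) within {..0})" by (auto intro!: derivative_eq_intros)
  ultimately have "((c \<circ> uminus) has_real_derivative b * - 1) (at 0 within {..0})" by (rule DERIV_image_chain)
  then show ?thesis by (simp add: o_def)
qed

text \<open>\<open>dyi\<close> differentiates at 0 along a translated line; the derivative at
  another parameter \<open>s\<close> is therefore read off at the translated base point.\<close>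

lemma heat_op_of_reg21:
  fixes w :: "real^'m::finite \<Rightarrow> real \<Rightarrow> real \<Rightarrow> real"
  assumes reg: "reg21 w Z" and Z: "open Z" "z \<in> Z" and t: "t > 0"
  shows "heat_op D w y z t (dt w y z t - D * lap w y z t)"
proof (rule heat_opI)
  have r: "(\<lambda>s. w y z s) differentiable (at t)" "(\<lambda>s. w y s t) differentiable (at z)"
     "(\<lambda>s. dz w y s t) differentiable (at z)" "(\<lambda>s. w (y + s *\<^sub>R axis i 1) z t) differentiable (at 0)"
     "(\<lambda>s. dyi i w (y + s *\<^sub>R axis i 1) z t) differentiable (at 0)" if "z \<in> Z" for y z i
    using reg that t unfolding reg21_def by blast+
  show "((\<lambda>s. w y z s) has_real_derivative dt w y z t) (at t)"
    unfolding dt_def using r(1)[OF Z(2)] by (simp add: DERIV_deriv_iff_real_differentiable)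
  show "has_d2 (\<lambda>s. w y s t) z (dz (dz w) y z t)"
  proof -
    have "dz w y s t = deriv (\<lambda>s. w y s t) s" for s by (simp add: dz_def)
    then have "has_d2 (\<lambda>s. w y s t) z (deriv (deriv (\<lambda>s. w y s t)) z)"
      using r(3)[OF Z(2), of y] by (intro has_d2_of_deriv[OF Z] r(2)) simp_all
    then show ?thesis by (simp add: dz_def)
  qed
  show "has_d2 (\<lambda>s. w (y + s *\<^sub>R axis i 1) z t) 0 (dyi i (dyi i w) y z t)" for i
  proof -
    let ?c = "\<lambda>s. w (y + s *\<^sub>R axis i 1) z t"
    have "(?c has_real_derivative dyi i w (y + s *\<^sub>R axis i 1) z t) (at s)" for s
    proof -
      have "((\<lambda>h. w (y + s *\<^sub>R axis i 1 + h *\<^sub>R axis i 1) z t) has_real_derivative dyi i w (y + s *\<^sub>R axis i 1) z t) (at 0)"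
        unfolding dyi_def using r(4)[OF Z(2)] by (simp add: DERIV_deriv_iff_real_differentiable)
      moreover have "y + s *\<^sub>R axis i 1 + h *\<^sub>R axis i 1 = y + (h + s) *\<^sub>R axis i 1" for h by (simp add: scaleR_add_left)
      ultimately have "((\<lambda>h. ?c (h + s)) has_real_derivative dyi i w (y + s *\<^sub>R axis i 1) z t) (at 0)" by simp
      then show ?thesis using DERIV_shift[of ?c _ 0 s] by simp
    qed
    moreover have "((\<lambda>s. dyi i w (y + s *\<^sub>R axis i 1) z t) has_real_derivative dyi i (dyi i w) y z t) (at 0)"
    proof -
      have "dyi i (dyi i w) y z t = deriv (\<lambda>s. dyi i w (y + s *\<^sub>R axis i 1) z t) 0" by (simp add: dyi_def)
      then show ?thesis using r(5)[OF Z(2), of i y] by (simp add: DERIV_deriv_iff_real_differentiable)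
    qed
    ultimately show ?thesis by (rule has_d2I)
  qed
  show "dt w y z t - D * ((\<Sum>i\<in>UNIV. dyi i (dyi i w) y z t) + dz (dz w) y z t) = dt w y z t - D * lap w y z t"
    by (simp add: lap_def)
qed

lemma heat_op_reflect:
  assumes "heat_op D w y (- z) t r"
  shows "heat_op D (\<lambda>y z t. w y (- z) t) y z t r"
proof -
  obtain ut uy uz where u: "((\<lambda>s. w y (- z) s) has_real_derivative ut) (at t)"
    "\<And>i. has_d2 (\<lambda>s. w (y + s *\<^sub>R axis i 1) (- z) t) 0 (uy i)" "has_d2 (\<lambda>s. w y s t) (- z) uz"
    "ut - D * ((\<Sum>i\<in>UNIV. uy i) + uz) = r" using assms(1) unfolding heat_op_def by blast
  show ?thesis by (rule heat_opI[where ut = ut and uy = uy and uz = uz]) (use u has_d2_reflect in auto)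
qed

lemma half_of_solution:
  fixes u v :: "real^'m::finite \<Rightarrow> real \<Rightarrow> real \<Rightarrow> real"
  assumes "is_solution_H D d \<mu> \<nu> g f u0 v0 u v"
  defines "w \<equiv> \<lambda>y z t. v y (- z) t"
  shows "half D g u (\<lambda>y t. \<nu> * w y 0 t - \<mu> * u y 0 t)" "half d f w (\<lambda>y t. \<mu> * u y 0 t - \<nu> * w y 0 t)"
proof -
  have cu: "continuous_on {p. fst (snd p) \<le> 0 \<and> snd (snd p) \<ge> 0} (\<lambda>(y, z, t). u y z t)"
    and cv: "continuous_on {p. fst (snd p) \<ge> 0 \<and> snd (snd p) \<ge> 0} (\<lambda>(y, z, t). v y z t)"
    and ru: "reg21 u {..<0}" and rv: "reg21 v {0<..}"
    and eu': "\<forall>y z t. z < 0 \<longrightarrow> t > 0 \<longrightarrow> dt u y z t - D * lap u y z t = g (u y z t)"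
    and ev': "\<forall>y z t. z > 0 \<longrightarrow> t > 0 \<longrightarrow> dt v y z t - d * lap v y z t = f (v y z t)"
    and fl': "\<forall>y t. t > 0 \<longrightarrow> (\<exists>a b. ((\<lambda>s. u y s t) has_real_derivative a) (at 0 within {..0})
       \<and> ((\<lambda>s. v y s t) has_real_derivative b) (at 0 within {0..})
       \<and> D * a = \<nu> * v y 0 t - \<mu> * u y 0 t \<and> - d * b = \<mu> * u y 0 t - \<nu> * v y 0 t)"
    using assms(1) unfolding is_solution_H_def by - (elim conjE, assumption)+
  note eu = eu'[rule_format] and ev = ev'[rule_format] and fl = fl'[rule_format]
  show "half D g u (\<lambda>y t. \<nu> * w y 0 t - \<mu> * u y 0 t)"
    unfolding half_def
  proof (intro conjI allI impI)
    show "heat_op D u y z t (g (u y z t))" if "z < 0" "t > 0" for y z t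
      using heat_op_of_reg21[OF ru, of z t D y] eu that by simp
    show "\<exists>a. ((\<lambda>s. u y s t) has_real_derivative a) (at 0 within {..0}) \<and> D * a = \<nu> * w y 0 t - \<mu> * u y 0 t" if "t > 0" for y t
      using fl[OF that, of y] by (auto simp: w_def)
  qed (fact cu)
  show "half d f w (\<lambda>y t. \<mu> * u y 0 t - \<nu> * w y 0 t)"
    unfolding half_def
  proof (intro conjI allI impI)
    have "continuous_on {p. fst (snd p) \<le> 0 \<and> snd (snd p) \<ge> 0} (\<lambda>p. (\<lambda>(y, z, t). v y z t) (fst p, - fst (snd p), snd (snd p)))"
      by (rule continuous_on_compose2[OF cv]) (auto intro!: continuous_intros)
    then show "continuous_on {p. fst (snd p) \<le> 0 \<and> snd (snd p) \<ge> 0} (\<lambda>(y, z, t). w y z t)"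
      by (simp add: w_def split_beta)
    show "heat_op d w y z t (f (w y z t))" if "z < 0" "t > 0" for y z t
      unfolding w_def using heat_op_of_reg21[OF rv, of "- z" t d y] ev[of "- z" t y] that by (intro heat_op_reflect) simp
    fix y and t :: real assume "t > 0"
    then obtain b where b: "((\<lambda>s. v y s t) has_real_derivative b) (at 0 within {0..})" "- d * b = \<mu> * u y 0 t - \<nu> * v y 0 t"
      using fl by blast
    then show "\<exists>a. ((\<lambda>s. w y s t) has_real_derivative a) (at 0 within {..0}) \<and> d * a = \<mu> * u y 0 t - \<nu> * w y 0 t"
      using has_real_derivative_reflect_within[OF b(1)] by (intro exI[of _ "- b"]) (simp add: w_def)
  qed
qed

text \<open>Makes every estimate for the evolution problem available for stationary profiles, with a
  constant in place of the flux function.\<close>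

lemma half_stationary:
  fixes U :: "real \<Rightarrow> real"
  assumes c: "continuous_on {..0} U" and D: "D > 0"
    and eq: "\<And>z. z < 0 \<Longrightarrow> has_d2 U z (- g (U z) / D)"
    and fl: "(U has_real_derivative a) (at 0 within {..0})" "D * a = q"
  shows "half D g (\<lambda>(y::real^'m::finite) z t. U z) (\<lambda>y t. q)"
  unfolding half_def
proof (intro conjI allI impI)
  have "continuous_on {p::(real^'m) \<times> real \<times> real. fst (snd p) \<le> 0 \<and> snd (snd p) \<ge> 0} (\<lambda>p. U (fst (snd p)))"
    by (rule continuous_on_compose2[OF c]) (auto intro!: continuous_intros)
  then show "continuous_on {p::(real^'m) \<times> real \<times> real. fst (snd p) \<le> 0 \<and> snd (snd p) \<ge> 0} (\<lambda>(y, z, t). U z)"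
    by (simp add: split_beta)
  show "heat_op D (\<lambda>(y::real^'m) z t. U z) y z t (g (U z))" if "z < 0" for y z t
  proof (rule heat_opI)
    show "has_d2 (\<lambda>s. U s) z (- g (U z) / D)" by (rule eq[OF that])
    show "0 - D * ((\<Sum>i\<in>(UNIV::'m set). 0) + - g (U z) / D) = g (U z)" using D by simp
  qed (auto intro: has_d2_const)
  show "\<exists>a. ((\<lambda>s. U s) has_real_derivative a) (at 0 within {..0}) \<and> D * a = q" using fl by blast
qed

lemma half_of_steady:
  assumes st: "steady_H D d \<mu> \<nu> g f U V" and D: "D > 0" "d > 0"
  shows "half D g (\<lambda>(y::real^'m::finite) z t. U z) (\<lambda>y t. \<nu> * V 0 - \<mu> * U 0)"
    "half d f (\<lambda>(y::real^'m::finite) z t. V (- z)) (\<lambda>y t. \<mu> * U 0 - \<nu> * V 0)"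
proof -
  have cU: "continuous_on {..0} U" and cV: "continuous_on {0..} V"
    and eU: "\<And>z. z < 0 \<Longrightarrow> U differentiable (at z) \<and> deriv U differentiable (at z) \<and> D * deriv (deriv U) z + g (U z) = 0"
    and eV: "\<And>z. z > 0 \<Longrightarrow> V differentiable (at z) \<and> deriv V differentiable (at z) \<and> d * deriv (deriv V) z + f (V z) = 0"
    using st unfolding steady_H_def by blast+
  obtain a b where ab: "(U has_real_derivative a) (at 0 within {..0})" "(V has_real_derivative b) (at 0 within {0..})"
    "D * a = \<nu> * V 0 - \<mu> * U 0" "- d * b = \<mu> * U 0 - \<nu> * V 0" using st unfolding steady_H_def by blast
  show "half D g (\<lambda>(y::real^'m) z t. U z) (\<lambda>y t. \<nu> * V 0 - \<mu> * U 0)"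
  proof (rule half_stationary[OF cU D(1) _ ab(1,3)])
    fix z :: real assume z: "z < 0"
    have "has_d2 U z (deriv (deriv U) z)" by (rule has_d2_of_deriv[of "{..<0}"]) (use z eU in auto)
    moreover have "deriv (deriv U) z = - g (U z) / D" using eU[OF z] D by (simp add: field_simps add_eq_0_iff)
    ultimately show "has_d2 U z (- g (U z) / D)" by simp
  qed
  show "half d f (\<lambda>(y::real^'m) z t. V (- z)) (\<lambda>y t. \<mu> * U 0 - \<nu> * V 0)"
  proof (rule half_stationary[OF _ D(2) _ has_real_derivative_reflect_within[OF ab(2)]])
    show "continuous_on {..0} (\<lambda>z. V (- z))" by (rule continuous_on_compose2[OF cV]) (auto intro!: continuous_intros)
    show "d * - b = \<mu> * U 0 - \<nu> * V 0" using ab(4) by simp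
    fix z :: real assume z: "z < 0"
    have "has_d2 V (- z) (deriv (deriv V) (- z))" by (rule has_d2_of_deriv[of "{0<..}"]) (use z eV in auto)
    moreover have "deriv (deriv V) (- z) = - f (V (- z)) / d" using eV[of "- z"] z D by (simp add: field_simps add_eq_0_iff)
    ultimately show "has_d2 (\<lambda>z. V (- z)) z (- f (V (- z)) / d)" by (intro has_d2_reflect) simp
  qed
qed

section \<open>Consequences of the KPP conditions\<close>

lemma KPP_g_iff: "KPP_g g gp \<longleftrightarrow> KPP_f g gp 1"
  by (simp add: KPP_g_def KPP_f_def)

lemma KPP_f_rate_pos: "KPP_f f fp S \<Longrightarrow> 0 < fp"
proof -
  assume k: "KPP_f f fp S"
  then have S: "0 < S" and h: "\<forall>s. 0 < s \<and> s < S \<longrightarrow> 0 < f s \<and> f s \<le> fp * s" by (simp_all add: KPP_f_def)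
  have "0 < f (S / 2) \<and> f (S / 2) \<le> fp * (S / 2)" by (rule h[rule_format]) (use S in simp)
  then have "0 < fp * (S / 2)" by linarith
  then show "0 < fp" using S by (simp add: zero_less_mult_iff)
qed

lemma KPP_f_le_linear:
  assumes k: "KPP_f f fp S" and s: "0 \<le> s"
  shows "f s \<le> fp * s"
proof -
  have "0 \<le> fp * s" using KPP_f_rate_pos[OF k] s by simp
  moreover have "f 0 = 0" "f S = 0" "0 < s \<Longrightarrow> s < S \<Longrightarrow> f s \<le> fp * s" "S < s \<Longrightarrow> f s < 0" using k by (auto simp: KPP_f_def)
  ultimately show ?thesis using s by (cases s S rule: linorder_cases; cases "s = 0") auto
qed

lemma KPP_f_growth:
  assumes k: "KPP_f f fp S" and lt: "k < fp"
  shows "\<exists>s0>0. \<forall>x. 0 \<le> x \<longrightarrow> x \<le> s0 \<longrightarrow> k * x \<le> f x"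
proof -
  have d: "((\<lambda>x. f x - k * x) has_real_derivative fp - k) (at 0)" and f0: "f 0 = 0"
    using k unfolding KPP_f_def by (auto intro!: derivative_eq_intros)
  obtain e where e: "e > 0" "\<And>h. 0 < h \<Longrightarrow> h < e \<Longrightarrow> f 0 - k * 0 < f (0 + h) - k * (0 + h)"
    using DERIV_pos_inc_right[OF d] lt by auto
  have "k * x \<le> f x" if "0 \<le> x" "x \<le> e / 2" for x
    using e(2)[of x] e(1) that f0 by (cases "x = 0") auto
  then show ?thesis using e(1) by (intro exI[of _ "e / 2"]) auto
qed

lemma KPP_f_sign_change: "KPP_f f fp S \<Longrightarrow> 0 < lo \<Longrightarrow> lo < S \<Longrightarrow> S < hi \<Longrightarrow> sign_change f lo S hi"
  by (auto simp: KPP_f_def sign_change_def)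

lemma pair_posI:
  fixes u v :: "real^'m::finite \<Rightarrow> real \<Rightarrow> real \<Rightarrow> real"
  assumes pos: "D > 0" "d > 0" "\<mu> > 0" "\<nu> > 0" and kg: "KPP_f g gp S" and kf: "KPP_f f fp S'"
    and hu: "half D g u (\<lambda>y t. \<nu> * v y 0 t - \<mu> * u y 0 t)" and hv: "half d f v (\<lambda>y t. \<mu> * u y 0 t - \<nu> * v y 0 t)"
    and nn: "\<And>y z t. z \<le> 0 \<Longrightarrow> 0 \<le> t \<Longrightarrow> 0 \<le> u y z t \<and> 0 \<le> v y z t"
  shows "pair_pos D \<mu> gp g u d \<nu> fp f v"
proof (rule pair_pos.intro)
  have "0 \<le> \<nu> * v y 0 t" "0 \<le> \<mu> * u y 0 t" if "t > 0" for y t using nn[of 0 t y] that pos by auto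
  then show "half_pos D \<mu> gp g u (\<lambda>y t. \<nu> * v y 0 t - \<mu> * u y 0 t)" "half_pos d \<nu> fp f v (\<lambda>y t. \<mu> * u y 0 t - \<nu> * v y 0 t)"
    by (unfold_locales; use hu hv pos nn KPP_f_growth[OF kg] KPP_f_growth[OF kf] in force)+
qed

section \<open>Spreading speed and steady state\<close>

text \<open>The KPP conditions say nothing about negative densities. There the Lipschitz slack
  \<open>L\<close> of \<open>pair_compare\<close> does the work: \<open>\<bar>h s\<bar>\<close> is
  at most \<open>L * \<bar>s\<bar>\<close> because \<open>h 0 = 0\<close>.\<close>

lemma pair_nonneg:
  fixes u v :: "real^'m::finite \<Rightarrow> real \<Rightarrow> real \<Rightarrow> real"
  assumes pos: "D > 0" "d > 0" "\<mu> > 0" "\<nu> > 0" and kg: "KPP_f g gp S" and kf: "KPP_f f fp S'"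
    and hu: "half D g u (\<lambda>y t. \<nu> * v y 0 t - \<mu> * u y 0 t)" and hv: "half d f v (\<lambda>y t. \<mu> * u y 0 t - \<nu> * v y 0 t)"
    and bd: "\<And>T. \<exists>M. \<forall>y z t. z \<le> 0 \<longrightarrow> 0 \<le> t \<longrightarrow> t \<le> T \<longrightarrow> \<bar>u y z t\<bar> \<le> M \<and> \<bar>v y z t\<bar> \<le> M"
    and init: "\<And>y z. z \<le> 0 \<Longrightarrow> 0 \<le> u y z 0 \<and> 0 \<le> v y z 0" and zt: "z \<le> 0" "0 \<le> t"
  shows "0 \<le> u y z t \<and> 0 \<le> v y z t"
proof -
  obtain M where M: "\<And>y z s. z \<le> 0 \<Longrightarrow> 0 \<le> s \<Longrightarrow> s \<le> t \<Longrightarrow> \<bar>u y z s\<bar> \<le> M \<and> \<bar>v y z s\<bar> \<le> M" using bd by blast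
  have "loc_lipschitz g" "loc_lipschitz f" and z: "g 0 = 0" "f 0 = 0" using kg kf by (auto simp: KPP_f_def)
  then obtain Lg Lf where L: "Lg \<ge> 0" "Lf \<ge> 0" "\<And>x y. \<bar>x\<bar> \<le> M \<Longrightarrow> \<bar>y\<bar> \<le> M \<Longrightarrow> \<bar>g x - g y\<bar> \<le> Lg * \<bar>x - y\<bar>"
    "\<And>x y. \<bar>x\<bar> \<le> M \<Longrightarrow> \<bar>y\<bar> \<le> M \<Longrightarrow> \<bar>f x - f y\<bar> \<le> Lf * \<bar>x - y\<bar>"
    using loc_lipschitz_on by metis
  have lin: "0 \<le> h s + (Lg + Lf) * (0 - s)"
    if "\<bar>s\<bar> \<le> M" "s \<le> 0" "h 0 = 0" "0 \<le> l" "l \<le> Lg + Lf" "\<And>x y. \<bar>x\<bar> \<le> M \<Longrightarrow> \<bar>y\<bar> \<le> M \<Longrightarrow> \<bar>h x - h y\<bar> \<le> l * \<bar>x - y\<bar>" for h :: "real \<Rightarrow> real" and s l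
  proof -
    have "\<bar>h s - h 0\<bar> \<le> l * \<bar>s - 0\<bar>" using that by (intro that(6)) auto
    also have "\<dots> = l * (- s)" using that(2) by simp
    also have "\<dots> \<le> (Lg + Lf) * (- s)" by (rule mult_right_mono) (use that in auto)
    finally have "\<bar>h s\<bar> \<le> (Lg + Lf) * (0 - s)" using that(3) by simp
    then show ?thesis by linarith
  qed
  have "\<nu> * 0 \<le> u y z t \<and> \<mu> * 0 \<le> v y z t"
  proof (rule pair_compare[OF pos _ hu hv M, where X = "\<lambda>y t. 0" and L = "Lg + Lf" and C = 0])
    fix y :: "real^'m" and s :: real assume "0 < s" "s \<le> t"
    show "\<exists>pt py. ((\<lambda>t. 0) has_real_derivative pt) (at s) \<and> (\<forall>i::'m. has_d2 (\<lambda>s. 0) 0 (py i)) \<and>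
      (\<forall>s. \<bar>s\<bar> \<le> M \<longrightarrow> s \<le> \<nu> * 0 \<longrightarrow> \<nu> * (pt - D * (\<Sum>i\<in>UNIV. py i)) \<le> g s + (Lg + Lf) * (\<nu> * 0 - s)) \<and>
      (\<forall>s. \<bar>s\<bar> \<le> M \<longrightarrow> s \<le> \<mu> * 0 \<longrightarrow> \<mu> * (pt - d * (\<Sum>i\<in>UNIV. py i)) \<le> f s + (Lg + Lf) * (\<mu> * 0 - s))"
      by (rule exI[of _ 0], rule exI[of _ "\<lambda>i. 0"])
        (use lin[of _ g Lg] lin[of _ f Lf] L z has_d2_const in auto)
  qed (use L init zt in auto)
  then show ?thesis by simp
qed

text \<open>The constants \<open>\<nu> * K\<close>, \<open>\<mu> * K\<close> exchange no flux, and
  \<open>K\<close> puts them above the datum and beyond both carrying capacities, where the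
  reactions are negative. The bound is uniform in time although the a priori bound \<open>M\<close>
  depends on \<open>T\<close>.\<close>

lemma pair_upper:
  fixes u v :: "real^'m::finite \<Rightarrow> real \<Rightarrow> real \<Rightarrow> real"
  assumes pos: "D > 0" "d > 0" "\<mu> > 0" "\<nu> > 0" and kg: "KPP_f g gp S" and kf: "KPP_f f fp S'"
    and hu: "half D g u (\<lambda>y t. \<nu> * v y 0 t - \<mu> * u y 0 t)" and hv: "half d f v (\<lambda>y t. \<mu> * u y 0 t - \<nu> * v y 0 t)"
    and bd: "\<And>T. \<exists>M. \<forall>y z t. z \<le> 0 \<longrightarrow> 0 \<le> t \<longrightarrow> t \<le> T \<longrightarrow> \<bar>u y z t\<bar> \<le> M \<and> \<bar>v y z t\<bar> \<le> M"
    and init: "\<And>y z. z \<le> 0 \<Longrightarrow> u y z 0 \<le> M0 \<and> v y z 0 \<le> M0"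
  shows "\<exists>A. \<forall>y z t. z \<le> 0 \<longrightarrow> 0 \<le> t \<longrightarrow> u y z t \<le> A \<and> v y z t \<le> A"
proof -
  define X where "X = \<bar>M0\<bar> + S + S' + 1"
  define K where "K = X / \<nu> + X / \<mu>"
  have S: "S > 0" "S' > 0" using kg kf by (auto simp: KPP_f_def)
  have K: "\<bar>M0\<bar> + S + S' < \<nu> * K" "\<bar>M0\<bar> + S + S' < \<mu> * K"
  proof -
    have "0 < X" using S unfolding X_def by linarith
    then have "0 < \<nu> * (X / \<mu>)" "0 < \<mu> * (X / \<nu>)" using pos by auto
    moreover have "\<nu> * K = X + \<nu> * (X / \<mu>)" "\<mu> * K = X + \<mu> * (X / \<nu>)" using pos by (simp_all add: K_def distrib_left)
    ultimately show "\<bar>M0\<bar> + S + S' < \<nu> * K" "\<bar>M0\<bar> + S + S' < \<mu> * K" unfolding X_def by linarith+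
  qed
  have ng: "x > S \<Longrightarrow> g x < 0" "x > S' \<Longrightarrow> f x < 0" for x using kg kf by (auto simp: KPP_f_def)
  have "u y z t \<le> \<nu> * K \<and> v y z t \<le> \<mu> * K" if zt: "z \<le> 0" "0 \<le> t" for y z t
  proof -
    obtain M where M: "\<And>y z s. z \<le> 0 \<Longrightarrow> 0 \<le> s \<Longrightarrow> s \<le> t \<Longrightarrow> \<bar>u y z s\<bar> \<le> M \<and> \<bar>v y z s\<bar> \<le> M" using bd by blast
    have hu': "half D (flip g) (\<lambda>y z t. - u y z t) (\<lambda>y t. \<nu> * (- v y 0 t) - \<mu> * (- u y 0 t))"
      using half_uminus[OF hu] by (simp add: flip_def[abs_def])
    have hv': "half d (flip f) (\<lambda>y z t. - v y z t) (\<lambda>y t. \<mu> * (- u y 0 t) - \<nu> * (- v y 0 t))"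
      using half_uminus[OF hv] by (simp add: flip_def[abs_def])
    have "\<nu> * (- K) \<le> - u y z t \<and> \<mu> * (- K) \<le> - v y z t"
    proof (rule pair_compare[OF pos _ hu' hv', where X = "\<lambda>y t. - K" and L = 0 and C = "- K" and T = t and M = M])
      fix y :: "real^'m" and s :: real assume "0 < s" "s \<le> t"
      have "0 \<le> flip g s" if "s \<le> \<nu> * (- K)" for s
      proof -
        have "S < - s" using that K S unfolding mult_minus_right by linarith
        then show ?thesis using ng(1)[of "- s"] by (simp add: flip_def)
      qed
      moreover have "0 \<le> flip f s" if "s \<le> \<mu> * (- K)" for s
      proof -
        have "S' < - s" using that K S unfolding mult_minus_right by linarith
        then show ?thesis using ng(2)[of "- s"] by (simp add: flip_def)
      qed
      ultimately show "\<exists>pt py. ((\<lambda>t. - K) has_real_derivative pt) (at s) \<and> (\<forall>i::'m. has_d2 (\<lambda>s. - K) 0 (py i)) \<and>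
        (\<forall>s. \<bar>s\<bar> \<le> M \<longrightarrow> s \<le> \<nu> * - K \<longrightarrow> \<nu> * (pt - D * (\<Sum>i\<in>UNIV. py i)) \<le> flip g s + 0 * (\<nu> * - K - s)) \<and>
        (\<forall>s. \<bar>s\<bar> \<le> M \<longrightarrow> s \<le> \<mu> * - K \<longrightarrow> \<mu> * (pt - d * (\<Sum>i\<in>UNIV. py i)) \<le> flip f s + 0 * (\<mu> * - K - s))"
        by (intro exI[of _ 0] exI[of _ "\<lambda>i. 0"]) (auto intro: has_d2_const)
    next
      fix y :: "real^'m" and z :: real assume "z \<le> 0"
      then show "\<nu> * - K \<le> - u y z 0 \<and> \<mu> * - K \<le> - v y z 0" using init[of z y] K S by auto
    qed (use M zt in auto)
    then show ?thesis by simp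
  qed
  then have "u y z t \<le> max (\<nu> * K) (\<mu> * K) \<and> v y z t \<le> max (\<nu> * K) (\<mu> * K)" if "z \<le> 0" "0 \<le> t" for y z t
    using that by (meson max.coboundedI1 max.coboundedI2)
  then show ?thesis by blast
qed

text \<open>In the first two cases the exponent is the minimiser of one dispersion curve, and the
  case condition says precisely that the other curve is not higher there; in the third it is the
  crossing point.\<close>

lemma cstar_inf_exponent:
  assumes pos: "D > 0" "d > 0" "gp > 0" "fp > 0"
  shows "\<exists>\<alpha>>0. D * \<alpha>\<^sup>2 + gp \<le> cstar_inf D d fp gp * \<alpha> \<and> d * \<alpha>\<^sup>2 + fp \<le> cstar_inf D d fp gp * \<alpha>"
proof -
  have one: "2 * sqrt (a * b) * sqrt (b / a) = 2 * b" "a * (sqrt (b / a))\<^sup>2 = b" if "a > 0" "b > 0" for a b :: real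
  proof -
    have "sqrt (a * b) * sqrt (b / a) = sqrt (b\<^sup>2)"
      using that by (simp add: real_sqrt_mult[symmetric] power2_eq_square)
    then show "2 * sqrt (a * b) * sqrt (b / a) = 2 * b" using that by simp
    show "a * (sqrt (b / a))\<^sup>2 = b" using that by simp
  qed
  consider "D / d \<le> 2 - gp / fp" | "\<not> D / d \<le> 2 - gp / fp" "d / D \<le> 2 - fp / gp"
    | "\<not> D / d \<le> 2 - gp / fp" "\<not> d / D \<le> 2 - fp / gp" by blast
  then show ?thesis
  proof cases
    case 1
    have "D * (fp / d) + gp \<le> 2 * fp"
    proof -
      have "D / d * fp \<le> (2 - gp / fp) * fp" using 1 pos by (intro mult_right_mono) auto
      then show ?thesis using pos by (simp add: left_diff_distrib)
    qed
    then show ?thesis using 1 pos one[of d fp] by (intro exI[of _ "sqrt (fp / d)"]) (auto simp: cstar_inf_def)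
  next
    case 2
    have "d * (gp / D) + fp \<le> 2 * gp"
    proof -
      have "d / D * gp \<le> (2 - fp / gp) * gp" using 2 pos by (intro mult_right_mono) auto
      then show ?thesis using pos by (simp add: left_diff_distrib)
    qed
    then show ?thesis using 2 pos one[of D gp] by (intro exI[of _ "sqrt (gp / D)"]) (auto simp: cstar_inf_def)
  next
    case 3
    define A where "A = (fp - gp) / (D - d)"
    note ano = cstar_inf_anomalous[OF pos 3, folded A_def]
    have "A * (D - d) = fp - gp" using ano(2) by (simp add: A_def)
    then have "d * A + fp = D * A + gp" by (simp add: algebra_simps)
    then show ?thesis using ano by (intro exI[of _ "sqrt A"]) auto
  qed
qed

text \<open>\<alpha> encodes the dispersion inequality of both media, and
  \<open>f s \<le> f'(0) * s\<close> lets the linearised equations dominate. The sign \<zeta>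
  selects the direction of decay along the axis \<open>i\<close>.\<close>

lemma pair_decay:
  fixes u v :: "real^'m::finite \<Rightarrow> real \<Rightarrow> real \<Rightarrow> real"
  assumes pos: "D > 0" "d > 0" "\<mu> > 0" "\<nu> > 0" and kg: "KPP_f g gp S" and kf: "KPP_f f fp S'"
    and hu: "half D g u (\<lambda>y t. \<nu> * v y 0 t - \<mu> * u y 0 t)" and hv: "half d f v (\<lambda>y t. \<mu> * u y 0 t - \<nu> * v y 0 t)"
    and bd: "\<And>T. \<exists>M. \<forall>y z t. z \<le> 0 \<longrightarrow> 0 \<le> t \<longrightarrow> t \<le> T \<longrightarrow> \<bar>u y z t\<bar> \<le> M \<and> \<bar>v y z t\<bar> \<le> M"
    and \<alpha>: "D * \<alpha>\<^sup>2 + gp \<le> c * \<alpha>" "d * \<alpha>\<^sup>2 + fp \<le> c * \<alpha>" and K: "K > 0" and \<zeta>: "\<zeta>\<^sup>2 = (1::real)"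
    and init: "\<And>y z. z \<le> 0 \<Longrightarrow> u y z 0 \<le> \<nu> * (K * exp (- \<alpha> * (\<zeta> * y $ i))) \<and> v y z 0 \<le> \<mu> * (K * exp (- \<alpha> * (\<zeta> * y $ i)))"
    and zt: "z \<le> 0" "0 \<le> t"
  shows "u y z t \<le> \<nu> * (K * exp (- \<alpha> * (\<zeta> * y $ i - c * t))) \<and> v y z t \<le> \<mu> * (K * exp (- \<alpha> * (\<zeta> * y $ i - c * t)))"
proof -
  obtain M where M: "\<And>y z s. z \<le> 0 \<Longrightarrow> 0 \<le> s \<Longrightarrow> s \<le> t \<Longrightarrow> \<bar>u y z s\<bar> \<le> M \<and> \<bar>v y z s\<bar> \<le> M" using bd by blast
  have hu': "half D (flip g) (\<lambda>y z t. - u y z t) (\<lambda>y t. \<nu> * (- v y 0 t) - \<mu> * (- u y 0 t))"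
    using half_uminus[OF hu] by (simp add: flip_def[abs_def])
  have hv': "half d (flip f) (\<lambda>y z t. - v y z t) (\<lambda>y t. \<mu> * (- u y 0 t) - \<nu> * (- v y 0 t))"
    using half_uminus[OF hv] by (simp add: flip_def[abs_def])
  have rates: "gp > 0" "fp > 0" using KPP_f_rate_pos kg kf by auto
  define X where "X y t = - (K * exp (- \<alpha> * (\<zeta> * y $ i - c * t)))" for y :: "real^'m" and t
  have X0: "X y t < 0" for y t using K by (simp add: X_def)
  have lin: "m * ((c * \<alpha>) * X y s - E * (\<alpha>\<^sup>2 * X y s)) \<le> flip h x + (gp + fp) * (m * X y s - x)"
    if "KPP_f h hp H" "hp \<le> gp + fp" "E * \<alpha>\<^sup>2 + hp \<le> c * \<alpha>" "m > 0" "x \<le> m * X y s" for h hp H E m x y s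
  proof -
    have mX: "m * X y s < 0" using X0[of y s] that(4) by (simp add: mult_pos_neg)
    have "h (- x) \<le> hp * (- x)" using mX that(5) by (intro KPP_f_le_linear[OF that(1)]) simp
    then have "hp * x \<le> flip h x" by (simp add: flip_def)
    moreover have "hp * (m * X y s - x) \<le> (gp + fp) * (m * X y s - x)" using that by (intro mult_right_mono) auto
    ultimately have 1: "hp * (m * X y s) \<le> flip h x + (gp + fp) * (m * X y s - x)" by (simp add: right_diff_distrib)
    have "(c * \<alpha> - E * \<alpha>\<^sup>2) * (m * X y s) \<le> hp * (m * X y s)"
      using that mX by (intro mult_right_mono_neg) auto
    also note 1
    also have "(c * \<alpha> - E * \<alpha>\<^sup>2) * (m * X y s) = m * ((c * \<alpha>) * X y s - E * (\<alpha>\<^sup>2 * X y s))" by (simp add: algebra_simps)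
    finally show ?thesis .
  qed
  have "\<nu> * X y t \<le> - u y z t \<and> \<mu> * X y t \<le> - v y z t"
  proof (rule pair_compare[OF pos _ hu' hv', where X = X and L = "gp + fp" and C = 0 and T = t and M = M])
    show "continuous_on UNIV (\<lambda>(y, t). X y t)" unfolding X_def split_beta by (intro continuous_intros)
    show "X y s \<le> 0" for y s using X0 less_imp_le by blast
    fix y :: "real^'m" and s :: real assume "0 < s" "s \<le> t"
    show "\<exists>pt py. ((\<lambda>t. X y t) has_real_derivative pt) (at s) \<and> (\<forall>j. has_d2 (\<lambda>r. X (y + r *\<^sub>R axis j 1) s) 0 (py j)) \<and>
      (\<forall>x. \<bar>x\<bar> \<le> M \<longrightarrow> x \<le> \<nu> * X y s \<longrightarrow> \<nu> * (pt - D * (\<Sum>i\<in>UNIV. py i)) \<le> flip g x + (gp + fp) * (\<nu> * X y s - x)) \<and>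
      (\<forall>x. \<bar>x\<bar> \<le> M \<longrightarrow> x \<le> \<mu> * X y s \<longrightarrow> \<mu> * (pt - d * (\<Sum>i\<in>UNIV. py i)) \<le> flip f x + (gp + fp) * (\<mu> * X y s - x))"
    proof (intro exI conjI)
      define py where "py j = (if j = i then \<alpha>\<^sup>2 * X y s else 0)" for j
      show "((\<lambda>t. X y t) has_real_derivative (c * \<alpha>) * X y s) (at s)"
        unfolding X_def by (auto intro!: derivative_eq_intros)
      show "\<forall>j. has_d2 (\<lambda>r. X (y + r *\<^sub>R axis j 1) s) 0 (py j)"
      proof
        fix j
        show "has_d2 (\<lambda>r. X (y + r *\<^sub>R axis j 1) s) 0 (py j)"
        proof (cases "j = i")
          case True
          have eq: "X (y + r *\<^sub>R axis j 1) s = X y s * exp (- \<alpha> * \<zeta> * r)" for r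
            using True by (simp add: X_def exp_add[symmetric] algebra_simps)
          show ?thesis unfolding eq
            by (rule has_d2I[where c' = "\<lambda>r. X y s * (- \<alpha> * \<zeta>) * exp (- \<alpha> * \<zeta> * r)"])
              (use \<zeta> True in \<open>auto intro!: derivative_eq_intros simp: py_def power2_eq_square\<close>)
        next
          case False
          then have "X (y + r *\<^sub>R axis j 1) s = X y s" for r by (simp add: X_def axis_def)
          then show ?thesis using False by (simp add: py_def has_d2_const)
        qed
      qed
      have sum: "(\<Sum>i\<in>UNIV. py i) = \<alpha>\<^sup>2 * X y s" by (simp add: py_def)
      show "\<forall>x. \<bar>x\<bar> \<le> M \<longrightarrow> x \<le> \<nu> * X y s \<longrightarrow> \<nu> * ((c * \<alpha>) * X y s - D * (\<Sum>i\<in>UNIV. py i)) \<le> flip g x + (gp + fp) * (\<nu> * X y s - x)"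
        unfolding sum using lin[OF kg _ \<alpha>(1) pos(4)] rates by auto
      show "\<forall>x. \<bar>x\<bar> \<le> M \<longrightarrow> x \<le> \<mu> * X y s \<longrightarrow> \<mu> * ((c * \<alpha>) * X y s - d * (\<Sum>i\<in>UNIV. py i)) \<le> flip f x + (gp + fp) * (\<mu> * X y s - x)"
        unfolding sum using lin[OF kf _ \<alpha>(2) pos(3)] rates by auto
    qed
  next
    fix y :: "real^'m" and z :: real assume "z \<le> 0"
    then show "\<nu> * X y 0 \<le> - u y z 0 \<and> \<mu> * X y 0 \<le> - v y z 0" using init[of z y] by (simp add: X_def)
  qed (use M zt rates in auto)
  then show ?thesis by (simp add: X_def)
qed

text \<open>Interface values of the steady state.  If \<open>\<mu>S \<ge> \<nu>S'\<close> then the lower density decreases and the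
  upper one increases towards the interface, which fixes the interval for the intermediate value theorem.\<close>

lemma interface_values_ordered:
  assumes pos: "D > 0" "d > 0" "\<mu> > 0" "\<nu> > 0" and kg: "KPP_f g gp S" and kf: "KPP_f f fp S'" and ord: "\<nu> * S' \<le> \<mu> * S"
  shows "\<exists>a b. 0 < a \<and> 0 < b \<and> D * slope D g S a = \<nu> * b - \<mu> * a \<and> d * slope d f S' b = \<mu> * a - \<nu> * b"
proof -
  have S: "S > 0" "S' > 0" using kg kf by (auto simp: KPP_f_def)
  show ?thesis
  proof (cases "\<nu> * S' = \<mu> * S")
    case True
    then show ?thesis using S by (intro exI[of _ S] exI[of _ S']) (simp add: slope_def)
  next
    case False
    with ord have ord: "\<nu> * S' < \<mu> * S" by simp
    \<comment> \<open>Because \<open>lo\<close> is below \<open>\<nu> * S' / \<mu>\<close> and the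
      slope at \<open>lo\<close> is negative, \<open>B lo\<close> falls below \<open>S'\<close>;
      this is the left end for the first use of the intermediate value theorem.\<close>
    define m where "m = min (\<nu> * S' / \<mu>) (min S S')"
    define lo where "lo = m / 2"
    have m: "0 < m" "m \<le> \<nu> * S' / \<mu>" "m \<le> S" "m \<le> S'" using S pos by (auto simp: m_def)
    define hi where "hi = S + S' + \<mu> * S / \<nu> + 1"
    have lo: "0 < lo" "lo < S" "lo < S'" "lo < \<nu> * S' / \<mu>" using m unfolding lo_def by linarith+
    have "0 < \<mu> * S / \<nu>" using S pos by simp
    then have hi: "S < hi" "S' < hi" "\<mu> * S / \<nu> < hi" using S unfolding hi_def by linarith+
    interpret G: profile D g lo S hi by (rule profile_sign_change[OF KPP_f_sign_change[OF kg lo(1,2) hi(1)] pos(1)])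
    interpret H: profile d f lo S' hi by (rule profile_sign_change[OF KPP_f_sign_change[OF kf lo(1,3) hi(2)] pos(2)])
    \<comment> \<open>The upper interface value that the lower flux balance assigns to
      \<open>a\<close>.\<close>
    define B where "B a = (D * G.P a + \<mu> * a) / \<nu>" for a
    have cB: "isCont B a" for a unfolding B_def[abs_def] using G.P_isCont pos by (intro continuous_intros) auto
    have BS: "B S = \<mu> * S / \<nu>" by (simp add: B_def G.P_s)
    have "B lo < S'"
    proof -
      have "D * G.P lo < 0" using G.P_neg[OF lo(2)] pos by (simp add: mult_pos_neg)
      moreover have "\<mu> * lo < \<nu> * S'" using lo(4) pos by (simp add: field_simps)
      ultimately show ?thesis using pos by (simp add: B_def field_simps)
    qed
    moreover have BSS: "S' < B S" using ord pos by (simp add: BS field_simps)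
    ultimately obtain a0 where a0: "lo \<le> a0" "a0 \<le> S" "B a0 = S'" using IVT[of B lo S' S] cB lo by auto
    have a0S: "a0 < S" using a0 BSS by (cases "a0 = S") auto
    \<comment> \<open>The sum of the two fluxes, whose zero solves the second balance as well. At
      \<open>a0\<close> the upper slope vanishes and the lower is negative; at \<open>S\<close> the
      lower vanishes and the upper is positive.\<close>
    define E where "E a = D * G.P a + d * H.P (B a)" for a
    have cE: "isCont E a" for a
      unfolding E_def[abs_def] using G.P_isCont isCont_o2[OF cB H.P_isCont] by (intro continuous_intros) auto
    have "E a0 \<le> 0" using G.P_neg[OF a0S] pos a0(3) by (simp add: E_def H.P_s mult_pos_neg less_imp_le)
    moreover have "0 \<le> E S" using H.P_pos[OF BSS] pos by (simp add: E_def G.P_s)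
    ultimately obtain a where a: "a0 \<le> a" "a \<le> S" "E a = 0" using IVT[of E a0 0 S] cE a0 by auto
    have Bmono: "B x \<le> B y" if "x \<le> y" for x y
      using G.P_mono[OF that] that pos unfolding B_def by (intro divide_right_mono add_mono mult_left_mono) auto
    have b: "S' \<le> B a" "B a \<le> \<mu> * S / \<nu>" using Bmono[OF a(1)] Bmono[OF a(2)] a0(3) BS by auto
    have "G.P a = slope D g S a" by (rule G.P_eq) (use a(1,2) a0(1,2) hi lo in linarith)+
    moreover have "H.P (B a) = slope d f S' (B a)" by (rule H.P_eq) (use b hi lo in linarith)+
    moreover have "D * G.P a = \<nu> * B a - \<mu> * a" using pos by (simp add: B_def)
    moreover have "d * H.P (B a) = - (D * G.P a)" using a(3) by (simp add: E_def)
    ultimately show ?thesis using a a0 lo b S by (intro exI[of _ a] exI[of _ "B a"]) auto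
  qed
qed

lemma interface_values:
  assumes pos: "D > 0" "d > 0" "\<mu> > 0" "\<nu> > 0" and kg: "KPP_f g gp S" and kf: "KPP_f f fp S'"
  shows "\<exists>a b. 0 < a \<and> 0 < b \<and> D * slope D g S a = \<nu> * b - \<mu> * a \<and> d * slope d f S' b = \<mu> * a - \<nu> * b"
proof (cases "\<nu> * S' \<le> \<mu> * S")
  case True
  then show ?thesis by (rule interface_values_ordered[OF pos kg kf])
next
  case False
  then show ?thesis using interface_values_ordered[OF pos(2,1,4,3) kf kg] by fastforce
qed

lemma steady_exists:
  assumes pos: "D > 0" "d > 0" "\<mu> > 0" "\<nu> > 0" and kg: "KPP_f g gp S" and kf: "KPP_f f fp S'"
  shows "\<exists>U V. steady_H D d \<mu> \<nu> g f U V"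
proof -
  obtain a b where ab: "0 < a" "0 < b" "D * slope D g S a = \<nu> * b - \<mu> * a" "d * slope d f S' b = \<mu> * a - \<nu> * b"
    using interface_values[OF pos kg kf] by blast
  have S: "S > 0" "S' > 0" using kg kf by (auto simp: KPP_f_def)
  \<comment> \<open>Orbits stay between their start value and the rest point, hence strictly between
    \<open>lo\<close> and \<open>hi\<close>, where the clamping in \<open>P\<close> has no
    effect.\<close>
  define lo where "lo = min (min a b) (min S S') / 2"
  define hi where "hi = a + b + S + S'"
  have lo: "0 < lo" "lo < S" "lo < S'" "lo < a" "lo < b" using S ab by (auto simp: lo_def min_def)
  have hi: "S < hi" "S' < hi" "a < hi" "b < hi" using S ab by (auto simp: hi_def)
  interpret G: profile D g lo S hi by (rule profile_sign_change[OF KPP_f_sign_change[OF kg lo(1,2) hi(1)] pos(1)])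
  interpret H: profile d f lo S' hi by (rule profile_sign_change[OF KPP_f_sign_change[OF kf lo(1,3) hi(2)] pos(2)])
  define U where "U = G.orbit a"
  define V where "V z = H.orbit b (- z)" for z
  have rU: "lo < U z" "U z < hi" if "z \<le> 0" for z
    using G.orbit_lower[OF that, of a] G.orbit_upper[OF that, of a] lo hi by (auto simp: U_def)
  have rV: "lo < H.orbit b z" "H.orbit b z < hi" if "z \<le> 0" for z
    using H.orbit_lower[OF that, of b] H.orbit_upper[OF that, of b] lo hi by auto
  have dV: "(V has_real_derivative - H.P (V z)) (at z)" for z
    unfolding V_def[abs_def] using H.orbit_deriv[of b "- z"] by (simp add: DERIV_mirror)
  have d2U: "has_d2 U z (- g (U z) / D)" if "z \<le> 0" for z
    using G.orbit_has_d2[of a z] rU[OF that] by (simp add: U_def)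
  have d2V: "has_d2 V z (- f (V z) / d)" if "0 \<le> z" for z
    unfolding V_def[abs_def] using H.orbit_has_d2[of b "- z"] rV[of "- z"] that by (intro has_d2_reflect) simp
  have "steady_H D d \<mu> \<nu> g f U V"
    unfolding steady_H_def
  proof (intro conjI allI impI)
    show "continuous_on {..0} U"
      unfolding U_def using G.orbit_deriv DERIV_isCont by (intro continuous_at_imp_continuous_on) blast
    show "continuous_on {0..} V" using dV DERIV_isCont by (intro continuous_at_imp_continuous_on) blast
    fix z :: real
    show "U differentiable (at z)" "deriv U differentiable (at z)" "D * deriv (deriv U) z + g (U z) = 0" if "z < 0"
      using has_d2_deriv[OF d2U[of z]] that pos DERIV_imp_deriv[OF has_d2_deriv(2)[OF d2U[of z]]]
      by (auto simp: real_differentiable_def)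
    show "V differentiable (at z)" "deriv V differentiable (at z)" "d * deriv (deriv V) z + f (V z) = 0" if "z > 0"
      using has_d2_deriv[OF d2V[of z]] that pos DERIV_imp_deriv[OF has_d2_deriv(2)[OF d2V[of z]]]
      by (auto simp: real_differentiable_def)
    show "0 < U z" if "z \<le> 0" using rU(1)[OF that] lo by simp
    show "0 < V z" if "0 \<le> z" using rV(1)[of "- z"] that lo by (simp add: V_def)
  next
    have U0: "U 0 = a" "V 0 = b" by (simp_all add: U_def V_def G.orbit_0 H.orbit_0)
    have "(U has_real_derivative slope D g S a) (at 0)"
      using G.orbit_deriv[of a 0] G.P_eq[of a] lo hi by (simp add: U_def G.orbit_0)
    moreover have "(V has_real_derivative - slope d f S' b) (at 0)"
      using dV[of 0] H.P_eq[of b] lo hi U0 by simp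
    ultimately show "\<exists>a b. (U has_real_derivative a) (at 0 within {..0}) \<and> (V has_real_derivative b) (at 0 within {0..}) \<and>
      D * a = \<nu> * V 0 - \<mu> * U 0 \<and> - d * b = \<mu> * U 0 - \<nu> * V 0"
      using ab U0 by (intro exI[of _ "slope D g S a"] exI[of _ "- slope d f S' b"]) (auto intro: has_field_derivative_at_within)
    show "\<exists>M. (\<forall>z\<le>0. U z \<le> M) \<and> (\<forall>z\<ge>0. V z \<le> M)"
      using rU(2) rV(2) by (intro exI[of _ hi]) (auto simp: V_def intro: less_imp_le)
  qed
  then show ?thesis by blast
qed

text \<open>No behaviour at infinity is assumed of the steady state. As a time-independent solution
  it is bounded below on one ball by compactness, then uniformly by
  \<open>uniformly_positive_pair\<close>; \<open>slope_ge_of_level\<close>, applied to the profile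
  and to its negative, gives the flux balance as two opposite inequalities.\<close>

lemma steady_interface:
  assumes st: "steady_H D d \<mu> \<nu> g f U V" and pos: "D > 0" "d > 0" "\<mu> > 0" "\<nu> > 0"
    and kg: "KPP_f g gp S" and kf: "KPP_f f fp S'"
  shows "\<exists>\<epsilon>>0. (\<forall>z\<le>0. \<epsilon> \<le> U z \<and> \<epsilon> \<le> V (- z)) \<and> D * slope D g S (U 0) = \<nu> * V 0 - \<mu> * U 0
     \<and> d * slope d f S' (V 0) = \<mu> * U 0 - \<nu> * V 0"
proof -
  let ?F = "cone 0 :: ((real^1) \<times> real) filter"
  have F: "thick ?F" by (rule thick_cone) simp
  \<comment> \<open>For statements free of \<open>(y, t)\<close>, holding eventually along a
    nontrivial filter means holding.\<close>
  have const: "P" if "eventually (\<lambda>(y, t). P) ?F" for P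
    using that F by (cases P) (simp_all add: thick_def case_prod_unfold)
  obtain M where M: "\<And>z. z \<le> 0 \<Longrightarrow> U z \<le> M" "\<And>z. z \<ge> 0 \<Longrightarrow> V z \<le> M"
    and Upos: "\<And>z. z \<le> 0 \<Longrightarrow> 0 < U z" and Vpos: "\<And>z. z \<ge> 0 \<Longrightarrow> 0 < V z"
    using st unfolding steady_H_def by blast
  note hs = half_of_steady[OF st pos(1,2), where 'm = 1]
  interpret P: pair_pos D \<mu> gp g "\<lambda>(y::real^1) z t. U z" d \<nu> fp f "\<lambda>(y::real^1) z t. V (- z)"
    by (rule pair_posI[OF pos kg kf]) (use hs Upos Vpos in \<open>auto intro: less_imp_le\<close>)
  have rates: "gp > 0" "fp > 0" using KPP_f_rate_pos kg kf by auto
  obtain \<epsilon>1 where e1: "\<epsilon>1 > 0" "\<And>t. 0 \<le> t \<Longrightarrow> t \<le> 0 \<Longrightarrow> lower_on_ball (\<lambda>(y::real^1) z t. V (- z)) 0 (- 2 - 1) 2 t \<epsilon>1"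
    using P.V.positive_on_compact[of 0 0 2 0] Vpos by auto
  have "lower_on_ball (\<lambda>(y::real^1) z t. V (- z)) y (- 2 - 1) 2 t \<epsilon>1" for y t
    unfolding lower_on_ball_def
  proof (intro allI impI)
    fix y' :: "real^1" and z :: real assume "z \<le> 0" "(norm (y' - y))\<^sup>2 + (z - (- 2 - 1))\<^sup>2 \<le> 2\<^sup>2"
    then show "\<epsilon>1 \<le> V (- z)" using e1(2)[of 0] unfolding lower_on_ball_def by (auto dest!: spec[of _ "y' - y"] spec[of _ z])
  qed
  then have "eventually (\<lambda>(y, t). lower_on_ball (\<lambda>(y::real^1) z t. V (- z)) y (- 2 - 1) 2 t \<epsilon>1) ?F"
    by (intro always_eventually) (simp add: split_paired_all)
  then obtain \<epsilon> where e: "\<epsilon> > 0" "\<And>Z. eventually (\<lambda>(y, t). \<forall>z. - Z \<le> z \<longrightarrow> z \<le> 0 \<longrightarrow> \<epsilon> \<le> U z \<and> \<epsilon> \<le> V (- z)) ?F"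
    using P.uniformly_positive_pair[where R = 2, OF F rates(2,1) order_refl e1(1)] by blast
  have lb: "\<epsilon> \<le> U z \<and> \<epsilon> \<le> V (- z)" if "z \<le> 0" for z
    using const[OF e(2)[of "- z"]] that by auto
  have S: "S > 0" "S' > 0" using kg kf by (auto simp: KPP_f_def)
  \<comment> \<open>The level at the interface is the value \<open>W 0\<close> itself and the flux
    is the constant \<open>q\<close>, hence the choice \<mu> = 0.\<close>
  have sl: "q = E * slope E h H (W 0)"
    if kh: "KPP_f h hp H" and E: "E > 0" and hW: "half E h (\<lambda>(y::real^1) z t. W z) (\<lambda>y t. q)" and W: "\<And>z. z \<le> 0 \<Longrightarrow> \<epsilon> \<le> W z \<and> W z \<le> M"
    for h hp H E W q
  proof -
    have H: "H > 0" and lip: "loc_lipschitz h" using kh by (auto simp: KPP_f_def)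
    define lo where "lo = min \<epsilon> H / 2"
    define hi where "hi = M + H + 1"
    have M0: "M \<ge> \<epsilon>" using W[of 0] by simp
    have lo: "0 < lo" "lo < H" "lo + lo \<le> \<epsilon>" using e H by (auto simp: lo_def min_def)
    have hi: "H < hi" "M + 1 \<le> hi" using H M0 e by (auto simp: hi_def)
    define \<eta> where "\<eta> = min lo 1"
    have \<eta>: "\<eta> > 0" "\<eta> \<le> lo" "\<eta> \<le> 1" using lo by (auto simp: \<eta>_def)
    note sc = KPP_f_sign_change[OF kh lo(1,2) hi(1)]
    have "q \<le> E * slope E h H (W 0)"
    proof (rule slope_ge_of_level[OF E hW F sc \<eta>(1), where \<mu> = 0])
      show "eventually (\<lambda>(y, t). \<forall>z. - Z \<le> z \<longrightarrow> z \<le> 0 \<longrightarrow> lo + \<eta> \<le> W z) ?F" for Z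
        using W \<eta> lo by (auto intro!: always_eventually) (smt (verit))
      show "\<not> eventually (\<lambda>(y, t). W 0 + \<theta> \<le> W 0) ?F" if "\<theta> > 0" for \<theta>
        using const[of "W 0 + \<theta> \<le> W 0"] that by auto
    qed (use W[of 0] lo hi \<eta> e in \<open>auto intro!: always_eventually\<close>)
    moreover have "- q \<le> E * slope E (flip h) (- H) (- W 0)"
    proof (rule slope_ge_of_level[OF E _ F sign_change_flip[OF sc] \<eta>(1), where \<mu> = 0])
      show "half E (flip h) (\<lambda>(y::real^1) z t. - W z) (\<lambda>y t. - q)" using half_uminus[OF hW] by (simp add: flip_def[abs_def])
      show "eventually (\<lambda>(y, t). \<forall>z. - Z \<le> z \<longrightarrow> z \<le> 0 \<longrightarrow> - hi + \<eta> \<le> - W z) ?F" for Z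
        using W \<eta> hi by (auto intro!: always_eventually) (smt (verit))
      show "\<not> eventually (\<lambda>(y, t). - W 0 + \<theta> \<le> - W 0) ?F" if "\<theta> > 0" for \<theta>
        using const[of "- W 0 + \<theta> \<le> - W 0"] that by auto
    qed (use W[of 0] lo hi \<eta> e in \<open>auto intro!: always_eventually\<close>)
    ultimately show ?thesis using slope_flip[OF loc_lipschitz_isCont[OF lip], of E H "W 0"] by simp
  qed
  have "\<nu> * V 0 - \<mu> * U 0 = D * slope D g S (U 0)"
    by (rule sl[OF kg pos(1) hs(1)]) (use lb M in auto)
  moreover have "\<mu> * U 0 - \<nu> * V 0 = d * slope d f S' (V (- 0))"
    by (rule sl[where W = "\<lambda>z. V (- z)", OF kf pos(2) hs(2)]) (use lb M in auto)
  ultimately show ?thesis using e(1) lb by (intro exI[of _ \<epsilon>]) auto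
qed

text \<open>The solution and the given steady state lie between the same envelopes, whose start
  values are the interface values of the steady state; the distance of the envelopes is small by
  \<open>env_gap\<close>. No formula for the steady state enters.\<close>

lemma pair_converges:
  fixes u v :: "real^'m::finite \<Rightarrow> real \<Rightarrow> real \<Rightarrow> real"
  assumes pos: "D > 0" "d > 0" "\<mu> > 0" "\<nu> > 0" and kg: "KPP_f g gp S" and kf: "KPP_f f fp S'"
    and hu: "half D g u (\<lambda>y t. \<nu> * v y 0 t - \<mu> * u y 0 t)" and hv: "half d f v (\<lambda>y t. \<mu> * u y 0 t - \<nu> * v y 0 t)"
    and nn: "\<And>y z t. z \<le> 0 \<Longrightarrow> 0 \<le> t \<Longrightarrow> 0 \<le> u y z t \<and> 0 \<le> v y z t"
    and upper: "\<And>y z t. z \<le> 0 \<Longrightarrow> 0 \<le> t \<Longrightarrow> u y z t \<le> A \<and> v y z t \<le> A"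
    and init: "(\<exists>y z. z \<le> 0 \<and> 0 < u y z 0) \<or> (\<exists>y z. z \<le> 0 \<and> 0 < v y z 0)"
    and c: "0 < c" "c < cstar_inf D d fp gp" and st: "steady_H D d \<mu> \<nu> g f U V" and \<epsilon>: "\<epsilon> > 0"
  shows "eventually (\<lambda>(y, t). \<forall>z\<in>{- Z..0}. \<bar>u y z t - U z\<bar> < \<epsilon> \<and> \<bar>v y z t - V (- z)\<bar> < \<epsilon>) (cone c)"
proof -
  have S: "S > 0" "S' > 0" using kg kf by (auto simp: KPP_f_def)
  have rates: "gp > 0" "fp > 0" using KPP_f_rate_pos kg kf by auto
  interpret P: pair_pos D \<mu> gp g u d \<nu> fp f v by (rule pair_posI[OF pos kg kf hu hv nn])
  have F: "thick (cone c :: ((real^'m) \<times> real) filter)" by (rule thick_cone) (use c in simp)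
  obtain R \<epsilon>1 where R: "R \<ge> 2" "\<epsilon>1 > 0" "eventually (\<lambda>(y, t). lower_on_ball v y (- R - 1) R t \<epsilon>1) (cone c)"
    using P.persistence[OF init rates(2,1) c] by blast
  obtain \<epsilon>0 where e0: "\<epsilon>0 > 0" "\<And>Z. eventually (\<lambda>(y, t). \<forall>z. - Z \<le> z \<longrightarrow> z \<le> 0 \<longrightarrow> \<epsilon>0 \<le> u y z t \<and> \<epsilon>0 \<le> v y z t) (cone c)"
    using P.uniformly_positive_pair[OF F rates(2,1) R] by blast
  obtain \<epsilon>s where es: "\<epsilon>s > 0" "\<And>z. z \<le> 0 \<Longrightarrow> \<epsilon>s \<le> U z \<and> \<epsilon>s \<le> V (- z)"
    and root: "D * slope D g S (U 0) = \<nu> * V 0 - \<mu> * U 0" "d * slope d f S' (V 0) = \<mu> * U 0 - \<nu> * V 0"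
    using steady_interface[OF st pos kg kf] by blast
  obtain M where M: "\<And>z. z \<le> 0 \<Longrightarrow> U z \<le> M" "\<And>z. z \<ge> 0 \<Longrightarrow> V z \<le> M" using st unfolding steady_H_def by blast
  define m where "m = min (min \<epsilon>0 \<epsilon>s) (min S S')"
  \<comment> \<open>\<eta> serves both as the lower end \<open>lo\<close> and as the margin above
    it, so \<open>\<eta> + \<eta>\<close> has to stay below both uniform lower bounds.\<close>
  define \<eta> where "\<eta> = m / 2"
  define hi where "hi = \<bar>A\<bar> + \<bar>M\<bar> + S + S' + \<eta>"
  have m: "m > 0" "m \<le> \<epsilon>0" "m \<le> \<epsilon>s" "m \<le> S" "m \<le> S'" using e0 es S by (auto simp: m_def)
  have lo: "0 < \<eta>" "\<eta> < S" "\<eta> < S'" "\<eta> + \<eta> \<le> \<epsilon>0" "\<eta> + \<eta> \<le> \<epsilon>s" using m by (auto simp: \<eta>_def)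
  have hi: "S < hi" "S' < hi" "A \<le> hi - \<eta>" "M \<le> hi - \<eta>" using S lo unfolding hi_def by linarith+
  note g = KPP_f_sign_change[OF kg lo(1,2) hi(1)] and f = KPP_f_sign_change[OF kf lo(1,3) hi(2)]
  have ab: "\<eta> < U 0" "U 0 < hi" "\<eta> < V 0" "V 0 < hi" using es(2)[of 0] M[of 0] lo hi by auto
  \<comment> \<open>The envelopes are at most \<open>e\<close> apart and each is relaxed by
    \<open>e\<close>: in total 3e, strictly less than \<epsilon>.\<close>
  define e where "e = \<epsilon> / 4"
  have e: "e > 0" "4 * e = \<epsilon>" using \<epsilon> by (auto simp: e_def)
  obtain \<delta>1 where d1: "\<delta>1 > 0" "\<And>\<delta>. 0 < \<delta> \<Longrightarrow> \<delta> < \<delta>1 \<Longrightarrow> \<delta> < 1 \<and> \<delta> < S - \<eta> \<and> \<delta> < hi - S \<and>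
     (\<forall>z\<in>{- Z..0}. - lower_env D (flip g) (- hi) (- S) (- \<eta>) \<delta> (- U 0) z - lower_env D g \<eta> S hi \<delta> (U 0) z \<le> e)"
    using env_gap[OF g pos(1) ab(1,2) e(1)] by blast
  obtain \<delta>2 where d2: "\<delta>2 > 0" "\<And>\<delta>. 0 < \<delta> \<Longrightarrow> \<delta> < \<delta>2 \<Longrightarrow> \<delta> < 1 \<and> \<delta> < S' - \<eta> \<and> \<delta> < hi - S' \<and>
     (\<forall>z\<in>{- Z..0}. - lower_env d (flip f) (- hi) (- S') (- \<eta>) \<delta> (- V 0) z - lower_env d f \<eta> S' hi \<delta> (V 0) z \<le> e)"
    using env_gap[OF f pos(2) ab(3,4) e(1)] by blast
  define \<delta> where "\<delta> = min \<delta>1 \<delta>2 / 2"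
  have \<delta>: "0 < \<delta>" "\<delta> < \<delta>1" "\<delta> < \<delta>2" using d1 d2 by (auto simp: \<delta>_def min_def)
  note D1 = d1(2)[OF \<delta>(1,2)] and D2 = d2(2)[OF \<delta>(1,3)]
  let ?L = "\<lambda>z. lower_env D g \<eta> S hi \<delta> (U 0) z" and ?H = "\<lambda>z. - lower_env D (flip g) (- hi) (- S) (- \<eta>) \<delta> (- U 0) z"
  let ?l = "\<lambda>z. lower_env d f \<eta> S' hi \<delta> (V 0) z" and ?h = "\<lambda>z. - lower_env d (flip f) (- hi) (- S') (- \<eta>) \<delta> (- V 0) z"
  have hs: "half D g (\<lambda>(y::real^'m) z t. U z) (\<lambda>y t. \<nu> * V (- 0) - \<mu> * U 0)"
    "half d f (\<lambda>(y::real^'m) z t. V (- z)) (\<lambda>y t. \<mu> * U 0 - \<nu> * V (- 0))"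
    using half_of_steady[OF st pos(1,2), where 'm = 'm] by simp_all
  have "eventually (\<lambda>(y::real^'m, t::real). \<forall>z\<in>{- Z..0}. ?L z - e \<le> U z \<and> ?l z - e \<le> V (- z) \<and> U z \<le> ?H z + e \<and> V (- z) \<le> ?h z + e) (cone c)"
  proof (rule pair_sandwich[OF pos hs F g f lo(1) _ ab root])
    show "eventually (\<lambda>(y, t). \<forall>z. - Z \<le> z \<longrightarrow> z \<le> 0 \<longrightarrow> \<eta> + \<eta> \<le> U z \<and> \<eta> + \<eta> \<le> V (- z) \<and> U z \<le> hi - \<eta> \<and> V (- z) \<le> hi - \<eta>) (cone c)" for Z
    proof (rule always_eventually, safe)
      fix z :: real assume z: "z \<le> 0"
      show "\<eta> + \<eta> \<le> U z" "\<eta> + \<eta> \<le> V (- z)" "U z \<le> hi - \<eta>" "V (- z) \<le> hi - \<eta>"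
        using es(2)[OF z] M(1)[OF z] M(2)[of "- z"] z lo hi by linarith+
    qed
  qed (use D1 D2 \<delta> e in auto)
  moreover have "eventually (\<lambda>(y, t). \<forall>z\<in>{- Z..0}. ?L z - e \<le> u y z t \<and> ?l z - e \<le> v y z t \<and> u y z t \<le> ?H z + e \<and> v y z t \<le> ?h z + e) (cone c)"
  proof (rule pair_sandwich[OF pos hu hv F g f lo(1) _ ab root])
    show "eventually (\<lambda>(y, t). \<forall>z. - Z \<le> z \<longrightarrow> z \<le> 0 \<longrightarrow> \<eta> + \<eta> \<le> u y z t \<and> \<eta> + \<eta> \<le> v y z t \<and> u y z t \<le> hi - \<eta> \<and> v y z t \<le> hi - \<eta>) (cone c)" for Z
      using e0(2)[of Z] thick_late[OF F, of 0]
    proof eventually_elim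
      case (elim p)
      show ?case
        unfolding split_beta
      proof (intro allI impI)
        fix z assume z: "- Z \<le> z" "z \<le> 0"
        have "\<epsilon>0 \<le> u (fst p) z (snd p) \<and> \<epsilon>0 \<le> v (fst p) z (snd p)" "0 \<le> snd p" using elim z by (auto simp: split_beta)
        then show "\<eta> + \<eta> \<le> u (fst p) z (snd p) \<and> \<eta> + \<eta> \<le> v (fst p) z (snd p) \<and> u (fst p) z (snd p) \<le> hi - \<eta> \<and> v (fst p) z (snd p) \<le> hi - \<eta>"
          using upper[OF z(2), of "snd p" "fst p"] lo hi by auto
      qed
    qed
  qed (use D1 D2 \<delta> e in auto)
  ultimately show ?thesis
  proof eventually_elim
    case (elim p)
    show ?case
      unfolding split_beta
    proof
      fix z assume z: "z \<in> {- Z..0}"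
      have "?L z - e \<le> U z \<and> ?l z - e \<le> V (- z) \<and> U z \<le> ?H z + e \<and> V (- z) \<le> ?h z + e"
        "?L z - e \<le> u (fst p) z (snd p) \<and> ?l z - e \<le> v (fst p) z (snd p) \<and> u (fst p) z (snd p) \<le> ?H z + e \<and> v (fst p) z (snd p) \<le> ?h z + e"
        using elim z by (auto simp: split_beta)
      moreover have "?H z - ?L z \<le> e" "?h z - ?l z \<le> e" using D1 D2 z by blast+
      ultimately show "\<bar>u (fst p) z (snd p) - U z\<bar> < \<epsilon> \<and> \<bar>v (fst p) z (snd p) - V (- z)\<bar> < \<epsilon>" using e by (auto simp: abs_less_iff)
    qed
  qed
qed

text \<open>Two exponential supersolutions, one for each sign of the coordinate \<open>i\<close>,
  cover both directions. The factor \<open>exp (\<alpha> * R0)\<close> in \<open>X\<close> lifts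
  each above the datum on its support.\<close>

lemma pair_spreading_upper:
  fixes u v :: "real^'m::finite \<Rightarrow> real \<Rightarrow> real \<Rightarrow> real"
  assumes pos: "D > 0" "d > 0" "\<mu> > 0" "\<nu> > 0" and kg: "KPP_f g gp S" and kf: "KPP_f f fp S'"
    and hu: "half D g u (\<lambda>y t. \<nu> * v y 0 t - \<mu> * u y 0 t)" and hv: "half d f v (\<lambda>y t. \<mu> * u y 0 t - \<nu> * v y 0 t)"
    and bd: "\<And>T. \<exists>M. \<forall>y z t. z \<le> 0 \<longrightarrow> 0 \<le> t \<longrightarrow> t \<le> T \<longrightarrow> \<bar>u y z t\<bar> \<le> M \<and> \<bar>v y z t\<bar> \<le> M"
    and init: "\<And>y z. z \<le> 0 \<Longrightarrow> u y z 0 \<le> M0 \<and> v y z 0 \<le> M0"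
    and supp: "\<And>y z. z \<le> 0 \<Longrightarrow> norm y > R0 \<Longrightarrow> u y z 0 \<le> 0 \<and> v y z 0 \<le> 0"
    and c: "c > cstar_inf D d fp gp" and \<epsilon>: "\<epsilon> > 0"
  shows "\<exists>T\<ge>0. \<forall>t\<ge>T. \<forall>y z. z \<le> 0 \<longrightarrow> c * t \<le> \<bar>y $ i\<bar> \<longrightarrow> u y z t < \<epsilon> \<and> v y z t < \<epsilon>"
proof -
  have rates: "gp > 0" "fp > 0" using KPP_f_rate_pos kg kf by auto
  define cs where "cs = cstar_inf D d fp gp"
  obtain \<alpha> where \<alpha>: "\<alpha> > 0" "D * \<alpha>\<^sup>2 + gp \<le> cs * \<alpha>" "d * \<alpha>\<^sup>2 + fp \<le> cs * \<alpha>"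
    using cstar_inf_exponent[OF pos(1,2) rates] unfolding cs_def by blast
  define X where "X = (\<bar>M0\<bar> + 1) * exp (\<alpha> * R0)"
  define K where "K = X / \<nu> + X / \<mu>"
  have X: "X > 0" by (simp add: X_def)
  have K: "K > 0" "X \<le> \<nu> * K" "X \<le> \<mu> * K" using pos X by (auto simp: K_def distrib_left intro!: add_pos_pos)
  have decay: "u y z t \<le> \<nu> * (K * exp (- \<alpha> * (\<zeta> * y $ i - cs * t))) \<and> v y z t \<le> \<mu> * (K * exp (- \<alpha> * (\<zeta> * y $ i - cs * t)))"
    if "\<zeta> = 1 \<or> \<zeta> = - 1" "z \<le> 0" "0 \<le> t" for \<zeta> y z t
  proof (rule pair_decay[OF pos kg kf hu hv bd \<alpha>(2,3) K(1) _ _ that(2,3)])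
    show "\<zeta>\<^sup>2 = 1" using that by auto
    fix y :: "real^'m" and z :: real assume z: "z \<le> 0"
    define E where "E = exp (- \<alpha> * (\<zeta> * y $ i))"
    have E: "E > 0" by (simp add: E_def)
    have "u y z 0 \<le> X * E \<and> v y z 0 \<le> X * E"
    proof (cases "norm y > R0")
      case True
      then show ?thesis using supp[OF z True] X E by (smt (verit) mult_pos_pos)
    next
      case False
      have "\<zeta> * y $ i \<le> R0" using that(1) component_le_norm_cart[of y i] False by auto
      then have "\<alpha> * (\<zeta> * y $ i) \<le> \<alpha> * R0" using \<alpha>(1) by simp
      then have "1 \<le> exp (\<alpha> * R0) * E" unfolding E_def exp_add[symmetric] by simp
      then have "(\<bar>M0\<bar> + 1) * 1 \<le> (\<bar>M0\<bar> + 1) * (exp (\<alpha> * R0) * E)" by (intro mult_left_mono) auto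
      moreover have "M0 \<le> (\<bar>M0\<bar> + 1) * 1" by simp
      ultimately have "M0 \<le> X * E" unfolding X_def mult.assoc by (rule order_trans[rotated])
      then show ?thesis using init[OF z, of y] by linarith
    qed
    moreover have "X * E \<le> \<nu> * (K * E)" "X * E \<le> \<mu> * (K * E)"
      using mult_right_mono[OF K(2), of E] mult_right_mono[OF K(3), of E] E by (simp_all add: mult.assoc)
    ultimately show "u y z 0 \<le> \<nu> * (K * exp (- \<alpha> * (\<zeta> * y $ i))) \<and> v y z 0 \<le> \<mu> * (K * exp (- \<alpha> * (\<zeta> * y $ i)))"
      unfolding E_def by linarith
  qed
  define r where "r = \<alpha> * (c - cs)"
  have r: "r > 0" using \<alpha> c by (simp add: r_def cs_def)
  define \<epsilon>' where "\<epsilon>' = \<epsilon> / ((\<nu> + \<mu>) * K)"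
  have e': "\<epsilon>' > 0" "\<nu> * K * \<epsilon>' < \<epsilon>" "\<mu> * K * \<epsilon>' < \<epsilon>"
  proof -
    have N: "0 < (\<nu> + \<mu>) * K" using pos K by simp
    then show e': "\<epsilon>' > 0" using \<epsilon> by (simp add: \<epsilon>'_def)
    have "(\<nu> + \<mu>) * K * \<epsilon>' = \<epsilon>" using N unfolding \<epsilon>'_def by (metis less_irrefl nonzero_mult_div_cancel_left times_divide_eq_right)
    then have "\<nu> * K * \<epsilon>' + \<mu> * K * \<epsilon>' = \<epsilon>" by (simp only: distrib_right)
    moreover have "0 < \<nu> * K * \<epsilon>'" "0 < \<mu> * K * \<epsilon>'" using pos K e' by simp_all
    ultimately show "\<nu> * K * \<epsilon>' < \<epsilon>" "\<mu> * K * \<epsilon>' < \<epsilon>" by linarith+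
  qed
  \<comment> \<open>For \<open>\<bar>y $ i\<bar> \<ge> c * t\<close> the exponential is at most
    \<open>exp (- r * t)\<close>, which is at most \<epsilon>' from this time on.\<close>
  define T where "T = max 0 (- ln \<epsilon>' / r)"
  show ?thesis
  proof (intro exI[of _ T] conjI allI impI)
    show "0 \<le> T" by (simp add: T_def)
    fix t y z assume t: "T \<le> t" and z: "z \<le> (0::real)" and y: "c * t \<le> \<bar>y $ i\<bar>"
    have t0: "0 \<le> t" and "- ln \<epsilon>' / r \<le> t" using t by (auto simp: T_def)
    then have "- (r * t) \<le> ln \<epsilon>'" using r by (simp add: field_simps)
    then have ex: "exp (- (r * t)) \<le> \<epsilon>'" using e'(1) by (simp add: ln_ge_iff)
    obtain \<zeta> :: real where \<zeta>: "\<zeta> = 1 \<or> \<zeta> = - 1" "\<zeta> * y $ i = \<bar>y $ i\<bar>" by (metis abs_if mult_1 mult_minus1)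
    have "\<alpha> * (c * t - cs * t) \<le> \<alpha> * (\<zeta> * y $ i - cs * t)" using y \<zeta>(2) \<alpha>(1) by simp
    then have "r * t \<le> \<alpha> * (\<zeta> * y $ i - cs * t)" by (simp add: r_def algebra_simps)
    then have "exp (- \<alpha> * (\<zeta> * y $ i - cs * t)) \<le> exp (- (r * t))" by simp
    then have E: "exp (- \<alpha> * (\<zeta> * y $ i - cs * t)) \<le> \<epsilon>'" (is "?E \<le> _") using ex by linarith
    have "\<nu> * (K * ?E) \<le> \<nu> * (K * \<epsilon>')" "\<mu> * (K * ?E) \<le> \<mu> * (K * \<epsilon>')"
      using E pos K by (intro mult_left_mono; simp)+
    then show "u y z t < \<epsilon>" "v y z t < \<epsilon>" using decay[OF \<zeta>(1) z t0, of y] e' by (simp_all add: mult.assoc)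
  qed
qed

text \<open>Uniqueness of the steady state on the two closed half-lines is contained in the last
  conjunct: one solution cannot converge to two different pairs.\<close>

theorem theorem2p8:
  fixes D d \<mu> \<nu> gp fp S :: real
    and g f :: "real \<Rightarrow> real"
    and u0 v0 :: "real^'m::finite \<Rightarrow> real \<Rightarrow> real"
    and u v :: "real^'m \<Rightarrow> real \<Rightarrow> real \<Rightarrow> real"
    and i :: 'm
  assumes "D > 0" and "d > 0" and "\<mu> > 0" and "\<nu> > 0"
    and "KPP_g g gp" and "KPP_f f fp S"
    and "\<forall>y z. z \<le> 0 \<longrightarrow> u0 y z \<ge> 0"
    and "\<forall>y z. z \<ge> 0 \<longrightarrow> v0 y z \<ge> 0"
    and "continuous_on {p. snd p \<le> 0} (\<lambda>(y, z). u0 y z)"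
    and "continuous_on {p. snd p \<ge> 0} (\<lambda>(y, z). v0 y z)"
    and "\<exists>M. \<forall>y z. (z \<le> 0 \<longrightarrow> u0 y z \<le> M) \<and> (z \<ge> 0 \<longrightarrow> v0 y z \<le> M)"
    and "\<exists>R. \<forall>y z. norm y + \<bar>z\<bar> > R \<longrightarrow>
           (z \<le> 0 \<longrightarrow> u0 y z = 0) \<and> (z \<ge> 0 \<longrightarrow> v0 y z = 0)"
    and "(\<exists>y z. z \<le> 0 \<and> u0 y z \<noteq> 0) \<or> (\<exists>y z. z \<ge> 0 \<and> v0 y z \<noteq> 0)"
    and "is_solution_H D d \<mu> \<nu> g f u0 v0 u v"
  shows "(\<forall>c > cstar_inf D d fp gp. \<forall>\<epsilon> > 0. \<exists>T. \<forall>t \<ge> T. \<forall>y z. \<bar>y $ i\<bar> \<ge> c * t \<longrightarrow>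
            (z \<le> 0 \<longrightarrow> \<bar>u y z t\<bar> < \<epsilon>) \<and> (z \<ge> 0 \<longrightarrow> \<bar>v y z t\<bar> < \<epsilon>))
       \<and> (\<exists>U V. steady_H D d \<mu> \<nu> g f U V)
       \<and> (\<forall>U V. steady_H D d \<mu> \<nu> g f U V \<longrightarrow>
           (\<forall>c. 0 < c \<longrightarrow> c < cstar_inf D d fp gp \<longrightarrow> (\<forall>R \<epsilon>. \<epsilon> > 0 \<longrightarrow> (\<exists>T. \<forall>t \<ge> T. \<forall>y z.
              \<bar>y $ i\<bar> \<le> c * t \<longrightarrow> (\<forall>j. j \<noteq> i \<longrightarrow> \<bar>y $ j\<bar> \<le> R) \<longrightarrow> \<bar>z\<bar> \<le> R \<longrightarrow>
              (z \<le> 0 \<longrightarrow> \<bar>u y z t - U z\<bar> < \<epsilon>) \<and> (z \<ge> 0 \<longrightarrow> \<bar>v y z t - V z\<bar> < \<epsilon>)))))"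
proof -
  note pos = assms(1-4)
  have kg: "KPP_f g gp 1" using assms(5) by (simp add: KPP_g_iff)
  note kf = assms(6)
  define w where "w y z t = v y (- z) t" for y z t
  have hu: "half D g u (\<lambda>y t. \<nu> * w y 0 t - \<mu> * u y 0 t)" and hw: "half d f w (\<lambda>y t. \<mu> * u y 0 t - \<nu> * w y 0 t)"
    using half_of_solution[OF assms(14)] by (simp_all add: w_def[abs_def])
  have u0: "\<And>y z. z \<le> 0 \<Longrightarrow> u y z 0 = u0 y z" and v0: "\<And>y z. z \<le> 0 \<Longrightarrow> w y z 0 = v0 y (- z)"
    and bd': "\<And>T. \<exists>M. \<forall>y z t. 0 \<le> t \<longrightarrow> t \<le> T \<longrightarrow> (z \<le> 0 \<longrightarrow> \<bar>u y z t\<bar> \<le> M) \<and> (z \<ge> 0 \<longrightarrow> \<bar>v y z t\<bar> \<le> M)"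
    using assms(14) unfolding is_solution_H_def w_def by - (elim conjE, simp)+
  have bd: "\<exists>M. \<forall>y z t. z \<le> 0 \<longrightarrow> 0 \<le> t \<longrightarrow> t \<le> T \<longrightarrow> \<bar>u y z t\<bar> \<le> M \<and> \<bar>w y z t\<bar> \<le> M" for T
  proof -
    obtain M where "\<forall>y z t. 0 \<le> t \<longrightarrow> t \<le> T \<longrightarrow> (z \<le> 0 \<longrightarrow> \<bar>u y z t\<bar> \<le> M) \<and> (z \<ge> 0 \<longrightarrow> \<bar>v y z t\<bar> \<le> M)" using bd' by blast
    then show ?thesis by (intro exI[of _ M]) (simp add: w_def)
  qed
  have i0: "0 \<le> u y z 0 \<and> 0 \<le> w y z 0" if "z \<le> 0" for y z using assms(7,8) u0 v0 that by simp
  have nn: "0 \<le> u y z t \<and> 0 \<le> w y z t" if "z \<le> 0" "0 \<le> t" for y z t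
    by (rule pair_nonneg[OF pos kg kf hu hw bd i0 that])
  obtain M0 where M0: "\<forall>y z. (z \<le> 0 \<longrightarrow> u0 y z \<le> M0) \<and> (z \<ge> 0 \<longrightarrow> v0 y z \<le> M0)" using assms(11) by blast
  have iM: "u y z 0 \<le> M0 \<and> w y z 0 \<le> M0" if "z \<le> 0" for y z using M0 u0 v0 that by simp
  obtain A where A: "\<And>y z t. z \<le> 0 \<Longrightarrow> 0 \<le> t \<Longrightarrow> u y z t \<le> A \<and> w y z t \<le> A"
    using pair_upper[OF pos kg kf hu hw bd iM] by blast
  obtain R0 where R0: "\<forall>y z. norm y + \<bar>z\<bar> > R0 \<longrightarrow> (z \<le> 0 \<longrightarrow> u0 y z = 0) \<and> (z \<ge> 0 \<longrightarrow> v0 y z = 0)" using assms(12) by blast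
  have supp: "u y z 0 \<le> 0 \<and> w y z 0 \<le> 0" if z: "z \<le> 0" and y: "norm y > R0" for y z
  proof -
    have "norm y + \<bar>z\<bar> > R0" "norm y + \<bar>- z\<bar> > R0" using y by simp_all
    then show ?thesis using R0 u0 v0 z by (metis neg_0_le_iff_le order_refl)
  qed
  have init: "(\<exists>y z. z \<le> 0 \<and> 0 < u y z 0) \<or> (\<exists>y z. z \<le> 0 \<and> 0 < w y z 0)"
    using assms(13)
  proof
    assume "\<exists>y z. z \<le> 0 \<and> u0 y z \<noteq> 0"
    then show ?thesis using u0 assms(7) by (metis order_le_less)
  next
    assume "\<exists>y z. z \<ge> 0 \<and> v0 y z \<noteq> 0"
    then obtain y z where "z \<ge> 0" "v0 y z \<noteq> 0" by blast
    then have "- z \<le> 0 \<and> 0 < w y (- z) 0" using v0[of "- z" y] assms(8) by (simp add: order_less_le)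
    then show ?thesis by blast
  qed
  have reflect: "v y z t = w y (- z) t" for y z t by (simp add: w_def)
  show ?thesis
  proof (intro conjI)
    show "\<forall>c > cstar_inf D d fp gp. \<forall>\<epsilon> > 0. \<exists>T. \<forall>t \<ge> T. \<forall>y z. \<bar>y $ i\<bar> \<ge> c * t \<longrightarrow>
            (z \<le> 0 \<longrightarrow> \<bar>u y z t\<bar> < \<epsilon>) \<and> (z \<ge> 0 \<longrightarrow> \<bar>v y z t\<bar> < \<epsilon>)"
    proof (intro allI impI)
      fix c \<epsilon> :: real assume c: "cstar_inf D d fp gp < c" and \<epsilon>: "0 < \<epsilon>"
      have "\<exists>T\<ge>0. \<forall>t\<ge>T. \<forall>y z. z \<le> 0 \<longrightarrow> c * t \<le> \<bar>y $ i\<bar> \<longrightarrow> u y z t < \<epsilon> \<and> w y z t < \<epsilon>"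
        by (rule pair_spreading_upper[OF pos kg kf hu hw bd iM supp c \<epsilon>])
      then obtain T where T: "T \<ge> 0" "\<And>t y z. t \<ge> T \<Longrightarrow> z \<le> 0 \<Longrightarrow> c * t \<le> \<bar>y $ i\<bar> \<Longrightarrow> u y z t < \<epsilon> \<and> w y z t < \<epsilon>"
        by metis
      show "\<exists>T. \<forall>t \<ge> T. \<forall>y z. \<bar>y $ i\<bar> \<ge> c * t \<longrightarrow> (z \<le> 0 \<longrightarrow> \<bar>u y z t\<bar> < \<epsilon>) \<and> (z \<ge> 0 \<longrightarrow> \<bar>v y z t\<bar> < \<epsilon>)"
      proof (intro exI[of _ T] allI impI conjI)
        fix t y z assume t: "T \<le> t" and y: "c * t \<le> \<bar>y $ i\<bar>"
        show "\<bar>u y z t\<bar> < \<epsilon>" if "z \<le> 0" using T(2)[OF t that y] nn[OF that, of t y] T(1) t by auto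
        show "\<bar>v y z t\<bar> < \<epsilon>" if "z \<ge> 0"
          unfolding reflect using T(2)[OF t _ y, of "- z"] nn[of "- z" t y] that T(1) t by auto
      qed
    qed
    show "\<exists>U V. steady_H D d \<mu> \<nu> g f U V" by (rule steady_exists[OF pos kg kf])
    show "\<forall>U V. steady_H D d \<mu> \<nu> g f U V \<longrightarrow>
           (\<forall>c. 0 < c \<longrightarrow> c < cstar_inf D d fp gp \<longrightarrow> (\<forall>R \<epsilon>. \<epsilon> > 0 \<longrightarrow> (\<exists>T. \<forall>t \<ge> T. \<forall>y z.
              \<bar>y $ i\<bar> \<le> c * t \<longrightarrow> (\<forall>j. j \<noteq> i \<longrightarrow> \<bar>y $ j\<bar> \<le> R) \<longrightarrow> \<bar>z\<bar> \<le> R \<longrightarrow>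
              (z \<le> 0 \<longrightarrow> \<bar>u y z t - U z\<bar> < \<epsilon>) \<and> (z \<ge> 0 \<longrightarrow> \<bar>v y z t - V z\<bar> < \<epsilon>))))"
    proof (intro allI impI)
      fix U V c R \<epsilon>
      assume st: "steady_H D d \<mu> \<nu> g f U V" and c: "0 < c" "c < cstar_inf D d fp gp" and \<epsilon>: "0 < (\<epsilon>::real)"
      have "eventually (\<lambda>(y, t). \<forall>z\<in>{- R..0}. \<bar>u y z t - U z\<bar> < \<epsilon> \<and> \<bar>w y z t - V (- z)\<bar> < \<epsilon>) (cone c)"
        by (rule pair_converges[OF pos kg kf hu hw nn A init c st \<epsilon>])
      then obtain c' T where c': "c' > c"
        and T: "\<And>t y z. t \<ge> T \<Longrightarrow> norm y \<le> c' * t \<Longrightarrow> z \<in> {- R..0} \<Longrightarrow> \<bar>u y z t - U z\<bar> < \<epsilon> \<and> \<bar>w y z t - V (- z)\<bar> < \<epsilon>"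
        unfolding eventually_cone by fastforce
      \<comment> \<open>The coordinates other than \<open>i\<close> are bounded and add at most
        \<open>n\<close> to the norm of \<open>y\<close>; the margin \<open>c' - c\<close> of the
        cone absorbs this for large \<open>t\<close>. The absolute value covers negative
        \<open>R\<close>.\<close>
      define n where "n = real CARD('m) * \<bar>R\<bar>"
      show "\<exists>T. \<forall>t \<ge> T. \<forall>y z. \<bar>y $ i\<bar> \<le> c * t \<longrightarrow> (\<forall>j. j \<noteq> i \<longrightarrow> \<bar>y $ j\<bar> \<le> R) \<longrightarrow> \<bar>z\<bar> \<le> R \<longrightarrow>
              (z \<le> 0 \<longrightarrow> \<bar>u y z t - U z\<bar> < \<epsilon>) \<and> (z \<ge> 0 \<longrightarrow> \<bar>v y z t - V z\<bar> < \<epsilon>)"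
      proof (intro exI[of _ "max T (n / (c' - c))"] allI impI)
        fix t y z assume t: "max T (n / (c' - c)) \<le> t" and y: "\<bar>y $ i\<bar> \<le> c * t" "\<forall>j. j \<noteq> i \<longrightarrow> \<bar>y $ j\<bar> \<le> R" and z: "\<bar>z\<bar> \<le> R"
        have "norm y \<le> (\<Sum>j\<in>UNIV. \<bar>y $ j\<bar>)" by (rule norm_le_l1_cart)
        also have "\<dots> \<le> (\<Sum>j\<in>UNIV. (if j = i then c * t else 0) + \<bar>R\<bar>)"
          using y by (intro sum_mono) (smt (verit))
        also have "\<dots> = c * t + n" by (simp add: sum.distrib n_def)
        also have "\<dots> \<le> c' * t"
        proof -
          have "n \<le> t * (c' - c)" using t c' by (simp add: pos_divide_le_eq)
          then show ?thesis by (simp add: algebra_simps)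
        qed
        finally have "norm y \<le> c' * t" .
        note T' = T[OF _ this]
        show "(z \<le> 0 \<longrightarrow> \<bar>u y z t - U z\<bar> < \<epsilon>) \<and> (z \<ge> 0 \<longrightarrow> \<bar>v y z t - V z\<bar> < \<epsilon>)"
          unfolding reflect using T'[of z] T'[of "- z"] t z by auto
      qed
    qed
  qed
qed

end
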